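(* Let $\eta>0$ be fixed and let $\Phi(\xi)=-|\xi|^p+\Phi_1(\xi)$ be a real valued Fourier symbol with $p>3$ and $|\Phi_1(\xi)|\le C(1+|\xi|^q)$ for some constants $C$ and $0\le q<p$. Let $L$ be the linear operator defined by $\widehat{Lf}(\xi)=-\Phi(\xi)\hat f(\xi)$. Then for any $s>-\frac p2$ and any data $v_0\in H^s(\mathbb{R})$ there exist a time $T=T(\|v_0\|_{H^s})>0$ and a unique solution $v$ in $C([0,T];H^s(\mathbb{R}))$ to the initial value problem $$v_t+v_{xxx}+\eta Lv+(v^2)_x=0,\quad x\in\mathbb{R},\ t\ge 0,\qquad v(x,0)=v_0(x).$$ Moreover, the map $v_0\mapsto v$ is smooth from $H^s(\mathbb{R})$ to $C([0,T];H^s(\mathbb{R}))\cap X_T^s$, and $v\in C((0,T];H^\infty(\mathbb{R}))$.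
   Context: $\hat f(\xi)=\int_{\mathbb{R}}e^{-ix\xi}f(x)\,dx$ (the factor $1/\sqrt{2\pi}$ is omitted). $H^s(\mathbb{R})=\{f\in\mathcal{S}'(\mathbb{R}):\|f\|_{H^s}<\infty\}$ with $\|f\|_{H^s}=\big(\int_{\mathbb{R}}(1+|\xi|^2)^s|\hat f(\xi)|^2d\xi\big)^{1/2}$, and $H^\infty(\mathbb{R})=\bigcap_{\sigma\in\mathbb{R}}H^\sigma(\mathbb{R})$. The initial value problem is understood in its equivalent integral form $v(t)=V(t)v_0-\int_0^tV(t-t')(v^2)_x(t')\,dt'$, where $\widehat{V(t)w_0}(\xi)=e^{it\xi^3+\eta t\Phi(\xi)}\widehat{w_0}(\xi)$. For $0\le T\le 1$, $X_T^s$ is the space defined by the norm $$\|f\|_{X_T^s}=\sup_{t\in[0,T]}\Big\{\|f(t)\|_{H^s}+t^{\frac{|s|}{p}}\|f(t)\|_{L^2}\Big\}$$ (with the convention $0\cdot\infty=0$ at $t=0$).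
   Formalization: For s<0 the square v² of a general v in C([0,T];H^s) is undefined, so a solution is also required to lie in L²((0,T);L²), and uniqueness is among these (this includes all of C([0,T];H^s)∩X_T^s; for s≥0 it is automatic). *)

theory Defs
  imports "HOL-Analysis.Analysis"
begin

section \<open>Schwartz functions and tempered distributions on the real line\<close>

definition vderiv :: "(real \<Rightarrow> complex) \<Rightarrow> real \<Rightarrow> complex" where
  "vderiv \<phi> x = vector_derivative \<phi> (at x)"

definition schwartz :: "(real \<Rightarrow> complex) set" where
  "schwartz = {\<phi>. (\<forall>n x. (vderiv ^^ n) \<phi> differentiable (at x)) \<and>
     (\<forall>m n. bounded (range (\<lambda>x. complex_of_real x ^ m * (vderiv ^^ n) \<phi> x)))}"

definition schwartz_norm :: "nat \<Rightarrow> (real \<Rightarrow> complex) \<Rightarrow> real" where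
  "schwartz_norm N \<phi> =
     (\<Sum>m\<le>N. \<Sum>n\<le>N. SUP x. cmod (complex_of_real x ^ m * (vderiv ^^ n) \<phi> x))"

definition is_tempered :: "((real \<Rightarrow> complex) \<Rightarrow> complex) \<Rightarrow> bool" where
  "is_tempered u \<longleftrightarrow>
     (\<forall>\<phi>\<in>schwartz. \<forall>\<psi>\<in>schwartz. u (\<lambda>x. \<phi> x + \<psi> x) = u \<phi> + u \<psi>) \<and>
     (\<forall>\<phi>\<in>schwartz. \<forall>c. u (\<lambda>x. c * \<phi> x) = c * u \<phi>) \<and>
     (\<exists>C N. \<forall>\<phi>\<in>schwartz. cmod (u \<phi>) \<le> C * schwartz_norm N \<phi>) \<and>
     (\<forall>\<phi>. \<phi> \<notin> schwartz \<longrightarrow> u \<phi> = 0)"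

text \<open>The value 0 outside the Schwartz space is a dummy; it makes equality of
  elements of this type the equality of distributions.\<close>

typedef tempered = "{u. is_tempered u}" morphisms td_apply Abs_tempered
  by (rule exI [of _ "\<lambda>_. 0"]) (auto simp: is_tempered_def intro!: exI [of _ 0])

setup_lifting type_definition_tempered

lemma schwartz_sup_nonneg:
  assumes "\<phi> \<in> schwartz"
  shows "0 \<le> (SUP x. cmod (complex_of_real x ^ m * (vderiv ^^ n) \<phi> x))"
proof -
  have "bdd_above (range (\<lambda>x. cmod (complex_of_real x ^ m * (vderiv ^^ n) \<phi> x)))"
    using assms by (auto simp: schwartz_def bounded_iff bdd_above_def)
  then show ?thesis
    by (rule cSUP_upper2 [of _ _ 0]) auto
qed

lemma schwartz_norm_nonneg: "\<phi> \<in> schwartz \<Longrightarrow> 0 \<le> schwartz_norm N \<phi>"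
  by (simp add: schwartz_norm_def sum_nonneg schwartz_sup_nonneg)

lemma schwartz_norm_mono:
  assumes "\<phi> \<in> schwartz" "N \<le> M" shows "schwartz_norm N \<phi> \<le> schwartz_norm M \<phi>"
proof -
  note nn = schwartz_sup_nonneg [OF assms(1)]
  have "schwartz_norm N \<phi> \<le>
      (\<Sum>m\<le>N. \<Sum>n\<le>M. SUP x. cmod (complex_of_real x ^ m * (vderiv ^^ n) \<phi> x))"
    unfolding schwartz_norm_def using assms(2) by (intro sum_mono sum_mono2) (auto simp: nn)
  also have "\<dots> \<le> schwartz_norm M \<phi>"
    unfolding schwartz_norm_def using assms(2) by (intro sum_mono2) (auto simp: nn sum_nonneg)
  finally show ?thesis .
qed

lemma vderiv_funpow_add:
  assumes "\<phi> \<in> schwartz" "\<psi> \<in> schwartz"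
  shows "(vderiv ^^ n) (\<lambda>x. \<phi> x + \<psi> x) = (\<lambda>x. (vderiv ^^ n) \<phi> x + (vderiv ^^ n) \<psi> x)"
proof (induction n)
  case (Suc n)
  have "vderiv (\<lambda>x. (vderiv ^^ n) \<phi> x + (vderiv ^^ n) \<psi> x) =
      (\<lambda>x. vderiv ((vderiv ^^ n) \<phi>) x + vderiv ((vderiv ^^ n) \<psi>) x)"
    using assms unfolding vderiv_def schwartz_def by (intro ext vector_derivative_add_at) auto
  then show ?case using Suc by simp
qed simp

lemma vderiv_funpow_cmult:
  assumes "\<phi> \<in> schwartz"
  shows "(vderiv ^^ n) (\<lambda>x. c * \<phi> x) = (\<lambda>x. c * (vderiv ^^ n) \<phi> x)"
proof (induction n)
  case (Suc n)
  have "vderiv (\<lambda>x. c * (vderiv ^^ n) \<phi> x) = (\<lambda>x. c * vderiv ((vderiv ^^ n) \<phi>) x)"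
    using assms unfolding vderiv_def schwartz_def
    by (intro ext vector_derivative_at has_vector_derivative_mult_right)
      (simp add: vector_derivative_works)
  then show ?case using Suc by simp
qed simp

lemma schwartz_add:
  assumes "\<phi> \<in> schwartz" "\<psi> \<in> schwartz" shows "(\<lambda>x. \<phi> x + \<psi> x) \<in> schwartz"
  using assms bounded_plus_comp [of "\<lambda>x. complex_of_real x ^ m * (vderiv ^^ n) \<phi> x" UNIV
      "\<lambda>x. complex_of_real x ^ m * (vderiv ^^ n) \<psi> x" for m n]
  by (auto simp: schwartz_def vderiv_funpow_add [OF assms] distrib_left intro!: derivative_intros)

lemma schwartz_cmult:
  assumes "\<phi> \<in> schwartz" shows "(\<lambda>x. c * \<phi> x) \<in> schwartz"
proof -
  have "bounded (range (\<lambda>x. complex_of_real x ^ m * (c * (vderiv ^^ n) \<phi> x)))" for m n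
  proof -
    from assms obtain B where "\<And>x. cmod (complex_of_real x ^ m * (vderiv ^^ n) \<phi> x) \<le> B"
      unfolding schwartz_def bounded_iff by blast
    then have "cmod (complex_of_real x ^ m * (c * (vderiv ^^ n) \<phi> x)) \<le> cmod c * B" for x
      using mult_left_mono [of "cmod (complex_of_real x ^ m * (vderiv ^^ n) \<phi> x)" B "cmod c"]
      by (simp add: norm_mult ac_simps)
    then show ?thesis by (auto simp: bounded_iff)
  qed
  then show ?thesis
    using assms
    by (auto simp: schwartz_def vderiv_funpow_cmult [OF assms] intro!: derivative_intros)
qed

lemma schwartz_vderiv:
  assumes "\<phi> \<in> schwartz" shows "vderiv \<phi> \<in> schwartz"
proof -
  have eq: "(vderiv ^^ n) (vderiv \<phi>) = (vderiv ^^ Suc n) \<phi>" for n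
    by (simp add: funpow_swap1)
  from assms have d: "\<And>n x. (vderiv ^^ n) \<phi> differentiable (at x)"
    and b: "\<And>m n. bounded (range (\<lambda>x. complex_of_real x ^ m * (vderiv ^^ n) \<phi> x))"
    by (auto simp: schwartz_def)
  show ?thesis
    unfolding schwartz_def mem_Collect_eq eq using d b by blast
qed

lemma schwartz_norm_vderiv:
  assumes "\<phi> \<in> schwartz" shows "schwartz_norm N (vderiv \<phi>) \<le> schwartz_norm (Suc N) \<phi>"
proof -
  define a where "a m n = (SUP x. cmod (complex_of_real x ^ m * (vderiv ^^ n) \<phi> x))" for m n
  have nn: "0 \<le> a m n" for m n
    unfolding a_def by (rule schwartz_sup_nonneg [OF assms])
  have "schwartz_norm N (vderiv \<phi>) = (\<Sum>m\<le>N. \<Sum>n\<le>N. a m (Suc n))"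
    by (simp add: schwartz_norm_def a_def funpow_swap1)
  also have "\<dots> \<le> (\<Sum>m\<le>N. \<Sum>n\<le>Suc N. a m n)"
    by (intro sum_mono) (simp add: sum.atMost_Suc_shift nn del: sum.atMost_Suc)
  also have "\<dots> \<le> (\<Sum>m\<le>Suc N. \<Sum>n\<le>Suc N. a m n)"
    by (intro sum_mono2) (auto intro!: sum_nonneg add_nonneg_nonneg nn)
  finally show ?thesis by (simp add: schwartz_norm_def a_def)
qed

lemma is_tempered_bound:
  "is_tempered u \<Longrightarrow> \<exists>C N. \<forall>\<phi>\<in>schwartz. cmod (u \<phi>) \<le> C * schwartz_norm N \<phi>"
  by (simp add: is_tempered_def)

lemma is_tempered_add:
  assumes "is_tempered u" "is_tempered w" shows "is_tempered (\<lambda>\<phi>. u \<phi> + w \<phi>)"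
proof -
  obtain C N where
    C: "\<And>\<phi>. \<phi> \<in> schwartz \<Longrightarrow> cmod (u \<phi>) \<le> C * schwartz_norm N \<phi>"
    using is_tempered_bound [OF assms(1)] by blast
  obtain D M where
    D: "\<And>\<phi>. \<phi> \<in> schwartz \<Longrightarrow> cmod (w \<phi>) \<le> D * schwartz_norm M \<phi>"
    using is_tempered_bound [OF assms(2)] by blast
  have "cmod (u \<phi> + w \<phi>) \<le> (\<bar>C\<bar> + \<bar>D\<bar>) * schwartz_norm (max N M) \<phi>" if "\<phi> \<in> schwartz" for \<phi>
  proof -
    have "C * schwartz_norm N \<phi> \<le> \<bar>C\<bar> * schwartz_norm (max N M) \<phi>"
      by (intro mult_mono) (auto simp: schwartz_norm_nonneg schwartz_norm_mono that)
    moreover have "D * schwartz_norm M \<phi> \<le> \<bar>D\<bar> * schwartz_norm (max N M) \<phi>"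
      by (intro mult_mono) (auto simp: schwartz_norm_nonneg schwartz_norm_mono that)
    ultimately show ?thesis
      using C [OF that] D [OF that] norm_triangle_ineq [of "u \<phi>" "w \<phi>"]
      by (simp add: distrib_right)
  qed
  then have "\<exists>C N. \<forall>\<phi>\<in>schwartz. cmod (u \<phi> + w \<phi>) \<le> C * schwartz_norm N \<phi>"
    by blast
  with assms show ?thesis
    unfolding is_tempered_def by (simp add: algebra_simps)
qed

lemma is_tempered_scale:
  fixes c :: complex
  assumes "is_tempered u" shows "is_tempered (\<lambda>\<phi>. c * u \<phi>)"
proof -
  from assms obtain C N where
    C: "\<And>\<phi>. \<phi> \<in> schwartz \<Longrightarrow> cmod (u \<phi>) \<le> C * schwartz_norm N \<phi>"
    by (blast dest: is_tempered_bound)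
  have "cmod (c * u \<phi>) \<le> (cmod c * C) * schwartz_norm N \<phi>" if "\<phi> \<in> schwartz" for \<phi>
    using mult_left_mono [OF C [OF that], of "cmod c"] by (simp add: norm_mult ac_simps)
  then have "\<exists>C N. \<forall>\<phi>\<in>schwartz. cmod (c * u \<phi>) \<le> C * schwartz_norm N \<phi>"
    by blast
  with assms show ?thesis
    unfolding is_tempered_def by (simp add: algebra_simps)
qed

instantiation tempered :: real_vector
begin

lift_definition zero_tempered :: tempered is "\<lambda>_. 0"
  by (auto simp: is_tempered_def intro!: exI [of _ 0])

lift_definition plus_tempered :: "tempered \<Rightarrow> tempered \<Rightarrow> tempered" is "\<lambda>u w \<phi>. u \<phi> + w \<phi>"
  by (rule is_tempered_add)

lift_definition uminus_tempered :: "tempered \<Rightarrow> tempered" is "\<lambda>u \<phi>. - u \<phi>"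
  using is_tempered_scale [of _ "-1"] by simp

lift_definition minus_tempered :: "tempered \<Rightarrow> tempered \<Rightarrow> tempered" is "\<lambda>u w \<phi>. u \<phi> - w \<phi>"
  using is_tempered_add [OF _ is_tempered_scale [of _ "-1"]] by simp

lift_definition scaleR_tempered :: "real \<Rightarrow> tempered \<Rightarrow> tempered" is "\<lambda>c u \<phi>. c *\<^sub>R u \<phi>"
  by (simp add: scaleR_conv_of_real is_tempered_scale)

instance
  by standard (transfer; simp add: algebra_simps)+

end

text \<open>The distributional derivative \<open>u\<^sub>x\<close>.\<close>

lift_definition td_deriv :: "tempered \<Rightarrow> tempered" is
  "\<lambda>u \<phi>. if \<phi> \<in> schwartz then - u (vderiv \<phi>) else 0"
proof -
  fix u assume u: "is_tempered u"
  then obtain C N where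
    C: "\<And>\<phi>. \<phi> \<in> schwartz \<Longrightarrow> cmod (u \<phi>) \<le> C * schwartz_norm N \<phi>"
    by (blast dest: is_tempered_bound)
  have "cmod (u (vderiv \<phi>)) \<le> \<bar>C\<bar> * schwartz_norm (Suc N) \<phi>" if "\<phi> \<in> schwartz" for \<phi>
  proof -
    have "C * schwartz_norm N (vderiv \<phi>) \<le> \<bar>C\<bar> * schwartz_norm (Suc N) \<phi>"
      by (intro mult_mono)
        (auto simp: schwartz_norm_nonneg schwartz_norm_vderiv schwartz_vderiv that)
    with C [OF schwartz_vderiv [OF that]] show ?thesis by linarith
  qed
  moreover have "vderiv (\<lambda>x. \<phi> x + \<psi> x) = (\<lambda>x. vderiv \<phi> x + vderiv \<psi> x)"
    if "\<phi> \<in> schwartz" "\<psi> \<in> schwartz" for \<phi> \<psi>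
    using vderiv_funpow_add [OF that, of 1] by simp
  moreover have "vderiv (\<lambda>x. c * \<phi> x) = (\<lambda>x. c * vderiv \<phi> x)" if "\<phi> \<in> schwartz" for \<phi> c
    using vderiv_funpow_cmult [OF that, of 1] by simp
  ultimately show "is_tempered (\<lambda>\<phi>. if \<phi> \<in> schwartz then - u (vderiv \<phi>) else 0)"
    using u unfolding is_tempered_def
    by (auto simp: schwartz_add schwartz_cmult schwartz_vderiv)
qed

text \<open>The functional \<open>F\<close> is integration against the function \<open>g\<close>; such a \<open>g\<close> is unique up to
  a null set.\<close>

definition given_by :: "((real \<Rightarrow> complex) \<Rightarrow> complex) \<Rightarrow> (real \<Rightarrow> complex) \<Rightarrow> bool" where
  "given_by F g \<longleftrightarrow> g \<in> borel_measurable borel \<and>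
     (\<forall>\<phi>\<in>schwartz. integrable lborel (\<lambda>x. g x * \<phi> x) \<and> F \<phi> = (\<integral>x. g x * \<phi> x \<partial>lborel))"

section \<open>Fourier transform and Sobolev spaces\<close>

definition fourier :: "(real \<Rightarrow> complex) \<Rightarrow> real \<Rightarrow> complex" where
  "fourier \<phi> \<xi> = (\<integral>x. exp (- (\<i> * complex_of_real (x * \<xi>))) * \<phi> x \<partial>lborel)"

text \<open>The Fourier transform of a tempered distribution, by duality.\<close>

definition td_fourier :: "tempered \<Rightarrow> (real \<Rightarrow> complex) \<Rightarrow> complex" where
  "td_fourier u \<phi> = td_apply u (fourier \<phi>)"

definition ennsqrt :: "ennreal \<Rightarrow> ennreal" where
  "ennsqrt a = (if a = \<infinity> then \<infinity> else ennreal (sqrt (enn2real a)))"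

text \<open>Since the representing function is unique almost everywhere, the infimum ranges over at most
  one value; it is \<open>\<infinity>\<close> if the functional is not a function.\<close>

definition weighted_L2 :: "(real \<Rightarrow> real) \<Rightarrow> ((real \<Rightarrow> complex) \<Rightarrow> complex) \<Rightarrow> ennreal" where
  "weighted_L2 w F =
     (INF g\<in>{g. given_by F g}. ennsqrt (\<integral>\<^sup>+ x. ennreal (w x * (cmod (g x))\<^sup>2) \<partial>lborel))"

definition Hs_norm :: "real \<Rightarrow> tempered \<Rightarrow> ennreal" where
  "Hs_norm s u = weighted_L2 (\<lambda>\<xi>. (1 + \<bar>\<xi>\<bar>\<^sup>2) powr s) (td_fourier u)"

definition L2_norm :: "tempered \<Rightarrow> ennreal" where
  "L2_norm u = weighted_L2 (\<lambda>_. 1) (td_apply u)"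

definition Hs :: "real \<Rightarrow> tempered set" where
  "Hs s = {u. Hs_norm s u < \<infinity>}"

definition Hs_nrm :: "real \<Rightarrow> tempered \<Rightarrow> real" where
  "Hs_nrm s u = enn2real (Hs_norm s u)"

definition Hs_ball :: "real \<Rightarrow> real \<Rightarrow> tempered set" where
  "Hs_ball s \<rho> = {u \<in> Hs s. Hs_nrm s u < \<rho>}"

definition Hs_continuous_on :: "real set \<Rightarrow> real \<Rightarrow> (real \<Rightarrow> tempered) \<Rightarrow> bool" where
  "Hs_continuous_on I s v \<longleftrightarrow> (\<forall>t\<in>I. v t \<in> Hs s) \<and>
     (\<forall>t0\<in>I. ((\<lambda>t. Hs_norm s (v t - v t0)) \<longlongrightarrow> 0) (at t0 within I))"

text \<open>\<open>H\<^sup>\<infinity>\<close> carries the projective limit topology of the spaces \<open>H\<^sup>\<sigma>\<close>.\<close>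

definition Hinf_continuous_on :: "real set \<Rightarrow> (real \<Rightarrow> tempered) \<Rightarrow> bool" where
  "Hinf_continuous_on I v \<longleftrightarrow> (\<forall>\<sigma>. Hs_continuous_on I \<sigma> v)"

text \<open>Curves on \<open>[0,T]\<close> are represented by functions on \<open>\<real>\<close> that vanish outside \<open>[0,T]\<close>, so that
  equality in \<open>C([0,T];H\<^sup>s)\<close> is equality of functions.\<close>

definition C_Hs :: "real \<Rightarrow> real \<Rightarrow> (real \<Rightarrow> tempered) set" where
  "C_Hs T s = {v. Hs_continuous_on {0..T} s v \<and> (\<forall>t. t \<notin> {0..T} \<longrightarrow> v t = 0)}"

text \<open>In \<open>ennreal\<close>, \<open>0 * \<infinity> = 0\<close>. The case distinction is needed because \<open>0 powr 0 = 0\<close>.\<close>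

definition X_norm :: "real \<Rightarrow> real \<Rightarrow> real \<Rightarrow> (real \<Rightarrow> tempered) \<Rightarrow> ennreal" where
  "X_norm p s T f = (SUP t\<in>{0..T}. Hs_norm s (f t) +
     ennreal (if s = 0 then 1 else t powr (\<bar>s\<bar> / p)) * L2_norm (f t))"

text \<open>\<open>C([0,T];H\<^sup>s) \<inter> X\<^sub>T\<^sup>s\<close>; as the \<open>X\<^sub>T\<^sup>s\<close> norm dominates the norm of \<open>C([0,T];H\<^sup>s)\<close>, it is the
  norm of the intersection.\<close>

definition CX :: "real \<Rightarrow> real \<Rightarrow> real \<Rightarrow> (real \<Rightarrow> tempered) set" where
  "CX p s T = {v \<in> C_Hs T s. X_norm p s T v < \<infinity>}"

definition X_nrm :: "real \<Rightarrow> real \<Rightarrow> real \<Rightarrow> (real \<Rightarrow> tempered) \<Rightarrow> real" where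
  "X_nrm p s T v = enn2real (X_norm p s T v)"

section \<open>The integral equation\<close>

text \<open>The distribution whose Fourier transform is the function \<open>m\<close> times that of \<open>w\<close>.\<close>

definition fourier_multiplier :: "(real \<Rightarrow> complex) \<Rightarrow> tempered \<Rightarrow> tempered" where
  "fourier_multiplier m w =
     (THE u. \<exists>g. given_by (td_fourier w) g \<and> given_by (td_fourier u) (\<lambda>\<xi>. m \<xi> * g \<xi>))"

definition V :: "real \<Rightarrow> (real \<Rightarrow> real) \<Rightarrow> real \<Rightarrow> tempered \<Rightarrow> tempered" where
  "V \<eta> \<Phi> t = fourier_multiplier
     (\<lambda>\<xi>. exp (\<i> * complex_of_real (t * \<xi> ^ 3) + complex_of_real (\<eta> * t * \<Phi> \<xi>)))"

definition td_square :: "tempered \<Rightarrow> tempered" where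
  "td_square u =
     (THE w. \<exists>g. given_by (td_apply u) g \<and> given_by (td_apply w) (\<lambda>x. (g x)\<^sup>2))"

text \<open>Integral of a distribution-valued function, in the weak sense. The completed measure allows
  the integrand to be arbitrary on a null set of times.\<close>

definition has_td_integral :: "(real \<Rightarrow> tempered) \<Rightarrow> tempered \<Rightarrow> real set \<Rightarrow> bool" where
  "has_td_integral F u I \<longleftrightarrow> (\<forall>\<phi>\<in>schwartz.
     set_integrable lebesgue I (\<lambda>t. td_apply (F t) \<phi>) \<and>
     td_apply u \<phi> = set_lebesgue_integral lebesgue I (\<lambda>t. td_apply (F t) \<phi>))"

text \<open>For \<open>s < 0\<close> the square of an element of \<open>H\<^sup>s\<close> has no meaning in general. A solution
  is therefore a curve in \<open>C([0,T];H\<^sup>s)\<close> whose square makes sense as an integrable function of time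
  with values in \<open>L\<^sup>1\<close>, that is, which also lies in \<open>L\<^sup>2((0,T);L\<^sup>2)\<close>. For \<open>s \<ge> 0\<close> every curve in
  \<open>C([0,T];H\<^sup>s)\<close> satisfies this condition, and for \<open>-p/2 < s < 0\<close> so does every curve in
  \<open>X\<^sub>T\<^sup>s \<inter> C([0,T];H\<^sup>s)\<close>.\<close>

definition solution ::
  "real \<Rightarrow> (real \<Rightarrow> real) \<Rightarrow> real \<Rightarrow> real \<Rightarrow> tempered \<Rightarrow> (real \<Rightarrow> tempered) \<Rightarrow> bool" where
  "solution \<eta> \<Phi> s T v0 v \<longleftrightarrow> v \<in> C_Hs T s \<and>
     (\<integral>\<^sup>+ t. (L2_norm (v t))\<^sup>2 * indicator {0..T} t \<partial>lborel) < \<infinity> \<and>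
     (\<forall>t\<in>{0..T}. \<exists>D. has_td_integral (\<lambda>t'. V \<eta> \<Phi> (t - t') (td_deriv (td_square (v t')))) D {0..t} \<and>
        v t = V \<eta> \<Phi> t v0 - D)"

definition solution_map ::
  "real \<Rightarrow> (real \<Rightarrow> real) \<Rightarrow> real \<Rightarrow> real \<Rightarrow> tempered \<Rightarrow> real \<Rightarrow> tempered" where
  "solution_map \<eta> \<Phi> s T v0 = (THE v. solution \<eta> \<Phi> s T v0 v)"

section \<open>Smooth maps between normed spaces given by carriers\<close>

text \<open>\<open>f\<close> is infinitely often Frechet differentiable, over the reals, from the open subset \<open>U\<close> of
  the normed space \<open>(E, N)\<close> to the normed space \<open>(G, M)\<close> of curves. The value \<open>D u [h\<^sub>n, \<dots>, h\<^sub>1]\<close> is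
  the derivative of order \<open>n\<close> at \<open>u\<close>, as a bounded multilinear map; by the last condition
  it is differentiable in \<open>u\<close> for the operator norm, and its derivative is that of order \<open>n + 1\<close>.\<close>

definition smooth_map :: "'a::real_vector set \<Rightarrow> ('a \<Rightarrow> real) \<Rightarrow> 'a set \<Rightarrow>
    ('c \<Rightarrow> 'b::real_vector) set \<Rightarrow> (('c \<Rightarrow> 'b) \<Rightarrow> real) \<Rightarrow> ('a \<Rightarrow> 'c \<Rightarrow> 'b) \<Rightarrow> bool" where
  "smooth_map E N U G M f \<longleftrightarrow> (\<exists>D :: 'a \<Rightarrow> 'a list \<Rightarrow> 'c \<Rightarrow> 'b. \<forall>u\<in>U.
     D u [] = f u \<and>
     (\<forall>hs. set hs \<subseteq> E \<longrightarrow> D u hs \<in> G) \<and>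
     (\<forall>hs ks. \<forall>h\<in>E. \<forall>k\<in>E. \<forall>a b. set hs \<subseteq> E \<longrightarrow> set ks \<subseteq> E \<longrightarrow>
        D u (hs @ (a *\<^sub>R h + b *\<^sub>R k) # ks) =
          (\<lambda>t. a *\<^sub>R D u (hs @ h # ks) t + b *\<^sub>R D u (hs @ k # ks) t)) \<and>
     (\<forall>n. \<exists>B. \<forall>hs. set hs \<subseteq> E \<longrightarrow> length hs = n \<longrightarrow>
        M (D u hs) \<le> B * prod_list (map N hs)) \<and>
     (\<forall>n. \<forall>\<epsilon>>0. \<exists>\<delta>>0. \<forall>h\<in>E. N h < \<delta> \<longrightarrow> u + h \<in> U \<longrightarrow>
        (\<forall>hs. set hs \<subseteq> E \<longrightarrow> length hs = n \<longrightarrow>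
          M (\<lambda>t. D (u + h) hs t - D u hs t - D u (h # hs) t) \<le> \<epsilon> * N h * prod_list (map N hs))))"

end

theory Submission imports Defs "HOL-Probability.Probability" "HOL-Computational_Algebra.Polynomial" begin

text \<open>
  On the Fourier side the integral equation is an equation between functions, \<open>g t \<xi> = e^(tm) g\<^sub>0
  \<xi> - (i \<xi> / 2 \<pi>) \<integral>\<^sub>0\<^sup>t e^((t-r)m) (g r * g r) \<xi> dr\<close> with \<open>m \<xi> = i \<xi>\<^sup>3 + \<eta> \<Phi> \<xi>\<close>. Since \<open>\<Phi>\<close> is \<open>-
  \<bar>\<xi>\<bar>\<^sup>p\<close> up to lower order, the propagator \<open>e^(tm)\<close> decays like \<open>exp (- c t \<langle>\<xi>\<rangle>\<^sup>p)\<close>, so it is at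
  most a constant times \<open>t^(-k) \<langle>\<xi>\<rangle>^(-pk)\<close> for every \<open>k\<close> in \<open>[0,1]\<close> (\<open>symbol_decay\<close>, \<open>sem_bound\<close>):
  powers of \<open>t\<close> are traded for derivatives, and this pays for the derivative in the nonlinearity.

  Existence. Put \<open>\<alpha> = max 0 (- s) / p\<close>; the hypothesis \<open>s > - p / 2\<close> says \<open>\<alpha> < 1/2\<close>. The free
  evolution of a datum in \<open>H\<^sup>s\<close> has \<open>L\<^sup>2\<close> norm \<open>O(t^(-\<alpha>))\<close>, so by Cauchy-Schwarz the
  self-convolution of its transform is bounded by \<open>O(t^(-2\<alpha>))\<close>, uniformly in \<open>\<xi>\<close>, and this is
  integrable in time. Estimating the propagator with \<open>k = 1/2\<close> and with \<open>k = 1/2 - \<alpha>\<close> bounds the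
  Duhamel integral, pointwise in \<open>(t, \<xi>)\<close>, by \<open>T^(1/2-\<alpha>)\<close> times an explicit weight \<open>om t \<xi>\<close>, which
  lies in the space of the solution because \<open>p / 2 - 1 > 1/2\<close>; this is where \<open>p > 3\<close> enters
  (\<open>duh_Gc_bound\<close>). Hence the solution is sought in the form \<open>e^(tm) g\<^sub>0 + om z\<close> with a bounded
  measurable function \<open>z\<close> of \<open>(t, \<xi>)\<close>. No continuity is imposed on \<open>z\<close>, and such functions form a
  Banach space with the supremum norm. The equation becomes \<open>z = b (v\<^sub>0, z) (v\<^sub>0, z)\<close> for a
  bilinear \<open>b\<close> whose norm is small for small \<open>T\<close>, and is solved by contraction.

  Smoothness. The derivatives of the solution of a quadratic equation solve the linear equations
  obtained by differentiating it formally. One estimate for such hierarchies of linear equations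
  (\<open>stability\<close>) shows that these candidates are multilinear, depend Lipschitz continuously on the
  base point, and leave a remainder that is quadratic in the increment.

  Regularity. For fixed \<open>\<xi>\<close> a Duhamel integral is continuous in \<open>t\<close>, and dominated convergence
  turns this into continuity in \<open>H\<^sup>s\<close>. For positive times one derivative after the other is
  gained: the part of the Duhamel integral with \<open>r < \<epsilon>/2\<close> is smoothed by the propagator, and for
  \<open>r \<ge> \<epsilon>/2\<close> the regularity known so far is used (\<open>regular_Suc\<close>).

  Uniqueness. A solution is only assumed to be continuous in \<open>H\<^sup>s\<close> and square integrable in time
  with values in \<open>L\<^sup>2\<close>. Its Fourier transform can be chosen measurable in both variables
  (\<open>joint_rep\<close>), and then satisfies the equation above pointwise almost everywhere. For two
  solutions the squared \<open>L\<^sup>2\<close> norm \<open>a t\<close> of the difference satisfies \<open>a t \<le> C \<integral>\<^sub>0\<^sup>t (t - r)^(-2k)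
  a r dr\<close> for some \<open>k < 1/2\<close> with \<open>p k > 3/2\<close>, which again exists because \<open>p > 3\<close>, and Gronwall's
  lemma with a singular kernel gives \<open>a = 0\<close> (\<open>mild_unique\<close>, \<open>singular_gronwall\<close>).

  The first half of the text supplies the dictionary between tempered distributions and functions
  on the Fourier side: Fourier inversion, uniqueness of the representing function, Plancherel's
  inequality, and the transforms of squares, derivatives, multipliers and weak integrals
  (\<open>given_by_unique\<close>, \<open>rep_inv_td\<close>, \<open>rep_td_square\<close>, \<open>rep_bounded_multiplier\<close>,
  \<open>has_td_integral_rep\<close>).
\<close>

section \<open>Notation and the weight \<open>\<langle>x\<rangle>\<close>\<close>

abbreviation cx :: "real \<Rightarrow> complex" where "cx \<equiv> of_real"

abbreviation ek :: "real \<Rightarrow> complex" where "ek a \<equiv> exp (- (\<i> * cx a))"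

text \<open>Joint measurability, needed for every exchange of an integral in time with one in frequency.\<close>

abbreviation jmeas :: "(real \<Rightarrow> real \<Rightarrow> complex) \<Rightarrow> bool" where
  "jmeas G \<equiv> (\<lambda>(t, x). G t x) \<in> borel_measurable (borel \<Otimes>\<^sub>M borel)"

text \<open>All integrals are with respect to the Lebesgue measure on the line.\<close>

abbreviation leb_integral :: "(real \<Rightarrow> 'b::{banach, second_countable_topology}) \<Rightarrow> 'b" (binder "\<integral>" 10) where
  "leb_integral f \<equiv> integral\<^sup>L lborel f"

abbreviation leb_nn_integral :: "(real \<Rightarrow> ennreal) \<Rightarrow> ennreal" (binder "\<integral>\<^sup>+" 10) where
  "leb_nn_integral f \<equiv> nn_integral lborel f"

text \<open>The Japanese bracket \<open>\<langle>x\<rangle>\<close>.\<close>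

definition jap :: "real \<Rightarrow> real" where "jap x = sqrt (1 + x\<^sup>2)"

lemma jap_ge_1 [simp]: "1 \<le> jap x"
  by (simp add: jap_def)

lemma jap_pos [simp]: "0 < jap x"
  using jap_ge_1 [of x] by linarith

lemma jap_nonneg [simp]: "0 \<le> jap x" and jap_nz [simp]: "jap x \<noteq> 0"
  using jap_pos [of x] by linarith+

lemma jap_sq: "(jap x)\<^sup>2 = 1 + x\<^sup>2"
  by (simp add: jap_def)

lemma abs_le_jap: "\<bar>x\<bar> \<le> jap x"
  unfolding jap_def by (rule real_le_rsqrt) simp

lemma jap_le: "jap x \<le> 1 + \<bar>x\<bar>"
  unfolding jap_def by (rule real_le_lsqrt) (auto simp: power2_eq_square algebra_simps)

lemma jap_ge: "(1 + \<bar>x\<bar>) / 2 \<le> jap x"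
proof -
  have "1 + \<bar>x\<bar> \<le> jap x + jap x" by (intro add_mono jap_ge_1 abs_le_jap)
  then show ?thesis by simp
qed

lemma borel_measurable_jap [measurable]: "jap \<in> borel_measurable borel"
  unfolding jap_def by measurable

lemma jap_powr_sq: "(1 + \<bar>x\<bar>\<^sup>2) powr s = (jap x powr s)\<^sup>2"
proof -
  have "(1 + \<bar>x\<bar>\<^sup>2) powr s = ((jap x)\<^sup>2) powr s" by (simp add: jap_sq)
  also have "\<dots> = (jap x powr s)\<^sup>2"
    by (simp add: power2_eq_square powr_mult)
  finally show ?thesis .
qed

text \<open>Peetre's inequality: it distributes the weight over the two factors of a convolution.\<close>

lemma jap_submult: "jap x \<le> 2 * jap (x - y) * jap y"
proof (rule power2_le_imp_le)
  have "(jap x)\<^sup>2 = 1 + ((x - y) + y)\<^sup>2" by (simp add: jap_sq)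
  also have "\<dots> \<le> 1 + (2 * (x - y)\<^sup>2 + 2 * y\<^sup>2)"
    using zero_le_power2 [of "(x - y) - y"] by (simp add: power2_eq_square algebra_simps)
  also have "\<dots> \<le> 4 * (1 + (x - y)\<^sup>2) * (1 + y\<^sup>2)"
    using mult_nonneg_nonneg [of "(x - y)\<^sup>2" "y\<^sup>2"] by (simp add: algebra_simps add_nonneg_nonneg del: power2_diff)
  also have "\<dots> = (2 * jap (x - y) * jap y)\<^sup>2"
    by (simp add: power_mult_distrib jap_sq)
  finally show "(jap x)\<^sup>2 \<le> (2 * jap (x - y) * jap y)\<^sup>2" .
qed simp

lemma nn_integral_tail_powr:
  assumes "r > 1"
  shows "(\<integral>\<^sup>+x. ennreal ((1 + x) powr - r) * indicator {0..} x) < \<infinity>"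
proof -
  have "(\<integral>\<^sup>+x. ennreal ((1 + x) powr - r) * indicator {0..} x)
      = ennreal (0 - (1 + 0) powr (1 - r) / (1 - r))"
  proof (rule nn_integral_FTC_atLeast)
    show "(\<lambda>x::real. (1 + x) powr - r) \<in> borel_measurable borel" by measurable
    show "((\<lambda>x. (1 + x) powr (1 - r) / (1 - r)) has_real_derivative (1 + x) powr - r) (at x)"
      if "0 \<le> x" for x
    proof -
      have "((\<lambda>x. (1 + x) powr (1 - r)) has_real_derivative (1 - r) * (1 + x) powr - r) (at x)"
        using that by (auto intro!: derivative_eq_intros)
      from DERIV_cdivide [OF this, of "1 - r"] show ?thesis using assms by simp
    qed
    have "((\<lambda>x. (1 + x) powr (1 - r)) \<longlongrightarrow> 0) at_top"
      using assms
      by (intro tendsto_neg_powr filterlim_tendsto_add_at_top [OF tendsto_const filterlim_ident]) auto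
    then show "((\<lambda>x. (1 + x) powr (1 - r) / (1 - r)) \<longlongrightarrow> 0) at_top"
      using tendsto_divide [OF _ tendsto_const, of _ 0 at_top "1 - r"] assms by auto
  qed auto
  then show ?thesis by simp
qed

lemma integrable_jap_powr:
  assumes "r > 1"
  shows "integrable lborel (\<lambda>x. jap x powr - r)"
proof (rule integrableI_bounded)
  show "(\<lambda>x. jap x powr - r) \<in> borel_measurable lborel" by measurable
  let ?f = "\<lambda>x::real. ennreal ((1 + x) powr - r) * indicator {0..} x"
  have le: "ennreal (norm (jap x powr - r)) \<le> ennreal (2 powr r) * (?f x + ?f (- x))" for x
  proof -
    have "jap x powr - r \<le> ((1 + \<bar>x\<bar>) / 2) powr - r"
      using assms jap_ge [of x] by (intro powr_mono2') auto
    also have "\<dots> = 2 powr r * (1 + \<bar>x\<bar>) powr - r"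
      by (simp add: powr_divide powr_minus field_simps)
    finally have "jap x powr - r \<le> 2 powr r * (1 + \<bar>x\<bar>) powr - r" .
    then have "ennreal (norm (jap x powr - r)) \<le> ennreal (2 powr r) * ennreal ((1 + \<bar>x\<bar>) powr - r)"
      by (simp add: ennreal_mult [symmetric] ennreal_leI)
    also have "ennreal ((1 + \<bar>x\<bar>) powr - r) \<le> ?f x + ?f (- x)"
      by (cases "x \<ge> 0"; cases "x = 0") (auto simp: indicator_def)
    finally show ?thesis by (simp add: mult_left_mono)
  qed
  have "(\<integral>\<^sup>+x. ?f (- x)) = (\<integral>\<^sup>+x. ?f x)"
    using nn_integral_real_affine [of ?f "-1" 0] by simp
  then have "(\<integral>\<^sup>+x. ennreal (2 powr r) * (?f x + ?f (- x))) < \<infinity>"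
    using nn_integral_tail_powr [OF assms]
    by (simp add: nn_integral_cmult nn_integral_add ennreal_mult_less_top)
  then show "(\<integral>\<^sup>+x. ennreal (norm (jap x powr - r))) < \<infinity>"
    using nn_integral_mono [OF le] by (rule order.strict_trans1 [rotated])
qed

section \<open>Schwartz functions\<close>

lemma schwartz_has_vector_derivative:
  assumes "\<phi> \<in> schwartz"
  shows "((vderiv ^^ n) \<phi> has_vector_derivative (vderiv ^^ Suc n) \<phi> x) (at x)"
proof -
  have "(vderiv ^^ n) \<phi> differentiable (at x)"
    using assms by (simp add: schwartz_def)
  then show ?thesis
    by (simp add: vderiv_def vector_derivative_works)
qed

lemma vderivI: "(\<And>x. (f has_vector_derivative g x) (at x)) \<Longrightarrow> vderiv f = g"
  by (rule ext) (simp add: vderiv_def vector_derivative_at)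

lemma schwartz_isCont:
  assumes "\<phi> \<in> schwartz" shows "isCont \<phi> x"
  using schwartz_has_vector_derivative [OF assms, of 0 x]
  by (auto intro: has_vector_derivative_continuous)

lemma schwartz_measurable:
  assumes "\<phi> \<in> schwartz" shows "\<phi> \<in> borel_measurable borel"
  by (rule borel_measurable_continuous_onI) (auto simp: continuous_on_eq_continuous_at schwartz_isCont [OF assms])

lemma schwartz_pointwise:
  assumes "\<phi> \<in> schwartz" "m \<le> N" "n \<le> N"
  shows "cmod (cx x ^ m * (vderiv ^^ n) \<phi> x) \<le> schwartz_norm N \<phi>"
proof -
  define a where "a m n = (SUP x. cmod (cx x ^ m * (vderiv ^^ n) \<phi> x))" for m n
  have nn: "0 \<le> a m n" for m n
    unfolding a_def by (rule schwartz_sup_nonneg [OF assms(1)])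
  have "bdd_above (range (\<lambda>x. cmod (cx x ^ m * (vderiv ^^ n) \<phi> x)))"
    using assms(1) by (auto simp: schwartz_def bounded_iff bdd_above_def)
  then have "cmod (cx x ^ m * (vderiv ^^ n) \<phi> x) \<le> a m n"
    unfolding a_def by (rule cSUP_upper [rotated]) auto
  also have "\<dots> \<le> (\<Sum>n\<le>N. a m n)"
    using assms by (intro member_le_sum) (auto simp: nn)
  also have "\<dots> \<le> (\<Sum>m\<le>N. \<Sum>n\<le>N. a m n)"
    using assms by (intro member_le_sum [of m "{..N}" "\<lambda>m. \<Sum>n\<le>N. a m n"]) (auto simp: nn sum_nonneg)
  finally show ?thesis by (simp add: schwartz_norm_def a_def)
qed

lemma schwartz_decay:
  assumes "\<phi> \<in> schwartz"
  shows "cmod (\<phi> x) * jap x ^ k \<le> 2 ^ k * schwartz_norm k \<phi>"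
proof -
  have "jap x ^ k \<le> (1 + \<bar>x\<bar>) ^ k" by (intro power_mono jap_le) simp
  also have "\<dots> \<le> (2 * max 1 \<bar>x\<bar>) ^ k" by (intro power_mono) auto
  also have "\<dots> = 2 ^ k * max 1 (\<bar>x\<bar> ^ k)"
    proof (cases "\<bar>x\<bar> \<le> 1")
    case True
    then show ?thesis using power_le_one [of "\<bar>x\<bar>" k] by (simp add: max_def power_mult_distrib)
  next
    case False
    then show ?thesis using one_le_power [of "\<bar>x\<bar>" k] by (simp add: max_def power_mult_distrib)
  qed
  finally have "cmod (\<phi> x) * jap x ^ k \<le> cmod (\<phi> x) * (2 ^ k * max 1 (\<bar>x\<bar> ^ k))"
    by (simp add: mult_left_mono)
  also have "\<dots> = 2 ^ k * max (cmod (\<phi> x)) (cmod (cx x ^ k * \<phi> x))"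
    by (simp add: norm_mult norm_power max_mult_distrib_left mult_ac)
  also have "\<dots> \<le> 2 ^ k * schwartz_norm k \<phi>"
    using schwartz_pointwise [OF assms, of 0 k 0 x] schwartz_pointwise [OF assms, of k k 0 x]
    by (intro mult_left_mono) auto
  finally show ?thesis .
qed

text \<open>Integration against such a function is a tempered distribution. It is the common class for all
  transforms that occur below: weighted square integrable functions and functions of polynomial
  growth belong to it.\<close>

definition moderate :: "(real \<Rightarrow> complex) \<Rightarrow> bool" where
  "moderate g \<longleftrightarrow> g \<in> borel_measurable borel \<and>
     (\<exists>k::nat. integrable lborel (\<lambda>x. cmod (g x) / jap x ^ k))"

lemma moderate_pairing:
  assumes "g \<in> borel_measurable borel" "integrable lborel (\<lambda>x. cmod (g x) / jap x ^ k)" "\<phi> \<in> schwartz"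
  shows "integrable lborel (\<lambda>x. g x * \<phi> x)"
    and "(\<integral>x. cmod (g x * \<phi> x)) \<le>
      (2 ^ k * (\<integral>x. cmod (g x) / jap x ^ k)) * schwartz_norm k \<phi>"
    and "cmod (\<integral>x. g x * \<phi> x) \<le>
      (2 ^ k * (\<integral>x. cmod (g x) / jap x ^ k)) * schwartz_norm k \<phi>"
proof -
  note [measurable] = assms(1) schwartz_measurable [OF assms(3)]
  have le: "cmod (g x * \<phi> x) \<le> (2 ^ k * schwartz_norm k \<phi>) * (cmod (g x) / jap x ^ k)" for x
    using mult_left_mono [OF schwartz_decay [OF assms(3), of x k], of "cmod (g x) / jap x ^ k"]
    by (simp add: norm_mult mult_ac)
  show i: "integrable lborel (\<lambda>x. g x * \<phi> x)"
  proof (rule Bochner_Integration.integrable_bound)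
    show "integrable lborel (\<lambda>x. (2 ^ k * schwartz_norm k \<phi>) * (cmod (g x) / jap x ^ k))"
      using assms(2) by (rule integrable_mult_right)
    show "AE x in lborel. norm (g x * \<phi> x) \<le> norm (2 ^ k * schwartz_norm k \<phi> * (cmod (g x) / jap x ^ k))"
      using order_trans [OF le abs_ge_self] by (intro AE_I2) (simp only: real_norm_def)
  qed measurable
  have "(\<integral>x. cmod (g x * \<phi> x)) \<le> (\<integral>x. (2 ^ k * schwartz_norm k \<phi>) * (cmod (g x) / jap x ^ k))"
    using integrable_mult_right [OF assms(2), of "2 ^ k * schwartz_norm k \<phi>"] i le
    by (intro integral_mono integrable_norm)
  also have "\<dots> = (2 ^ k * schwartz_norm k \<phi>) * (\<integral>x. cmod (g x) / jap x ^ k)"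
    by (rule integral_mult_right_zero)
  finally show b: "(\<integral>x. cmod (g x * \<phi> x)) \<le>
      (2 ^ k * (\<integral>x. cmod (g x) / jap x ^ k)) * schwartz_norm k \<phi>"
    by (simp add: mult_ac)
  show "cmod (\<integral>x. g x * \<phi> x) \<le>
      (2 ^ k * (\<integral>x. cmod (g x) / jap x ^ k)) * schwartz_norm k \<phi>"
    using integral_norm_bound [of lborel "\<lambda>x. g x * \<phi> x"] b by linarith
qed

lemma integrable_jap_power:
  assumes "k \<ge> 2" shows "integrable lborel (\<lambda>x. 1 / jap x ^ k)"
proof -
  have "1 / jap x ^ k = jap x powr - real k" for x
    by (simp add: powr_minus powr_realpow field_simps)
  then show ?thesis using integrable_jap_powr [of "real k"] assms by simp
qed

lemma moderateI_poly:
  assumes "g \<in> borel_measurable borel" "\<And>x. cmod (g x) \<le> B * jap x ^ k"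
  shows "moderate g"
proof -
  note [measurable] = assms(1)
  have "integrable lborel (\<lambda>x. cmod (g x) / jap x ^ (k + 2))"
  proof (rule Bochner_Integration.integrable_bound)
    show "integrable lborel (\<lambda>x. B * (1 / jap x ^ 2))"
      by (intro integrable_mult_right integrable_jap_power) simp
    have le: "cmod (g x) / jap x ^ (k + 2) \<le> B * (1 / jap x ^ 2)" for x
      using assms(2) [of x] by (simp add: power_add divide_simps mult_ac power2_eq_square)
    then show "AE x in lborel. norm (cmod (g x) / jap x ^ (k + 2)) \<le> norm (B * (1 / jap x ^ 2))"
      using order_trans [OF le abs_ge_self] by (intro AE_I2) (simp add: norm_divide)
  qed measurable
  then show ?thesis using assms(1) unfolding moderate_def by blast
qed

lemma schwartz_integrable_abs:
  assumes "\<phi> \<in> schwartz"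
  shows "integrable lborel \<phi>"
    and "(\<integral>x. cmod (\<phi> x)) \<le> (4 * (\<integral>x. 1 / jap x ^ 2)) * schwartz_norm 2 \<phi>"
  using moderate_pairing [of "\<lambda>_. 1" 2 \<phi>] assms integrable_jap_power [of 2] by simp_all

section \<open>The Fourier transform on the Schwartz space\<close>

text \<open>Continuity for the seminorms, stated for operators that need not be linear; it is what the
  continuity of a distribution composed with the operator requires.\<close>

definition schwartz_cont :: "((real \<Rightarrow> complex) \<Rightarrow> real \<Rightarrow> complex) \<Rightarrow> bool" where
  "schwartz_cont A \<longleftrightarrow> (\<forall>\<phi>\<in>schwartz. A \<phi> \<in> schwartz) \<and>
     (\<forall>N. \<exists>C M. 0 \<le> C \<and> (\<forall>\<phi>\<in>schwartz. schwartz_norm N (A \<phi>) \<le> C * schwartz_norm M \<phi>))"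

lemma schwartz_contI:
  assumes "\<And>\<phi> n x. \<phi> \<in> schwartz \<Longrightarrow> (vderiv ^^ n) (A \<phi>) differentiable (at x)"
    and "\<And>m n. \<exists>C M. 0 \<le> C \<and> (\<forall>\<phi>\<in>schwartz. \<forall>x. cmod (cx x ^ m * (vderiv ^^ n) (A \<phi>) x)
            \<le> C * schwartz_norm M \<phi>)"
  shows "schwartz_cont A"
  unfolding schwartz_cont_def
proof (intro conjI ballI allI)
  show "A \<phi> \<in> schwartz" if "\<phi> \<in> schwartz" for \<phi>
    unfolding schwartz_def mem_Collect_eq
  proof (intro conjI allI)
    show "bounded (range (\<lambda>x. cx x ^ m * (vderiv ^^ n) (A \<phi>) x))" for m n
      using assms(2) [of m n] that unfolding bounded_iff by blast
  qed (rule assms(1) [OF that])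
  fix N
  obtain C M where CM: "\<And>m n. 0 \<le> C m n" "\<And>m n \<phi> x. \<phi> \<in> schwartz \<Longrightarrow>
      cmod (cx x ^ m * (vderiv ^^ n) (A \<phi>) x) \<le> C m n * schwartz_norm (M m n) \<phi>"
    using assms(2) by metis
  define K where "K = (\<Sum>m\<le>N. \<Sum>n\<le>N. M m n)"
  have MK: "M m n \<le> K" if "m \<le> N" "n \<le> N" for m n
  proof -
    have "M m n \<le> (\<Sum>n\<le>N. M m n)" using that by (intro member_le_sum) auto
    also have "\<dots> \<le> K" unfolding K_def
      using that by (intro member_le_sum [of m "{..N}" "\<lambda>m. \<Sum>n\<le>N. M m n"]) auto
    finally show ?thesis .
  qed
  have "schwartz_norm N (A \<phi>) \<le> (\<Sum>m\<le>N. \<Sum>n\<le>N. C m n) * schwartz_norm K \<phi>" if "\<phi> \<in> schwartz" for \<phi>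
    unfolding schwartz_norm_def [of N] sum_distrib_right
  proof (intro sum_mono cSUP_least)
    fix m n x assume "m \<in> {..N}" "n \<in> {..N}"
    then have "C m n * schwartz_norm (M m n) \<phi> \<le> C m n * schwartz_norm K \<phi>"
      using MK CM(1) that by (intro mult_left_mono schwartz_norm_mono) auto
    then show "cmod (cx x ^ m * (vderiv ^^ n) (A \<phi>) x) \<le> C m n * schwartz_norm K \<phi>"
      using CM(2) [OF that, of x m n] by linarith
  qed simp
  then show "\<exists>C M. 0 \<le> C \<and> (\<forall>\<phi>\<in>schwartz. schwartz_norm N (A \<phi>) \<le> C * schwartz_norm M \<phi>)"
    using CM(1) by (meson sum_nonneg)
qed

lemma schwartz_contD: "schwartz_cont A \<Longrightarrow> \<phi> \<in> schwartz \<Longrightarrow> A \<phi> \<in> schwartz"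
  by (simp add: schwartz_cont_def)

lemma schwartz_contE:
  assumes "schwartz_cont A"
  obtains C M where "0 \<le> C" "\<And>\<phi>. \<phi> \<in> schwartz \<Longrightarrow> schwartz_norm N (A \<phi>) \<le> C * schwartz_norm M \<phi>"
  using assms unfolding schwartz_cont_def by meson

lemma schwartz_cont_comp:
  assumes "schwartz_cont A" "schwartz_cont B"
  shows "schwartz_cont (\<lambda>\<phi>. A (B \<phi>))"
  unfolding schwartz_cont_def
proof (intro conjI ballI allI)
  show "A (B \<phi>) \<in> schwartz" if "\<phi> \<in> schwartz" for \<phi>
    using assms that by (simp add: schwartz_cont_def)
  fix N
  obtain C M where "0 \<le> C" and C: "\<And>\<phi>. \<phi> \<in> schwartz \<Longrightarrow> schwartz_norm N (A \<phi>) \<le> C * schwartz_norm M \<phi>"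
    using assms(1) unfolding schwartz_cont_def by meson
  obtain D L where "0 \<le> D" and D: "\<And>\<phi>. \<phi> \<in> schwartz \<Longrightarrow> schwartz_norm M (B \<phi>) \<le> D * schwartz_norm L \<phi>"
    using assms(2) unfolding schwartz_cont_def by meson
  have "schwartz_norm N (A (B \<phi>)) \<le> (C * D) * schwartz_norm L \<phi>" if "\<phi> \<in> schwartz" for \<phi>
  proof -
    have "B \<phi> \<in> schwartz" using assms(2) that by (simp add: schwartz_cont_def)
    then have "schwartz_norm N (A (B \<phi>)) \<le> C * schwartz_norm M (B \<phi>)" by (rule C)
    also have "\<dots> \<le> C * (D * schwartz_norm L \<phi>)" using \<open>0 \<le> C\<close> D [OF that] by (rule mult_left_mono [rotated])
    finally show ?thesis by (simp add: mult_ac)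
  qed
  then show "\<exists>C M. 0 \<le> C \<and> (\<forall>\<phi>\<in>schwartz. schwartz_norm N (A (B \<phi>)) \<le> C * schwartz_norm M \<phi>)"
    using \<open>0 \<le> C\<close> \<open>0 \<le> D\<close> by (meson mult_nonneg_nonneg)
qed

lemma schwartz_cont_id: "schwartz_cont (\<lambda>\<phi>. \<phi>)"
  unfolding schwartz_cont_def by (metis mult_1 order_refl zero_le_one)

lemma schwartz_cont_funpow:
  assumes "schwartz_cont A" shows "schwartz_cont (A ^^ n)"
proof (induction n)
  case 0 then show ?case using schwartz_cont_id by (simp add: id_def)
next
  case (Suc n)
  then show ?case using schwartz_cont_comp [OF assms Suc] by (simp add: comp_def)
qed

lemma schwartz_cont_cmult_vderiv: "schwartz_cont (\<lambda>\<phi> x. c * vderiv \<phi> x)"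
proof (rule schwartz_contI)
  fix \<phi> n x assume \<phi>: "\<phi> \<in> schwartz"
  have "(\<lambda>x. c * vderiv \<phi> x) \<in> schwartz"
    using \<phi> by (intro schwartz_cmult schwartz_vderiv)
  then show "(vderiv ^^ n) (\<lambda>x. c * vderiv \<phi> x) differentiable (at x)"
    by (simp add: schwartz_def)
next
  fix m n
  have "cmod (cx x ^ m * (vderiv ^^ n) (\<lambda>x. c * vderiv \<phi> x) x) \<le> cmod c * schwartz_norm (Suc (max m n)) \<phi>"
    if "\<phi> \<in> schwartz" for \<phi> x
  proof -
    have "(vderiv ^^ n) (\<lambda>x. c * vderiv \<phi> x) x = c * (vderiv ^^ Suc n) \<phi> x"
      using vderiv_funpow_cmult [OF schwartz_vderiv [OF that], of n c] by (simp add: funpow_swap1)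
    then have "cmod (cx x ^ m * (vderiv ^^ n) (\<lambda>x. c * vderiv \<phi> x) x) =
       cmod c * cmod (cx x ^ m * (vderiv ^^ Suc n) \<phi> x)" by (simp add: norm_mult mult_ac)
    then show ?thesis using schwartz_pointwise [OF that, of m "Suc (max m n)" "Suc n" x]
      by (simp add: mult_left_mono)
  qed
  then show "\<exists>C M. 0 \<le> C \<and> (\<forall>\<phi>\<in>schwartz. \<forall>x. cmod (cx x ^ m * (vderiv ^^ n) (\<lambda>x. c * vderiv \<phi> x) x)
            \<le> C * schwartz_norm M \<phi>)"
    by (meson norm_ge_zero)
qed

lemma vderiv_funpow_mult_x:
  assumes "\<phi> \<in> schwartz"
  shows "(vderiv ^^ n) (\<lambda>x. cx x * \<phi> x) =
     (\<lambda>x. cx x * (vderiv ^^ n) \<phi> x + of_nat n * (vderiv ^^ (n - 1)) \<phi> x)"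
proof (induction n)
  case (Suc n)
  have "((\<lambda>x. cx x * (vderiv ^^ n) \<phi> x + of_nat n * (vderiv ^^ (n - 1)) \<phi> x) has_vector_derivative
      cx x * (vderiv ^^ Suc n) \<phi> x + of_nat (Suc n) * (vderiv ^^ n) \<phi> x) (at x)" for x
  proof -
    have 1: "((\<lambda>x. cx x * (vderiv ^^ n) \<phi> x) has_vector_derivative
        cx x * (vderiv ^^ Suc n) \<phi> x + 1 * (vderiv ^^ n) \<phi> x) (at x)"
      by (rule has_vector_derivative_mult [OF _ schwartz_has_vector_derivative [OF assms]])
        (auto intro!: derivative_eq_intros)
    have 2: "((\<lambda>x. of_nat n * (vderiv ^^ (n - 1)) \<phi> x) has_vector_derivative of_nat n * (vderiv ^^ n) \<phi> x) (at x)"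
    proof (cases n)
      case (Suc k)
      then show ?thesis
        using has_vector_derivative_mult_right [OF schwartz_has_vector_derivative [OF assms, of k x], of "of_nat n"] by simp
    qed simp
    show ?thesis using has_vector_derivative_add [OF 1 2] by (simp add: algebra_simps)
  qed
  from vderivI [OF this] show ?case using Suc by simp
qed simp

lemma schwartz_cont_mult_x: "schwartz_cont (\<lambda>\<phi> x. cx x * \<phi> x)"
proof (rule schwartz_contI)
  fix \<phi> n x assume \<phi>: "\<phi> \<in> schwartz"
  have d: "(vderiv ^^ n) \<phi> differentiable (at x)" for n
    using \<phi> by (simp add: schwartz_def)
  have "cx differentiable (at x)"
    using differentiableI_vector [OF has_vector_derivative_of_real [OF DERIV_ident]] by simp
  then show "(vderiv ^^ n) (\<lambda>x. cx x * \<phi> x) differentiable (at x)"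
    unfolding vderiv_funpow_mult_x [OF \<phi>] by (intro derivative_intros d)
next
  fix m n
  have "cmod (cx x ^ m * (vderiv ^^ n) (\<lambda>x. cx x * \<phi> x) x)
     \<le> (1 + real n) * schwartz_norm (Suc (max m n)) \<phi>"
    if "\<phi> \<in> schwartz" for \<phi> x
  proof -
    have "cmod (cx x ^ m * (vderiv ^^ n) (\<lambda>x. cx x * \<phi> x) x)
       = cmod (cx x ^ Suc m * (vderiv ^^ n) \<phi> x + of_nat n * (cx x ^ m * (vderiv ^^ (n - 1)) \<phi> x))"
      unfolding vderiv_funpow_mult_x [OF that] by (simp add: algebra_simps)
    also have "\<dots> \<le> cmod (cx x ^ Suc m * (vderiv ^^ n) \<phi> x) +
        real n * cmod (cx x ^ m * (vderiv ^^ (n - 1)) \<phi> x)"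
      by (rule order_trans [OF norm_triangle_ineq]) (simp add: norm_mult)
    also have "\<dots> \<le> schwartz_norm (Suc (max m n)) \<phi> + real n * schwartz_norm (Suc (max m n)) \<phi>"
      by (intro add_mono mult_left_mono schwartz_pointwise [OF that]) auto
    finally show ?thesis by (simp add: algebra_simps)
  qed
  then show "\<exists>C M. 0 \<le> C \<and> (\<forall>\<phi>\<in>schwartz. \<forall>x. cmod (cx x ^ m * (vderiv ^^ n) (\<lambda>x. cx x * \<phi> x) x)
            \<le> C * schwartz_norm M \<phi>)"
    by (intro exI [of _ "1 + real n"] exI [of _ "Suc (max m n)"]) auto
qed

lemma schwartz_mult_x: "\<phi> \<in> schwartz \<Longrightarrow> (\<lambda>x. cx x * \<phi> x) \<in> schwartz"
  using schwartz_cont_mult_x by (simp add: schwartz_cont_def)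

lemma schwartz_cont_cmult: "schwartz_cont (\<lambda>\<phi> x. c * \<phi> x)"
proof (rule schwartz_contI)
  fix \<phi> n x assume \<phi>: "\<phi> \<in> schwartz"
  show "(vderiv ^^ n) (\<lambda>x. c * \<phi> x) differentiable (at x)"
    using schwartz_cmult [OF \<phi>] by (simp add: schwartz_def)
next
  fix m n
  have "cmod (cx x ^ m * (vderiv ^^ n) (\<lambda>x. c * \<phi> x) x) \<le> cmod c * schwartz_norm (max m n) \<phi>"
    if "\<phi> \<in> schwartz" for \<phi> x
  proof -
    have "cmod (cx x ^ m * (vderiv ^^ n) (\<lambda>x. c * \<phi> x) x) =
       cmod c * cmod (cx x ^ m * (vderiv ^^ n) \<phi> x)"
      using vderiv_funpow_cmult [OF that, of n c] by (simp add: norm_mult mult_ac)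
    then show ?thesis using schwartz_pointwise [OF that, of m "max m n" n x]
      by (simp add: mult_left_mono)
  qed
  then show "\<exists>C M. 0 \<le> C \<and> (\<forall>\<phi>\<in>schwartz. \<forall>x. cmod (cx x ^ m * (vderiv ^^ n) (\<lambda>x. c * \<phi> x) x)
            \<le> C * schwartz_norm M \<phi>)"
    by (meson norm_ge_zero)
qed

lemma vderiv_reflect:
  assumes "\<phi> \<in> schwartz"
  shows "(vderiv ^^ n) (\<lambda>x. \<phi> (- x)) = (\<lambda>x. (-1) ^ n * (vderiv ^^ n) \<phi> (- x))"
proof (induction n)
  case (Suc n)
  have "((\<lambda>x. (-1) ^ n * (vderiv ^^ n) \<phi> (- x)) has_vector_derivative (-1) ^ Suc n * (vderiv ^^ Suc n) \<phi> (- x)) (at x)" for x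
  proof -
    have minus: "(uminus has_vector_derivative -1) (at x)"
      by (auto intro!: derivative_eq_intros)
    have "((\<lambda>x. (vderiv ^^ n) \<phi> (- x)) has_vector_derivative (- 1) *\<^sub>R (vderiv ^^ Suc n) \<phi> (- x)) (at x)"
      using vector_diff_chain_at [of uminus "-1" x "(vderiv ^^ n) \<phi>" "(vderiv ^^ Suc n) \<phi> (- x)"]
        schwartz_has_vector_derivative [OF assms, of n "- x"]
        minus by (simp add: o_def)
    from has_vector_derivative_mult_right [OF this, of "(-1)^n"] show ?thesis by simp
  qed
  from vderivI [OF this] show ?case using Suc by simp
qed simp

lemma schwartz_cont_reflect: "schwartz_cont (\<lambda>\<phi> x. \<phi> (- x))"
proof (rule schwartz_contI)
  fix \<phi> n x assume \<phi>: "\<phi> \<in> schwartz"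
  have minus: "(uminus has_vector_derivative -1) (at x)"
    by (auto intro!: derivative_eq_intros)
  have "((\<lambda>x. (vderiv ^^ n) \<phi> (- x)) has_vector_derivative (- 1) *\<^sub>R (vderiv ^^ Suc n) \<phi> (- x)) (at x)"
      using vector_diff_chain_at [of uminus "-1" x "(vderiv ^^ n) \<phi>" "(vderiv ^^ Suc n) \<phi> (- x)"]
        schwartz_has_vector_derivative [OF \<phi>, of n "- x"]
        minus by (simp add: o_def)
  from has_vector_derivative_mult_right [OF this, of "(-1)^n"]
  show "(vderiv ^^ n) (\<lambda>x. \<phi> (- x)) differentiable (at x)"
    unfolding vderiv_reflect [OF \<phi>] by (rule differentiableI_vector)
next
  fix m n
  have "cmod (cx x ^ m * (vderiv ^^ n) (\<lambda>x. \<phi> (- x)) x) \<le> 1 * schwartz_norm (max m n) \<phi>"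
    if "\<phi> \<in> schwartz" for \<phi> x
    using schwartz_pointwise [OF that, of m "max m n" n "- x"]
    by (simp add: vderiv_reflect [OF that] norm_mult norm_power)
  then show "\<exists>C M. 0 \<le> C \<and> (\<forall>\<phi>\<in>schwartz. \<forall>x. cmod (cx x ^ m * (vderiv ^^ n) (\<lambda>x. \<phi> (- x)) x)
            \<le> C * schwartz_norm M \<phi>)"
    by (meson zero_le_one)
qed

lemma norm_fourier_kernel [simp]: "cmod (ek a) = 1"
  using norm_exp_i_times [of "- a"] by simp

lemma fourier_integrable:
  assumes "integrable lborel \<phi>"
  shows "integrable lborel (\<lambda>x. ek (x * \<xi>) * \<phi> x)"
  using assms
proof (rule Bochner_Integration.integrable_bound)
  show "(\<lambda>x. ek (x * \<xi>) * \<phi> x) \<in> borel_measurable lborel"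
    using borel_measurable_integrable [OF assms] by measurable
qed (simp add: norm_mult del: of_real_mult)

lemma norm_fourier_le:
  assumes "integrable lborel \<phi>"
  shows "cmod (fourier \<phi> \<xi>) \<le> (\<integral>x. cmod (\<phi> x))"
  unfolding fourier_def
  by (rule order_trans [OF integral_norm_bound]) (simp add: norm_mult del: of_real_mult)

text \<open>A Taylor bound with explicit quadratic remainder gives differentiability, which avoids
  differentiating under the integral sign by dominated convergence.\<close>

lemma has_vector_derivative_of_quadratic_bound:
  fixes f :: "real \<Rightarrow> 'a::real_normed_vector"
  assumes "\<And>h. norm (f (x + h) - f x - h *\<^sub>R D) \<le> C * h\<^sup>2"
  shows "(f has_vector_derivative D) (at x)"
  unfolding has_vector_derivative_def has_derivative_at
proof (intro conjI bounded_linear_scaleR_left)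
  have le: "norm (f (x + h) - f x - h *\<^sub>R D) / norm h \<le> C * \<bar>h\<bar>" for h
    using assms [of h] by (cases "h = 0") (auto simp: field_simps power2_eq_square abs_mult_self_eq)
  have "((\<lambda>h::real. C * \<bar>h\<bar>) \<longlongrightarrow> C * \<bar>0\<bar>) (at 0)" by (intro tendsto_intros)
  then have lim: "((\<lambda>h::real. C * \<bar>h\<bar>) \<longlongrightarrow> 0) (at 0)" by simp
  show "(\<lambda>h. norm (f (x + h) - f x - h *\<^sub>R D) / norm h) \<midarrow>0\<rightarrow> 0"
    by (rule tendsto_sandwich [OF always_eventually always_eventually tendsto_const lim], intro allI divide_nonneg_nonneg norm_ge_zero, rule allI, rule le)
qed

lemma integral_combination:
  fixes f g k :: "real \<Rightarrow> complex"
  assumes "integrable M f" "integrable M g" "integrable M k"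
  shows "(\<integral>x. f x \<partial>M) - (\<integral>x. g x \<partial>M) - h *\<^sub>R (\<integral>x. k x \<partial>M) = (\<integral>x. f x - g x - h *\<^sub>R k x \<partial>M)"
  using assms by simp

lemma fourier_has_vector_derivative:
  assumes "\<phi> \<in> schwartz"
  shows "(fourier \<phi> has_vector_derivative fourier (\<lambda>x. (- \<i>) * (cx x * \<phi> x)) \<xi>) (at \<xi>)"
proof (rule has_vector_derivative_of_quadratic_bound)
  let ?D = "\<lambda>x. (- \<i>) * (cx x * \<phi> x)"
  have Ds: "?D \<in> schwartz" and xs: "(\<lambda>x. cx x * (cx x * \<phi> x)) \<in> schwartz"
    by (intro schwartz_cmult schwartz_mult_x assms)+
  note i = fourier_integrable [OF schwartz_integrable_abs(1)]
  fix h
  have "fourier \<phi> (\<xi> + h) - fourier \<phi> \<xi> - h *\<^sub>R fourier ?D \<xi> =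
    (\<integral>x. ek (x * (\<xi> + h)) * \<phi> x - ek (x * \<xi>) * \<phi> x
       - h *\<^sub>R (ek (x * \<xi>) * ?D x))"
    unfolding fourier_def
    by (rule integral_combination [OF i [OF assms] i [OF assms] i [OF Ds]])
  also have "cmod \<dots> \<le> (\<integral>x. h\<^sup>2 / 2 * cmod (cx x * (cx x * \<phi> x)))"
  proof (rule Bochner_Integration.integral_norm_bound_integral)
    show "integrable lborel (\<lambda>x. ek (x * (\<xi> + h)) * \<phi> x - ek (x * \<xi>) * \<phi> x
       - h *\<^sub>R (ek (x * \<xi>) * ?D x))"
      by (intro Bochner_Integration.integrable_diff integrable_scaleR_right i assms Ds)
    show "integrable lborel (\<lambda>x. h\<^sup>2 / 2 * cmod (cx x * (cx x * \<phi> x)))"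
      using schwartz_integrable_abs(1) [OF xs] by simp
    fix x
    have split: "ek (x * (\<xi> + h)) =
        ek (x * \<xi>) * exp (\<i> * cx (- (x * h)))"
      by (simp add: exp_add [symmetric] algebra_simps)
    have "ek (x * (\<xi> + h)) * \<phi> x - ek (x * \<xi>) * \<phi> x
       - h *\<^sub>R (ek (x * \<xi>) * ?D x) =
       ek (x * \<xi>) * \<phi> x * (exp (\<i> * cx (- (x * h))) - (1 + \<i> * cx (- (x * h))))"
      unfolding split by (simp add: algebra_simps scaleR_conv_of_real)
    also have "cmod \<dots> \<le> cmod (\<phi> x) * (\<bar>- (x * h)\<bar>\<^sup>2 / 2)"
      unfolding norm_mult norm_fourier_kernel
      using mult_left_mono [OF iexp_approx1 [of "- (x * h)" 1], of "cmod (\<phi> x)"]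
      by (simp add: power2_eq_square del: of_real_mult of_real_minus)
    also have "\<bar>- (x * h)\<bar>\<^sup>2 = h\<^sup>2 * (\<bar>x\<bar> * \<bar>x\<bar>)"
      by (simp add: power_mult_distrib power2_eq_square)
    also have "cmod (\<phi> x) * (h\<^sup>2 * (\<bar>x\<bar> * \<bar>x\<bar>) / 2) = h\<^sup>2 / 2 * cmod (cx x * (cx x * \<phi> x))"
      unfolding norm_mult norm_of_real by algebra
    finally show "cmod (ek (x * (\<xi> + h)) * \<phi> x - ek (x * \<xi>) * \<phi> x
       - h *\<^sub>R (ek (x * \<xi>) * ?D x)) \<le> h\<^sup>2 / 2 * cmod (cx x * (cx x * \<phi> x))" .
  qed
  also have "\<dots> = h\<^sup>2 / 2 * (\<integral>x. cmod (cx x * (cx x * \<phi> x)))"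
    by (rule integral_mult_right_zero)
  also have "\<dots> = ((\<integral>x. cmod (cx x * (cx x * \<phi> x))) / 2) * h\<^sup>2"
    by (rule trans [OF times_divide_eq_left]) (simp only: times_divide_eq_left mult.commute)
  finally show "cmod (fourier \<phi> (\<xi> + h) - fourier \<phi> \<xi> - h *\<^sub>R fourier ?D \<xi>) \<le>
      ((\<integral>x. cmod (cx x * (cx x * \<phi> x))) / 2) * h\<^sup>2" .
qed

text \<open>The fundamental theorem of calculus, as Schwartz functions vanish at infinity.\<close>

lemma schwartz_integral_vderiv:
  assumes "\<phi> \<in> schwartz" shows "(\<integral>x. vderiv \<phi> x) = 0"
proof -
  have bd: "cmod (\<phi> x) \<le> 2 * schwartz_norm 1 \<phi> * inverse (1 + \<bar>x\<bar>) * 2" for x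
  proof -
    have "cmod (\<phi> x) * ((1 + \<bar>x\<bar>) / 2) \<le> cmod (\<phi> x) * jap x"
      by (intro mult_left_mono jap_ge) auto
    also have "\<dots> \<le> 2 * schwartz_norm 1 \<phi>" using schwartz_decay [OF assms, of x 1] by simp
    finally show ?thesis by (simp add: field_simps)
  qed
  have "filterlim (\<lambda>x::real. 1 + \<bar>x\<bar>) at_top at_top"
    by (intro filterlim_tendsto_add_at_top [OF tendsto_const]
        filterlim_at_top_mono [OF filterlim_ident] always_eventually) auto
  then have "((\<lambda>x::real. 2 * schwartz_norm 1 \<phi> * inverse (1 + \<bar>x\<bar>) * 2) \<longlongrightarrow> 2 * schwartz_norm 1 \<phi> * 0 * 2) at_top"
    by (intro tendsto_intros tendsto_inverse_0_at_top)
  then have top: "(\<phi> \<longlongrightarrow> 0) at_top"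
    by (intro Lim_null_comparison [OF always_eventually [OF allI [OF bd]]]) simp
  have "filterlim (\<lambda>x::real. 1 + \<bar>x\<bar>) at_top at_bot"
    by (intro filterlim_tendsto_add_at_top [OF tendsto_const]
        filterlim_at_top_mono [OF filterlim_uminus_at_top_at_bot] always_eventually) auto
  then have "((\<lambda>x::real. 2 * schwartz_norm 1 \<phi> * inverse (1 + \<bar>x\<bar>) * 2) \<longlongrightarrow> 2 * schwartz_norm 1 \<phi> * 0 * 2) at_bot"
    by (intro tendsto_intros tendsto_inverse_0_at_top)
  then have bot: "(\<phi> \<longlongrightarrow> 0) at_bot"
    by (intro Lim_null_comparison [OF always_eventually [OF allI [OF bd]]]) simp
  have "(LBINT x=-\<infinity>..\<infinity>. vderiv \<phi> x) = 0 - 0"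
  proof (rule interval_integral_FTC_integrable)
    show "(\<phi> has_vector_derivative vderiv \<phi> x) (at x)" for x
      using schwartz_has_vector_derivative [OF assms, of 0 x] by simp
    show "isCont (vderiv \<phi>) x" for x
      by (rule schwartz_isCont [OF schwartz_vderiv [OF assms]])
    show "set_integrable lborel (einterval (-\<infinity>) \<infinity>) (vderiv \<phi>)"
      using schwartz_integrable_abs(1) [OF schwartz_vderiv [OF assms]]
      by (simp add: set_integrable_def einterval_def)
    show "((\<phi> \<circ> real_of_ereal) \<longlongrightarrow> 0) (at_right (-\<infinity>))" "((\<phi> \<circ> real_of_ereal) \<longlongrightarrow> 0) (at_left \<infinity>)"
      using top bot by (auto simp: ereal_tendsto_simps)
  qed auto
  then show ?thesis
    by (simp add: interval_lebesgue_integral_def einterval_def set_lebesgue_integral_def)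
qed

lemma mult_exp_has_vector_derivative:
  assumes "\<phi> \<in> schwartz"
  shows "((\<lambda>x. ek (x * \<xi>) * \<phi> x) has_vector_derivative
    ek (x * \<xi>) * (vderiv \<phi> x - \<i> * cx \<xi> * \<phi> x)) (at x)"
proof -
  let ?e = "\<lambda>x. ek (x * \<xi>)"
  have "((\<lambda>x. cx (x * \<xi>)) has_vector_derivative cx \<xi>) (at x)"
    by (rule has_vector_derivative_of_real) (auto intro!: derivative_eq_intros)
  then have "((\<lambda>x. - (\<i> * cx (x * \<xi>))) has_vector_derivative - (\<i> * cx \<xi>)) (at x)"
    by (intro has_vector_derivative_minus has_vector_derivative_mult_right)
  then have "(?e has_vector_derivative (- (\<i> * cx \<xi>)) * ?e x) (at x)"
    using field_vector_diff_chain_at [of "\<lambda>x. - (\<i> * cx (x * \<xi>))" "- (\<i> * cx \<xi>)" x exp] DERIV_exp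
    by (simp add: o_def)
  from has_vector_derivative_mult [OF this schwartz_has_vector_derivative [OF assms, of 0 x]]
  show ?thesis by (simp add: algebra_simps)
qed

text \<open>Multiplication by \<open>e^(-ix\<xi>)\<close> conjugates \<open>d/dx\<close> to \<open>d/dx - i \<xi>\<close>, which preserves the Schwartz
  space.\<close>

lemma schwartz_mult_exp:
  assumes "\<phi> \<in> schwartz"
  shows "(\<lambda>x. ek (x * \<xi>) * \<phi> x) \<in> schwartz"
proof -
  let ?e = "\<lambda>x. ek (x * \<xi>)"
  have "((\<lambda>\<phi> x. vderiv \<phi> x - \<i> * cx \<xi> * \<phi> x) ^^ n) \<phi> \<in> schwartz \<and>
      (vderiv ^^ n) (\<lambda>x. ?e x * \<phi> x) = (\<lambda>x. ?e x * ((\<lambda>\<phi> x. vderiv \<phi> x - \<i> * cx \<xi> * \<phi> x) ^^ n) \<phi> x)" for n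
  proof (induction n)
    case 0 then show ?case using assms by simp
  next
    case (Suc n)
    define \<psi> where "\<psi> = ((\<lambda>\<phi> x. vderiv \<phi> x - \<i> * cx \<xi> * \<phi> x) ^^ n) \<phi>"
    have \<psi>: "\<psi> \<in> schwartz" and eq: "(vderiv ^^ n) (\<lambda>x. ?e x * \<phi> x) = (\<lambda>x. ?e x * \<psi> x)"
      using Suc by (auto simp: \<psi>_def)
    have "(\<lambda>x. vderiv \<psi> x + (- (\<i> * cx \<xi>)) * \<psi> x) \<in> schwartz"
      using \<psi> by (intro schwartz_add schwartz_cmult schwartz_vderiv)
    moreover have "((\<lambda>x. ?e x * \<psi> x) has_vector_derivative ?e x * (vderiv \<psi> x - \<i> * cx \<xi> * \<psi> x)) (at x)" for x
      by (rule mult_exp_has_vector_derivative [OF \<psi>])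
    then have "vderiv (\<lambda>x. ?e x * \<psi> x) = (\<lambda>x. ?e x * (vderiv \<psi> x - \<i> * cx \<xi> * \<psi> x))"
      by (rule vderivI)
    ultimately show ?case using eq
      by (simp add: \<psi>_def [symmetric])
  qed
  then have s: "\<And>n. ((\<lambda>\<phi> x. vderiv \<phi> x - \<i> * cx \<xi> * \<phi> x) ^^ n) \<phi> \<in> schwartz"
    and eq: "\<And>n. (vderiv ^^ n) (\<lambda>x. ?e x * \<phi> x) = (\<lambda>x. ?e x * ((\<lambda>\<phi> x. vderiv \<phi> x - \<i> * cx \<xi> * \<phi> x) ^^ n) \<phi> x)"
    by blast+
  show ?thesis
    unfolding schwartz_def mem_Collect_eq eq
  proof (intro conjI allI)
    fix n x
    define \<psi> where "\<psi> = ((\<lambda>\<phi> x. vderiv \<phi> x - \<i> * cx \<xi> * \<phi> x) ^^ n) \<phi>"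
    have "\<psi> \<in> schwartz" using s by (simp add: \<psi>_def)
    from mult_exp_has_vector_derivative [OF this]
    show "(\<lambda>x. ?e x * ((\<lambda>\<phi> x. vderiv \<phi> x - \<i> * cx \<xi> * \<phi> x) ^^ n) \<phi> x) differentiable at x"
      unfolding \<psi>_def [symmetric] by (auto intro: differentiableI_vector)
  next
    fix m n
    define \<psi> where "\<psi> = ((\<lambda>\<phi> x. vderiv \<phi> x - \<i> * cx \<xi> * \<phi> x) ^^ n) \<phi>"
    have "\<psi> \<in> schwartz" using s by (simp add: \<psi>_def)
    then have "cmod (cx x ^ m * (?e x * \<psi> x)) \<le> schwartz_norm m \<psi>" for x
      using schwartz_pointwise [of \<psi> m m 0 x] by (simp add: norm_mult del: of_real_mult)
    then show "bounded (range (\<lambda>x. cx x ^ m * (?e x * ((\<lambda>\<phi> x. vderiv \<phi> x - \<i> * cx \<xi> * \<phi> x) ^^ n) \<phi> x)))"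
      unfolding \<psi>_def [symmetric] bounded_iff by blast
  qed
qed

text \<open>Integration by parts: the derivative of \<open>e^(-ix\<xi>) \<phi>\<close> has integral zero.\<close>

lemma fourier_vderiv:
  assumes "\<phi> \<in> schwartz"
  shows "fourier (vderiv \<phi>) \<xi> = \<i> * cx \<xi> * fourier \<phi> \<xi>"
proof -
  let ?e = "\<lambda>x. ek (x * \<xi>)"
  have "((\<lambda>x. ?e x * \<phi> x) has_vector_derivative ?e x * vderiv \<phi> x - \<i> * cx \<xi> * (?e x * \<phi> x)) (at x)" for x
    using mult_exp_has_vector_derivative [OF assms, of \<xi> x] by (simp add: algebra_simps)
  then have eq: "vderiv (\<lambda>x. ?e x * \<phi> x) = (\<lambda>x. ?e x * vderiv \<phi> x - \<i> * cx \<xi> * (?e x * \<phi> x))"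
    by (rule vderivI)
  have "0 = (\<integral>x. ?e x * vderiv \<phi> x - \<i> * cx \<xi> * (?e x * \<phi> x))"
    using schwartz_integral_vderiv [OF schwartz_mult_exp [OF assms, of \<xi>]] unfolding eq by simp
  also have "\<dots> = fourier (vderiv \<phi>) \<xi> - \<i> * cx \<xi> * fourier \<phi> \<xi>"
    unfolding fourier_def
    using fourier_integrable [OF schwartz_integrable_abs(1) [OF schwartz_vderiv [OF assms]], of \<xi>]
     fourier_integrable [OF schwartz_integrable_abs(1) [OF assms], of \<xi>]
    by simp
  finally have "fourier (vderiv \<phi>) \<xi> - \<i> * cx \<xi> * fourier \<phi> \<xi> = 0" by (rule sym)
  then show ?thesis by (simp only: right_minus_eq)
qed

lemma fourier_cmult: "fourier (\<lambda>x. c * \<phi> x) \<xi> = c * fourier \<phi> \<xi>"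
proof -
  have "(\<lambda>x. ek (x * \<xi>) * (c * \<phi> x)) = (\<lambda>x. c * (ek (x * \<xi>) * \<phi> x))"
    by (rule ext) (rule mult.left_commute)
  then show ?thesis unfolding fourier_def by (simp only: integral_mult_right_zero)
qed

text \<open>The transform exchanges multiplication by \<open>x\<close> and differentiation, up to factors \<open>\<plusminus> i\<close>. A
  weighted derivative of the transform is therefore the transform of a Schwartz function, which is
  bounded by an integral, hence by a seminorm.\<close>

lemma schwartz_cont_fourier: "schwartz_cont fourier"
proof -
  define X where "X = (\<lambda>\<phi> x. (- \<i>) * (cx x * \<phi> x))"
  define D where "D = (\<lambda>\<phi> x. (- \<i>) * vderiv \<phi> x)"
  have X: "schwartz_cont X"
    unfolding X_def using schwartz_cont_comp [OF schwartz_cont_cmult schwartz_cont_mult_x] .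
  have D: "schwartz_cont D" unfolding D_def by (rule schwartz_cont_cmult_vderiv)
  have Xs: "(X ^^ n) \<phi> \<in> schwartz" if "\<phi> \<in> schwartz" for n \<phi>
    using schwartz_cont_funpow [OF X, of n] that by (simp add: schwartz_cont_def)
  have Ds: "(D ^^ n) \<phi> \<in> schwartz" if "\<phi> \<in> schwartz" for n \<phi>
    using schwartz_cont_funpow [OF D, of n] that by (simp add: schwartz_cont_def)
  have vd: "(vderiv ^^ n) (fourier \<phi>) = fourier ((X ^^ n) \<phi>)" if "\<phi> \<in> schwartz" for n \<phi>
  proof (induction n)
    case (Suc n)
    then show ?case
      using vderivI [OF fourier_has_vector_derivative [OF Xs [OF that, of n]]] by (simp add: X_def)
  qed simp
  have mx: "cx \<xi> ^ m * fourier \<phi> \<xi> = fourier ((D ^^ m) \<phi>) \<xi>" if "\<phi> \<in> schwartz" for m \<phi> \<xi>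
  proof (induction m)
    case (Suc m)
    have "fourier ((D ^^ Suc m) \<phi>) \<xi> = - \<i> * fourier (vderiv ((D ^^ m) \<phi>)) \<xi>"
      using fourier_cmult [of "- \<i>" "vderiv ((D ^^ m) \<phi>)" \<xi>] by (simp only: D_def funpow.simps comp_def)
    also have "\<dots> = cx \<xi> * fourier ((D ^^ m) \<phi>) \<xi>"
      by (simp add: fourier_vderiv [OF Ds [OF that]] mult.assoc [symmetric])
    finally have *: "fourier ((D ^^ Suc m) \<phi>) \<xi> = cx \<xi> * fourier ((D ^^ m) \<phi>) \<xi>" .
    show ?case unfolding * Suc [symmetric] by (simp only: power_Suc mult.assoc)
  qed simp
  show ?thesis
  proof (rule schwartz_contI)
    show "(vderiv ^^ n) (fourier \<phi>) differentiable at x" if "\<phi> \<in> schwartz" for \<phi> n x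
      unfolding vd [OF that] by (rule differentiableI_vector [OF fourier_has_vector_derivative [OF Xs [OF that]]])
    fix m n
    have DX: "schwartz_cont (\<lambda>\<phi>. (D ^^ m) ((X ^^ n) \<phi>))"
      by (rule schwartz_cont_comp [OF schwartz_cont_funpow [OF D] schwartz_cont_funpow [OF X]])
    obtain C M where "0 \<le> C" and C: "\<And>\<phi>. \<phi> \<in> schwartz \<Longrightarrow> schwartz_norm 2 ((D ^^ m) ((X ^^ n) \<phi>)) \<le> C * schwartz_norm M \<phi>"
      by (rule schwartz_contE [OF DX, of 2]) (rule that)
    let ?I = "4 * (\<integral>x. 1 / jap x ^ 2)"
    have I: "0 \<le> ?I" by (simp add: integral_nonneg_AE)
    have "cmod (cx x ^ m * (vderiv ^^ n) (fourier \<phi>) x) \<le> (?I * C) * schwartz_norm M \<phi>"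
      if "\<phi> \<in> schwartz" for \<phi> x
    proof -
      have s: "(D ^^ m) ((X ^^ n) \<phi>) \<in> schwartz" by (intro Ds Xs that)
      have "cmod (cx x ^ m * (vderiv ^^ n) (fourier \<phi>) x) = cmod (fourier ((D ^^ m) ((X ^^ n) \<phi>)) x)"
        unfolding vd [OF that] mx [OF Xs [OF that]] ..
      also have "\<dots> \<le> ?I * schwartz_norm 2 ((D ^^ m) ((X ^^ n) \<phi>))"
        using norm_fourier_le [OF schwartz_integrable_abs(1) [OF s], of x] schwartz_integrable_abs(2) [OF s] by linarith
      also have "\<dots> \<le> ?I * (C * schwartz_norm M \<phi>)"
        by (rule mult_left_mono [OF C [OF that] I])
      finally show ?thesis by (simp add: mult_ac)
    qed
    then show "\<exists>C M. 0 \<le> C \<and> (\<forall>\<phi>\<in>schwartz. \<forall>x. cmod (cx x ^ m * (vderiv ^^ n) (fourier \<phi>) x)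
            \<le> C * schwartz_norm M \<phi>)"
      by (intro exI [of _ "?I * C"] exI [of _ M] conjI ballI allI mult_nonneg_nonneg I \<open>0 \<le> C\<close>)
  qed
qed

lemma fourier_schwartz: "\<phi> \<in> schwartz \<Longrightarrow> fourier \<phi> \<in> schwartz"
  using schwartz_cont_fourier by (simp add: schwartz_cont_def)

section \<open>Gaussians\<close>

lemma norm_iexp_real [simp]: "cmod (exp (\<i> * cx a)) = 1"
  by (rule norm_exp_i_times)

lemma jap_power_le_exp:
  assumes "0 < a"
  shows "\<exists>B. \<forall>x. jap x ^ k * exp (- (a * x\<^sup>2)) \<le> B"
proof (intro exI allI)
  fix x
  \<comment> \<open>\<open>(1 + x\<^sup>2)\<^sup>m \<le> (b e^(a x^2 / m))\<^sup>m\<close>, with \<open>m > 0\<close> even for \<open>k = 0\<close>.\<close>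
  define m where "m = real (Suc k)"
  define b where "b = max 1 (m / a)"
  have m: "0 < m" and b: "1 \<le> b" "m \<le> b * a"
    using assms by (auto simp: m_def b_def max_def field_simps)
  have "jap x ^ k \<le> jap x ^ (2 * Suc k)"
    by (rule power_increasing) auto
  also have "\<dots> = (1 + x\<^sup>2) ^ Suc k" by (simp only: power_mult jap_sq)
  also have "\<dots> \<le> (b * exp (a * x\<^sup>2 / m)) ^ Suc k"
  proof (rule power_mono)
    have "x\<^sup>2 * m \<le> b * a * x\<^sup>2" using b by (simp add: mult_right_mono mult.commute)
    then have "x\<^sup>2 \<le> b * (a * x\<^sup>2 / m)" using m by (simp add: field_simps)
    then have "1 + x\<^sup>2 \<le> b * (1 + a * x\<^sup>2 / m)" using b(1) by (simp add: distrib_left)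
    also have "\<dots> \<le> b * exp (a * x\<^sup>2 / m)"
      using b(1) exp_ge_add_one_self [of "a * x\<^sup>2 / m"] by (intro mult_left_mono) auto
    finally show "1 + x\<^sup>2 \<le> b * exp (a * x\<^sup>2 / m)" .
  qed (simp add: add_nonneg_nonneg)
  also have "\<dots> = b ^ Suc k * exp (a * x\<^sup>2)"
    unfolding power_mult_distrib exp_of_nat_mult [symmetric] by (simp add: m_def)
  finally have "jap x ^ k * exp (- (a * x\<^sup>2)) \<le> b ^ Suc k * exp (a * x\<^sup>2) * exp (- (a * x\<^sup>2))"
    by (rule mult_right_mono) simp
  then show "jap x ^ k * exp (- (a * x\<^sup>2)) \<le> (max 1 (real (Suc k) / a)) ^ Suc k"
    by (simp add: mult.assoc exp_minus b_def m_def)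
qed

lemma poly_le_jap: "\<exists>C k. 0 \<le> C \<and> (\<forall>x. cmod (poly P (cx x)) \<le> C * jap x ^ k)"
proof (induction P)
  case 0 show ?case by (intro exI [of _ 0]) auto
next
  case (pCons a P)
  then obtain C k where C: "0 \<le> C" "\<And>x. cmod (poly P (cx x)) \<le> C * jap x ^ k" by auto
  have "cmod (poly (pCons a P) (cx x)) \<le> (cmod a + C) * jap x ^ Suc k" for x
  proof -
    have "cmod (poly (pCons a P) (cx x)) \<le> cmod a + \<bar>x\<bar> * cmod (poly P (cx x))"
      by (simp add: norm_mult norm_triangle_le)
    also have "\<dots> \<le> cmod a * jap x ^ Suc k + jap x * (C * jap x ^ k)"
      using one_le_power [OF jap_ge_1, of x "Suc k"]
      by (intro add_mono mult_mono C abs_le_jap) (auto simp: mult_le_cancel_left1 simp del: power_Suc)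
    finally show ?thesis by (simp add: algebra_simps)
  qed
  then show ?case using C(1) by (intro exI [of _ "cmod a + C"] exI [of _ "Suc k"]) auto
qed

lemma poly_gauss_derivative:
  "((\<lambda>x. poly P (cx x) * cx (exp (- (x\<^sup>2 / 2)))) has_vector_derivative
    poly (pderiv P - [:0, 1:] * P) (cx x) * cx (exp (- (x\<^sup>2 / 2)))) (at x)"
proof -
  have 0: "(cx has_vector_derivative 1) (at x)"
    by (rule has_vector_derivative_eq_rhs [OF has_vector_derivative_of_real [OF DERIV_ident]]) simp
  have 1: "((\<lambda>x. poly P (cx x)) has_vector_derivative poly (pderiv P) (cx x)) (at x)"
    using field_vector_diff_chain_at [of cx 1 x "poly P" "poly (pderiv P) (cx x)"]
      0 by (simp add: o_def poly_DERIV)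
  have "((\<lambda>x. exp (- (x\<^sup>2 / 2))) has_real_derivative exp (- (x\<^sup>2 / 2)) * (- x)) (at x)"
    by (auto intro!: derivative_eq_intros)
  then have 2: "((\<lambda>x. cx (exp (- (x\<^sup>2 / 2)))) has_vector_derivative cx (exp (- (x\<^sup>2 / 2)) * (- x))) (at x)"
    by (rule has_vector_derivative_of_real)
  show ?thesis using has_vector_derivative_mult [OF 1 2] by (simp add: algebra_simps)
qed

text \<open>The derivatives of a Gaussian are polynomials times the Gaussian.\<close>

lemma gauss_schwartz: "(\<lambda>x. cx (exp (- (x\<^sup>2 / 2)))) \<in> schwartz"
proof -
  define Q where "Q = (\<lambda>P :: complex poly. pderiv P - [:0, 1:] * P)"
  define G where "G = (\<lambda>P x. poly P (cx x) * cx (exp (- (x\<^sup>2 / 2))))"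
  have G: "(G P has_vector_derivative G (Q P) x) (at x)" for P x
    unfolding G_def Q_def by (rule poly_gauss_derivative)
  have it: "(vderiv ^^ n) (G P) = G ((Q ^^ n) P)" for n P
    by (induction n) (simp_all add: vderivI [OF G])
  have "G P \<in> schwartz" for P
    unfolding schwartz_def mem_Collect_eq it
  proof (intro conjI allI)
    show "G ((Q ^^ n) P) differentiable at x" for n x
      by (rule differentiableI_vector [OF G])
    fix m n
    obtain C k where C: "0 \<le> C" "\<And>x. cmod (poly (monom 1 m * (Q ^^ n) P) (cx x)) \<le> C * jap x ^ k"
      using poly_le_jap [of "monom 1 m * (Q ^^ n) P"] by blast
    obtain B where B: "\<And>x. jap x ^ k * exp (- (1/2 * x\<^sup>2)) \<le> B"
      using jap_power_le_exp [of "1/2" k] by auto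
    have "cmod (cx x ^ m * G ((Q ^^ n) P) x) \<le> C * B" for x
    proof -
      have "cmod (cx x ^ m * G ((Q ^^ n) P) x) =
          cmod (poly (monom 1 m * (Q ^^ n) P) (cx x)) * exp (- (x\<^sup>2 / 2))"
        by (simp add: G_def poly_monom norm_mult)
      also have "\<dots> \<le> C * jap x ^ k * exp (- (x\<^sup>2 / 2))"
        by (intro mult_right_mono C) auto
      also have "\<dots> \<le> C * B"
        using mult_left_mono [OF B [of x] C(1)] by (simp add: mult.assoc)
      finally show ?thesis .
    qed
    then show "bounded (range (\<lambda>x. cx x ^ m * G ((Q ^^ n) P) x))"
      unfolding bounded_iff by blast
  qed
  from this [of 1] show ?thesis by (simp add: G_def)
qed

lemma fourier_std_normal:
  "(\<integral>x. cx (std_normal_density x) * iexp (t * x)) = cx (exp (- t\<^sup>2 / 2))"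
proof -
  have "cx (exp (- t\<^sup>2 / 2)) = (\<integral>x. iexp (t * x) \<partial>std_normal_distribution)"
    using fun_cong [OF char_std_normal_distribution, of t] unfolding char_def by (rule sym)
  also have "\<dots> = (\<integral>x. std_normal_density x *\<^sub>R iexp (t * x))"
    by (rule integral_density) auto
  finally show ?thesis by (simp add: scaleR_conv_of_real)
qed

lemma exp_eq_std_normal: "exp (- t\<^sup>2 / 2) = sqrt (2 * pi) * std_normal_density t"
  by (simp add: std_normal_density_def)

text \<open>The transform of the standard normal density is known as its characteristic function; scaling
  gives all widths.\<close>

lemma fourier_gauss:
  fixes n t :: real
  assumes n: "0 < n"
  shows "(\<integral>\<xi>. iexp (t * \<xi>) * cx (exp (- (\<xi> / n)\<^sup>2 / 2)))
      = cx (2 * pi * (n * std_normal_density (n * t)))"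
proof -
  have "cx (exp (- (n * t)\<^sup>2 / 2)) =
      \<bar>1 / n\<bar> *\<^sub>R (\<integral>\<xi>. cx (std_normal_density (0 + (1 / n) * (\<xi>::real))) * iexp ((n * t) * (0 + (1 / n) * (\<xi>::real))))"
    unfolding fourier_std_normal [symmetric] using n by (intro lborel_integral_real_affine) simp
  also have "(\<lambda>\<xi>::real. cx (std_normal_density (0 + (1 / n) * (\<xi>::real))) * iexp ((n * t) * (0 + (1 / n) * (\<xi>::real))))
     = (\<lambda>\<xi>. cx (1 / sqrt (2 * pi)) * (iexp (t * \<xi>) * cx (exp (- (\<xi> / n)\<^sup>2 / 2))))"
    using n by (intro ext) (simp add: std_normal_density_def)
  finally have "cx (exp (- (n * t)\<^sup>2 / 2)) = cx (1 / n * (1 / sqrt (2 * pi))) *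
      (\<integral>\<xi>. iexp (t * \<xi>) * cx (exp (- (\<xi> / n)\<^sup>2 / 2)))"
    using n by (simp only: integral_mult_right_zero) (simp add: scaleR_conv_of_real)
  then have "cx (n * sqrt (2 * pi)) * cx (exp (- (n * t)\<^sup>2 / 2)) =
     cx (n * sqrt (2 * pi)) * (cx (1 / n * (1 / sqrt (2 * pi))) *
      (\<integral>\<xi>. iexp (t * \<xi>) * cx (exp (- (\<xi> / n)\<^sup>2 / 2))))" by (rule arg_cong)
  also have "\<dots> = cx ((n * sqrt (2 * pi)) * (1 / n * (1 / sqrt (2 * pi)))) *
      (\<integral>\<xi>. iexp (t * \<xi>) * cx (exp (- (\<xi> / n)\<^sup>2 / 2)))"
    by (simp only: of_real_mult mult.assoc)
  also have "(n * sqrt (2 * pi)) * (1 / n * (1 / sqrt (2 * pi))) = 1"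
    using n by simp
  also have "cx (n * sqrt (2 * pi)) * cx (exp (- (n * t)\<^sup>2 / 2)) =
      cx (n * (sqrt (2 * pi) * sqrt (2 * pi)) * std_normal_density (n * t))"
    unfolding exp_eq_std_normal by (simp only: of_real_mult mult_ac)
  finally show ?thesis by (simp add: mult_ac)
qed

lemma integrable_gauss:
  fixes n :: real
  assumes n: "0 < n"
  shows "integrable lborel (\<lambda>\<xi>. exp (- (\<xi> / n)\<^sup>2 / 2))"
proof -
  have "integrable lborel (\<lambda>\<xi>::real. sqrt (2 * pi) * std_normal_density (0 + (1 / n) * \<xi>))"
    using n by (intro integrable_mult_right lborel_integrable_real_affine) auto
  then show ?thesis by (simp add: std_normal_density_def)
qed

section \<open>Fubini for bounded kernels\<close>

lemma integrable_product:
  fixes f g :: "real \<Rightarrow> complex"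
  assumes "integrable lborel f" "integrable lborel g"
  shows "integrable (lborel \<Otimes>\<^sub>M lborel) (\<lambda>(x, y). f x * g y)"
proof (rule lborel_pair.Fubini_integrable)
  note [measurable] = borel_measurable_integrable [OF assms(1)] borel_measurable_integrable [OF assms(2)]
  show "(\<lambda>(x, y). f x * g y) \<in> borel_measurable (lborel \<Otimes>\<^sub>M lborel)" by measurable
  show "integrable lborel (\<lambda>x. \<integral>y. norm (case (x, y) of (x, y) \<Rightarrow> f x * g y) \<partial>lborel)"
    using assms by (simp add: norm_mult)
  show "AE x in lborel. integrable lborel (\<lambda>y. case (x, y) of (x, y) \<Rightarrow> f x * g y)"
    using assms by simp
qed

text \<open>The form of Fubini's theorem used for all Fourier integrals: the kernel has modulus at most one,
  so the double integral converges absolutely.\<close>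

lemma fubini_kernel:
  fixes f g :: "real \<Rightarrow> complex"
  assumes f: "integrable lborel f" and g: "integrable lborel g"
    and K [measurable]: "jmeas K"
    and le: "\<And>x y. cmod (K x y) \<le> 1"
  shows "(\<integral>x. f x * (\<integral>y. K x y * g y)) = (\<integral>y. g y * (\<integral>x. K x y * f x))"
proof -
  note [measurable] = borel_measurable_integrable [OF f] borel_measurable_integrable [OF g]
  have i: "integrable (lborel \<Otimes>\<^sub>M lborel) (\<lambda>(x, y). f x * (K x y * g y))"
    using integrable_product [OF f g]
  proof (rule Bochner_Integration.integrable_bound)
    show "AE z in lborel \<Otimes>\<^sub>M lborel. norm (case z of (x, y) \<Rightarrow> f x * (K x y * g y)) \<le> norm (case z of (x, y) \<Rightarrow> f x * g y)"
    proof (intro AE_I2, clarsimp simp: norm_mult)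
      fix x y
      show "cmod (f x) * (cmod (K x y) * cmod (g y)) \<le> cmod (f x) * cmod (g y)"
        using mult_right_mono [OF le [of x y], of "cmod (g y)"] by (intro mult_left_mono) auto
    qed
  qed measurable
  have "(\<integral>x. f x * (\<integral>y. K x y * g y)) = (\<integral>x. (\<integral>y. f x * (K x y * g y)))"
    by (simp only: integral_mult_right_zero)
  also have "\<dots> = (\<integral>y. (\<integral>x. f x * (K x y * g y)))"
    using lborel_pair.Fubini_integral [OF i] by simp
  also have "\<dots> = (\<integral>y. (\<integral>x. g y * (K x y * f x)))"
    by (simp only: mult_ac)
  finally show ?thesis by (simp only: integral_mult_right_zero)
qed

lemma fourier_kernel_measurable:
  "jmeas (\<lambda>x y. ek (y * x))"
  by measurable

lemma norm_fourier_kernel_le: "cmod (ek a) \<le> 1"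
  by (simp only: norm_fourier_kernel order_refl)

lemma fourier_parseval:
  assumes "integrable lborel f" "integrable lborel g"
  shows "(\<integral>x. f x * fourier g x) = (\<integral>y. fourier f y * g y)"
proof -
  have "(\<integral>x. f x * (\<integral>y. ek (y * x) * g y)) =
        (\<integral>y. g y * (\<integral>x. ek (y * x) * f x))"
    by (rule fubini_kernel [OF assms fourier_kernel_measurable norm_fourier_kernel_le])
  then show ?thesis by (simp only: fourier_def mult.commute [of "g _"] mult.commute [of _ "_ :: real"])
qed

section \<open>Fourier inversion\<close>

text \<open>After rescaling, integrating against a narrow Gaussian is averaging over a small normal
  perturbation of the argument.\<close>

lemma gauss_mean:
  assumes "\<phi> \<in> schwartz" "0 < n"
  shows "(\<integral>y. \<phi> y * cx (2 * pi * (n * std_normal_density (n * (x - y)))))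
      = cx (2 * pi) * (\<integral>z. \<phi> (x + z / n) * cx (std_normal_density z))"
proof -
  have "(\<integral>y. \<phi> y * cx (2 * pi * (n * std_normal_density (n * (x - y)))))
     = \<bar>1 / n\<bar> *\<^sub>R (\<integral>z. \<phi> (x + 1 / n * z) * cx (2 * pi * (n * std_normal_density (n * (x - (x + 1 / n * z))))))"
    using assms(2) by (intro lborel_integral_real_affine) simp
  also have "(\<lambda>z. \<phi> (x + 1 / n * z) * cx (2 * pi * (n * std_normal_density (n * (x - (x + 1 / n * z)))))) =
     (\<lambda>z. cx (2 * pi * n) * (\<phi> (x + z / n) * cx (std_normal_density z)))"
    using assms(2) by (intro ext) (simp add: std_normal_density_def)
  also have "\<bar>1 / n\<bar> *\<^sub>R (\<integral>z. cx (2 * pi * n) * (\<phi> (x + z / n) * cx (std_normal_density z)))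
     = cx (\<bar>1 / n\<bar> * (2 * pi * n)) * (\<integral>z. \<phi> (x + z / n) * cx (std_normal_density z))"
    by (simp only: integral_mult_right_zero) (simp add: scaleR_conv_of_real)
  finally show ?thesis using assms(2) by simp
qed

lemma schwartz_bounded:
  assumes "\<phi> \<in> schwartz" shows "cmod (\<phi> x) \<le> schwartz_norm 0 \<phi>"
  using schwartz_pointwise [OF assms, of 0 0 0 x] by simp

text \<open>A factor \<open>exp (- (\<xi>/n)\<^sup>2 / 2)\<close> makes the double integral absolutely convergent; Fubini's theorem
  turns it into a Gaussian mean of \<open>\<phi>\<close> around \<open>- x\<close>, and \<open>n\<close> tends to infinity on both sides.\<close>

theorem fourier_inversion:
  assumes "\<phi> \<in> schwartz"
  shows "fourier (fourier \<phi>) x = cx (2 * pi) * \<phi> (- x)"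
proof (rule LIMSEQ_unique)
  note F = fourier_schwartz [OF assms]
  note [measurable] = schwartz_measurable [OF assms] schwartz_measurable [OF F]
  let ?I = "\<lambda>n::nat. \<integral>\<xi>. cx (exp (- (\<xi> / real (Suc n))\<^sup>2 / 2)) * (ek (\<xi> * x) * fourier \<phi> \<xi>) \<partial>lborel"
  have conv: "(\<lambda>n. \<xi> / real (Suc n)) \<longlonglongrightarrow> 0" for \<xi>
    using tendsto_mult [OF tendsto_const LIMSEQ_inverse_real_of_nat, of \<xi>] by (simp add: divide_inverse)
  show "?I \<longlonglongrightarrow> fourier (fourier \<phi>) x"
    unfolding fourier_def [of "fourier \<phi>" x]
  proof (rule integral_dominated_convergence)
    show "integrable lborel (\<lambda>\<xi>. cmod (fourier \<phi> \<xi>))"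
      using schwartz_integrable_abs(1) [OF F] by (rule integrable_norm)
    show "AE \<xi> in lborel. (\<lambda>n. cx (exp (- (\<xi> / real (Suc n))\<^sup>2 / 2)) * (ek (\<xi> * x) * fourier \<phi> \<xi>))
       \<longlonglongrightarrow> ek (\<xi> * x) * fourier \<phi> \<xi>"
    proof (rule AE_I2)
      fix \<xi>
      have "(\<lambda>n. cx (exp (- (\<xi> / real (Suc n))\<^sup>2 / 2)) * (ek (\<xi> * x) * fourier \<phi> \<xi>))
       \<longlonglongrightarrow> cx (exp (- 0\<^sup>2 / 2)) * (ek (\<xi> * x) * fourier \<phi> \<xi>)"
        by (intro tendsto_intros conv) simp
      then show "(\<lambda>n. cx (exp (- (\<xi> / real (Suc n))\<^sup>2 / 2)) * (ek (\<xi> * x) * fourier \<phi> \<xi>))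
       \<longlonglongrightarrow> ek (\<xi> * x) * fourier \<phi> \<xi>" by simp
    qed
    show "AE \<xi> in lborel. norm (cx (exp (- (\<xi> / real (Suc n))\<^sup>2 / 2)) * (ek (\<xi> * x) * fourier \<phi> \<xi>)) \<le> cmod (fourier \<phi> \<xi>)" for n
      by (intro AE_I2) (simp add: norm_mult mult_le_cancel_right2 del: of_real_mult of_nat_Suc)
  qed measurable
  have eq: "?I n = cx (2 * pi) * (\<integral>z. \<phi> (- x + z / real (Suc n)) * cx (std_normal_density z))" for n
  proof -
    let ?e = "\<lambda>\<xi>. cx (exp (- (\<xi> / real (Suc n))\<^sup>2 / 2)) * ek (\<xi> * x)"
    have ie: "integrable lborel ?e"
    proof (rule Bochner_Integration.integrable_bound)
      show "integrable lborel (\<lambda>\<xi>. exp (- (\<xi> / real (Suc n))\<^sup>2 / 2))" by (rule integrable_gauss) simp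
      show "AE x' in lborel. norm (?e x') \<le> norm (exp (- (x' / real (Suc n))\<^sup>2 / 2))"
        by (intro AE_I2) (simp add: norm_mult del: of_real_mult of_nat_Suc)
    qed measurable
    have "?I n = (\<integral>\<xi>. ?e \<xi> * (\<integral>y. ek (y * \<xi>) * \<phi> y))"
      by (simp only: fourier_def mult.assoc)
    also have "\<dots> = (\<integral>y. \<phi> y * (\<integral>\<xi>. ek (y * \<xi>) * ?e \<xi>))"
      by (rule fubini_kernel [OF ie schwartz_integrable_abs(1) [OF assms] fourier_kernel_measurable norm_fourier_kernel_le])
    also have "\<dots> = (\<integral>y. \<phi> y * cx (2 * pi * (real (Suc n) * std_normal_density (real (Suc n) * (- x - y)))))"
    proof (rule Bochner_Integration.integral_cong [OF refl])
      fix y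
      have "ek (y * \<xi>) * ?e \<xi> = iexp ((- x - y) * \<xi>) * cx (exp (- (\<xi> / real (Suc n))\<^sup>2 / 2))" for \<xi>
      proof -
        have "ek (y * \<xi>) * ek (\<xi> * x) = iexp ((- x - y) * \<xi>)"
          by (simp add: exp_add [symmetric] algebra_simps)
        moreover have "ek (y * \<xi>) * ?e \<xi> =
            (ek (y * \<xi>) * ek (\<xi> * x)) * cx (exp (- (\<xi> / real (Suc n))\<^sup>2 / 2))"
          by (simp only: mult_ac)
        ultimately show ?thesis by (simp only:)
      qed
      then show "\<phi> y * (\<integral>\<xi>. ek (y * \<xi>) * ?e \<xi>) = \<phi> y * cx (2 * pi * (real (Suc n) * std_normal_density (real (Suc n) * (- x - y))))"
        by (simp only: fourier_gauss of_nat_0_less_iff zero_less_Suc)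
    qed
    also have "\<dots> = cx (2 * pi) * (\<integral>z. \<phi> (- x + z / real (Suc n)) * cx (std_normal_density z))"
      by (rule gauss_mean [OF assms]) simp
    finally show ?thesis .
  qed
  have "(\<lambda>n. \<integral>z. \<phi> (- x + z / real (Suc n)) * cx (std_normal_density z) \<partial>lborel) \<longlonglongrightarrow>
      (\<integral>z. \<phi> (- x) * cx (std_normal_density z))"
  proof (rule integral_dominated_convergence)
    show "integrable lborel (\<lambda>z. schwartz_norm 0 \<phi> * std_normal_density z)" by simp
    show "AE z in lborel. (\<lambda>n. \<phi> (- x + z / real (Suc n)) * cx (std_normal_density z)) \<longlonglongrightarrow> \<phi> (- x) * cx (std_normal_density z)"
    proof (rule AE_I2)
      fix z
      have "(\<lambda>n. - x + z / real (Suc n)) \<longlonglongrightarrow> - x + 0" by (intro tendsto_intros conv)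
      then have "(\<lambda>n. \<phi> (- x + z / real (Suc n))) \<longlonglongrightarrow> \<phi> (- x)"
        using isCont_tendsto_compose [OF schwartz_isCont [OF assms, of "- x"]] by simp
      then show "(\<lambda>n. \<phi> (- x + z / real (Suc n)) * cx (std_normal_density z)) \<longlonglongrightarrow> \<phi> (- x) * cx (std_normal_density z)"
        by (intro tendsto_mult tendsto_const)
    qed
    show "AE z in lborel. norm (\<phi> (- x + z / real (Suc n)) * cx (std_normal_density z)) \<le> schwartz_norm 0 \<phi> * std_normal_density z" for n
      by (intro AE_I2) (simp add: norm_mult mult_right_mono schwartz_bounded [OF assms] del: of_nat_Suc)
  qed measurable
  also have "(\<integral>z. \<phi> (- x) * cx (std_normal_density z)) = \<phi> (- x)"
    by (simp only: integral_mult_right_zero integral_complex_of_real integral_normal_density [of 1 0]) simp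
  finally show "?I \<longlonglongrightarrow> cx (2 * pi) * \<phi> (- x)"
    unfolding eq by (intro tendsto_intros)
qed

definition inverse_fourier :: "(real \<Rightarrow> complex) \<Rightarrow> real \<Rightarrow> complex" where
  "inverse_fourier \<phi> = (\<lambda>x. cx (1 / (2 * pi)) * fourier \<phi> (- x))"

lemma schwartz_cont_inverse_fourier: "schwartz_cont inverse_fourier"
  unfolding inverse_fourier_def
  by (rule schwartz_cont_comp [OF schwartz_cont_cmult schwartz_cont_comp [OF schwartz_cont_reflect schwartz_cont_fourier]])

lemma fourier_reflect: "fourier (\<lambda>x. f (- x)) \<xi> = fourier f (- \<xi>)"
  unfolding fourier_def
  using lborel_integral_real_affine [of "-1" "\<lambda>x. ek (x * \<xi>) * f (- x)" 0] by simp

lemma fourier_inverse_fourier: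
  assumes "\<phi> \<in> schwartz" shows "fourier (inverse_fourier \<phi>) = \<phi>"
  by (rule ext) (simp add: inverse_fourier_def fourier_cmult fourier_reflect fourier_inversion [OF assms] del: of_real_mult of_real_divide,
    simp add: field_simps)

lemma inverse_fourier_fourier:
  assumes "\<phi> \<in> schwartz" shows "inverse_fourier (fourier \<phi>) = \<phi>"
  by (rule ext) (simp add: inverse_fourier_def fourier_inversion [OF assms])

section \<open>Injectivity of the Fourier transform\<close>

text \<open>Levy's uniqueness theorem, applied to the positive and the negative part. They have equal mass,
  as one sees at frequency \<open>0\<close>, and so become probability densities with the same characteristic
  function.\<close>

lemma fourier_real_unique:
  fixes r :: "real \<Rightarrow> real"
  assumes r: "integrable lborel r" and z: "\<And>t. (\<integral>x. iexp (t * x) * cx (r x)) = 0"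
  shows "AE x in lborel. r x = 0"
proof -
  note [measurable] = borel_measurable_integrable [OF r]
  define P where "P = (\<lambda>x. max 0 (r x))"
  define N where "N = (\<lambda>x. max 0 (- r x))"
  have [measurable]: "P \<in> borel_measurable borel" "N \<in> borel_measurable borel" by (auto simp: P_def N_def)
  have iP: "integrable lborel P" and iN: "integrable lborel N"
    unfolding P_def N_def using r by (auto intro!: integrable_max)
  have rPN: "r x = P x - N x" for x by (auto simp: P_def N_def)
  have nn: "0 \<le> P x" "0 \<le> N x" for x by (auto simp: P_def N_def)
  have ii: "integrable lborel (\<lambda>x. iexp (t * x) * cx (f x))" if "integrable lborel f" for f :: "real \<Rightarrow> real" and t
  proof (rule Bochner_Integration.integrable_bound [OF that])
    show "(\<lambda>x. iexp (t * x) * cx (f x)) \<in> borel_measurable lborel"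
      using borel_measurable_integrable [OF that] by measurable
  qed (simp add: norm_mult del: of_real_mult)
  have eq: "(\<integral>x. iexp (t * x) * cx (P x)) = (\<integral>x. iexp (t * x) * cx (N x))" for t
    using z [of t] Bochner_Integration.integral_diff [OF ii [OF iP, of t] ii [OF iN, of t]]
    unfolding rPN of_real_diff right_diff_distrib by simp
  define c where "c = (\<integral>x. P x)"
  have "cx c = cx (\<integral>x. N x)"
    using eq [of 0] by (simp add: c_def)
  then have cN: "c = (\<integral>x. N x)" by (simp only: of_real_eq_iff)
  show ?thesis
  proof (cases "c = 0")
    case True
    have "AE x in lborel. P x = 0"
      using True nn iP by (simp add: c_def integral_nonneg_eq_0_iff_AE)
    moreover have "AE x in lborel. N x = 0"
      using True nn iN by (simp add: cN integral_nonneg_eq_0_iff_AE)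
    ultimately show ?thesis by eventually_elim (simp add: rPN)
  next
    case False
    then have c: "0 < c" using nn by (simp add: c_def order_less_le integral_nonneg_AE)
    define D :: "(real \<Rightarrow> real) \<Rightarrow> real \<Rightarrow> ennreal" where "D = (\<lambda>f x. ennreal (f x / c))"
    have dist: "real_distribution (density lborel (D f))"
      if "integrable lborel f" "\<And>x. 0 \<le> f x" "(\<integral>x. f x) = c" for f
    proof -
      note [measurable] = borel_measurable_integrable [OF that(1)]
      have "(\<integral>\<^sup>+x. D f x) = ennreal (\<integral>x. f x / c)"
        unfolding D_def using that c by (intro nn_integral_eq_integral) auto
      then have "prob_space (density lborel (D f))"
        using that c by (intro prob_spaceI) (simp add: emeasure_density D_def)
      then show ?thesis by (simp add: real_distribution_def real_distribution_axioms_def)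
    qed
    have ch: "char (density lborel (D f)) t = (\<integral>x. iexp (t * x) * cx (f x)) / cx c"
      if "integrable lborel f" "\<And>x. 0 \<le> f x" for f t
    proof -
      note [measurable] = borel_measurable_integrable [OF that(1)]
      have "char (density lborel (D f)) t = (\<integral>x. (f x / c) *\<^sub>R iexp (t * x))"
        unfolding char_def D_def using that c by (intro integral_density) auto
      also have "\<dots> = (\<integral>x. (iexp (t * x) * cx (f x)) / cx c)"
        by (simp add: scaleR_conv_of_real mult_ac)
      finally show ?thesis by simp
    qed
    have "char (density lborel (D P)) = char (density lborel (D N))"
      by (rule ext) (simp only: ch iP iN nn eq)
    then have "density lborel (D P) = density lborel (D N)"
      by (intro Levy_uniqueness dist iP iN nn) (simp_all add: c_def [symmetric] cN [symmetric])
    then have "AE x in lborel. D P x = D N x"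
      by (rule sigma_finite_measure.density_unique [OF sigma_finite_lborel, rotated 2]) (auto simp: D_def)
    then show ?thesis
    proof eventually_elim
      case (elim x)
      then show ?case using c nn by (simp add: D_def rPN)
    qed
  qed
qed

text \<open>Real and imaginary part are handled separately; the transform of \<open>cnj h\<close> vanishes along with
  that of \<open>h\<close>.\<close>

lemma fourier_unique:
  assumes h: "integrable lborel h" and z: "\<And>\<xi>. fourier h \<xi> = 0"
  shows "AE x in lborel. h x = 0"
proof -
  note [measurable] = borel_measurable_integrable [OF h]
  have z': "(\<integral>x. iexp (t * x) * h x) = 0" for t
    using z [of "- t"] by (simp add: fourier_def mult_ac)
  have zc: "(\<integral>x. iexp (t * x) * cnj (h x)) = 0" for t
  proof -
    have "(\<integral>x. iexp (t * x) * cnj (h x)) = cnj (\<integral>x. iexp ((- t) * x) * h x)"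
      unfolding Bochner_Integration.integral_cnj [symmetric]
      by (rule Bochner_Integration.integral_cong [OF refl]) (simp add: exp_cnj)
    then show ?thesis by (simp only: z' complex_cnj_zero)
  qed
  have ik: "integrable lborel (\<lambda>x. iexp (t * x) * k x)" if "integrable lborel k" for t and k :: "real \<Rightarrow> complex"
  proof (rule Bochner_Integration.integrable_bound [OF that])
    show "(\<lambda>x. iexp (t * x) * k x) \<in> borel_measurable lborel"
      using borel_measurable_integrable [OF that] by measurable
  qed (simp add: norm_mult del: of_real_mult)
  have hc: "integrable lborel (\<lambda>x. cnj (h x))" using h by simp
  note ih = ik [OF h] ik [OF hc]
  have "AE x in lborel. Re (h x) = 0"
  proof (rule fourier_real_unique)
    fix t
    have "(\<integral>x. iexp (t * x) * cx (Re (h x))) =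
       (\<integral>x. (iexp (t * x) * h x + iexp (t * x) * cnj (h x)) / 2)"
      by (rule Bochner_Integration.integral_cong [OF refl]) (simp add: distrib_left [symmetric] complex_add_cnj)
    then show "(\<integral>x. iexp (t * x) * cx (Re (h x))) = 0"
      using ih [of t] by (simp only: integral_divide_zero Bochner_Integration.integral_add z' zc) simp
  qed (use h in auto)
  moreover have "AE x in lborel. Im (h x) = 0"
  proof (rule fourier_real_unique)
    fix t
    have "(\<integral>x. iexp (t * x) * cx (Im (h x))) =
       (\<integral>x. (iexp (t * x) * h x - iexp (t * x) * cnj (h x)) / (2 * \<i>))"
    proof (rule Bochner_Integration.integral_cong [OF refl])
      fix x
      have "cx (Im (h x)) = (h x - cnj (h x)) / (2 * \<i>)"
        by (simp add: complex_eq_iff)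
      then show "iexp (t * x) * cx (Im (h x)) = (iexp (t * x) * h x - iexp (t * x) * cnj (h x)) / (2 * \<i>)"
        by (simp only: right_diff_distrib times_divide_eq_right)
    qed
    then show "(\<integral>x. iexp (t * x) * cx (Im (h x))) = 0"
      using ih [of t] by (simp only: integral_divide_zero Bochner_Integration.integral_diff z' zc) simp
  qed (use h in auto)
  ultimately show ?thesis by eventually_elim (simp add: complex_eq_iff)
qed

text \<open>The test functions \<open>e^(-ix\<xi>) e^(- x^2 / 2)\<close> suffice: the product of \<open>g - g'\<close> with the Gaussian
  is integrable and has vanishing Fourier transform.\<close>

lemma given_by_unique:
  assumes "given_by F g" "given_by F g'"
  shows "AE x in lborel. g x = g' x"
proof -
  define e where "e = (\<lambda>x. cx (exp (- (x\<^sup>2 / 2))))"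
  have e: "e \<in> schwartz" unfolding e_def by (rule gauss_schwartz)
  have i: "integrable lborel (\<lambda>x. g x * \<phi> x)" "integrable lborel (\<lambda>x. g' x * \<phi> x)"
    and q: "(\<integral>x. g x * \<phi> x) = (\<integral>x. g' x * \<phi> x)" if "\<phi> \<in> schwartz" for \<phi>
    using assms that by (auto simp: given_by_def)
  have "AE x in lborel. g x * e x - g' x * e x = 0"
  proof (rule fourier_unique)
    show "integrable lborel (\<lambda>x. g x * e x - g' x * e x)" by (intro Bochner_Integration.integrable_diff i e)
    fix \<xi>
    have m: "(\<lambda>x. ek (x * \<xi>) * e x) \<in> schwartz" by (rule schwartz_mult_exp [OF e])
    have "fourier (\<lambda>x. g x * e x - g' x * e x) \<xi> = (\<integral>x. g x * (ek (x * \<xi>) * e x) - g' x * (ek (x * \<xi>) * e x))"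
      unfolding fourier_def right_diff_distrib by (simp only: mult.left_commute)
    also have "\<dots> = 0"
      using Bochner_Integration.integral_diff [OF i(1) [OF m] i(2) [OF m]] q [OF m] by simp
    finally show "fourier (\<lambda>x. g x * e x - g' x * e x) \<xi> = 0" .
  qed
  then show ?thesis
  proof eventually_elim
    case (elim x)
    then have "(g x - g' x) * e x = 0" by (simp add: left_diff_distrib)
    then show ?case by (simp add: e_def)
  qed
qed

section \<open>Tempered distributions described by their Fourier transform\<close>

text \<open>The distribution \<open>u\<close> has the function \<open>g\<close> as its Fourier transform. All arguments below are
  about \<open>g\<close>.\<close>

definition rep :: "tempered \<Rightarrow> (real \<Rightarrow> complex) \<Rightarrow> bool" where
  "rep u g \<longleftrightarrow> given_by (td_fourier u) g"

text \<open>The inverse Fourier transform of a moderate function, as a distribution.\<close>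

definition inv_td :: "(real \<Rightarrow> complex) \<Rightarrow> tempered" where
  "inv_td g = Abs_tempered (\<lambda>\<phi>. if \<phi> \<in> schwartz then \<integral>x. g x * inverse_fourier \<phi> x \<partial>lborel else 0)"

lemma rep_unique: "rep u g \<Longrightarrow> rep u g' \<Longrightarrow> AE x in lborel. g x = g' x"
  unfolding rep_def by (rule given_by_unique)

lemma rep_measurable: "rep u g \<Longrightarrow> g \<in> borel_measurable borel"
  by (simp add: rep_def given_by_def)

lemma rep_apply: "rep u g \<Longrightarrow> \<phi> \<in> schwartz \<Longrightarrow> td_apply u (fourier \<phi>) = (\<integral>x. g x * \<phi> x)"
  by (simp add: rep_def given_by_def td_fourier_def)

lemma rep_integrable: "rep u g \<Longrightarrow> \<phi> \<in> schwartz \<Longrightarrow> integrable lborel (\<lambda>x. g x * \<phi> x)"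
  by (simp add: rep_def given_by_def)

lemma repI:
  assumes "g \<in> borel_measurable borel" "\<And>\<phi>. \<phi> \<in> schwartz \<Longrightarrow> integrable lborel (\<lambda>x. g x * \<phi> x)"
    "\<And>\<phi>. \<phi> \<in> schwartz \<Longrightarrow> td_apply u (fourier \<phi>) = (\<integral>x. g x * \<phi> x)"
  shows "rep u g"
  using assms by (simp add: rep_def given_by_def td_fourier_def)

lemma td_apply_outside: "\<phi> \<notin> schwartz \<Longrightarrow> td_apply u \<phi> = 0"
  using td_apply [of u] by (simp add: is_tempered_def)

text \<open>Every Schwartz function is a Fourier transform, so transforms suffice as test functions.\<close>

lemma tempered_eqI:
  assumes "\<And>\<phi>. \<phi> \<in> schwartz \<Longrightarrow> td_apply u (fourier \<phi>) = td_apply w (fourier \<phi>)"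
  shows "u = w"
proof -
  have "td_apply u \<psi> = td_apply w \<psi>" for \<psi>
  proof (cases "\<psi> \<in> schwartz")
    case True
    then show ?thesis
      using assms [of "inverse_fourier \<psi>"] schwartz_contD [OF schwartz_cont_inverse_fourier, of \<psi>]
      by (simp add: fourier_inverse_fourier)
  qed (simp add: td_apply_outside)
  then show ?thesis by (simp add: td_apply_inject [symmetric] fun_eq_iff)
qed

lemma rep_inject: "rep u g \<Longrightarrow> rep w g \<Longrightarrow> u = w"
  by (rule tempered_eqI) (simp add: rep_apply)

lemma rep_cong_AE:
  assumes "rep u g" "g' \<in> borel_measurable borel" "AE x in lborel. g x = g' x"
  shows "rep u g'"
proof (rule repI [OF assms(2)])
  fix \<phi> assume \<phi>: "\<phi> \<in> schwartz"
  note [measurable] = schwartz_measurable [OF \<phi>] rep_measurable [OF assms(1)] assms(2)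
  have ae: "AE x in lborel. g x * \<phi> x = g' x * \<phi> x" using assms(3) by eventually_elim simp
  show "integrable lborel (\<lambda>x. g' x * \<phi> x)"
    by (rule integrable_cong_AE_imp [OF rep_integrable [OF assms(1) \<phi>] _ ae]) measurable
  have "(\<integral>x. g x * \<phi> x) = (\<integral>x. g' x * \<phi> x)"
    by (rule integral_cong_AE [OF _ _ ae]) measurable
  then show "td_apply u (fourier \<phi>) = (\<integral>x. g' x * \<phi> x)"
    using rep_apply [OF assms(1) \<phi>] by simp
qed

lemma rep_inject_AE:
  assumes "rep u g" "rep w g'" "AE x in lborel. g x = g' x" shows "u = w"
  using rep_inject [OF rep_cong_AE [OF assms(1) rep_measurable [OF assms(2)] assms(3)] assms(2)] .

lemma inverse_fourier_add:
  assumes "\<phi> \<in> schwartz" "\<psi> \<in> schwartz"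
  shows "inverse_fourier (\<lambda>x. \<phi> x + \<psi> x) = (\<lambda>x. inverse_fourier \<phi> x + inverse_fourier \<psi> x)"
  unfolding inverse_fourier_def fourier_def distrib_left
  using fourier_integrable [OF schwartz_integrable_abs(1) [OF assms(1)]]
    fourier_integrable [OF schwartz_integrable_abs(1) [OF assms(2)]]
  by (intro ext) (simp only: Bochner_Integration.integral_add distrib_left)

lemma inverse_fourier_cmult: "inverse_fourier (\<lambda>x. c * \<phi> x) = (\<lambda>x. c * inverse_fourier \<phi> x)"
  unfolding inverse_fourier_def fourier_cmult by (rule ext) (rule mult.left_commute)

lemma rep_inv_td:
  assumes "moderate g" shows "rep (inv_td g) g"
proof -
  obtain k where g: "g \<in> borel_measurable borel" "integrable lborel (\<lambda>x. cmod (g x) / jap x ^ k)"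
    using assms by (auto simp: moderate_def)
  define C where "C = 2 ^ k * (\<integral>x. cmod (g x) / jap x ^ k)"
  have C: "0 \<le> C" by (simp add: C_def integral_nonneg_AE)
  have p: "integrable lborel (\<lambda>x. g x * \<phi> x)" "cmod (\<integral>x. g x * \<phi> x) \<le> C * schwartz_norm k \<phi>"
    if "\<phi> \<in> schwartz" for \<phi>
    using moderate_pairing [OF g that] by (auto simp: C_def)
  note I = schwartz_contD [OF schwartz_cont_inverse_fourier]
  obtain D M where D: "0 \<le> D" "\<And>\<phi>. \<phi> \<in> schwartz \<Longrightarrow> schwartz_norm k (inverse_fourier \<phi>) \<le> D * schwartz_norm M \<phi>"
    by (rule schwartz_contE [OF schwartz_cont_inverse_fourier, of k]) (rule that)
  have bd: "cmod (\<integral>x. g x * inverse_fourier \<phi> x) \<le> (C * D) * schwartz_norm M \<phi>" if "\<phi> \<in> schwartz" for \<phi>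
    using p(2) [OF I [OF that]] mult_left_mono [OF D(2) [OF that] C] by (simp add: mult.assoc)
  have "is_tempered (\<lambda>\<phi>. if \<phi> \<in> schwartz then \<integral>x. g x * inverse_fourier \<phi> x \<partial>lborel else 0)"
    unfolding is_tempered_def
  proof (intro conjI ballI allI impI)
    fix \<phi> \<psi> assume s: "\<phi> \<in> schwartz" "\<psi> \<in> schwartz"
    have "(\<integral>x. g x * inverse_fourier (\<lambda>x. \<phi> x + \<psi> x) x) =
      (\<integral>x. g x * inverse_fourier \<phi> x) + (\<integral>x. g x * inverse_fourier \<psi> x)"
      unfolding inverse_fourier_add [OF s] distrib_left
      by (intro Bochner_Integration.integral_add p I s)
    then show "(if (\<lambda>x. \<phi> x + \<psi> x) \<in> schwartz then \<integral>x. g x * inverse_fourier (\<lambda>x. \<phi> x + \<psi> x) x \<partial>lborel else 0) =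
      (if \<phi> \<in> schwartz then \<integral>x. g x * inverse_fourier \<phi> x \<partial>lborel else 0) +
      (if \<psi> \<in> schwartz then \<integral>x. g x * inverse_fourier \<psi> x \<partial>lborel else 0)"
      using s schwartz_add [OF s] by (simp only: if_True)
  next
    fix \<phi> c assume s: "\<phi> \<in> schwartz"
    have "(\<integral>x. g x * inverse_fourier (\<lambda>x. c * \<phi> x) x) = c * (\<integral>x. g x * inverse_fourier \<phi> x)"
      unfolding inverse_fourier_cmult mult.left_commute [of _ c] by (rule integral_mult_right_zero)
    then show "(if (\<lambda>x. c * \<phi> x) \<in> schwartz then \<integral>x. g x * inverse_fourier (\<lambda>x. c * \<phi> x) x \<partial>lborel else 0) =
      c * (if \<phi> \<in> schwartz then \<integral>x. g x * inverse_fourier \<phi> x \<partial>lborel else 0)"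
      using s schwartz_cmult [OF s] by (simp only: if_True)
  next
    show "\<exists>C N. \<forall>\<phi>\<in>schwartz. cmod (if \<phi> \<in> schwartz then \<integral>x. g x * inverse_fourier \<phi> x \<partial>lborel else 0) \<le> C * schwartz_norm N \<phi>"
      by (intro exI [of _ "C * D"] exI [of _ M] ballI) (simp only: if_True bd)
  qed (simp only: if_False)
  then have "td_apply (inv_td g) = (\<lambda>\<phi>. if \<phi> \<in> schwartz then \<integral>x. g x * inverse_fourier \<phi> x \<partial>lborel else 0)"
    unfolding inv_td_def by (intro Abs_tempered_inverse) simp
  then show ?thesis
    by (intro repI g(1) p(1)) (simp_all only: fourier_schwartz inverse_fourier_fourier if_True)
qed

section \<open>Square integrable functions\<close>

text \<open>The square of the \<open>L\<^sup>2\<close> norm, in the extended reals so that it can be bounded before it is known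
  to be finite.\<close>

definition l2 :: "(real \<Rightarrow> complex) \<Rightarrow> ennreal" where
  "l2 g = (\<integral>\<^sup>+x. ennreal ((cmod (g x))\<^sup>2))"

text \<open>Measurability and a finite bound in one predicate; the bound is on the norm, not on its square.\<close>

definition l2_le :: "(real \<Rightarrow> complex) \<Rightarrow> real \<Rightarrow> bool" where
  "l2_le g A \<longleftrightarrow> g \<in> borel_measurable borel \<and> 0 \<le> A \<and> l2 g \<le> ennreal (A\<^sup>2)"

lemma norm_integral_le_nn_integral:
  fixes f :: "'a \<Rightarrow> 'b::{banach, second_countable_topology}"
  shows "ennreal (norm (\<integral>x. f x \<partial>M)) \<le> (\<integral>\<^sup>+x. ennreal (norm (f x)) \<partial>M)"
proof (cases "integrable M f")
  case True then show ?thesis by (rule integral_norm_bound_ennreal)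
next
  case False then show ?thesis by (simp add: not_integrable_integral_eq)
qed

lemma l2_cong_AE: "AE x in lborel. cmod (g x) = cmod (h x) \<Longrightarrow> l2 g = l2 h"
  unfolding l2_def by (rule nn_integral_cong_AE) (auto elim!: eventually_mono)

lemma l2_mono_AE: "AE x in lborel. cmod (g x) \<le> cmod (h x) \<Longrightarrow> l2 g \<le> l2 h"
  unfolding l2_def by (rule nn_integral_mono_AE) (auto elim!: eventually_mono intro!: ennreal_leI power_mono)

lemma l2_cmult:
  assumes [measurable]: "g \<in> borel_measurable borel"
  shows "l2 (\<lambda>x. c * g x) = ennreal ((cmod c)\<^sup>2) * l2 g"
  unfolding l2_def by (simp add: norm_mult power_mult_distrib ennreal_mult nn_integral_cmult)

lemma l2_leD:
  assumes "l2_le g A" shows "g \<in> borel_measurable borel" "0 \<le> A" "l2 g \<le> ennreal (A\<^sup>2)" "l2 g < \<infinity>"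
  using assms by (auto simp: l2_le_def intro: le_less_trans)

lemma l2_finite_le:
  assumes "g \<in> borel_measurable borel" "l2 g < \<infinity>"
  shows "l2_le g (sqrt (enn2real (l2 g)))"
  using assms by (simp add: l2_le_def)

lemma l2_le_bound:
  assumes "l2_le g A" "h \<in> borel_measurable borel" "0 \<le> c" "AE x in lborel. cmod (h x) \<le> c * cmod (g x)"
  shows "l2_le h (c * A)"
proof -
  note [measurable] = l2_leD(1) [OF assms(1)]
  have "l2 h \<le> l2 (\<lambda>x. cx c * g x)"
    using assms(3,4) by (intro l2_mono_AE) (simp add: norm_mult)
  also have "\<dots> = ennreal (c\<^sup>2) * l2 g" using assms(3) by (simp add: l2_cmult)
  also have "\<dots> \<le> ennreal (c\<^sup>2) * ennreal (A\<^sup>2)" by (intro mult_left_mono l2_leD [OF assms(1)]) simp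
  finally show ?thesis
    using assms(2,3) l2_leD(2) [OF assms(1)] by (simp add: l2_le_def ennreal_mult [symmetric] power_mult_distrib)
qed

lemma l2_le_weaken: "l2_le g A \<Longrightarrow> A \<le> B \<Longrightarrow> l2_le g B"
  unfolding l2_le_def by (auto intro: order_trans power_mono ennreal_leI)

lemma l2_add_le:
  assumes [measurable]: "g \<in> borel_measurable borel" "h \<in> borel_measurable borel"
  shows "l2 (\<lambda>x. g x + h x) \<le> 2 * l2 g + 2 * l2 h"
proof -
  have "l2 (\<lambda>x. g x + h x) \<le> (\<integral>\<^sup>+x. 2 * ennreal ((cmod (g x))\<^sup>2) + 2 * ennreal ((cmod (h x))\<^sup>2))"
    unfolding l2_def
  proof (rule nn_integral_mono)
    fix x
    have "(cmod (g x + h x))\<^sup>2 \<le> (cmod (g x) + cmod (h x))\<^sup>2" by (intro power_mono norm_triangle_ineq) simp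
    also have "\<dots> \<le> 2 * (cmod (g x))\<^sup>2 + 2 * (cmod (h x))\<^sup>2"
      using zero_le_power2 [of "cmod (g x) - cmod (h x)"] by (simp add: power2_eq_square algebra_simps)
    finally have "ennreal ((cmod (g x + h x))\<^sup>2) \<le> ennreal (2 * (cmod (g x))\<^sup>2 + 2 * (cmod (h x))\<^sup>2)" by (rule ennreal_leI)
    then show "ennreal ((cmod (g x + h x))\<^sup>2) \<le> 2 * ennreal ((cmod (g x))\<^sup>2) + 2 * ennreal ((cmod (h x))\<^sup>2)"
      by (simp add: ennreal_mult)
  qed
  also have "\<dots> = 2 * l2 g + 2 * l2 h"
    unfolding l2_def by (simp add: nn_integral_add nn_integral_cmult)
  finally show ?thesis .
qed

text \<open>The triangle inequality up to a factor \<open>2\<close>, which is cheaper to prove and harmless for the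
  estimates.\<close>

lemma l2_le_add:
  assumes "l2_le g A" "l2_le h B" shows "l2_le (\<lambda>x. g x + h x) (2 * (A + B))"
proof -
  note m [measurable] = l2_leD(1) [OF assms(1)] l2_leD(1) [OF assms(2)]
  note nn = l2_leD(2) [OF assms(1)] l2_leD(2) [OF assms(2)]
  have "l2 (\<lambda>x. g x + h x) \<le> 2 * ennreal (A\<^sup>2) + 2 * ennreal (B\<^sup>2)"
    using l2_add_le [OF m] l2_leD(3) [OF assms(1)] l2_leD(3) [OF assms(2)]
    by (meson add_mono mult_left_mono order_trans zero_le)
  also have "\<dots> = ennreal (2 * A\<^sup>2 + 2 * B\<^sup>2)" by (simp add: ennreal_mult)
  also have "\<dots> \<le> ennreal ((2 * (A + B))\<^sup>2)"
    using nn by (intro ennreal_leI) (simp add: power2_eq_square algebra_simps)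
  finally show ?thesis using nn by (simp add: l2_le_def)
qed

lemma l2_le_uminus: "l2_le g A \<Longrightarrow> l2_le (\<lambda>x. - g x) A"
  by (simp add: l2_le_def l2_def)

lemma l2_le_diff:
  assumes "l2_le g A" "l2_le h B" shows "l2_le (\<lambda>x. g x - h x) (2 * (A + B))"
  using l2_le_add [OF assms(1) l2_le_uminus [OF assms(2)]] by simp

lemma ennreal_power2_le_imp_le:
  assumes "x\<^sup>2 \<le> (ennreal b)\<^sup>2" "0 \<le> b" shows "x \<le> ennreal b"
proof (cases x)
  case (real a)
  then have "a\<^sup>2 \<le> b\<^sup>2" using assms by (simp add: ennreal_power)
  then have "a \<le> b" by (rule power2_le_imp_le [OF _ assms(2)])
  then show ?thesis unfolding real(2) by (rule ennreal_leI)
next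
  case top
  then show ?thesis using assms by (simp add: ennreal_power top_unique)
qed

lemma nn_integral_mult_le_l2:
  assumes "l2_le g A" "l2_le h B"
  shows "(\<integral>\<^sup>+x. ennreal (cmod (g x * h x))) \<le> ennreal (A * B)"
proof -
  note [measurable] = l2_leD(1) [OF assms(1)] l2_leD(1) [OF assms(2)]
  note nn = l2_leD(2) [OF assms(1)] l2_leD(2) [OF assms(2)]
  have "(\<integral>\<^sup>+x. ennreal (cmod (g x)) * ennreal (cmod (h x)))\<^sup>2 \<le>
     (\<integral>\<^sup>+x. ennreal (cmod (g x)) ^ 2) * (\<integral>\<^sup>+x. ennreal (cmod (h x)) ^ 2)"
    by (rule Cauchy_Schwarz_nn_integral) measurable
  also have "\<dots> = l2 g * l2 h" by (simp add: l2_def ennreal_power)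
  also have "\<dots> \<le> ennreal (A\<^sup>2) * ennreal (B\<^sup>2)"
    by (intro mult_mono l2_leD(3) assms) auto
  also have "\<dots> = (ennreal (A * B))\<^sup>2"
    using nn by (simp add: ennreal_mult [symmetric] ennreal_power power_mult_distrib)
  finally have "(\<integral>\<^sup>+x. ennreal (cmod (g x)) * ennreal (cmod (h x)))\<^sup>2 \<le> (ennreal (A * B))\<^sup>2" .
  from ennreal_power2_le_imp_le [OF this mult_nonneg_nonneg [OF nn]]
  have "(\<integral>\<^sup>+x. ennreal (cmod (g x)) * ennreal (cmod (h x))) \<le> ennreal (A * B)" .
  then show ?thesis by (simp add: norm_mult ennreal_mult)
qed

lemma l2_pairing:
  assumes "l2_le g A" "l2_le h B"
  shows "integrable lborel (\<lambda>x. g x * h x)" "cmod (\<integral>x. g x * h x) \<le> A * B"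
proof -
  note [measurable] = l2_leD(1) [OF assms(1)] l2_leD(1) [OF assms(2)]
  note nn = l2_leD(2) [OF assms(1)] l2_leD(2) [OF assms(2)]
  note b = nn_integral_mult_le_l2 [OF assms]
  show "integrable lborel (\<lambda>x. g x * h x)"
    by (rule integrableI_bounded) (auto intro: le_less_trans [OF b])
  have "ennreal (cmod (\<integral>x. g x * h x)) \<le> ennreal (A * B)"
    using norm_integral_le_nn_integral b by (rule order_trans)
  then show "cmod (\<integral>x. g x * h x) \<le> A * B" using nn by simp
qed

lemma l2_reflect:
  assumes [measurable]: "g \<in> borel_measurable borel"
  shows "l2 (\<lambda>x. g (a - x)) = l2 g"
  unfolding l2_def using nn_integral_real_affine [of "\<lambda>x. ennreal ((cmod (g x))\<^sup>2)" "-1" a] by simp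

lemma l2_le_reflect: "l2_le g A \<Longrightarrow> l2_le (\<lambda>x. g (a - x)) A"
  unfolding l2_le_def by (auto simp: l2_reflect)

lemma l2_le_jap:
  assumes "r > 1/2" shows "\<exists>A. l2_le (\<lambda>\<xi>. cx (jap \<xi> powr - r)) A"
proof -
  have "integrable lborel (\<lambda>x. jap x powr - (2 * r))" using assms by (intro integrable_jap_powr) simp
  moreover have "(jap x powr - r)\<^sup>2 = jap x powr - (2 * r)" for x
    by (simp add: power2_eq_square powr_add [symmetric])
  ultimately have "l2 (\<lambda>\<xi>. cx (jap \<xi> powr - r)) < \<infinity>"
    by (simp add: l2_def nn_integral_eq_integral)
  then show ?thesis using l2_finite_le [of "\<lambda>\<xi>. cx (jap \<xi> powr - r)"] by auto
qed

lemma l2_weighted_moderate: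
  assumes [measurable]: "g \<in> borel_measurable borel" and l: "l2 (\<lambda>\<xi>. cx (jap \<xi> powr \<sigma>) * g \<xi>) < \<infinity>"
  shows "moderate g"
proof -
  obtain k :: nat where k: "1 - \<sigma> \<le> real k" using real_arch_simple by blast
  obtain A where A: "l2_le (\<lambda>\<xi>. cx (jap \<xi> powr - (\<sigma> + real k))) A"
    using l2_le_jap [of "\<sigma> + real k"] k by auto
  have m: "l2_le (\<lambda>\<xi>. cx (jap \<xi> powr \<sigma>) * g \<xi>) (sqrt (enn2real (l2 (\<lambda>\<xi>. cx (jap \<xi> powr \<sigma>) * g \<xi>))))"
    by (rule l2_finite_le [OF _ l]) measurable
  have "integrable lborel (\<lambda>\<xi>. cx (jap \<xi> powr \<sigma>) * g \<xi> * cx (jap \<xi> powr - (\<sigma> + real k)))"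
    by (rule l2_pairing [OF m A])
  moreover have "jap \<xi> powr \<sigma> * cmod (g \<xi>) * jap \<xi> powr - (\<sigma> + real k) = cmod (g \<xi>) / jap \<xi> ^ k" for \<xi>
  proof -
    have "jap \<xi> powr \<sigma> * jap \<xi> powr - (\<sigma> + real k) = inverse (jap \<xi> ^ k)"
      by (simp add: powr_add [symmetric] powr_minus powr_realpow)
    moreover have "jap \<xi> powr \<sigma> * cmod (g \<xi>) * jap \<xi> powr - (\<sigma> + real k) =
        cmod (g \<xi>) * (jap \<xi> powr \<sigma> * jap \<xi> powr - (\<sigma> + real k))" by (simp only: mult_ac)
    ultimately show ?thesis by (simp only: divide_inverse)
  qed
  ultimately have "integrable lborel (\<lambda>\<xi>. cmod (g \<xi>) / jap \<xi> ^ k)"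
    by (drule_tac integrable_norm) (simp add: norm_mult)
  then show ?thesis unfolding moderate_def using assms(1) by blast
qed

lemma schwartz_l2:
  assumes "\<phi> \<in> schwartz" shows "\<exists>A. l2_le \<phi> A"
proof -
  obtain A where A: "l2_le (\<lambda>\<xi>. cx (jap \<xi> powr - 1)) A" using l2_le_jap [of 1] by auto
  have "cmod (\<phi> x) \<le> (2 * schwartz_norm 1 \<phi>) * cmod (cx (jap x powr - 1))" for x
    using schwartz_decay [OF assms, of x 1] by (simp add: powr_minus norm_inverse norm_divide field_simps)
  then have "l2_le \<phi> ((2 * schwartz_norm 1 \<phi>) * A)"
    using schwartz_norm_nonneg [OF assms, of 1]
    by (intro l2_le_bound [OF A schwartz_measurable [OF assms]]) auto
  then show ?thesis by blast
qed

lemma fatou_bound: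
  fixes f :: "nat \<Rightarrow> real \<Rightarrow> ennreal"
  assumes "\<And>n. f n \<in> borel_measurable lborel" "AE x in lborel. (\<lambda>n. f n x) \<longlonglongrightarrow> F x"
    "\<And>n. (\<integral>\<^sup>+x. f n x) \<le> C"
  shows "(\<integral>\<^sup>+x. F x) \<le> C"
proof -
  have "(\<integral>\<^sup>+x. F x) = (\<integral>\<^sup>+x. liminf (\<lambda>n. f n x))"
    using assms(2) by (intro nn_integral_cong_AE) (auto elim!: eventually_mono simp: lim_imp_Liminf)
  also have "\<dots> \<le> liminf (\<lambda>n. \<integral>\<^sup>+x. f n x \<partial>lborel)"
    by (rule nn_integral_liminf [OF assms(1)])
  also have "\<dots> \<le> liminf (\<lambda>n. C)"
    by (intro Liminf_mono always_eventually allI assms(3))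
  also have "\<dots> = C" by (simp add: Liminf_const)
  finally show ?thesis .
qed

lemma l2_fatou:
  assumes "\<And>n. f n \<in> borel_measurable borel" "AE x in lborel. (\<lambda>n. f n x) \<longlonglongrightarrow> F x" "\<And>n. l2 (f n) \<le> C"
  shows "l2 F \<le> C"
  unfolding l2_def
proof (rule fatou_bound)
  note [measurable] = assms(1)
  show "(\<lambda>x. ennreal ((cmod (f n x))\<^sup>2)) \<in> borel_measurable lborel" for n by measurable
  show "AE x in lborel. (\<lambda>n. ennreal ((cmod (f n x))\<^sup>2)) \<longlonglongrightarrow> ennreal ((cmod (F x))\<^sup>2)"
    using assms(2) by eventually_elim (intro tendsto_intros)
  show "(\<integral>\<^sup>+ x. ennreal ((cmod (f n x))\<^sup>2)) \<le> C" for n using assms(3) by (simp add: l2_def)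
qed

text \<open>A geometric rate makes \<open>\<Sum>n. 4\<^sup>n \<bar>f\<^sub>n\<bar>\<^sup>2\<close> integrable, hence finite almost everywhere, and so
  \<open>\<bar>f\<^sub>n\<bar> = O(2^(-n))\<close> there.\<close>

lemma AE_summable_of_l2:
  assumes [measurable]: "\<And>n. f n \<in> borel_measurable borel" and le: "\<And>n. l2 (f n) \<le> ennreal ((1/8) ^ n)"
  shows "AE x in lborel. summable (\<lambda>n. cmod (f n x))"
proof -
  have "(\<integral>\<^sup>+x. (\<Sum>n. ennreal (4 ^ n * (cmod (f n x))\<^sup>2))) = (\<Sum>n. \<integral>\<^sup>+x. ennreal (4 ^ n * (cmod (f n x))\<^sup>2) \<partial>lborel)"
    by (rule nn_integral_suminf) measurable
  also have "\<dots> = (\<Sum>n. ennreal (4 ^ n) * l2 (f n))"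
    by (simp add: l2_def ennreal_mult nn_integral_cmult)
  also have "\<dots> \<le> (\<Sum>n. ennreal ((1/2) ^ n))"
  proof (intro suminf_le allI)
    fix n
    have "ennreal (4 ^ n) * l2 (f n) \<le> ennreal (4 ^ n) * ennreal ((1/8) ^ n)" by (intro mult_left_mono le) simp
    then show "ennreal (4 ^ n) * l2 (f n) \<le> ennreal ((1/2) ^ n)"
      by (simp add: ennreal_mult [symmetric] power_mult_distrib [symmetric])
  qed auto
  also have "\<dots> = ennreal (\<Sum>n. (1/2) ^ n)"
    by (rule suminf_ennreal2) (auto intro: summable_geometric)
  also have "\<dots> < \<infinity>" by simp
  finally have "AE x in lborel. (\<Sum>n. ennreal (4 ^ n * (cmod (f n x))\<^sup>2)) \<noteq> \<infinity>"
    by (intro nn_integral_noteq_infinite) auto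
  then show ?thesis
  proof eventually_elim
    case (elim x)
    have s: "summable (\<lambda>n. 4 ^ n * (cmod (f n x))\<^sup>2)"
      using elim by (intro summable_suminf_not_top) auto
    then obtain B where B: "\<And>n. norm (4 ^ n * (cmod (f n x))\<^sup>2) \<le> B"
      using Bseq_eq_bounded summable_imp_Bseq unfolding Bseq_def by blast
    have B0: "0 \<le> B" using order_trans [OF norm_ge_zero B] .
    have le: "cmod (f n x) \<le> sqrt B * (1/2) ^ n" for n
    proof (rule power2_le_imp_le)
      have "(cmod (f n x))\<^sup>2 = (4 ^ n * (cmod (f n x))\<^sup>2) * (1/4) ^ n" by (simp add: power_divide)
      also have "\<dots> \<le> B * (1/4) ^ n" using B [of n] by (intro mult_right_mono) auto
      also have "\<dots> = (sqrt B * (1/2) ^ n)\<^sup>2"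
        using B0 by (simp add: power_mult_distrib power_divide power_mult [symmetric] mult.commute [of n] power_mult)
      finally show "(cmod (f n x))\<^sup>2 \<le> (sqrt B * (1/2) ^ n)\<^sup>2" .
    qed (use B0 in simp)
    show ?case
      by (rule summable_comparison_test' [of "\<lambda>n. sqrt B * (1/2) ^ n" 0])
        (use le in \<open>auto intro!: summable_mult summable_geometric\<close>)
  qed
qed

text \<open>Riesz-Fischer: a subsequence that converges fast converges almost everywhere, and Fatou's lemma
  transfers the bounds to the limit.\<close>

lemma l2_complete:
  assumes m [measurable]: "\<And>n. f n \<in> borel_measurable borel"
    and cauchy: "\<And>n k. n \<le> k \<Longrightarrow> l2_le (\<lambda>x. f k x - f n x) (a n)" and a: "a \<longlonglongrightarrow> 0"
  shows "\<exists>F r. F \<in> borel_measurable borel \<and> strict_mono (r :: nat \<Rightarrow> nat) \<and>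
     (AE x in lborel. (\<lambda>k. f (r k) x) \<longlonglongrightarrow> F x) \<and> (\<forall>n. l2_le (\<lambda>x. F x - f n x) (a n))"
proof -
  have ann: "0 \<le> a n" for n using cauchy [of n n] by (simp add: l2_le_def)
  have "\<exists>r :: nat \<Rightarrow> nat. strict_mono r \<and> (\<forall>k. (a (r k))\<^sup>2 \<le> (1/8) ^ k)"
  proof -
    have ex: "\<exists>N. \<forall>n\<ge>N. (a n)\<^sup>2 \<le> (1/8) ^ k" for k
    proof -
      have "(\<lambda>n. (a n)\<^sup>2) \<longlonglongrightarrow> 0\<^sup>2" by (intro tendsto_intros a)
      then have "\<forall>\<^sub>F n in sequentially. (a n)\<^sup>2 < (1/8) ^ k" by (rule order_tendstoD) simp
      then show ?thesis unfolding eventually_sequentially by (meson less_imp_le)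
    qed
    have "\<exists>r. \<forall>k. (\<forall>n\<ge>r k. (a n)\<^sup>2 \<le> (1/8) ^ k) \<and> r k < r (Suc k)"
    proof (rule dependent_nat_choice)
      show "\<exists>x. \<forall>n\<ge>x. (a n)\<^sup>2 \<le> (1/8) ^ 0" using ex [of 0] .
      fix x k
      obtain N where "\<forall>n\<ge>N. (a n)\<^sup>2 \<le> (1/8) ^ Suc k" using ex by blast
      then show "\<exists>y. (\<forall>n\<ge>y. (a n)\<^sup>2 \<le> (1/8) ^ Suc k) \<and> x < y"
        by (intro exI [of _ "max N (Suc x)"]) auto
    qed
    then obtain r where "\<And>k. \<forall>n\<ge>r k. (a n)\<^sup>2 \<le> (1/8) ^ k" "\<And>k. r k < r (Suc k)" by blast
    then show ?thesis by (intro exI [of _ r]) (auto simp: strict_mono_Suc_iff)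
  qed
  then obtain r :: "nat \<Rightarrow> nat" where r: "strict_mono r" "\<And>k. (a (r k))\<^sup>2 \<le> (1/8) ^ k" by blast
  have "AE x in lborel. summable (\<lambda>k. cmod (f (r (Suc k)) x - f (r k) x))"
  proof (rule AE_summable_of_l2)
    show "l2 (\<lambda>x. f (r (Suc k)) x - f (r k) x) \<le> ennreal ((1/8) ^ k)" for k
    proof -
      have "r k \<le> r (Suc k)" using r(1) by (simp add: strict_mono_Suc_iff less_imp_le)
      then have "l2 (\<lambda>x. f (r (Suc k)) x - f (r k) x) \<le> ennreal ((a (r k))\<^sup>2)"
        using cauchy by (simp add: l2_le_def)
      also have "\<dots> \<le> ennreal ((1/8) ^ k)" by (intro ennreal_leI r(2))
      finally show ?thesis .
    qed
  qed measurable
  then have conv: "AE x in lborel. convergent (\<lambda>k. f (r k) x)"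
  proof eventually_elim
    case (elim x)
    then have "summable (\<lambda>k. f (r (Suc k)) x - f (r k) x)" by (rule summable_norm_cancel)
    then have "convergent (\<lambda>n. f (r 0) x + (\<Sum>k<n. f (r (Suc k)) x - f (r k) x))"
      by (intro convergent_add convergent_const) (simp add: summable_iff_convergent)
    moreover have "f (r 0) x + (\<Sum>k<n. f (r (Suc k)) x - f (r k) x) = f (r n) x" for n
      using sum_lessThan_telescope [of "\<lambda>k. f (r k) x" n] by simp
    ultimately show ?case by simp
  qed
  define F where "F x = lim (\<lambda>k. f (r k) x)" for x
  have F [measurable]: "F \<in> borel_measurable borel"
    unfolding F_def by measurable
  have lim: "AE x in lborel. (\<lambda>k. f (r k) x) \<longlonglongrightarrow> F x"
    using conv by eventually_elim (simp add: F_def convergent_LIMSEQ_iff)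
  have "l2_le (\<lambda>x. F x - f n x) (a n)" for n
  proof -
    have "l2 (\<lambda>x. F x - f n x) \<le> ennreal ((a n)\<^sup>2)"
    proof (rule l2_fatou [where f = "\<lambda>k x. f (r (k + n)) x - f n x"])
      show "AE x in lborel. (\<lambda>k. f (r (k + n)) x - f n x) \<longlonglongrightarrow> F x - f n x"
        using lim by eventually_elim (intro tendsto_intros LIMSEQ_ignore_initial_segment)
      show "l2 (\<lambda>x. f (r (k + n)) x - f n x) \<le> ennreal ((a n)\<^sup>2)" for k
        using cauchy [of n "r (k + n)"] seq_suble [OF r(1), of "k + n"] by (simp add: l2_le_def)
    qed measurable
    then show ?thesis using ann by (simp add: l2_le_def)
  qed
  then show ?thesis using F r(1) lim by blast
qed

section \<open>Plancherel\<close>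

lemma std_normal_conv_mass:
  assumes "0 < n"
  shows "(\<integral>\<^sup>+z. ennreal (n * std_normal_density (n * (z - y)))) = 1"
    and "(\<integral>\<^sup>+y. ennreal (n * std_normal_density (n * (z - y)))) = 1"
proof -
  have one: "(\<integral>\<^sup>+x. ennreal (std_normal_density x)) = 1"
    using nn_integral_eq_integral [of lborel std_normal_density] by simp
  have "(\<integral>\<^sup>+z. ennreal n * ennreal (std_normal_density (- (n * y) + n * z))) = 1"
    using nn_integral_real_affine [of "\<lambda>x. ennreal (std_normal_density x)" n "- (n * y)"] assms one
    by (simp add: nn_integral_cmult)
  then show "(\<integral>\<^sup>+z. ennreal (n * std_normal_density (n * (z - y)))) = 1"
    using assms by (simp add: ennreal_mult algebra_simps)
  have "(\<integral>\<^sup>+y. ennreal n * ennreal (std_normal_density (n * z + (- n) * y))) = 1"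
    using nn_integral_real_affine [of "\<lambda>x. ennreal (std_normal_density x)" "- n" "n * z"] assms one
    by (simp add: nn_integral_cmult)
  then show "(\<integral>\<^sup>+y. ennreal (n * std_normal_density (n * (z - y)))) = 1"
    using assms by (simp add: ennreal_mult algebra_simps)
qed

lemma fourier_measurable:
  assumes [measurable]: "g \<in> borel_measurable borel" shows "fourier g \<in> borel_measurable borel"
  unfolding fourier_def by measurable

lemma measurable_cnj [measurable (raw)]:
  "g \<in> borel_measurable M \<Longrightarrow> (\<lambda>x. cnj (g x)) \<in> borel_measurable M"
  by (rule measurable_compose [OF _ borel_measurable_continuous_onI]) (auto intro: continuous_intros)

lemma cnj_fourier: "cnj (fourier g x) = (\<integral>z. iexp (z * x) * cnj (g z))"
  unfolding fourier_def Bochner_Integration.integral_cnj [symmetric]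
  by (rule Bochner_Integration.integral_cong [OF refl]) (simp add: exp_cnj)

lemma iexp_kernel_measurable:
  "jmeas (\<lambda>x y. iexp (y * x))"
  by measurable

text \<open>Half of Plancherel's identity, with a Gaussian factor that makes all integrals converge.
  Expanding \<open>\<bar>fourier g\<bar>\<^sup>2\<close> and integrating in \<open>x\<close> first gives the quadratic form \<open>\<integral>\<integral> g y cnj (g
  z) k (z - y)\<close> with a kernel \<open>k\<close> of mass \<open>2 \<pi>\<close>, which is bounded with \<open>2 \<bar>g y\<bar> \<bar>g z\<bar> \<le> \<bar>g y\<bar>\<^sup>2 +
  \<bar>g z\<bar>\<^sup>2\<close>.\<close>

lemma fourier_l2_gauss:
  fixes n :: real
  assumes g: "integrable lborel g" and n: "0 < n"
  shows "(\<integral>\<^sup>+x. ennreal ((cmod (fourier g x))\<^sup>2 * exp (- (x / n)\<^sup>2 / 2))) \<le> ennreal (2 * pi) * l2 g"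
proof -
  note [measurable] = borel_measurable_integrable [OF g]
  have Fm [measurable]: "fourier g \<in> borel_measurable borel" by (rule fourier_measurable) measurable
  let ?k = "\<lambda>z y. n * std_normal_density (n * (z - y))"
  let ?e = "\<lambda>x. cx (exp (- (x / n)\<^sup>2 / 2))"
  have ie: "integrable lborel ?e" using integrable_gauss [OF n] by simp
  have gc: "integrable lborel (\<lambda>z. cnj (g z))" using g by simp
  have Fb: "cmod (fourier g x) \<le> (\<integral>x. cmod (g x))" for x by (rule norm_fourier_le [OF g])
  have bi: "integrable lborel (\<lambda>x. F x * ?e x)" if "F \<in> borel_measurable borel" "\<And>x. cmod (F x) \<le> B" for F B
  proof (rule Bochner_Integration.integrable_bound)
    note [measurable] = that(1)
    show "integrable lborel (\<lambda>x. B * exp (- (x / n)\<^sup>2 / 2))" using integrable_gauss [OF n] by simp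
    show "(\<lambda>x. F x * ?e x) \<in> borel_measurable lborel" by measurable
    have "cmod (F x * ?e x) \<le> norm (B * exp (- (x / n)\<^sup>2 / 2))" for x
      using order_trans [OF that(2) [of x] abs_ge_self] by (simp add: norm_mult abs_mult)
    then show "AE x in lborel. norm (F x * ?e x) \<le> norm (B * exp (- (x / n)\<^sup>2 / 2))" by (intro AE_I2)
  qed
  have Fce: "integrable lborel (\<lambda>x. cnj (fourier g x) * ?e x)"
    by (rule bi [where B = "\<integral>x. cmod (g x) \<partial>lborel"]) (measurable, simp only: complex_mod_cnj Fb)
  have inner: "(\<integral>x. ek (y * x) * (cnj (fourier g x) * ?e x)) =
      (\<integral>z. cnj (g z) * cx (2 * pi * (?k z y)))" for y
  proof -
    have ie': "integrable lborel (\<lambda>x. ek (y * x) * ?e x)"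
      by (rule bi [OF _ norm_fourier_kernel_le]) measurable
    have "(\<integral>x. ek (y * x) * (cnj (fourier g x) * ?e x)) =
        (\<integral>x. (ek (y * x) * ?e x) * (\<integral>z. iexp (z * x) * cnj (g z)))"
      unfolding cnj_fourier by (simp only: mult_ac)
    also have "\<dots> = (\<integral>z. cnj (g z) * (\<integral>x. iexp (z * x) * (ek (y * x) * ?e x)))"
      by (rule fubini_kernel [OF ie' gc iexp_kernel_measurable]) (simp only: norm_iexp_real order_refl)
    also have "\<dots> = (\<integral>z. cnj (g z) * cx (2 * pi * (?k z y)))"
    proof (rule Bochner_Integration.integral_cong [OF refl])
      fix z
      have "iexp (z * x) * (ek (y * x) * ?e x) = iexp ((z - y) * x) * ?e x" for x
      proof -
        have "iexp (z * x) * ek (y * x) = iexp ((z - y) * x)"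
          by (simp add: exp_add [symmetric] algebra_simps)
        then show ?thesis by (simp only: mult.assoc [symmetric])
      qed
      then show "cnj (g z) * (\<integral>x. iexp (z * x) * (ek (y * x) * ?e x)) =
         cnj (g z) * cx (2 * pi * (?k z y))"
        by (simp only: fourier_gauss [OF n])
    qed
    finally show ?thesis .
  qed
  have sq: "cx ((cmod (fourier g x))\<^sup>2 * exp (- (x / n)\<^sup>2 / 2)) =
      (cnj (fourier g x) * ?e x) * (\<integral>y. ek (y * x) * g y)" for x
    unfolding fourier_def [of g, symmetric]
    by (simp only: of_real_mult complex_norm_square mult_ac)
  have isq: "integrable lborel (\<lambda>x. (cmod (fourier g x))\<^sup>2 * exp (- (x / n)\<^sup>2 / 2))"
  proof -
    have "integrable lborel (\<lambda>x. cx ((cmod (fourier g x))\<^sup>2) * ?e x)"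
    proof (rule bi [where B = "(\<integral>x. cmod (g x))\<^sup>2"])
      show "cmod (cx ((cmod (fourier g x))\<^sup>2)) \<le> (\<integral>x. cmod (g x))\<^sup>2" for x
        using power_mono [OF Fb [of x] norm_ge_zero, of 2] by (simp add: norm_power)
    qed measurable
    then have "integrable lborel (\<lambda>x. cx ((cmod (fourier g x))\<^sup>2 * exp (- (x / n)\<^sup>2 / 2)))" by simp
    then show ?thesis by (subst (asm) complex_of_real_integrable_eq)
  qed
  have "cx (\<integral>x. (cmod (fourier g x))\<^sup>2 * exp (- (x / n)\<^sup>2 / 2)) =
     (\<integral>x. (cnj (fourier g x) * ?e x) * (\<integral>y. ek (y * x) * g y))"
    unfolding sq [symmetric] by (rule integral_complex_of_real [symmetric])
  also have "\<dots> = (\<integral>y. g y * (\<integral>x. ek (y * x) * (cnj (fourier g x) * ?e x)))"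
    by (rule fubini_kernel [OF Fce g fourier_kernel_measurable norm_fourier_kernel_le])
  also have "\<dots> = (\<integral>y. g y * (\<integral>z. cnj (g z) * cx (2 * pi * (?k z y))))"
    by (simp only: inner)
  finally have eq: "cx (\<integral>x. (cmod (fourier g x))\<^sup>2 * exp (- (x / n)\<^sup>2 / 2)) = \<dots>" .
  have "(\<integral>\<^sup>+x. ennreal ((cmod (fourier g x))\<^sup>2 * exp (- (x / n)\<^sup>2 / 2))) =
      ennreal (\<integral>x. (cmod (fourier g x))\<^sup>2 * exp (- (x / n)\<^sup>2 / 2))"
    by (rule nn_integral_eq_integral [OF isq]) simp
  also have "\<dots> \<le> ennreal (cmod (cx (\<integral>x. (cmod (fourier g x))\<^sup>2 * exp (- (x / n)\<^sup>2 / 2))))"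
    by (intro ennreal_leI) (simp only: norm_of_real abs_ge_self)
  also have "\<dots> \<le> (\<integral>\<^sup>+y. ennreal (cmod (g y * (\<integral>z. cnj (g z) * cx (2 * pi * (?k z y))))))"
    unfolding eq by (rule norm_integral_le_nn_integral)
  also have "\<dots> \<le> (\<integral>\<^sup>+y. (\<integral>\<^sup>+z. ennreal pi * (ennreal ((cmod (g y))\<^sup>2) * ennreal (?k z y)
       + ennreal ((cmod (g z))\<^sup>2) * ennreal (?k z y))))"
  proof (rule nn_integral_mono)
    fix y
    have "ennreal (cmod (g y * (\<integral>z. cnj (g z) * cx (2 * pi * (?k z y))))) =
        ennreal (cmod (\<integral>z. g y * (cnj (g z) * cx (2 * pi * (?k z y)))))"
      by (simp only: integral_mult_right_zero)
    also have "\<dots> \<le> (\<integral>\<^sup>+z. ennreal (cmod (g y * (cnj (g z) * cx (2 * pi * (?k z y))))))"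
      by (rule norm_integral_le_nn_integral)
    also have "\<dots> \<le> (\<integral>\<^sup>+z. ennreal pi * (ennreal ((cmod (g y))\<^sup>2) * ennreal (?k z y)
       + ennreal ((cmod (g z))\<^sup>2) * ennreal (?k z y)))"
    proof (rule nn_integral_mono)
      fix z
      define K where "K = ?k z y"
      have K: "0 \<le> K" using n by (simp add: K_def)
      have "cmod (g y * (cnj (g z) * cx (2 * pi * K))) = pi * K * (2 * cmod (g y) * cmod (g z))"
        using K by (simp add: norm_mult abs_mult)
      also have "\<dots> \<le> pi * K * ((cmod (g y))\<^sup>2 + (cmod (g z))\<^sup>2)"
        using K sum_squares_bound by (intro mult_left_mono) auto
      finally have "ennreal (cmod (g y * (cnj (g z) * cx (2 * pi * K)))) \<le> ennreal (pi * K * ((cmod (g y))\<^sup>2 + (cmod (g z))\<^sup>2))"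
        by (rule ennreal_leI)
      also have "\<dots> = ennreal pi * (ennreal ((cmod (g y))\<^sup>2) * ennreal K + ennreal ((cmod (g z))\<^sup>2) * ennreal K)"
        using K by (simp add: ennreal_mult [symmetric] ennreal_plus [symmetric] algebra_simps del: ennreal_plus)
      finally show "ennreal (cmod (g y * (cnj (g z) * cx (2 * pi * (?k z y)))))
         \<le> ennreal pi * (ennreal ((cmod (g y))\<^sup>2) * ennreal (?k z y)
       + ennreal ((cmod (g z))\<^sup>2) * ennreal (?k z y))" by (simp add: K_def)
    qed
    finally show "ennreal (cmod (g y * (\<integral>z. cnj (g z) * cx (2 * pi * (?k z y))))) \<le>
        (\<integral>\<^sup>+z. ennreal pi * (ennreal ((cmod (g y))\<^sup>2) * ennreal (?k z y)
       + ennreal ((cmod (g z))\<^sup>2) * ennreal (?k z y)))" .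
  qed
  also have "\<dots> = ennreal pi * ((\<integral>\<^sup>+y. \<integral>\<^sup>+z. ennreal ((cmod (g y))\<^sup>2) * ennreal (?k z y) \<partial>lborel \<partial>lborel)
     + (\<integral>\<^sup>+y. \<integral>\<^sup>+z. ennreal ((cmod (g z))\<^sup>2) * ennreal (?k z y) \<partial>lborel \<partial>lborel))"
    by (simp add: nn_integral_cmult nn_integral_add)
  also have "(\<integral>\<^sup>+y. \<integral>\<^sup>+z. ennreal ((cmod (g y))\<^sup>2) * ennreal (?k z y) \<partial>lborel \<partial>lborel) = l2 g"
    by (simp add: nn_integral_cmult std_normal_conv_mass [OF n] l2_def)
  also have "(\<integral>\<^sup>+y. \<integral>\<^sup>+z. ennreal ((cmod (g z))\<^sup>2) * ennreal (?k z y) \<partial>lborel \<partial>lborel) =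
     (\<integral>\<^sup>+z. \<integral>\<^sup>+y. ennreal ((cmod (g z))\<^sup>2) * ennreal (?k z y) \<partial>lborel \<partial>lborel)"
    by (rule lborel_pair.Fubini') measurable
  also have "\<dots> = l2 g"
    by (simp add: nn_integral_cmult std_normal_conv_mass [OF n] l2_def)
  also have "ennreal pi * (l2 g + l2 g) = ennreal (2 * pi) * l2 g"
  proof -
    have "ennreal (2 * pi) = ennreal pi + ennreal pi" by (simp add: ennreal_plus [symmetric] del: ennreal_plus)
    then show ?thesis by (simp only: distrib_left distrib_right)
  qed
  finally show ?thesis .
qed

lemma fourier_l2:
  assumes g: "integrable lborel g" shows "l2 (fourier g) \<le> ennreal (2 * pi) * l2 g"
  unfolding l2_def [of "fourier g"]
proof (rule fatou_bound [where f = "\<lambda>n x. ennreal ((cmod (fourier g x))\<^sup>2 * exp (- (x / real (Suc n))\<^sup>2 / 2))"])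
  have [measurable]: "fourier g \<in> borel_measurable borel"
    using borel_measurable_integrable [OF g] by (intro fourier_measurable) simp
  show "(\<lambda>x. ennreal ((cmod (fourier g x))\<^sup>2 * exp (- (x / real (Suc n))\<^sup>2 / 2))) \<in> borel_measurable lborel" for n
    by measurable
  show "(\<integral>\<^sup>+x. ennreal ((cmod (fourier g x))\<^sup>2 * exp (- (x / real (Suc n))\<^sup>2 / 2))) \<le> ennreal (2 * pi) * l2 g" for n
    by (rule fourier_l2_gauss [OF g]) simp
  have conv: "(\<lambda>n. \<xi> / real (Suc n)) \<longlonglongrightarrow> 0" for \<xi>
    using tendsto_mult [OF tendsto_const LIMSEQ_inverse_real_of_nat, of \<xi>] by (simp add: divide_inverse)
  have "(\<lambda>n. ennreal ((cmod (fourier g x))\<^sup>2 * exp (- (x / real (Suc n))\<^sup>2 / 2))) \<longlonglongrightarrow> ennreal ((cmod (fourier g x))\<^sup>2 * exp (- 0\<^sup>2 / 2))" for x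
    by (intro tendsto_intros conv) simp
  then show "AE x in lborel. (\<lambda>n. ennreal ((cmod (fourier g x))\<^sup>2 * exp (- (x / real (Suc n))\<^sup>2 / 2))) \<longlonglongrightarrow> ennreal ((cmod (fourier g x))\<^sup>2)"
    by simp
qed

text \<open>The truncations of an \<open>L\<^sup>2\<close> function are integrable, so that the integral defining the transform
  makes sense for them.\<close>

definition trunc :: "nat \<Rightarrow> (real \<Rightarrow> complex) \<Rightarrow> real \<Rightarrow> complex" where
  "trunc n g = (\<lambda>x. if \<bar>x\<bar> \<le> real n then g x else 0)"

lemma trunc_measurable [measurable (raw)]:
  assumes [measurable]: "g \<in> borel_measurable borel"
  shows "trunc n g \<in> borel_measurable borel"
  unfolding trunc_def by measurable

lemma l2_le_trunc: "l2_le g A \<Longrightarrow> l2_le (trunc n g) A"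
  using l2_le_bound [of g A "trunc n g" 1] l2_leD(1) [of g A] trunc_measurable [of g n]
  by (auto simp: trunc_def)

lemma trunc_integrable:
  assumes "l2_le g A" shows "integrable lborel (trunc n g)"
proof -
  have m: "(\<lambda>x. indicator {- real n..real n} x :: complex) \<in> borel_measurable borel" by measurable
  have "l2 (\<lambda>x. indicator {- real n..real n} x) = (\<integral>\<^sup>+x. indicator {- real n..real n} x)"
    unfolding l2_def by (rule nn_integral_cong) (auto simp: indicator_def)
  also have "\<dots> < \<infinity>" by simp
  finally have "l2 (\<lambda>x. indicator {- real n..real n} x) < \<infinity>" .
  from l2_pairing(1) [OF assms l2_finite_le [OF m this]]
  show ?thesis
    by (rule back_subst [of "integrable lborel"]) (auto simp: trunc_def indicator_def fun_eq_iff)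
qed

lemma trunc_tail:
  assumes "l2_le g A"
  shows "\<exists>a. a \<longlonglongrightarrow> 0 \<and> (\<forall>n k. n \<le> k \<longrightarrow> l2_le (\<lambda>x. trunc k g x - trunc n g x) (a n)) \<and>
     (\<forall>n. l2_le (\<lambda>x. g x - trunc n g x) (a n))"
proof -
  note [measurable] = l2_leD(1) [OF assms]
  have i: "integrable lborel (\<lambda>x. (cmod (g x))\<^sup>2)"
    using l2_leD(4) [OF assms] by (intro integrableI_bounded) (auto simp: l2_def)
  define e where "e n = (\<integral>x. (cmod (g x - trunc n g x))\<^sup>2)" for n
  have i': "integrable lborel (\<lambda>x. (cmod (g x - trunc n g x))\<^sup>2)" for n
    by (rule Bochner_Integration.integrable_bound [OF i]) (measurable, auto simp: trunc_def)
  have "e \<longlonglongrightarrow> (\<integral>x. 0 \<partial>(lborel :: real measure))"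
    unfolding e_def
  proof (rule integral_dominated_convergence [OF _ _ i])
    show "AE x in lborel. (\<lambda>n. (cmod (g x - trunc n g x))\<^sup>2) \<longlonglongrightarrow> 0"
    proof (intro AE_I2 tendsto_eventually)
      fix x :: real
      obtain N :: nat where "\<bar>x\<bar> \<le> real N" using real_arch_simple by blast
      then show "\<forall>\<^sub>F n in sequentially. (cmod (g x - trunc n g x))\<^sup>2 = 0"
        unfolding eventually_sequentially by (intro exI [of _ N]) (auto simp: trunc_def)
    qed
    show "AE x in lborel. norm ((cmod (g x - trunc n g x))\<^sup>2) \<le> (cmod (g x))\<^sup>2" for n
      by (auto simp: trunc_def)
  qed measurable
  then have e: "e \<longlonglongrightarrow> 0" by simp
  have enn: "0 \<le> e n" for n by (simp add: e_def integral_nonneg_AE)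
  have l2e: "l2 (\<lambda>x. g x - trunc n g x) = ennreal (e n)" for n
    unfolding l2_def e_def by (rule nn_integral_eq_integral [OF i']) simp
  have le: "l2_le (\<lambda>x. g x - trunc n g x) (sqrt (e n))" for n
    using enn by (simp add: l2_le_def l2e)
  moreover have "l2_le (\<lambda>x. trunc k g x - trunc n g x) (sqrt (e n))" if "n \<le> k" for n k
  proof -
    have "l2_le (\<lambda>x. trunc k g x - trunc n g x) (1 * sqrt (e n))"
      using that by (intro l2_le_bound [OF le]) (auto simp: trunc_def)
    then show ?thesis by simp
  qed
  moreover have "(\<lambda>n. sqrt (e n)) \<longlonglongrightarrow> 0"
    using tendsto_real_sqrt [OF e] by simp
  ultimately show ?thesis by blast
qed

lemma fourier_diff:
  assumes "integrable lborel f" "integrable lborel g"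
  shows "fourier (\<lambda>x. f x - g x) \<xi> = fourier f \<xi> - fourier g \<xi>"
  unfolding fourier_def right_diff_distrib
  by (intro Bochner_Integration.integral_diff fourier_integrable assms)

lemma l2_le_fourier:
  assumes "integrable lborel g" "l2_le g A" shows "l2_le (fourier g) (sqrt (2 * pi) * A)"
proof -
  have "l2 (fourier g) \<le> ennreal (2 * pi) * ennreal (A\<^sup>2)"
    using order_trans [OF fourier_l2 [OF assms(1)] mult_left_mono [OF l2_leD(3) [OF assms(2)]]] by simp
  then show ?thesis
    using l2_leD(1,2) [OF assms(2)] by (simp add: l2_le_def fourier_measurable ennreal_mult [symmetric] power_mult_distrib)
qed

text \<open>The transform extends to \<open>L\<^sup>2\<close>: the transforms of the truncations form a Cauchy sequence by
  Plancherel's inequality. The limit is given together with the rate at which it is approached.\<close>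

lemma fourier_l2_extension:
  assumes "l2_le g A"
  shows "\<exists>F a. l2_le F (sqrt (2 * pi) * A) \<and> a \<longlonglongrightarrow> 0 \<and> (\<forall>n. l2_le (\<lambda>x. F x - fourier (trunc n g) x) (a n))"
proof -
  note [measurable] = l2_leD(1) [OF assms]
  obtain a where a: "a \<longlonglongrightarrow> 0" "\<And>n k. n \<le> k \<Longrightarrow> l2_le (\<lambda>x. trunc k g x - trunc n g x) (a n)"
    using trunc_tail [OF assms] by blast
  note i = trunc_integrable [OF assms]
  have m: "fourier (trunc n g) \<in> borel_measurable borel" for n
    by (intro fourier_measurable) measurable
  have c: "l2_le (\<lambda>x. fourier (trunc k g) x - fourier (trunc n g) x) (sqrt (2 * pi) * a n)" if "n \<le> k" for n k
    using l2_le_fourier [OF Bochner_Integration.integrable_diff [OF i i] a(2) [OF that]]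
    unfolding fourier_diff [OF i i] .
  have "(\<lambda>n. sqrt (2 * pi) * a n) \<longlonglongrightarrow> 0"
    using tendsto_mult [OF tendsto_const a(1), of "sqrt (2 * pi)"] by simp
  from l2_complete [OF m c this] this
  obtain F r where F: "F \<in> borel_measurable borel" "AE x in lborel. (\<lambda>k. fourier (trunc (r k) g) x) \<longlonglongrightarrow> F x"
    "\<forall>n. l2_le (\<lambda>x. F x - fourier (trunc n g) x) (sqrt (2 * pi) * a n)" "(\<lambda>n. sqrt (2 * pi) * a n) \<longlonglongrightarrow> 0"
    by blast
  have "l2 F \<le> ennreal ((sqrt (2 * pi) * A)\<^sup>2)"
    by (rule l2_fatou [OF m F(2)]) (rule l2_leD(3) [OF l2_le_fourier [OF i l2_le_trunc [OF assms]]])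
  then have "l2_le F (sqrt (2 * pi) * A)"
    using F(1) l2_leD(2) [OF assms] by (simp add: l2_le_def)
  then show ?thesis using F(3,4) by blast
qed

lemma pairing_limit:
  assumes "\<And>n. l2_le (\<lambda>x. F x - f n x) (a n)" "a \<longlonglongrightarrow> 0" "l2_le k B" "l2_le F A"
    "\<And>n. f n \<in> borel_measurable borel"
  shows "(\<lambda>n. \<integral>x. f n x * k x \<partial>lborel) \<longlonglongrightarrow> (\<integral>x. F x * k x)"
proof (rule LIM_zero_cancel, rule Lim_null_comparison [OF always_eventually], rule allI)
  fix n
  have i: "integrable lborel (\<lambda>x. F x * k x)" by (rule l2_pairing [OF assms(4,3)])
  have d: "integrable lborel (\<lambda>x. (F x - f n x) * k x)" by (rule l2_pairing [OF assms(1,3)])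
  have "integrable lborel (\<lambda>x. F x * k x - (F x - f n x) * k x)"
    by (rule Bochner_Integration.integrable_diff [OF i d])
  moreover have "F x * k x - (F x - f n x) * k x = f n x * k x" for x by (simp add: algebra_simps)
  ultimately have fi: "integrable lborel (\<lambda>x. f n x * k x)" by simp
  have "(\<integral>x. F x * k x) - (\<integral>x. f n x * k x) = (\<integral>x. (F x - f n x) * k x)"
    using Bochner_Integration.integral_diff [OF i fi] by (simp add: left_diff_distrib)
  then have "norm ((\<integral>x. F x * k x) - (\<integral>x. f n x * k x)) \<le> a n * B"
    using l2_pairing(2) [OF assms(1) [of n] assms(3)] by simp
  then show "norm ((\<integral>x. f n x * k x) - (\<integral>x. F x * k x)) \<le> a n * B"
    by (simp only: norm_minus_commute)
next
  show "(\<lambda>n. a n * B) \<longlonglongrightarrow> 0" using tendsto_mult_left_zero [OF assms(2)] .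
qed

text \<open>The extension agrees with the transform by duality, since both sides of Parseval's formula pass
  to the limit along the truncations.\<close>

lemma fourier_l2_duality:
  assumes g: "l2_le g A" and F: "l2_le F B" and a: "a \<longlonglongrightarrow> 0" "\<And>n. l2_le (\<lambda>x. F x - fourier (trunc n g) x) (a n)"
    and \<phi>: "\<phi> \<in> schwartz"
  shows "(\<integral>x. F x * \<phi> x) = (\<integral>x. g x * fourier \<phi> x)"
proof (rule LIMSEQ_unique)
  note [measurable] = l2_leD(1) [OF g]
  obtain D where D: "l2_le \<phi> D" using schwartz_l2 [OF \<phi>] by blast
  obtain E where E: "l2_le (fourier \<phi>) E" using schwartz_l2 [OF fourier_schwartz [OF \<phi>]] by blast
  show "(\<lambda>n. \<integral>x. fourier (trunc n g) x * \<phi> x \<partial>lborel) \<longlonglongrightarrow> (\<integral>x. F x * \<phi> x)"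
    by (rule pairing_limit [OF a(2,1) D F]) (intro fourier_measurable, measurable)
  obtain b where b: "b \<longlonglongrightarrow> 0" "\<And>n. l2_le (\<lambda>x. g x - trunc n g x) (b n)"
    using trunc_tail [OF g] by blast
  have "(\<lambda>n. \<integral>x. trunc n g x * fourier \<phi> x \<partial>lborel) \<longlonglongrightarrow> (\<integral>x. g x * fourier \<phi> x)"
    by (rule pairing_limit [OF b(2,1) E g]) measurable
  then show "(\<lambda>n. \<integral>x. fourier (trunc n g) x * \<phi> x \<partial>lborel) \<longlonglongrightarrow> (\<integral>x. g x * fourier \<phi> x)"
    by (simp only: fourier_parseval [OF trunc_integrable [OF g] schwartz_integrable_abs(1) [OF \<phi>]])
qed

section \<open>Convolution\<close>

definition conv :: "(real \<Rightarrow> complex) \<Rightarrow> (real \<Rightarrow> complex) \<Rightarrow> real \<Rightarrow> complex" where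
  "conv g h \<xi> = (\<integral>\<zeta>. g (\<xi> - \<zeta>) * h \<zeta>)"

lemma conv_bound:
  assumes "l2_le g A" "l2_le h B"
  shows "integrable lborel (\<lambda>\<zeta>. g (\<xi> - \<zeta>) * h \<zeta>)" "cmod (conv g h \<xi>) \<le> A * B"
  unfolding conv_def by (rule l2_pairing [OF l2_le_reflect [OF assms(1)] assms(2)])+

text \<open>Cauchy-Schwarz after distributing the weight with Peetre's inequality.\<close>

lemma conv_weighted_bound:
  assumes \<sigma>: "0 \<le> \<sigma>" and m: "g \<in> borel_measurable borel" "h \<in> borel_measurable borel"
    and g: "l2_le (\<lambda>\<xi>. cx (jap \<xi> powr \<sigma>) * g \<xi>) A"
    and h: "l2_le (\<lambda>\<xi>. cx (jap \<xi> powr \<sigma>) * h \<xi>) B"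
  shows "jap \<xi> powr \<sigma> * cmod (conv g h \<xi>) \<le> 2 powr \<sigma> * (A * B)"
proof -
  note [measurable] = m
  have "ennreal (jap \<xi> powr \<sigma> * cmod (conv g h \<xi>)) = ennreal (cmod (\<integral>\<zeta>. cx (jap \<xi> powr \<sigma>) * (g (\<xi> - \<zeta>) * h \<zeta>)))"
    by (simp only: conv_def integral_mult_right_zero norm_mult norm_of_real abs_of_nonneg powr_ge_zero)
  also have "\<dots> \<le> (\<integral>\<^sup>+\<zeta>. ennreal (cmod (cx (jap \<xi> powr \<sigma>) * (g (\<xi> - \<zeta>) * h \<zeta>))))"
    by (rule norm_integral_le_nn_integral)
  also have "\<dots> \<le> (\<integral>\<^sup>+\<zeta>. ennreal (2 powr \<sigma>) * ennreal (cmod ((cx (jap (\<xi> - \<zeta>) powr \<sigma>) * g (\<xi> - \<zeta>)) * (cx (jap \<zeta> powr \<sigma>) * h \<zeta>))))"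
  proof (rule nn_integral_mono)
    fix \<zeta>
    have "jap \<xi> powr \<sigma> \<le> (2 * jap (\<xi> - \<zeta>) * jap \<zeta>) powr \<sigma>"
      using \<sigma> by (intro powr_mono2 jap_submult) auto
    also have "\<dots> = 2 powr \<sigma> * (jap (\<xi> - \<zeta>) powr \<sigma> * jap \<zeta> powr \<sigma>)"
      by (simp add: powr_mult)
    finally have "jap \<xi> powr \<sigma> * (cmod (g (\<xi> - \<zeta>)) * cmod (h \<zeta>)) \<le> 2 powr \<sigma> * (jap (\<xi> - \<zeta>) powr \<sigma> * jap \<zeta> powr \<sigma>) * (cmod (g (\<xi> - \<zeta>)) * cmod (h \<zeta>))"
      by (rule mult_right_mono) simp
    then show "ennreal (cmod (cx (jap \<xi> powr \<sigma>) * (g (\<xi> - \<zeta>) * h \<zeta>))) \<le>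
       ennreal (2 powr \<sigma>) * ennreal (cmod ((cx (jap (\<xi> - \<zeta>) powr \<sigma>) * g (\<xi> - \<zeta>)) * (cx (jap \<zeta> powr \<sigma>) * h \<zeta>)))"
      by (simp add: norm_mult ennreal_mult [symmetric] ennreal_leI mult_ac)
  qed
  also have "\<dots> = ennreal (2 powr \<sigma>) * (\<integral>\<^sup>+\<zeta>. ennreal (cmod ((cx (jap (\<xi> - \<zeta>) powr \<sigma>) * g (\<xi> - \<zeta>)) * (cx (jap \<zeta> powr \<sigma>) * h \<zeta>))))"
    by (rule nn_integral_cmult) measurable
  also have "\<dots> \<le> ennreal (2 powr \<sigma>) * ennreal (A * B)"
    by (intro mult_left_mono nn_integral_mult_le_l2 [OF l2_le_reflect [OF g] h]) simp
  finally show ?thesis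
    using l2_leD(2) [OF g] l2_leD(2) [OF h] by (simp add: ennreal_mult [symmetric])
qed

lemma conv_measurable2:
  assumes [measurable]: "jmeas G" "jmeas H"
  shows "jmeas (\<lambda>t \<xi>. conv (G t) (H t) \<xi>)"
  unfolding conv_def by measurable

lemma conv_measurable [measurable (raw)]:
  assumes [measurable]: "g \<in> borel_measurable borel" "h \<in> borel_measurable borel"
  shows "conv g h \<in> borel_measurable borel"
  unfolding conv_def by measurable

lemma AE_reflect:
  assumes "AE x in lborel. P (x::real)" shows "AE x in lborel. P (a - x)"
proof -
  obtain N where N: "N \<in> null_sets lborel" "{x \<in> space lborel. \<not> P x} \<subseteq> N"
    using assms unfolding eventually_ae_filter by blast
  have "AE x in lborel. x \<notin> N" by (rule AE_not_in [OF N(1)])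
  moreover have [measurable]: "N \<in> sets borel" using N(1) by (auto simp: null_sets_def)
  ultimately have "AE x in lborel. a + (-1) * x \<notin> N"
    by (intro AE_borel_affine) auto
  then show ?thesis using N(2) by (auto elim!: eventually_mono)
qed

lemma conv_cong_AE:
  assumes [measurable]: "g \<in> borel_measurable borel" "h \<in> borel_measurable borel" "g' \<in> borel_measurable borel" "h' \<in> borel_measurable borel"
    and "AE x in lborel. g x = g' x" "AE x in lborel. h x = h' x"
  shows "conv g h \<xi> = conv g' h' \<xi>"
  unfolding conv_def
proof (rule integral_cong_AE)
  show "AE \<zeta> in lborel. g (\<xi> - \<zeta>) * h \<zeta> = g' (\<xi> - \<zeta>) * h' \<zeta>"
    using AE_reflect [OF assms(5), of \<xi>] assms(6) by eventually_elim simp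
qed measurable

text \<open>The polarisation \<open>g * g - h * h = (g - h) * g + h * (g - h)\<close>, for the difference of two
  solutions.\<close>

lemma conv_diff_squares:
  assumes "l2_le g A" "l2_le h B"
  shows "conv g g \<xi> - conv h h \<xi> = conv (\<lambda>x. g x - h x) g \<xi> + conv h (\<lambda>x. g x - h x) \<xi>"
proof -
  note d = l2_le_diff [OF assms]
  note i = conv_bound(1) [OF assms(1) assms(1), of \<xi>] conv_bound(1) [OF assms(2) assms(2), of \<xi>]
    conv_bound(1) [OF d assms(1), of \<xi>] conv_bound(1) [OF assms(2) d, of \<xi>]
  show ?thesis
    unfolding conv_def
    by (subst Bochner_Integration.integral_diff [symmetric, OF i(1,2)], subst Bochner_Integration.integral_add [symmetric, OF i(3,4)])
      (rule Bochner_Integration.integral_cong [OF refl], simp add: algebra_simps)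
qed

lemma integrable_conv_pair:
  fixes g h :: "real \<Rightarrow> complex"
  assumes "integrable lborel g" "integrable lborel h"
  shows "integrable (lborel \<Otimes>\<^sub>M lborel) (\<lambda>(\<zeta>, \<xi>). g (\<xi> - \<zeta>) * h \<zeta>)"
proof (rule lborel_pair.Fubini_integrable)
  note [measurable] = borel_measurable_integrable [OF assms(1)] borel_measurable_integrable [OF assms(2)]
  have gi: "integrable lborel (\<lambda>\<xi>. g (\<xi> - \<zeta>))" for \<zeta>
    using lborel_integrable_real_affine [OF assms(1), of 1 "- \<zeta>"] by simp
  have gn: "(\<integral>\<xi>. cmod (g (\<xi> - \<zeta>))) = (\<integral>\<xi>. cmod (g \<xi>))" for \<zeta>
    using lborel_integral_real_affine [of 1 "\<lambda>\<xi>. cmod (g \<xi>)" "- \<zeta>"] by simp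
  show "(\<lambda>(\<zeta>, \<xi>). g (\<xi> - \<zeta>) * h \<zeta>) \<in> borel_measurable (lborel \<Otimes>\<^sub>M lborel)" by measurable
  show "integrable lborel (\<lambda>\<zeta>. \<integral>\<xi>. norm (case (\<zeta>, \<xi>) of (\<zeta>, \<xi>) \<Rightarrow> g (\<xi> - \<zeta>) * h \<zeta>) \<partial>lborel)"
    using assms(2) by (simp add: norm_mult gn)
  show "AE \<zeta> in lborel. integrable lborel (\<lambda>\<xi>. case (\<zeta>, \<xi>) of (\<zeta>, \<xi>) \<Rightarrow> g (\<xi> - \<zeta>) * h \<zeta>)"
    using gi by simp
qed

lemma conv_integrable:
  assumes "integrable lborel g" "integrable lborel h" shows "integrable lborel (conv g h)"
  using lborel_pair.integrable_snd [OF integrable_conv_pair [OF assms]] by (simp add: conv_def [abs_def])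

lemma fourier_conv:
  assumes g: "integrable lborel g" and h: "integrable lborel h"
  shows "fourier (conv g h) y = fourier g y * fourier h y"
proof -
  note [measurable] = borel_measurable_integrable [OF g] borel_measurable_integrable [OF h]
  let ?e = "\<lambda>x. ek (x * y)"
  have i: "integrable (lborel \<Otimes>\<^sub>M lborel) (\<lambda>(\<zeta>, \<xi>). ?e \<xi> * (g (\<xi> - \<zeta>) * h \<zeta>))"
    using integrable_conv_pair [OF g h]
    by (rule Bochner_Integration.integrable_bound) (measurable, intro AE_I2, simp add: norm_mult split: prod.split del: of_real_mult)
  have shift: "(\<integral>\<xi>. ?e \<xi> * g (\<xi> - \<zeta>)) = ?e \<zeta> * fourier g y" for \<zeta>
  proof -
    have "(\<integral>\<xi>. ?e \<xi> * g (\<xi> - \<zeta>)) = (\<integral>\<xi>. ?e (\<zeta> + \<xi>) * g \<xi>)"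
      using lborel_integral_real_affine [of 1 "\<lambda>\<xi>. ?e \<xi> * g (\<xi> - \<zeta>)" \<zeta>] by simp
    also have "(\<lambda>\<xi>. ?e (\<zeta> + \<xi>) * g \<xi>) = (\<lambda>\<xi>. ?e \<zeta> * (?e \<xi> * g \<xi>))"
    proof
      fix \<xi>
      have "?e (\<zeta> + \<xi>) = ?e \<zeta> * ?e \<xi>" by (simp add: exp_add [symmetric] algebra_simps)
      then show "?e (\<zeta> + \<xi>) * g \<xi> = ?e \<zeta> * (?e \<xi> * g \<xi>)" by (simp only: mult.assoc)
    qed
    finally show ?thesis by (simp only: integral_mult_right_zero fourier_def)
  qed
  have "fourier (conv g h) y = (\<integral>\<xi>. (\<integral>\<zeta>. ?e \<xi> * (g (\<xi> - \<zeta>) * h \<zeta>)))"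
    by (simp only: fourier_def conv_def integral_mult_right_zero)
  also have "\<dots> = (\<integral>\<zeta>. (\<integral>\<xi>. ?e \<xi> * (g (\<xi> - \<zeta>) * h \<zeta>)))"
    by (rule lborel_pair.Fubini_integral [OF i])
  also have "\<dots> = (\<integral>\<zeta>. (\<integral>\<xi>. (?e \<xi> * g (\<xi> - \<zeta>)) * h \<zeta>))"
    by (simp only: mult.assoc)
  also have "\<dots> = (\<integral>\<zeta>. fourier g y * (?e \<zeta> * h \<zeta>))"
    unfolding integral_mult_left_zero shift by (simp only: mult_ac)
  also have "\<dots> = fourier g y * fourier h y"
    by (simp only: integral_mult_right_zero fourier_def)
  finally show ?thesis .
qed

text \<open>For integrable functions the transform of a convolution is the product of the transforms; both
  sides are continuous in \<open>L\<^sup>2\<close>, so truncations give the identity for square integrable \<open>g\<close>.\<close>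

lemma fourier_l2_square:
  assumes g: "l2_le g A" and F: "l2_le F B" and a: "a \<longlonglongrightarrow> 0" "\<And>n. l2_le (\<lambda>x. F x - fourier (trunc n g) x) (a n)"
    and \<psi>: "\<psi> \<in> schwartz"
  shows "integrable lborel (\<lambda>x. (F x)\<^sup>2 * \<psi> x)"
    and "(\<integral>x. (F x)\<^sup>2 * \<psi> x) = (\<integral>\<xi>. conv g g \<xi> * fourier \<psi> \<xi>)"
proof -
  note [measurable] = l2_leD(1) [OF g] l2_leD(1) [OF F] schwartz_measurable [OF \<psi>] schwartz_measurable [OF fourier_schwartz [OF \<psi>]]
  define f where "f n = fourier (trunc n g)" for n
  have fm [measurable]: "f n \<in> borel_measurable borel" for n
    unfolding f_def by (intro fourier_measurable) measurable
  note ti = trunc_integrable [OF g]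
  note tl = l2_le_trunc [OF g]
  define S where "S = schwartz_norm 0 \<psi>"
  have S: "0 \<le> S" "\<And>x. cmod (\<psi> x) \<le> S"
    using schwartz_norm_nonneg [OF \<psi>] schwartz_bounded [OF \<psi>] by (auto simp: S_def)
  have mul: "l2_le (\<lambda>x. k x * \<psi> x) (S * K)" if "l2_le k K" for k K
  proof (rule l2_le_bound [OF that _ S(1)])
    note [measurable] = l2_leD(1) [OF that]
    show "(\<lambda>x. k x * \<psi> x) \<in> borel_measurable borel" by measurable
    show "AE x in lborel. cmod (k x * \<psi> x) \<le> S * cmod (k x)"
      by (intro AE_I2) (simp add: norm_mult mult.commute mult_right_mono S(2))
  qed
  have fl: "l2_le (f n) (sqrt (2 * pi) * A)" for n
    unfolding f_def by (rule l2_le_fourier [OF ti tl])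
  have sq: "integrable lborel (\<lambda>x. (k x)\<^sup>2 * \<psi> x)" if "l2_le k K" for k K
    using l2_pairing(1) [OF that mul [OF that]] by (simp add: power2_eq_square mult.assoc)
  show iF: "integrable lborel (\<lambda>x. (F x)\<^sup>2 * \<psi> x)" by (rule sq [OF F])
  show "(\<integral>x. (F x)\<^sup>2 * \<psi> x) = (\<integral>\<xi>. conv g g \<xi> * fourier \<psi> \<xi>)"
  proof (rule LIMSEQ_unique)
    show "(\<lambda>n. \<integral>x. (f n x)\<^sup>2 * \<psi> x \<partial>lborel) \<longlonglongrightarrow> (\<integral>x. (F x)\<^sup>2 * \<psi> x)"
    proof (rule LIM_zero_cancel, rule Lim_null_comparison [OF always_eventually], rule allI)
      fix n
      have "(\<integral>x. (f n x)\<^sup>2 * \<psi> x) - (\<integral>x. (F x)\<^sup>2 * \<psi> x) = (\<integral>x. (f n x)\<^sup>2 * \<psi> x - (F x)\<^sup>2 * \<psi> x)"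
        by (rule Bochner_Integration.integral_diff [symmetric, OF sq [OF fl] iF])
      also have "(\<lambda>x. (f n x)\<^sup>2 * \<psi> x - (F x)\<^sup>2 * \<psi> x) = (\<lambda>x. (F x - f n x) * - ((F x + f n x) * \<psi> x))"
        by (simp add: fun_eq_iff power2_eq_square algebra_simps)
      also have "cmod (\<integral>x. (F x - f n x) * - ((F x + f n x) * \<psi> x)) \<le> a n * (S * (2 * (B + sqrt (2 * pi) * A)))"
        using a(2) [of n] unfolding f_def [symmetric]
        by (intro l2_pairing(2) l2_le_uminus mul l2_le_add F fl)
      finally show "norm ((\<integral>x. (f n x)\<^sup>2 * \<psi> x) - (\<integral>x. (F x)\<^sup>2 * \<psi> x)) \<le> a n * (S * (2 * (B + sqrt (2 * pi) * A)))" .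
    next
      show "(\<lambda>n. a n * (S * (2 * (B + sqrt (2 * pi) * A)))) \<longlonglongrightarrow> 0" using tendsto_mult_left_zero [OF a(1)] .
    qed
    obtain b where b: "b \<longlonglongrightarrow> 0" "\<And>n. l2_le (\<lambda>x. g x - trunc n g x) (b n)"
      using trunc_tail [OF g] by blast
    have eq: "(\<integral>x. (f n x)\<^sup>2 * \<psi> x) = (\<integral>\<xi>. conv (trunc n g) (trunc n g) \<xi> * fourier \<psi> \<xi>)" for n
      unfolding fourier_parseval [OF conv_integrable [OF ti ti] schwartz_integrable_abs(1) [OF \<psi>]] fourier_conv [OF ti ti]
      by (simp only: f_def power2_eq_square)
    have C: "integrable lborel (fourier \<psi>)" by (rule schwartz_integrable_abs(1) [OF fourier_schwartz [OF \<psi>]])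
    have ci: "integrable lborel (\<lambda>\<xi>. conv k k \<xi> * fourier \<psi> \<xi>)" if "l2_le k K" for k K
    proof (rule Bochner_Integration.integrable_bound)
      note [measurable] = l2_leD(1) [OF that]
      show "integrable lborel (\<lambda>\<xi>. (K * K) *\<^sub>R fourier \<psi> \<xi>)" using C by simp
      show "(\<lambda>\<xi>. conv k k \<xi> * fourier \<psi> \<xi>) \<in> borel_measurable lborel" by measurable
      show "AE \<xi> in lborel. norm (conv k k \<xi> * fourier \<psi> \<xi>) \<le> norm ((K * K) *\<^sub>R fourier \<psi> \<xi>)"
        by (intro AE_I2) (simp add: norm_mult mult_right_mono conv_bound(2) [OF that that])
    qed
    show "(\<lambda>n. \<integral>x. (f n x)\<^sup>2 * \<psi> x \<partial>lborel) \<longlonglongrightarrow> (\<integral>\<xi>. conv g g \<xi> * fourier \<psi> \<xi>)"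
      unfolding eq
    proof (rule LIM_zero_cancel, rule Lim_null_comparison [OF always_eventually], rule allI)
      fix n
      let ?d = "\<lambda>x. g x - trunc n g x"
      have "(\<integral>\<xi>. conv g g \<xi> * fourier \<psi> \<xi>) - (\<integral>\<xi>. conv (trunc n g) (trunc n g) \<xi> * fourier \<psi> \<xi>)
         = (\<integral>\<xi>. conv g g \<xi> * fourier \<psi> \<xi> - conv (trunc n g) (trunc n g) \<xi> * fourier \<psi> \<xi>)"
        by (rule Bochner_Integration.integral_diff [symmetric, OF ci [OF g] ci [OF tl]])
      also have "(\<lambda>\<xi>. conv g g \<xi> * fourier \<psi> \<xi> - conv (trunc n g) (trunc n g) \<xi> * fourier \<psi> \<xi>) =
          (\<lambda>\<xi>. (conv ?d g \<xi> + conv (trunc n g) ?d \<xi>) * fourier \<psi> \<xi>)"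
        by (simp only: conv_diff_squares [OF g tl, symmetric] left_diff_distrib)
      also have "cmod (\<integral>\<xi>. (conv ?d g \<xi> + conv (trunc n g) ?d \<xi>) * fourier \<psi> \<xi>) \<le>
         (\<integral>\<xi>. cmod ((conv ?d g \<xi> + conv (trunc n g) ?d \<xi>) * fourier \<psi> \<xi>))"
        by (rule integral_norm_bound)
      also have "\<dots> \<le> (\<integral>\<xi>. (b n * A + A * b n) * cmod (fourier \<psi> \<xi>))"
      proof (rule integral_mono')
        show "integrable lborel (\<lambda>\<xi>. (b n * A + A * b n) * cmod (fourier \<psi> \<xi>))" using C by simp
        fix \<xi>
        show "cmod ((conv ?d g \<xi> + conv (trunc n g) ?d \<xi>) * fourier \<psi> \<xi>) \<le> (b n * A + A * b n) * cmod (fourier \<psi> \<xi>)"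
          unfolding norm_mult
          by (intro mult_right_mono norm_triangle_le add_mono conv_bound(2) g b tl) simp
        show "0 \<le> (b n * A + A * b n) * cmod (fourier \<psi> \<xi>)"
          by (intro mult_nonneg_nonneg add_nonneg_nonneg l2_leD(2) [OF g] l2_leD(2) [OF b(2)] norm_ge_zero)
      qed
      also have "\<dots> = b n * ((A + A) * (\<integral>\<xi>. cmod (fourier \<psi> \<xi>)))"
        by (simp only: integral_mult_right_zero) (simp add: algebra_simps)
      finally have "norm ((\<integral>\<xi>. conv g g \<xi> * fourier \<psi> \<xi>) - (\<integral>\<xi>. conv (trunc n g) (trunc n g) \<xi> * fourier \<psi> \<xi>))
        \<le> b n * ((A + A) * (\<integral>\<xi>. cmod (fourier \<psi> \<xi>)))" .
      then show "norm ((\<integral>\<xi>. conv (trunc n g) (trunc n g) \<xi> * fourier \<psi> \<xi>) - (\<integral>\<xi>. conv g g \<xi> * fourier \<psi> \<xi>))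
        \<le> b n * ((A + A) * (\<integral>\<xi>. cmod (fourier \<psi> \<xi>)))" by (simp only: norm_minus_commute)
    next
      show "(\<lambda>n. b n * ((A + A) * (\<integral>\<xi>. cmod (fourier \<psi> \<xi>)))) \<longlonglongrightarrow> 0" using tendsto_mult_left_zero [OF b(1)] .
    qed
  qed
qed

section \<open>Norms and operations on the Fourier side\<close>

lemma ennsqrt_le:
  assumes "0 \<le> A" "a \<le> ennreal (A\<^sup>2)" shows "ennsqrt a \<le> ennreal A"
proof -
  have "a \<noteq> \<infinity>" using assms(2) by (auto simp: top_unique)
  moreover have "sqrt (enn2real a) \<le> A"
    using enn2real_leI [OF _ assms(2)] assms(1) by (intro real_le_lsqrt) auto
  ultimately show ?thesis by (simp add: ennsqrt_def ennreal_leI)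
qed

lemma ennsqrt_finite: "ennsqrt a < \<infinity> \<longleftrightarrow> a < \<infinity>"
  by (auto simp: ennsqrt_def less_top)

lemma ennsqrt_sq: "(ennsqrt a)\<^sup>2 = a"
proof (cases "a = \<infinity>")
  case True then show ?thesis by (simp add: ennsqrt_def power2_eq_square)
next
  case False then show ?thesis by (cases a) (simp_all add: ennsqrt_def ennreal_power)
qed

text \<open>The infimum in the definition is attained, as the representing function is unique almost
  everywhere.\<close>

lemma weighted_L2_eq:
  assumes "given_by F g"
  shows "weighted_L2 w F = ennsqrt (\<integral>\<^sup>+x. ennreal (w x * (cmod (g x))\<^sup>2))"
proof -
  have eq: "ennsqrt (\<integral>\<^sup>+x. ennreal (w x * (cmod (g' x))\<^sup>2)) = ennsqrt (\<integral>\<^sup>+x. ennreal (w x * (cmod (g x))\<^sup>2))"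
    if "given_by F g'" for g'
    using given_by_unique [OF that assms]
    by (intro arg_cong [where f = ennsqrt] nn_integral_cong_AE) (auto elim!: eventually_mono)
  show ?thesis
    unfolding weighted_L2_def
  proof (rule INF_eq_const)
    show "{g. given_by F g} \<noteq> {}" using assms by blast
    fix g' assume "g' \<in> {g. given_by F g}"
    then show "ennsqrt (\<integral>\<^sup>+x. ennreal (w x * (cmod (g' x))\<^sup>2)) = ennsqrt (\<integral>\<^sup>+x. ennreal (w x * (cmod (g x))\<^sup>2))"
      using eq by simp
  qed
qed

text \<open>The Bessel potential of order \<open>s\<close> on the Fourier side.\<close>

definition wt :: "real \<Rightarrow> (real \<Rightarrow> complex) \<Rightarrow> real \<Rightarrow> complex" where
  "wt s g = (\<lambda>\<xi>. cx (jap \<xi> powr s) * g \<xi>)"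

lemma wt_measurable [measurable (raw)]:
  assumes [measurable]: "g \<in> borel_measurable borel" shows "wt s g \<in> borel_measurable borel"
  unfolding wt_def by measurable

lemma norm_wt: "cmod (wt s g \<xi>) = jap \<xi> powr s * cmod (g \<xi>)"
  by (simp add: wt_def norm_mult)

lemma wt_0 [simp]: "wt 0 g = g"
  by (simp add: wt_def fun_eq_iff)

lemma wt_add: "wt s (\<lambda>\<xi>. g \<xi> + h \<xi>) = (\<lambda>\<xi>. wt s g \<xi> + wt s h \<xi>)"
  and wt_diff: "wt s (\<lambda>\<xi>. g \<xi> - h \<xi>) = (\<lambda>\<xi>. wt s g \<xi> - wt s h \<xi>)"
  and wt_cmult: "wt s (\<lambda>\<xi>. c * g \<xi>) = (\<lambda>\<xi>. c * wt s g \<xi>)"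
  by (simp_all add: wt_def fun_eq_iff algebra_simps)

lemma Hs_norm_rep:
  assumes "rep u g" shows "Hs_norm s u = ennsqrt (l2 (wt s g))"
proof -
  have "Hs_norm s u = ennsqrt (\<integral>\<^sup>+x. ennreal ((1 + \<bar>x\<bar>\<^sup>2) powr s * (cmod (g x))\<^sup>2))"
    unfolding Hs_norm_def by (rule weighted_L2_eq) (use assms in \<open>simp add: rep_def\<close>)
  then show ?thesis
    by (simp only: l2_def norm_wt jap_powr_sq power_mult_distrib)
qed

lemma Hs_rep:
  assumes "u \<in> Hs s" shows "\<exists>g. rep u g"
proof (rule ccontr)
  assume "\<not> ?thesis"
  then have "{g. given_by (td_fourier u) g} = {}" by (auto simp: rep_def)
  then have "Hs_norm s u = \<infinity>" by (simp add: Hs_norm_def weighted_L2_def)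
  then show False using assms by (simp add: Hs_def)
qed

lemma Hs_nrm_rep:
  assumes "rep u g" "u \<in> Hs s" shows "l2_le (wt s g) (Hs_nrm s u)"
proof -
  have "Hs_norm s u \<noteq> \<infinity>" using assms(2) by (auto simp: Hs_def)
  then have "ennreal (enn2real (Hs_norm s u)) = Hs_norm s u" by (simp add: less_top)
  then have "ennreal ((Hs_nrm s u)\<^sup>2) = (Hs_norm s u)\<^sup>2"
    by (simp add: Hs_nrm_def ennreal_power [symmetric])
  also have "\<dots> = l2 (wt s g)" by (simp add: Hs_norm_rep [OF assms(1)] ennsqrt_sq)
  finally show ?thesis
    using wt_measurable [OF rep_measurable [OF assms(1)]] by (simp add: l2_le_def Hs_nrm_def)
qed

lemma Hs_norm_le:
  assumes "rep u g" "l2_le (wt s g) A" shows "Hs_norm s u \<le> ennreal A"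
  unfolding Hs_norm_rep [OF assms(1)] using l2_leD(2,3) [OF assms(2)] by (rule ennsqrt_le)

lemma HsI:
  assumes "rep u g" "l2_le (wt s g) A" shows "u \<in> Hs s" "Hs_nrm s u \<le> A"
proof -
  have le: "Hs_norm s u \<le> ennreal A" by (rule Hs_norm_le [OF assms])
  then show "u \<in> Hs s" by (auto simp: Hs_def intro: le_less_trans)
  show "Hs_nrm s u \<le> A" unfolding Hs_nrm_def by (rule enn2real_leI [OF l2_leD(2) [OF assms(2)] le])
qed

lemma Hs_nrm_nonneg [simp]: "0 \<le> Hs_nrm s u"
  by (simp add: Hs_nrm_def)

lemma rep_add:
  assumes "rep u g" "rep w h" shows "rep (u + w) (\<lambda>\<xi>. g \<xi> + h \<xi>)"
proof (rule repI)
  note [measurable] = rep_measurable [OF assms(1)] rep_measurable [OF assms(2)]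
  show "(\<lambda>\<xi>. g \<xi> + h \<xi>) \<in> borel_measurable borel" by measurable
  fix \<phi> assume \<phi>: "\<phi> \<in> schwartz"
  note i = rep_integrable [OF assms(1) \<phi>] rep_integrable [OF assms(2) \<phi>]
  show "integrable lborel (\<lambda>x. (g x + h x) * \<phi> x)" using i by (simp add: distrib_right)
  show "td_apply (u + w) (fourier \<phi>) = (\<integral>x. (g x + h x) * \<phi> x)"
    using i by (simp add: distrib_right plus_tempered.rep_eq rep_apply [OF assms(1) \<phi>] rep_apply [OF assms(2) \<phi>])
qed

lemma rep_scaleR:
  assumes "rep u g" shows "rep (c *\<^sub>R u) (\<lambda>\<xi>. cx c * g \<xi>)"
proof (rule repI)
  note [measurable] = rep_measurable [OF assms(1)]
  show "(\<lambda>\<xi>. cx c * g \<xi>) \<in> borel_measurable borel" by measurable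
  fix \<phi> assume \<phi>: "\<phi> \<in> schwartz"
  note i = rep_integrable [OF assms(1) \<phi>]
  show "integrable lborel (\<lambda>x. cx c * g x * \<phi> x)" using i by (simp add: mult.assoc)
  show "td_apply (c *\<^sub>R u) (fourier \<phi>) = (\<integral>x. cx c * g x * \<phi> x)"
    by (simp add: mult.assoc scaleR_tempered.rep_eq rep_apply [OF assms(1) \<phi>] scaleR_conv_of_real)
qed

lemma rep_diff:
  assumes "rep u g" "rep w h" shows "rep (u - w) (\<lambda>\<xi>. g \<xi> - h \<xi>)"
  using rep_add [OF assms(1) rep_scaleR [OF assms(2), of "-1"]] by simp

lemma rep_0: "rep 0 (\<lambda>_. 0)"
  by (rule repI) (simp_all add: zero_tempered.rep_eq)

lemma l2_le_0: "l2_le (\<lambda>_. 0) 0"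
  by (simp add: l2_le_def l2_def)

lemma Hs_0: "0 \<in> Hs s" "Hs_nrm s 0 = 0"
proof -
  have "l2_le (wt s (\<lambda>_. 0)) 0" using l2_le_0 by (simp add: wt_def)
  from HsI [OF rep_0 this] show "0 \<in> Hs s" "Hs_nrm s 0 = 0" using Hs_nrm_nonneg [of s 0] by auto
qed

lemma Hs_add: assumes "u \<in> Hs s" "w \<in> Hs s" shows "u + w \<in> Hs s"
proof -
  obtain g h where gh: "rep u g" "rep w h" using Hs_rep assms by blast
  have "l2_le (wt s (\<lambda>\<xi>. g \<xi> + h \<xi>)) (2 * (Hs_nrm s u + Hs_nrm s w))"
    unfolding wt_add by (intro l2_le_add Hs_nrm_rep gh assms)
  then show ?thesis by (rule HsI(1) [OF rep_add [OF gh]])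
qed

lemma Hs_scaleR: assumes "u \<in> Hs s" shows "c *\<^sub>R u \<in> Hs s"
proof -
  obtain g where g: "rep u g" using Hs_rep assms by blast
  have "l2_le (wt s (\<lambda>\<xi>. cx c * g \<xi>)) (\<bar>c\<bar> * Hs_nrm s u)"
    unfolding wt_cmult
    by (rule l2_le_bound [OF Hs_nrm_rep [OF g assms]])
      (use wt_measurable [OF rep_measurable [OF g]] in \<open>auto simp: norm_mult\<close>)
  then show ?thesis by (rule HsI(1) [OF rep_scaleR [OF g]])
qed

lemma reflect_l2_le: "l2_le F A \<Longrightarrow> l2_le (\<lambda>x. F (- x)) A"
  using l2_le_reflect [of F A 0] by simp

text \<open>The physical-side function of a distribution with square integrable transform \<open>g\<close> is the \<open>L\<^sup>2\<close>
  transform of \<open>g\<close>, reflected and divided by \<open>2 \<pi>\<close>. Its square is recorded weakly, as the inverse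
  transform of \<open>g * g / 2 \<pi>\<close>.\<close>

lemma rep_physical:
  assumes u: "rep u g" and g: "l2_le g A"
  shows "\<exists>f. given_by (td_apply u) f \<and> l2_le f A \<and>
     (\<forall>\<psi>\<in>schwartz. integrable lborel (\<lambda>x. (f x)\<^sup>2 * \<psi> x) \<and>
        (\<integral>x. (f x)\<^sup>2 * \<psi> x) = (\<integral>\<xi>. cx (1 / (2 * pi)) * conv g g \<xi> * inverse_fourier \<psi> \<xi>))"
proof -
  obtain F a where F: "l2_le F (sqrt (2 * pi) * A)" and a: "a \<longlonglongrightarrow> 0" "\<And>n. l2_le (\<lambda>x. F x - fourier (trunc n g) x) (a n)"
    using fourier_l2_extension [OF g] by blast
  define c where "c = cx (1 / (2 * pi))"
  define f where "f = (\<lambda>x. c * F (- x))"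
  have A0: "0 \<le> A" by (rule l2_leD(2) [OF g])
  note [measurable] = l2_leD(1) [OF F]
  have refl: "(\<integral>x. k (- x) * \<psi> x) = (\<integral>x. k x * \<psi> (- x))" for k \<psi> :: "real \<Rightarrow> complex"
    using lborel_integral_real_affine [of "-1" "\<lambda>x. k (- x) * \<psi> x" 0] by simp
  have refli: "integrable lborel (\<lambda>x. k (- x) * \<psi> x)" if "integrable lborel (\<lambda>x. k x * \<psi> (- x))" for k \<psi> :: "real \<Rightarrow> complex"
    using lborel_integrable_real_affine [OF that, of "-1" 0] by simp
  have inv: "c * fourier (\<lambda>x. \<psi> (- x)) \<xi> = inverse_fourier \<psi> \<xi>" for \<psi> \<xi>
    by (simp only: inverse_fourier_def c_def fourier_reflect)
  note R = schwartz_contD [OF schwartz_cont_reflect]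
  have fl: "l2_le f A"
  proof -
    have cc: "cmod c * (sqrt (2 * pi) * A) \<le> 1 * A"
    proof -
      have "1 \<le> sqrt (2 * pi)" using pi_gt3 by (intro real_le_rsqrt) simp
      then have "sqrt (2 * pi) * 1 \<le> sqrt (2 * pi) * sqrt (2 * pi)" by (intro mult_left_mono) auto
      then have "sqrt (2 * pi) \<le> 2 * pi" by simp
      then have "cmod c * sqrt (2 * pi) \<le> 1" by (simp add: c_def norm_divide)
      from mult_right_mono [OF this A0] show ?thesis by (simp only: mult.assoc)
    qed
    have "l2_le f (cmod c * (sqrt (2 * pi) * A))"
      by (rule l2_le_bound [OF reflect_l2_le [OF F]]) (unfold f_def, measurable, auto simp: norm_mult)
    then show ?thesis by (rule l2_le_weaken) (use cc in simp)
  qed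
  have gb: "given_by (td_apply u) f"
    unfolding given_by_def
  proof (intro conjI ballI)
    show "f \<in> borel_measurable borel" by (rule l2_leD(1) [OF fl])
    fix \<psi> assume \<psi>: "\<psi> \<in> schwartz"
    obtain B where B: "l2_le \<psi> B" using schwartz_l2 [OF \<psi>] by blast
    show "integrable lborel (\<lambda>x. f x * \<psi> x)" by (rule l2_pairing(1) [OF fl B])
    have "(\<integral>x. f x * \<psi> x) = c * (\<integral>x. F (- x) * \<psi> x)"
      by (simp only: f_def mult.assoc integral_mult_right_zero)
    also have "\<dots> = c * (\<integral>x. g x * fourier (\<lambda>x. \<psi> (- x)) x)"
      by (simp only: refl fourier_l2_duality [OF g F a R [OF \<psi>]])
    also have "\<dots> = (\<integral>x. g x * inverse_fourier \<psi> x)"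
      unfolding inv [symmetric] integral_mult_right_zero [symmetric] by (simp only: mult.left_commute)
    also have "\<dots> = td_apply u \<psi>"
      using rep_apply [OF u schwartz_contD [OF schwartz_cont_inverse_fourier \<psi>]]
      by (simp add: fourier_inverse_fourier [OF \<psi>])
    finally show "td_apply u \<psi> = (\<integral>x. f x * \<psi> x)" by simp
  qed
  have sq: "integrable lborel (\<lambda>x. (f x)\<^sup>2 * \<psi> x)"
    "(\<integral>x. (f x)\<^sup>2 * \<psi> x) = (\<integral>\<xi>. c * conv g g \<xi> * inverse_fourier \<psi> \<xi>)" if \<psi>: "\<psi> \<in> schwartz" for \<psi>
  proof -
    note S = fourier_l2_square [OF g F a R [OF \<psi>]]
    have f2: "(\<lambda>x. (f x)\<^sup>2 * \<psi> x) = (\<lambda>x. c\<^sup>2 * ((F (- x))\<^sup>2 * \<psi> x))"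
      by (simp add: f_def fun_eq_iff power_mult_distrib)
    show "integrable lborel (\<lambda>x. (f x)\<^sup>2 * \<psi> x)"
      unfolding f2 by (intro integrable_mult_right refli [of "\<lambda>x. (F x)\<^sup>2"] S(1))
    have "(\<integral>x. (f x)\<^sup>2 * \<psi> x) = c\<^sup>2 * (\<integral>x. (F (- x))\<^sup>2 * \<psi> x)"
      unfolding f2 by (rule integral_mult_right_zero)
    also have "\<dots> = c\<^sup>2 * (\<integral>\<xi>. conv g g \<xi> * fourier (\<lambda>x. \<psi> (- x)) \<xi>)"
      by (simp only: refl [of "\<lambda>x. (F x)\<^sup>2"] S(2))
    also have "\<dots> = (\<integral>\<xi>. c\<^sup>2 * (conv g g \<xi> * fourier (\<lambda>x. \<psi> (- x)) \<xi>))"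
      by (simp only: integral_mult_right_zero)
    also have "\<dots> = (\<integral>\<xi>. c * conv g g \<xi> * inverse_fourier \<psi> \<xi>)"
      unfolding inv [symmetric] power2_eq_square by (simp only: mult_ac)
    finally show "(\<integral>x. (f x)\<^sup>2 * \<psi> x) = (\<integral>\<xi>. c * conv g g \<xi> * inverse_fourier \<psi> \<xi>)" .
  qed
  show ?thesis using gb fl sq unfolding c_def by blast
qed

lemma L2_norm_le:
  assumes "rep u g" "l2_le g A" shows "L2_norm u \<le> ennreal A"
proof -
  obtain f where f: "given_by (td_apply u) f" "l2_le f A" using rep_physical [OF assms] by blast
  have "L2_norm u = ennsqrt (l2 f)"
    by (simp add: L2_norm_def weighted_L2_eq [OF f(1)] l2_def)
  then show ?thesis using ennsqrt_le [OF l2_leD(2,3) [OF f(2)]] by simp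
qed

text \<open>The converse direction of Plancherel: a distribution with finite \<open>L\<^sup>2\<close> norm has a square
  integrable transform.\<close>

lemma L2_norm_finite_rep:
  assumes "L2_norm u < \<infinity>"
  shows "\<exists>g. rep u g \<and> l2 g \<le> ennreal (2 * pi) * (L2_norm u)\<^sup>2"
proof -
  have "{f. given_by (td_apply u) f} \<noteq> {}"
  proof
    assume "{f. given_by (td_apply u) f} = {}"
    then have "L2_norm u = \<infinity>" by (simp add: L2_norm_def weighted_L2_def)
    then show False using assms by simp
  qed
  then obtain f where f: "given_by (td_apply u) f" by blast
  have fm: "f \<in> borel_measurable borel" using f by (simp add: given_by_def)
  have n: "L2_norm u = ennsqrt (l2 f)"
    by (simp add: L2_norm_def weighted_L2_eq [OF f] l2_def)
  have fin: "l2 f < \<infinity>" using assms unfolding n ennsqrt_finite .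
  define A where "A = sqrt (enn2real (l2 f))"
  have fl: "l2_le f A" unfolding A_def by (rule l2_finite_le [OF fm fin])
  obtain F a where F: "l2_le F (sqrt (2 * pi) * A)" and a: "a \<longlonglongrightarrow> 0" "\<And>n. l2_le (\<lambda>x. F x - fourier (trunc n f) x) (a n)"
    using fourier_l2_extension [OF fl] by blast
  have "rep u F"
  proof (rule repI)
    show "F \<in> borel_measurable borel" by (rule l2_leD(1) [OF F])
    fix \<phi> assume \<phi>: "\<phi> \<in> schwartz"
    obtain B where B: "l2_le \<phi> B" using schwartz_l2 [OF \<phi>] by blast
    show "integrable lborel (\<lambda>x. F x * \<phi> x)" by (rule l2_pairing(1) [OF F B])
    show "td_apply u (fourier \<phi>) = (\<integral>x. F x * \<phi> x)"
      using f fourier_schwartz [OF \<phi>] by (simp add: given_by_def fourier_l2_duality [OF fl F a \<phi>])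
  qed
  moreover have "l2 F \<le> ennreal (2 * pi) * (L2_norm u)\<^sup>2"
  proof -
    have "(sqrt (2 * pi) * A)\<^sup>2 = 2 * pi * enn2real (l2 f)" by (simp add: power_mult_distrib A_def)
    then have "ennreal ((sqrt (2 * pi) * A)\<^sup>2) = ennreal (2 * pi) * ennreal (enn2real (l2 f))"
      by (simp add: ennreal_mult)
    also have "ennreal (enn2real (l2 f)) = (L2_norm u)\<^sup>2"
      using fin by (simp add: n ennsqrt_sq)
    finally show ?thesis using l2_leD(3) [OF F] by simp
  qed
  ultimately show ?thesis by blast
qed

lemma conv_moderate:
  assumes "l2_le g A" "l2_le h B" shows "moderate (\<lambda>\<xi>. c * conv g h \<xi>)"
proof (rule moderateI_poly [where k = 0 and B = "cmod c * (A * B)"])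
  note [measurable] = l2_leD(1) [OF assms(1)] l2_leD(1) [OF assms(2)]
  show "(\<lambda>\<xi>. c * conv g h \<xi>) \<in> borel_measurable borel" by measurable
  show "cmod (c * conv g h \<xi>) \<le> cmod c * (A * B) * jap \<xi> ^ 0" for \<xi>
    using conv_bound(2) [OF assms, of \<xi>] by (simp add: norm_mult mult_left_mono)
qed

lemma rep_td_square:
  assumes u: "rep u g" and g: "l2_le g A"
  shows "rep (td_square u) (\<lambda>\<xi>. cx (1 / (2 * pi)) * conv g g \<xi>)"
proof -
  let ?c = "\<lambda>\<xi>. cx (1 / (2 * pi)) * conv g g \<xi>"
  obtain f where f: "given_by (td_apply u) f" "l2_le f A"
    and sq: "\<And>\<psi>. \<psi> \<in> schwartz \<Longrightarrow> integrable lborel (\<lambda>x. (f x)\<^sup>2 * \<psi> x)"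
     "\<And>\<psi>. \<psi> \<in> schwartz \<Longrightarrow> (\<integral>x. (f x)\<^sup>2 * \<psi> x) = (\<integral>\<xi>. ?c \<xi> * inverse_fourier \<psi> \<xi>)"
    using rep_physical [OF assms] by blast
  define w where "w = inv_td ?c"
  have w: "rep w ?c" unfolding w_def by (rule rep_inv_td [OF conv_moderate [OF g g]])
  note [measurable] = l2_leD(1) [OF f(2)]
  have wsq: "given_by (td_apply w) (\<lambda>x. (f x)\<^sup>2)"
    unfolding given_by_def
  proof (intro conjI ballI)
    show "(\<lambda>x. (f x)\<^sup>2) \<in> borel_measurable borel" by measurable
    fix \<psi> assume \<psi>: "\<psi> \<in> schwartz"
    show "integrable lborel (\<lambda>x. (f x)\<^sup>2 * \<psi> x)" by (rule sq(1) [OF \<psi>])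
    show "td_apply w \<psi> = (\<integral>x. (f x)\<^sup>2 * \<psi> x)"
      using rep_apply [OF w schwartz_contD [OF schwartz_cont_inverse_fourier \<psi>]]
      by (simp only: sq(2) [OF \<psi>] fourier_inverse_fourier [OF \<psi>])
  qed
  have "td_square u = w"
    unfolding td_square_def
  proof (rule the_equality)
    show "\<exists>g. given_by (td_apply u) g \<and> given_by (td_apply w) (\<lambda>x. (g x)\<^sup>2)" using f(1) wsq by blast
    fix w' assume "\<exists>g. given_by (td_apply u) g \<and> given_by (td_apply w') (\<lambda>x. (g x)\<^sup>2)"
    then obtain f' where f': "given_by (td_apply u) f'" "given_by (td_apply w') (\<lambda>x. (f' x)\<^sup>2)" by blast
    have ae: "AE x in lborel. f' x = f x" by (rule given_by_unique [OF f'(1) f(1)])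
    have [measurable]: "f' \<in> borel_measurable borel" using f'(1) by (simp add: given_by_def)
    show "w' = w"
    proof (rule tempered_eqI)
      fix \<phi> assume "\<phi> \<in> schwartz"
      then have F: "fourier \<phi> \<in> schwartz" by (rule fourier_schwartz)
      note [measurable] = schwartz_measurable [OF F]
      have "(\<integral>x. (f' x)\<^sup>2 * fourier \<phi> x) = (\<integral>x. (f x)\<^sup>2 * fourier \<phi> x)"
      proof (rule integral_cong_AE)
        show "AE x in lborel. (f' x)\<^sup>2 * fourier \<phi> x = (f x)\<^sup>2 * fourier \<phi> x"
          using ae by eventually_elim simp
      qed measurable
      then show "td_apply w' (fourier \<phi>) = td_apply w (fourier \<phi>)"
        using f'(2) wsq F by (simp add: given_by_def)
    qed
  qed
  then show ?thesis using w by simp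
qed

lemma rep_td_deriv:
  assumes "rep u g" shows "rep (td_deriv u) (\<lambda>\<xi>. \<i> * cx \<xi> * g \<xi>)"
proof (rule repI)
  note [measurable] = rep_measurable [OF assms]
  show "(\<lambda>\<xi>. \<i> * cx \<xi> * g \<xi>) \<in> borel_measurable borel" by measurable
  fix \<phi> assume \<phi>: "\<phi> \<in> schwartz"
  have s: "(\<lambda>x. (- \<i>) * (cx x * \<phi> x)) \<in> schwartz"
    by (intro schwartz_cmult schwartz_mult_x \<phi>)
  have eq: "(\<lambda>x. g x * ((- \<i>) * (cx x * \<phi> x))) = (\<lambda>x. - (\<i> * cx x * g x * \<phi> x))"
    by (simp add: fun_eq_iff)
  have "integrable lborel (\<lambda>x. - (\<i> * cx x * g x * \<phi> x))"
    using rep_integrable [OF assms s] unfolding eq .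
  then show "integrable lborel (\<lambda>x. \<i> * cx x * g x * \<phi> x)"
    using Bochner_Integration.integrable_minus by fastforce
  have "td_apply (td_deriv u) (fourier \<phi>) = - td_apply u (vderiv (fourier \<phi>))"
    using fourier_schwartz [OF \<phi>] by (simp add: td_deriv.rep_eq)
  also have "vderiv (fourier \<phi>) = fourier (\<lambda>x. (- \<i>) * (cx x * \<phi> x))"
    by (rule vderivI [OF fourier_has_vector_derivative [OF \<phi>]])
  also have "td_apply u (fourier (\<lambda>x. (- \<i>) * (cx x * \<phi> x))) = - (\<integral>x. \<i> * cx x * g x * \<phi> x)"
    unfolding rep_apply [OF assms s] eq by (rule integral_minus)
  finally show "td_apply (td_deriv u) (fourier \<phi>) = (\<integral>x. \<i> * cx x * g x * \<phi> x)" by simp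
qed

text \<open>The description defining the multiplier is unique because both \<open>g\<close> and the distribution with a
  given transform are.\<close>

lemma fourier_multiplier_eq:
  assumes w: "rep w g" and u: "rep u (\<lambda>\<xi>. m \<xi> * g \<xi>)" and [measurable]: "m \<in> borel_measurable borel"
  shows "fourier_multiplier m w = u"
  unfolding fourier_multiplier_def
proof (rule the_equality)
  show "\<exists>g. given_by (td_fourier w) g \<and> given_by (td_fourier u) (\<lambda>\<xi>. m \<xi> * g \<xi>)"
    using w u by (auto simp: rep_def)
  fix u' assume "\<exists>g. given_by (td_fourier w) g \<and> given_by (td_fourier u') (\<lambda>\<xi>. m \<xi> * g \<xi>)"
  then obtain g' where g': "rep w g'" "rep u' (\<lambda>\<xi>. m \<xi> * g' \<xi>)" by (auto simp: rep_def)
  have "AE \<xi> in lborel. m \<xi> * g' \<xi> = m \<xi> * g \<xi>"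
    using rep_unique [OF g'(1) w] by eventually_elim simp
  then show "u' = u" by (rule rep_inject_AE [OF g'(2) u])
qed

lemma norm_mono_real: "0 \<le> (a::real) \<Longrightarrow> a \<le> b \<Longrightarrow> norm a \<le> norm b"
  by simp

lemma rep_bounded_multiplier:
  assumes w: "rep w g" and [measurable]: "m \<in> borel_measurable borel" and b: "\<And>\<xi>. cmod (m \<xi>) \<le> K" and g: "moderate g"
  shows "rep (fourier_multiplier m w) (\<lambda>\<xi>. m \<xi> * g \<xi>)"
proof -
  obtain k where [measurable]: "g \<in> borel_measurable borel" and k: "integrable lborel (\<lambda>x. cmod (g x) / jap x ^ k)"
    using g by (auto simp: moderate_def)
  have "integrable lborel (\<lambda>x. cmod (m x * g x) / jap x ^ k)"
  proof (rule Bochner_Integration.integrable_bound)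
    show "integrable lborel (\<lambda>x. K * (cmod (g x) / jap x ^ k))" using k by (rule integrable_mult_right)
    have "cmod (m x * g x) / jap x ^ k \<le> K * (cmod (g x) / jap x ^ k)" for x
      using mult_right_mono [OF b [of x], of "cmod (g x) / jap x ^ k"] by (simp add: norm_mult)
    then have "norm (cmod (m x * g x) / jap x ^ k) \<le> norm (K * (cmod (g x) / jap x ^ k))" for x
      by (intro norm_mono_real) simp
    then show "AE x in lborel. norm (cmod (m x * g x) / jap x ^ k) \<le> norm (K * (cmod (g x) / jap x ^ k))" by simp
  qed measurable
  then have "moderate (\<lambda>\<xi>. m \<xi> * g \<xi>)" unfolding moderate_def by (intro conjI exI) measurable
  then have r: "rep (inv_td (\<lambda>\<xi>. m \<xi> * g \<xi>)) (\<lambda>\<xi>. m \<xi> * g \<xi>)" by (rule rep_inv_td)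
  have "fourier_multiplier m w = inv_td (\<lambda>\<xi>. m \<xi> * g \<xi>)"
    by (rule fourier_multiplier_eq [OF w r]) measurable
  then show ?thesis using r by simp
qed

section \<open>Weak integrals on the Fourier side\<close>

text \<open>The time integral on the Fourier side, frequency by frequency.\<close>

definition tint :: "real \<Rightarrow> (real \<Rightarrow> real \<Rightarrow> complex) \<Rightarrow> real \<Rightarrow> complex" where
  "tint t G \<xi> = (\<integral>r. indicator {0..t} r *\<^sub>R G r \<xi>)"

lemma tint_measurable:
  assumes [measurable]: "jmeas G"
  shows "tint t G \<in> borel_measurable borel"
  unfolding tint_def by measurable

context
  fixes G :: "real \<Rightarrow> real \<Rightarrow> complex" and t :: real and k :: nat
  assumes G [measurable]: "jmeas G"
    and fin: "(\<integral>\<^sup>+r. indicator {0..t} r * (\<integral>\<^sup>+\<xi>. ennreal (cmod (G r \<xi>) / jap \<xi> ^ k))) < \<infinity>"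
begin

lemma tint_weighted_integrable:
  "integrable (lborel \<Otimes>\<^sub>M lborel) (\<lambda>(r, \<xi>). (indicator {0..t} r * (cmod (G r \<xi>) / jap \<xi> ^ k) :: real))"
proof (rule integrableI_bounded)
  show "(\<lambda>(r, \<xi>). (indicator {0..t} r * (cmod (G r \<xi>) / jap \<xi> ^ k) :: real)) \<in> borel_measurable (lborel \<Otimes>\<^sub>M lborel)"
    by measurable
  have "(\<integral>\<^sup>+z. ennreal (norm (case z of (r, \<xi>) \<Rightarrow> indicator {0..t} r * (cmod (G r \<xi>) / jap \<xi> ^ k))) \<partial>(lborel \<Otimes>\<^sub>M lborel))
      = (\<integral>\<^sup>+r. \<integral>\<^sup>+\<xi>. ennreal (norm (indicator {0..t} r * (cmod (G r \<xi>) / jap \<xi> ^ k))) \<partial>lborel \<partial>lborel)"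
    by (subst lborel.nn_integral_fst [symmetric]) (auto simp: case_prod_beta')
  also have "\<dots> = (\<integral>\<^sup>+r. indicator {0..t} r * (\<integral>\<^sup>+\<xi>. ennreal (cmod (G r \<xi>) / jap \<xi> ^ k)))"
    by (intro nn_integral_cong) (auto simp: indicator_def)
  finally show "(\<integral>\<^sup>+z. ennreal (norm (case z of (r, \<xi>) \<Rightarrow> indicator {0..t} r * (cmod (G r \<xi>) / jap \<xi> ^ k))) \<partial>(lborel \<Otimes>\<^sub>M lborel)) < \<infinity>"
    using fin by simp
qed

lemma tint_pair_integrable:
  assumes \<psi>: "\<psi> \<in> schwartz"
  shows "integrable (lborel \<Otimes>\<^sub>M lborel) (\<lambda>(r, \<xi>). indicator {0..t} r *\<^sub>R (G r \<xi> * \<psi> \<xi>))"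
proof (rule Bochner_Integration.integrable_bound)
  note [measurable] = schwartz_measurable [OF \<psi>]
  let ?C = "2 ^ k * schwartz_norm k \<psi>"
  show "integrable (lborel \<Otimes>\<^sub>M lborel) (\<lambda>z. ?C * (case z of (r, \<xi>) \<Rightarrow> indicator {0..t} r * (cmod (G r \<xi>) / jap \<xi> ^ k)))"
    using tint_weighted_integrable by (rule integrable_mult_right)
  show "(\<lambda>(r, \<xi>). indicator {0..t} r *\<^sub>R (G r \<xi> * \<psi> \<xi>)) \<in> borel_measurable (lborel \<Otimes>\<^sub>M lborel)" by measurable
  have C: "0 \<le> ?C" using schwartz_norm_nonneg [OF \<psi>] by simp
  have "cmod (G r \<xi> * \<psi> \<xi>) \<le> ?C * (cmod (G r \<xi>) / jap \<xi> ^ k)" for r \<xi>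
    using mult_left_mono [OF schwartz_decay [OF \<psi>, of \<xi> k], of "cmod (G r \<xi>) / jap \<xi> ^ k"]
    by (simp add: norm_mult mult_ac)
  then show "AE z in lborel \<Otimes>\<^sub>M lborel. norm (case z of (r, \<xi>) \<Rightarrow> indicator {0..t} r *\<^sub>R (G r \<xi> * \<psi> \<xi>))
     \<le> norm (?C * (case z of (r, \<xi>) \<Rightarrow> indicator {0..t} r * (cmod (G r \<xi>) / jap \<xi> ^ k)))"
    using abs_of_nonneg [OF schwartz_norm_nonneg [OF \<psi>, of k]] by (intro AE_I2) (auto simp: indicator_def abs_mult)
qed

lemma tint_moderate: "moderate (tint t G)"
  unfolding moderate_def
proof (intro conjI exI)
  show m: "tint t G \<in> borel_measurable borel" by (rule tint_measurable [OF G])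
  note [measurable] = m
  show "integrable lborel (\<lambda>\<xi>. cmod (tint t G \<xi>) / jap \<xi> ^ k)"
  proof (rule Bochner_Integration.integrable_bound)
    show "integrable lborel (\<lambda>\<xi>. \<integral>r. (indicator {0..t} r * (cmod (G r \<xi>) / jap \<xi> ^ k) :: real) \<partial>lborel)"
      using lborel_pair.integrable_snd [OF tint_weighted_integrable] by simp
    have "cmod (tint t G \<xi>) / jap \<xi> ^ k \<le> (\<integral>r. indicator {0..t} r * (cmod (G r \<xi>) / jap \<xi> ^ k))" for \<xi>
    proof -
      have "cmod (tint t G \<xi>) \<le> (\<integral>r. cmod (indicator {0..t} r *\<^sub>R G r \<xi>))"
        unfolding tint_def by (rule integral_norm_bound)
      then have "cmod (tint t G \<xi>) / jap \<xi> ^ k \<le> (\<integral>r. cmod (indicator {0..t} r *\<^sub>R G r \<xi>)) / jap \<xi> ^ k"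
        by (rule divide_right_mono) simp
      also have "\<dots> = (\<integral>r. indicator {0..t} r * (cmod (G r \<xi>) / jap \<xi> ^ k))"
        by (subst integral_divide_zero [symmetric]) (auto intro!: Bochner_Integration.integral_cong simp: indicator_def)
      finally show ?thesis .
    qed
    then show "AE \<xi> in lborel. norm (cmod (tint t G \<xi>) / jap \<xi> ^ k) \<le> norm (\<integral>r. (indicator {0..t} r * (cmod (G r \<xi>) / jap \<xi> ^ k) :: real))"
      by (intro AE_I2) (simp add: norm_divide order_trans [OF _ abs_ge_self])
  qed measurable
qed

lemma tint_fubini:
  assumes \<psi>: "\<psi> \<in> schwartz"
  shows "integrable lborel (\<lambda>r. indicator {0..t} r *\<^sub>R (\<integral>\<xi>. G r \<xi> * \<psi> \<xi>))"
    and "(\<integral>r. indicator {0..t} r *\<^sub>R (\<integral>\<xi>. G r \<xi> * \<psi> \<xi>)) = (\<integral>\<xi>. tint t G \<xi> * \<psi> \<xi>)"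
proof -
  note i = tint_pair_integrable [OF \<psi>]
  show "integrable lborel (\<lambda>r. indicator {0..t} r *\<^sub>R (\<integral>\<xi>. G r \<xi> * \<psi> \<xi>))"
    using lborel_pair.integrable_fst [OF i] by simp
  have "(\<integral>\<xi>. tint t G \<xi> * \<psi> \<xi>) = (\<integral>\<xi>. (\<integral>r. indicator {0..t} r *\<^sub>R (G r \<xi> * \<psi> \<xi>)))"
    unfolding tint_def integral_mult_left_zero [symmetric] by (simp only: mult_scaleR_left)
  also have "\<dots> = (\<integral>r. (\<integral>\<xi>. indicator {0..t} r *\<^sub>R (G r \<xi> * \<psi> \<xi>)))"
    by (rule lborel_pair.Fubini_integral [OF i])
  also have "\<dots> = (\<integral>r. indicator {0..t} r *\<^sub>R (\<integral>\<xi>. G r \<xi> * \<psi> \<xi>))"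
    by (simp only: integral_scaleR_right)
  finally show "(\<integral>r. indicator {0..t} r *\<^sub>R (\<integral>\<xi>. G r \<xi> * \<psi> \<xi>)) = (\<integral>\<xi>. tint t G \<xi> * \<psi> \<xi>)" by simp
qed

text \<open>Fubini's theorem against the test function.\<close>

lemma has_td_integral_inv_td:
  assumes F: "\<And>r. r \<in> {0<..t} \<Longrightarrow> rep (F r) (G r)"
  shows "has_td_integral F (inv_td (tint t G)) {0..t}"
  unfolding has_td_integral_def
proof (intro ballI)
  fix \<phi> assume \<phi>: "\<phi> \<in> schwartz"
  define \<psi> where "\<psi> = inverse_fourier \<phi>"
  have \<psi>: "\<psi> \<in> schwartz" "fourier \<psi> = \<phi>"
    using schwartz_contD [OF schwartz_cont_inverse_fourier \<phi>] fourier_inverse_fourier [OF \<phi>] by (simp_all add: \<psi>_def)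
  let ?h = "\<lambda>r. indicator {0..t} r *\<^sub>R (\<integral>\<xi>. G r \<xi> * \<psi> \<xi>)"
  let ?h' = "\<lambda>r. indicator {0..t} r *\<^sub>R td_apply (F r) \<phi>"
  have h: "integrable lborel ?h" by (rule tint_fubini(1) [OF \<psi>(1)])
  define c where "c = indicator {0..t} (0::real) *\<^sub>R td_apply (F 0) \<phi>"
  have eq: "?h' r = (if r = 0 then c else ?h r)" for r
    using rep_apply [OF F \<psi>(1), of r] by (auto simp: \<psi>(2) indicator_def c_def)
  have hm: "?h' \<in> borel_measurable borel"
    unfolding eq using borel_measurable_integrable [OF h] by measurable
  have ae: "AE r in lborel. ?h r = ?h' r"
    using AE_lborel_singleton [of 0] by eventually_elim (simp only: eq if_False)
  have h': "integrable lborel ?h'"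
    by (rule integrable_cong_AE_imp [OF h _ ae]) (use hm in simp)
  have "integrable lebesgue ?h'" using integrable_completion [of ?h' lborel] hm h' by simp
  moreover have "integral\<^sup>L lebesgue ?h' = (\<integral>\<xi>. tint t G \<xi> * \<psi> \<xi>)"
  proof -
    have "integral\<^sup>L lebesgue ?h' = integral\<^sup>L lborel ?h'" by (rule integral_completion) (use hm in simp)
    also have "\<dots> = integral\<^sup>L lborel ?h"
      by (rule integral_cong_AE) (use hm borel_measurable_integrable [OF h] ae in \<open>auto elim!: eventually_mono\<close>)
    also have "\<dots> = (\<integral>\<xi>. tint t G \<xi> * \<psi> \<xi>)" by (rule tint_fubini(2) [OF \<psi>(1)])
    finally show ?thesis .
  qed
  moreover have "td_apply (inv_td (tint t G)) \<phi> = (\<integral>\<xi>. tint t G \<xi> * \<psi> \<xi>)"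
    using rep_apply [OF rep_inv_td [OF tint_moderate] \<psi>(1)] by (simp only: \<psi>(2))
  ultimately show "set_integrable lebesgue {0..t} (\<lambda>r. td_apply (F r) \<phi>) \<and>
      td_apply (inv_td (tint t G)) \<phi> = set_lebesgue_integral lebesgue {0..t} (\<lambda>r. td_apply (F r) \<phi>)"
    by (simp add: set_integrable_def set_lebesgue_integral_def)
qed

text \<open>Here the integrand may differ from the given one on a null set of times, which suffices for an
  arbitrary solution.\<close>

lemma has_td_integral_rep:
  assumes D: "has_td_integral F D {0..t}" and F: "AE r in lborel. r \<in> {0..t} \<longrightarrow> rep (F r) (G r)"
  shows "rep D (tint t G)"
proof -
  have "D = inv_td (tint t G)"
  proof (rule tempered_eqI)
    fix \<psi> assume \<psi>: "\<psi> \<in> schwartz"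
    let ?h = "\<lambda>r. indicator {0..t} r *\<^sub>R (\<integral>\<xi>. G r \<xi> * \<psi> \<xi>)"
    let ?h' = "\<lambda>r. indicator {0..t} r *\<^sub>R td_apply (F r) (fourier \<psi>)"
    have h: "integrable lborel ?h" by (rule tint_fubini(1) [OF \<psi>])
    have h': "integrable lebesgue ?h'" and Deq: "td_apply D (fourier \<psi>) = integral\<^sup>L lebesgue ?h'"
      using D fourier_schwartz [OF \<psi>] by (auto simp: has_td_integral_def set_integrable_def set_lebesgue_integral_def)
    have "AE r in lborel. ?h' r = ?h r"
      using F by eventually_elim (auto simp: indicator_def rep_apply [OF _ \<psi>])
    then have ae: "AE r in lebesgue. ?h' r = ?h r" by (rule AE_completion)
    have hl: "?h \<in> borel_measurable lborel" using h by (rule borel_measurable_integrable)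
    have "integral\<^sup>L lebesgue ?h' = integral\<^sup>L lebesgue ?h"
      by (rule integral_cong_AE [OF borel_measurable_integrable [OF h'] _ ae]) (rule measurable_completion [OF hl])
    also have "\<dots> = integral\<^sup>L lborel ?h" by (rule integral_completion [OF hl])
    also have "\<dots> = (\<integral>\<xi>. tint t G \<xi> * \<psi> \<xi>)" by (rule tint_fubini(2) [OF \<psi>])
    finally show "td_apply D (fourier \<psi>) = td_apply (inv_td (tint t G)) (fourier \<psi>)"
      using rep_apply [OF rep_inv_td [OF tint_moderate] \<psi>] Deq by simp
  qed
  then show ?thesis using rep_inv_td [OF tint_moderate] by simp
qed

end

section \<open>Quadratic fixed point problems\<close>

text \<open>All ways to distribute the entries of a list over two lists, keeping the order: the Leibniz rule
  for the derivative of a product in the directions of the list.\<close>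

fun splits :: "'a list \<Rightarrow> ('a list \<times> 'a list) list" where
  "splits [] = [([], [])]"
| "splits (x # xs) = map (\<lambda>(A, B). (x # A, B)) (splits xs) @ map (\<lambda>(A, B). (A, x # B)) (splits xs)"

lemma length_splits: "length (splits hs) = 2 ^ length hs"
  by (induction hs) auto

lemma splits_set: "p \<in> set (splits hs) \<Longrightarrow> length (fst p) + length (snd p) = length hs \<and>
    set (fst p) \<union> set (snd p) = set hs"
  by (induction hs arbitrary: p) (auto, fastforce+)

lemma splits_mem: "(hs, []) \<in> set (splits hs)"
  by (induction hs) force+

lemma splits_map: "splits (map f hs) = map (\<lambda>p. (map f (fst p), map f (snd p))) (splits hs)"
  by (induction hs) (auto simp: case_prod_unfold)

lemma splits_distinct:
  "distinct hs \<Longrightarrow> p \<in> set (splits hs) \<Longrightarrow> distinct (fst p) \<and> distinct (snd p) \<and> set (fst p) \<inter> set (snd p) = {}"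
proof (induction hs arbitrary: p)
  case (Cons x hs)
  from Cons.prems(2) obtain A B where q: "(A, B) \<in> set (splits hs)" "p = (x # A, B) \<or> p = (A, x # B)" by auto
  have "x \<notin> set A \<union> set B" using splits_set [OF q(1)] Cons.prems(1) by simp
  then show ?case using Cons.IH [OF _ q(1)] Cons.prems(1) q(2) by auto
qed simp

lemma splits_prod:
  fixes N :: "'a \<Rightarrow> real"
  shows "p \<in> set (splits hs) \<Longrightarrow> prod_list (map N (fst p)) * prod_list (map N (snd p)) = prod_list (map N hs)"
proof (induction hs arbitrary: p)
  case (Cons x xs)
  from Cons.prems consider A B where "(A, B) \<in> set (splits xs)" "p = (x # A, B)"
    | A B where "(A, B) \<in> set (splits xs)" "p = (A, x # B)" by auto
  then show ?case
  proof cases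
    case 1 then show ?thesis using Cons.IH [OF 1(1)] by (simp add: mult.assoc)
  next
    case 2 then show ?thesis using Cons.IH [OF 2(1)] by (simp add: mult.left_commute [of _ "N x"])
  qed
qed simp

text \<open>These two solve the inequalities below, in which the quantity to be bounded also occurs on the
  right with total weight \<open>1/2\<close>.\<close>

lemma absorb1: "d \<le> (a + d) / 4 + (a + d) / 4 + q \<Longrightarrow> a \<le> P \<Longrightarrow> a + d \<le> 2 * (P + q)" for a d q P :: real
  by (simp add: field_simps)

lemma absorb2:
  "a + r \<le> e \<Longrightarrow> d \<le> r + (((a + d) / 4 + q) + ((a + d) / 4 + q)) \<Longrightarrow> a + d \<le> 2 * e + 4 * q" for a r e d q :: real
  by (simp add: field_simps)

lemma filter_splits_snd: "filter (\<lambda>p. snd p = []) (splits hs) = [(hs, [])]"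
  by (induction hs) (auto simp: filter_map o_def case_prod_unfold)

lemma filter_splits_fst: "filter (\<lambda>p. fst p = []) (splits hs) = [([], hs)]"
  by (induction hs) (auto simp: filter_map o_def case_prod_unfold)

lemma sum_list_partition:
  fixes f :: "'a \<Rightarrow> 'b::ab_group_add"
  shows "sum_list (map f l) = sum_list (map f (filter P l)) + sum_list (map f (filter (\<lambda>x. \<not> P x) l))"
  by (induction l) (auto simp: algebra_simps)

lemma norm_sum_list_le:
  fixes f :: "'a \<Rightarrow> 'b::real_normed_vector"
  assumes "\<And>x. x \<in> set l \<Longrightarrow> norm (f x) \<le> C" shows "norm (sum_list (map f l)) \<le> real (length l) * C"
  using assms
proof (induction l)
  case (Cons a l)
  then have "norm (f a + sum_list (map f l)) \<le> C + real (length l) * C"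
    by (intro norm_triangle_le add_mono) auto
  then show ?case by (simp add: algebra_simps)
qed simp

text \<open>The term for \<open>q\<close> is singled out: in the linear equations for the derivatives it contains the
  unknown itself and has to be absorbed.\<close>

lemma norm_sum_list_split_off:
  fixes f :: "'b \<Rightarrow> 'c::real_normed_vector"
  assumes "filter P l = [q]" "norm (f q) \<le> x" "\<And>p. p \<in> set l \<Longrightarrow> \<not> P p \<Longrightarrow> norm (f p) \<le> C" "0 \<le> C"
  shows "norm (sum_list (map f l)) \<le> x + real (length l) * C"
proof -
  let ?l = "filter (\<lambda>p. \<not> P p) l"
  have eq: "sum_list (map f l) = f q + sum_list (map f ?l)"
    by (subst sum_list_partition [where P = P]) (simp add: assms(1))
  have "norm (sum_list (map f ?l)) \<le> real (length ?l) * C"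
    by (rule norm_sum_list_le) (use assms(3) in auto)
  also have "\<dots> \<le> real (length l) * C"
    by (intro mult_right_mono of_nat_mono length_filter_le assms(4))
  finally show ?thesis unfolding eq by (intro norm_triangle_le add_mono assms(2))
qed

text \<open>The splits into two non-empty lists. They only involve derivatives of lower order.\<close>

definition psplits :: "'a list \<Rightarrow> ('a list \<times> 'a list) list" where
  "psplits hs = filter (\<lambda>p. fst p \<noteq> [] \<and> snd p \<noteq> []) (splits hs)"

lemma psplits_length:
  assumes "p \<in> set (psplits hs)"
  shows "length (fst p) < length hs" "length (snd p) < length hs"
proof -
  have p: "p \<in> set (splits hs)" "fst p \<noteq> []" "snd p \<noteq> []" using assms by (auto simp: psplits_def)
  then have "length (fst p) + length (snd p) = length hs" "0 < length (fst p)" "0 < length (snd p)"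
    using splits_set [OF p(1)] by auto
  then show "length (fst p) < length hs" "length (snd p) < length hs" by linarith+
qed

lemma splits_sum_psplits:
  fixes f :: "'a list \<times> 'a list \<Rightarrow> 'b::ab_group_add"
  assumes "hs \<noteq> []"
  shows "sum_list (map f (splits hs)) = f (hs, []) + f ([], hs) + sum_list (map f (psplits hs))"
proof -
  have *: "filter (\<lambda>p. fst p = []) (filter (\<lambda>p. snd p \<noteq> []) (splits hs)) = [([], hs)]"
  proof -
    have "filter (\<lambda>p. fst p = []) (filter (\<lambda>p. snd p \<noteq> []) (splits hs)) = filter (\<lambda>p. snd p \<noteq> []) (filter (\<lambda>p. fst p = []) (splits hs))"
      by (simp add: filter_filter conj_commute)
    then show ?thesis using assms by (simp only: filter_splits_fst) simp
  qed
  have "sum_list (map f (splits hs)) = f (hs, []) + sum_list (map f (filter (\<lambda>p. snd p \<noteq> []) (splits hs)))"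
    by (subst sum_list_partition [where P = "\<lambda>p. snd p = []"]) (simp add: filter_splits_snd)
  also have "sum_list (map f (filter (\<lambda>p. snd p \<noteq> []) (splits hs))) = f ([], hs) + sum_list (map f (psplits hs))"
    by (subst sum_list_partition [where P = "\<lambda>p. fst p = []"])
      (simp only: * psplits_def, simp add: filter_filter conj_commute)
  finally show ?thesis by (simp add: add.assoc)
qed

text \<open>The equation \<open>z = b (u, z) (u, z)\<close> for an unknown \<open>z\<close> in a Banach space and a parameter \<open>u\<close> in a
  normed space that is given by a carrier. The smallness condition makes \<open>b y\<close> and \<open>\<lambda>w. b w y\<close>
  contractions with constant \<open>1/4\<close> for \<open>y\<close> in the ball of radius \<open>2 R\<close>, where the fixed point
  lies.\<close>

locale quadratic_problem =
  fixes E :: "'a::real_vector set" and N :: "'a \<Rightarrow> real" and b :: "'a \<times> 'z \<Rightarrow> 'a \<times> 'z \<Rightarrow> 'z::banach"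
    and \<beta> R :: real
  assumes E0: "0 \<in> E" and E_add: "x \<in> E \<Longrightarrow> x' \<in> E \<Longrightarrow> x + x' \<in> E" and E_scale: "x \<in> E \<Longrightarrow> r *\<^sub>R x \<in> E"
    and N_nonneg: "0 \<le> N x" and N_0: "N 0 = 0"
    and b_add1: "fst y \<in> E \<Longrightarrow> fst y' \<in> E \<Longrightarrow> fst w \<in> E \<Longrightarrow> b (y + y') w = b y w + b y' w"
    and b_add2: "fst y \<in> E \<Longrightarrow> fst y' \<in> E \<Longrightarrow> fst w \<in> E \<Longrightarrow> b w (y + y') = b w y + b w y'"
    and b_scale1: "fst y \<in> E \<Longrightarrow> fst w \<in> E \<Longrightarrow> b (r *\<^sub>R y) w = r *\<^sub>R b y w"
    and b_scale2: "fst y \<in> E \<Longrightarrow> fst w \<in> E \<Longrightarrow> b w (r *\<^sub>R y) = r *\<^sub>R b w y"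
    and b_bound: "fst y \<in> E \<Longrightarrow> fst w \<in> E \<Longrightarrow>
      norm (b y w) \<le> \<beta> * (N (fst y) + norm (snd y)) * (N (fst w) + norm (snd w))"
    and \<beta>_nonneg: "0 \<le> \<beta>" and R_pos: "0 < R" and small: "8 * R * \<beta> \<le> 1"
begin

definition pn :: "'a \<times> 'z \<Rightarrow> real" where "pn y = N (fst y) + norm (snd y)"

lemma pn_nonneg [simp]: "0 \<le> pn y"
  by (simp add: pn_def N_nonneg)

lemma E_uminus: "x \<in> E \<Longrightarrow> - x \<in> E"
  using E_scale [of x "-1"] by simp

lemma E_diff: "x \<in> E \<Longrightarrow> x' \<in> E \<Longrightarrow> x - x' \<in> E"
  using E_add [of x "- x'"] E_uminus by simp

lemma b_diff1: "fst y \<in> E \<Longrightarrow> fst y' \<in> E \<Longrightarrow> fst w \<in> E \<Longrightarrow> b (y - y') w = b y w - b y' w"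
  using b_add1 [of y "(-1) *\<^sub>R y'" w] b_scale1 [of y' w "-1"] by (simp add: E_uminus)

lemma b_diff2: "fst y \<in> E \<Longrightarrow> fst y' \<in> E \<Longrightarrow> fst w \<in> E \<Longrightarrow> b w (y - y') = b w y - b w y'"
  using b_add2 [of y "(-1) *\<^sub>R y'" w] b_scale2 [of y' w "-1"] by (simp add: E_uminus)

lemma b_pn: "fst y \<in> E \<Longrightarrow> fst w \<in> E \<Longrightarrow> norm (b y w) \<le> \<beta> * pn y * pn w"
  using b_bound by (simp add: pn_def)

lemma b_quarter1:
  assumes "fst y \<in> E" "fst w \<in> E" "pn w \<le> 2 * R" shows "norm (b y w) \<le> pn y / 4"
proof -
  have "norm (b y w) \<le> \<beta> * pn y * pn w" by (rule b_pn [OF assms(1,2)])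
  also have "\<dots> \<le> \<beta> * pn y * (2 * R)" using assms(3) by (intro mult_left_mono) (simp_all add: \<beta>_nonneg)
  also have "\<dots> = (8 * R * \<beta>) * (pn y / 4)" by simp
  also have "\<dots> \<le> 1 * (pn y / 4)" by (intro mult_right_mono small) simp
  finally show ?thesis by simp
qed

lemma b_quarter2:
  assumes "fst y \<in> E" "fst w \<in> E" "pn w \<le> 2 * R" shows "norm (b w y) \<le> pn y / 4"
proof -
  have "norm (b w y) \<le> \<beta> * pn w * pn y" by (rule b_pn [OF assms(2,1)])
  also have "\<dots> \<le> \<beta> * (2 * R) * pn y" using assms(3) by (intro mult_left_mono mult_right_mono) (simp_all add: \<beta>_nonneg)
  also have "\<dots> = (8 * R * \<beta>) * (pn y / 4)" by simp
  also have "\<dots> \<le> 1 * (pn y / 4)" by (intro mult_right_mono small) simp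
  finally show ?thesis by simp
qed

lemma pn_0z [simp]: "pn (0, z) = norm z"
  by (simp add: pn_def N_0)

definition U :: "'a set" where "U = {u \<in> E. N u < R}"

definition zsol :: "'a \<Rightarrow> 'z" where
  "zsol u = (SOME z. norm z \<le> R \<and> z = b (u, z) (u, z))"

lemma zsol:
  assumes "u \<in> U" shows "norm (zsol u) \<le> R" "zsol u = b (u, zsol u) (u, zsol u)"
proof -
  have u: "u \<in> E" "N u < R" using assms by (auto simp: U_def)
  have p: "pn (u, z) \<le> 2 * R" if "norm z \<le> R" for z using u that by (simp add: pn_def)
  have d: "b (u, z) (u, z) - b (u, z') (u, z') = b (0, z - z') (u, z) + b (u, z') (0, z - z')" for z z'
    using b_diff1 [of "(u, z)" "(u, z')" "(u, z)"] b_diff2 [of "(u, z)" "(u, z')" "(u, z')"] u by simp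
  have "\<exists>!z\<in>cball 0 R. b (u, z) (u, z) = z"
  proof (rule Banach_fix [OF iffD2 [OF complete_eq_closed closed_cball]])
    show "cball (0::'z) R \<noteq> {}" using R_pos by auto
    show "(\<lambda>z. b (u, z) (u, z)) ` cball 0 R \<subseteq> cball 0 R"
    proof (rule image_subsetI)
      fix z assume "z \<in> cball (0::'z) R"
      then have "pn (u, z) \<le> 2 * R" by (intro p) simp
      then have "norm (b (u, z) (u, z)) \<le> R"
        using b_quarter1 [of "(u, z)" "(u, z)"] u R_pos by simp
      then show "b (u, z) (u, z) \<in> cball 0 R" by simp
    qed
    fix z z' assume z: "z \<in> cball (0::'z) R" and z': "z' \<in> cball (0::'z) R"
    show "dist (b (u, z) (u, z)) (b (u, z') (u, z')) \<le> (1/2) * dist z z'"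
      unfolding dist_norm d
      using norm_triangle_le [OF add_mono [OF b_quarter1 [of "(0, z - z')" "(u, z)"] b_quarter2 [of "(0, z - z')" "(u, z')"]]]
        p z z' u E0 by simp
  qed auto
  then obtain z where z: "z \<in> cball 0 R" and eq: "b (u, z) (u, z) = z" by blast
  have "norm z \<le> R" using z by simp
  then have "\<exists>z. norm z \<le> R \<and> z = b (u, z) (u, z)" using eq [symmetric] by blast
  from someI_ex [OF this] show "norm (zsol u) \<le> R" "zsol u = b (u, zsol u) (u, zsol u)"
    unfolding zsol_def [symmetric] by blast+
qed

text \<open>The solution of the linearised equation with inhomogeneity \<open>c\<close>.\<close>

definition lin :: "'a \<times> 'z \<Rightarrow> 'z \<Rightarrow> 'z" where
  "lin y c = (SOME w. w = c + b y (0, w) + b (0, w) y)"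

lemma lin:
  assumes "fst y \<in> E" "pn y \<le> 2 * R"
  shows "lin y c = c + b y (0, lin y c) + b (0, lin y c) y"
proof -
  have d: "(c + b y (0, w) + b (0, w) y) - (c + b y (0, w') + b (0, w') y) = b y (0, w - w') + b (0, w - w') y" for w w'
    using b_diff1 [of "(0, w)" "(0, w')" y] b_diff2 [of "(0, w)" "(0, w')" y] assms E0 by simp
  have "\<exists>!w\<in>UNIV. c + b y (0, w) + b (0, w) y = w"
  proof (rule Banach_fix [OF complete_UNIV])
    fix w w'
    show "dist (c + b y (0, w) + b (0, w) y) (c + b y (0, w') + b (0, w') y) \<le> (1/2) * dist w w'"
      unfolding dist_norm d
      using norm_triangle_le [OF add_mono [OF b_quarter2 [of "(0, w - w')" y] b_quarter1 [of "(0, w - w')" y]]] assms E0 by simp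
  qed auto
  then obtain w where eq: "c + b y (0, w) + b (0, w) y = w" by blast
  have "\<exists>w. w = c + b y (0, w) + b (0, w) y" using eq [symmetric] by blast
  from someI_ex [OF this] show ?thesis unfolding lin_def [symmetric] .
qed

text \<open>The derivatives of the identity, that is, of the first component of \<open>\<lambda>u. (u, zsol u)\<close>.\<close>

definition lead :: "'a \<Rightarrow> 'a list \<Rightarrow> 'a" where
  "lead u hs = (if hs = [] then u else if length hs = 1 then hd hs else 0)"

text \<open>The derivative of \<open>zsol\<close> at \<open>u\<close> in the directions \<open>hs\<close>. Differentiating the quadratic equation
  gives a sum over all splits of \<open>hs\<close>; the two splits with an empty part contain the unknown
  derivative and form the linear operator that \<open>lin\<close> inverts.\<close>

function der :: "'a \<Rightarrow> 'a list \<Rightarrow> 'z" where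
  "der u hs = (if hs = [] then zsol u else
     lin (u, zsol u) (b (lead u hs, 0) (u, zsol u) + b (u, zsol u) (lead u hs, 0) +
       sum_list (map (\<lambda>p. b (lead u (fst p), der u (fst p)) (lead u (snd p), der u (snd p))) (psplits hs))))"
  by auto
termination
  by (relation "Wellfounded.measure (\<lambda>(u, hs). length hs)") (auto simp: psplits_length)

declare der.simps [simp del]

definition Y :: "'a \<Rightarrow> 'a list \<Rightarrow> 'a \<times> 'z" where "Y u hs = (lead u hs, der u hs)"

lemma der_Nil: "der u [] = zsol u"
  by (subst der.simps) simp

lemma Y_Nil: "Y u [] = (u, zsol u)"
  by (simp add: Y_def der_Nil lead_def)

lemma fst_Y:
  assumes "u \<in> U" "set hs \<subseteq> E" shows "fst (Y u hs) \<in> E"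
  using assms E0 by (cases hs) (auto simp: Y_def lead_def U_def)

lemma pn_Y_Nil: "u \<in> U \<Longrightarrow> pn (Y u []) \<le> 2 * R"
  using zsol(1) [of u] by (simp add: Y_Nil pn_def U_def)

lemma der_eq:
  assumes u: "u \<in> U" and hs: "set hs \<subseteq> E"
  shows "der u hs = sum_list (map (\<lambda>p. b (Y u (fst p)) (Y u (snd p))) (splits hs))"
proof (cases "hs = []")
  case True then show ?thesis using zsol(2) [OF u] by (simp add: Y_Nil der_Nil)
next
  case False
  have uE: "u \<in> E" using u by (simp add: U_def)
  have y0: "fst (u, zsol u) \<in> E" "pn (u, zsol u) \<le> 2 * R"
    using pn_Y_Nil [OF u] uE by (auto simp: Y_Nil)
  have l: "lead u hs \<in> E" using fst_Y [OF u hs] by (simp add: Y_def)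
  define c where "c = b (lead u hs, 0) (u, zsol u) + b (u, zsol u) (lead u hs, 0) +
       sum_list (map (\<lambda>p. b (Y u (fst p)) (Y u (snd p))) (psplits hs))"
  have d: "der u hs = lin (u, zsol u) c"
    using False by (subst der.simps) (simp add: c_def Y_def)
  have "der u hs = c + b (u, zsol u) (0, der u hs) + b (0, der u hs) (u, zsol u)"
    unfolding d by (rule lin [OF y0])
  moreover have "b (Y u hs) (u, zsol u) = b (lead u hs, 0) (u, zsol u) + b (0, der u hs) (u, zsol u)"
    using b_add1 [of "(lead u hs, 0)" "(0, der u hs)" "(u, zsol u)"] l E0 uE by (simp add: Y_def)
  moreover have "b (u, zsol u) (Y u hs) = b (u, zsol u) (lead u hs, 0) + b (u, zsol u) (0, der u hs)"
    using b_add2 [of "(lead u hs, 0)" "(0, der u hs)" "(u, zsol u)"] l E0 uE by (simp add: Y_def)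
  ultimately show ?thesis
    unfolding splits_sum_psplits [OF False] c_def by (simp add: Y_Nil algebra_simps)
qed

lemma prod_nonneg: "0 \<le> prod_list (map N hs)"
  by (induction hs) (auto simp: N_nonneg)

text \<open>Induction on the order: the two splits with an empty part contribute at most half of the
  left-hand side and are absorbed, the others are products of derivatives of lower order.\<close>

lemma Y_bound:
  "\<exists>K\<ge>0. \<forall>u\<in>U. \<forall>hs. set hs \<subseteq> E \<longrightarrow> length hs \<le> n \<longrightarrow> pn (Y u hs) \<le> K * prod_list (map N hs)"
proof (induction n)
  case 0
  then show ?case using pn_Y_Nil R_pos by (intro exI [of _ "2 * R"]) auto
next
  case (Suc n)
  then obtain K where K: "0 \<le> K" "\<And>u hs. u \<in> U \<Longrightarrow> set hs \<subseteq> E \<Longrightarrow> length hs \<le> n \<Longrightarrow> pn (Y u hs) \<le> K * prod_list (map N hs)"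
    by blast
  define K' where "K' = K + 2 * (1 + 2 ^ Suc n * (\<beta> * K * K))"
  have "pn (Y u hs) \<le> K' * prod_list (map N hs)" if u: "u \<in> U" and hs: "set hs \<subseteq> E" and len: "length hs \<le> Suc n" for u hs
  proof (cases "length hs \<le> n")
    case True
    have "K \<le> K'" using K(1) \<beta>_nonneg by (simp add: K'_def)
    then show ?thesis using K(2) [OF u hs True] mult_right_mono [OF _ prod_nonneg, of K K' hs] by linarith
  next
    case False
    then have len: "length hs = Suc n" and ne: "hs \<noteq> []" using len by auto
    let ?P = "prod_list (map N hs)"
    have P: "0 \<le> ?P" by (rule prod_nonneg)
    let ?f = "\<lambda>p. b (Y u (fst p)) (Y u (snd p))"
    have uE: "fst (Y u []) \<in> E" using fst_Y [OF u, of "[]"] by simp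
    have 1: "norm (?f (hs, [])) \<le> pn (Y u hs) / 4" "norm (?f ([], hs)) \<le> pn (Y u hs) / 4"
      using b_quarter1 [OF fst_Y [OF u hs] uE pn_Y_Nil [OF u]] b_quarter2 [OF fst_Y [OF u hs] uE pn_Y_Nil [OF u]] by simp_all
    have 2: "norm (sum_list (map ?f (psplits hs))) \<le> real (length (psplits hs)) * (\<beta> * K * K * ?P)"
    proof (rule norm_sum_list_le)
      fix p assume p: "p \<in> set (psplits hs)"
      then have ps: "p \<in> set (splits hs)" by (simp add: psplits_def)
      have s: "set (fst p) \<subseteq> E" "set (snd p) \<subseteq> E" using splits_set [OF ps] hs by auto
      have l: "length (fst p) \<le> n" "length (snd p) \<le> n" using psplits_length [OF p] len by auto
      have "norm (?f p) \<le> \<beta> * pn (Y u (fst p)) * pn (Y u (snd p))" by (intro b_pn fst_Y u s)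
      also have "\<dots> \<le> \<beta> * (K * prod_list (map N (fst p))) * (K * prod_list (map N (snd p)))"
        by (intro mult_mono mult_left_mono mult_nonneg_nonneg K u s l prod_nonneg \<beta>_nonneg pn_nonneg order_refl)
      also have "\<dots> = \<beta> * K * K * (prod_list (map N (fst p)) * prod_list (map N (snd p)))" by simp
      finally show "norm (?f p) \<le> \<beta> * K * K * ?P" by (simp only: splits_prod [OF ps])
    qed
    also have "\<dots> \<le> 2 ^ Suc n * (\<beta> * K * K * ?P)"
    proof (rule mult_right_mono)
      have "length (psplits hs) \<le> 2 ^ Suc n"
        unfolding psplits_def using length_filter_le [of _ "splits hs"] by (simp add: length_splits len)
      then show "real (length (psplits hs)) \<le> 2 ^ Suc n"
        using of_nat_mono [of "length (psplits hs)" "2 ^ Suc n"] by (simp del: power_Suc)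
    qed (use K(1) \<beta>_nonneg P in simp)
    finally have 2: "norm (sum_list (map ?f (psplits hs))) \<le> 2 ^ Suc n * (\<beta> * K * K * ?P)" .
    have "norm (der u hs) \<le> pn (Y u hs) / 4 + pn (Y u hs) / 4 + 2 ^ Suc n * (\<beta> * K * K * ?P)"
      unfolding der_eq [OF u hs] splits_sum_psplits [OF ne]
      by (intro norm_triangle_le add_mono 1 2)
    moreover have "N (lead u hs) \<le> ?P"
    proof (cases "length hs = 1")
      case True
      then obtain h where "hs = [h]" by (cases hs) auto
      then show ?thesis by (simp add: lead_def)
    next
      case False
      then show ?thesis using ne P by (simp add: lead_def N_0)
    qed
    ultimately have "pn (Y u hs) \<le> 2 * (?P + 2 ^ Suc n * (\<beta> * K * K * ?P))"
      unfolding pn_def Y_def fst_conv snd_conv by (rule absorb1)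
    also have "\<dots> = 2 * (1 + 2 ^ Suc n * (\<beta> * K * K)) * ?P" by (simp add: algebra_simps)
    also have "\<dots> \<le> K' * ?P" using K(1) P by (intro mult_right_mono) (simp_all add: K'_def)
    finally show ?thesis .
  qed
  moreover have "0 \<le> K'" using K(1) \<beta>_nonneg by (simp add: K'_def)
  ultimately show ?case by blast
qed

lemma sum_list_cong: "(\<And>p. p \<in> set l \<Longrightarrow> f p = g p) \<Longrightarrow> sum_list (map f l) = sum_list (map g l)"
  by (induction l) auto

lemma sum_list_diffs:
  fixes f g :: "'b \<Rightarrow> 'z"
  shows "sum_list (map f l) - sum_list (map g l) = sum_list (map (\<lambda>p. f p - g p) l)"
  by (induction l) auto

text \<open>The common estimate behind multilinearity, Lipschitz continuity and the remainder. Each of these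
  expressions, as a family \<open>X\<close> indexed by the list of directions, solves a linear hierarchy with
  source \<open>r\<close>; if the source and the first components are of size \<open>e\<close> times the product of the
  norms, so is the solution. The lists range over an arbitrary family \<open>G\<close> that is closed under
  splitting, and their entries over an arbitrary type: for multilinearity they are positions
  instead of vectors.\<close>

lemma stability:
  fixes X y y' :: "'i list \<Rightarrow> 'a \<times> 'z" and r :: "'i list \<Rightarrow> 'z" and w :: "'i \<Rightarrow> real"
  assumes G: "\<And>A p. G A \<Longrightarrow> p \<in> set (splits A) \<Longrightarrow> G (fst p) \<and> G (snd p)"
    and E: "\<And>A. G A \<Longrightarrow> fst (X A) \<in> E \<and> fst (y A) \<in> E \<and> fst (y' A) \<in> E"
    and y0: "pn (y []) \<le> 2 * R" "pn (y' []) \<le> 2 * R" and nn: "\<And>i. 0 \<le> w i" "0 \<le> K" "0 \<le> e"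
    and y: "\<And>A. G A \<Longrightarrow> length A \<le> n \<Longrightarrow> pn (y A) \<le> K * prod_list (map w A)"
    and y': "\<And>A. G A \<Longrightarrow> length A \<le> n \<Longrightarrow> pn (y' A) \<le> K * prod_list (map w A)"
    and eq: "\<And>A. G A \<Longrightarrow> length A \<le> n \<Longrightarrow>
      snd (X A) = r A + (\<Sum>p\<leftarrow>splits A. b (X (fst p)) (y' (snd p)) + b (y (fst p)) (X (snd p)))"
    and r: "\<And>A. G A \<Longrightarrow> length A \<le> n \<Longrightarrow> N (fst (X A)) + norm (r A) \<le> e * prod_list (map w A)"
    and A: "G A" "length A \<le> n"
  shows "pn (X A) \<le> (2 + 2 ^ (n + 2) * (\<beta> * K)) ^ Suc (length A) * (e * prod_list (map w A))"
  using A
proof (induction "length A" arbitrary: A rule: less_induct)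
  case less
  \<comment> \<open>Absorbing half of the left-hand side doubles the other terms; \<open>2\<^sup>n\<close> bounds the number of splits.\<close>
  define D where "D = 2 + 2 ^ (n + 2) * (\<beta> * K)"
  define P where "P A = prod_list (map w A)" for A
  have P: "0 \<le> P A" for A unfolding P_def by (induction A) (auto simp: nn)
  have PP: "P (fst p) * P (snd p) = P A" if "p \<in> set (splits A)" for p
    unfolding P_def by (rule splits_prod [OF that])
  have D: "1 \<le> D" using nn \<beta>_nonneg by (simp add: D_def add_increasing2)
  define Q where "Q = \<beta> * K * (D ^ length A * (e * P A))"
  have Q: "0 \<le> Q" using D nn P \<beta>_nonneg by (simp add: Q_def)
  have len: "real (length (splits A)) * Q \<le> 2 ^ n * Q"
    using less.prems(2) Q by (intro mult_right_mono) (simp_all add: length_splits)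
  have G0: "G []" using G [OF less.prems(1), of "(A, [])"] splits_mem [of A] by simp
  have X: "pn (X B) * (K * P C) \<le> K * (D ^ length A * (e * P A))"
    if B: "G B" "length B < length A" and PBC: "P B * P C = P A" for B C
  proof -
    have "pn (X B) \<le> D ^ Suc (length B) * (e * P B)"
      unfolding D_def P_def by (rule less.hyps) (use B less.prems in auto)
    also have "\<dots> \<le> D ^ length A * (e * P B)"
      using B(2) D nn P by (intro mult_right_mono power_increasing) auto
    finally have "pn (X B) * (K * P C) \<le> D ^ length A * (e * P B) * (K * P C)"
      using nn P by (intro mult_right_mono) auto
    also have "\<dots> = K * (D ^ length A * (e * (P B * P C)))" by simp
    finally show ?thesis unfolding PBC .
  qed
  have 1: "norm (\<Sum>p\<leftarrow>splits A. b (X (fst p)) (y' (snd p))) \<le> pn (X A) / 4 + real (length (splits A)) * Q"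
  proof (rule norm_sum_list_split_off [OF filter_splits_snd _ _ Q])
    show "norm (b (X (fst (A, []))) (y' (snd (A, [])))) \<le> pn (X A) / 4"
      using b_quarter1 [of "X A" "y' []"] E [OF less.prems(1)] E [OF G0] y0 by simp
    fix p assume p: "p \<in> set (splits A)" "snd p \<noteq> []"
    note g = G [OF less.prems(1) p(1)] and s = splits_set [OF p(1)]
    have l: "length (fst p) < length A" "length (snd p) \<le> n"
      using s p(2) less.prems(2) length_greater_0_conv [of "snd p"] by (auto simp del: length_greater_0_conv)
    have "norm (b (X (fst p)) (y' (snd p))) \<le> \<beta> * (pn (X (fst p)) * pn (y' (snd p)))"
      using b_pn [of "X (fst p)" "y' (snd p)"] E g by (simp add: mult.assoc)
    also have "\<dots> \<le> \<beta> * (pn (X (fst p)) * (K * P (snd p)))"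
      unfolding P_def using y' g l by (intro mult_left_mono \<beta>_nonneg pn_nonneg) auto
    also have "\<dots> \<le> \<beta> * (K * (D ^ length A * (e * P A)))"
      using g l PP [OF p(1)] by (intro mult_left_mono \<beta>_nonneg X) auto
    finally show "norm (b (X (fst p)) (y' (snd p))) \<le> Q" by (simp add: Q_def mult.assoc)
  qed
  have 2: "norm (\<Sum>p\<leftarrow>splits A. b (y (fst p)) (X (snd p))) \<le> pn (X A) / 4 + real (length (splits A)) * Q"
  proof (rule norm_sum_list_split_off [OF filter_splits_fst _ _ Q])
    show "norm (b (y (fst ([], A))) (X (snd ([], A)))) \<le> pn (X A) / 4"
      using b_quarter2 [of "X A" "y []"] E [OF less.prems(1)] E [OF G0] y0 by simp
    fix p assume p: "p \<in> set (splits A)" "fst p \<noteq> []"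
    note g = G [OF less.prems(1) p(1)] and s = splits_set [OF p(1)]
    have l: "length (snd p) < length A" "length (fst p) \<le> n"
      using s p(2) less.prems(2) length_greater_0_conv [of "fst p"] by (auto simp del: length_greater_0_conv)
    have "norm (b (y (fst p)) (X (snd p))) \<le> \<beta> * (pn (X (snd p)) * pn (y (fst p)))"
      using b_pn [of "y (fst p)" "X (snd p)"] E g by (simp add: mult_ac)
    also have "\<dots> \<le> \<beta> * (pn (X (snd p)) * (K * P (fst p)))"
      unfolding P_def using y g l by (intro mult_left_mono \<beta>_nonneg pn_nonneg) auto
    also have "\<dots> \<le> \<beta> * (K * (D ^ length A * (e * P A)))"
      using g l PP [OF p(1)] by (intro mult_left_mono \<beta>_nonneg X) (auto simp: mult.commute)
    finally show "norm (b (y (fst p)) (X (snd p))) \<le> Q" by (simp add: Q_def mult.assoc)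
  qed
  have sn: "norm (snd (X A)) \<le> norm (r A) + ((pn (X A) / 4 + 2 ^ n * Q) + (pn (X A) / 4 + 2 ^ n * Q))"
    unfolding eq [OF less.prems] sum_list_addf
    by (intro norm_triangle_le add_mono order_refl order_trans [OF 1] order_trans [OF 2] len)
  have "N (fst (X A)) + norm (r A) \<le> e * P A" unfolding P_def by (rule r [OF less.prems])
  then have "pn (X A) \<le> 2 * (e * P A) + 4 * (2 ^ n * Q)" using sn unfolding pn_def [of "X A"] by (rule absorb2)
  also have "\<dots> \<le> 2 * (D ^ length A * (e * P A)) + 4 * (2 ^ n * Q)"
    using mult_right_mono [of 1 "D ^ length A" "e * P A"] D nn P by (simp add: one_le_power)
  also have "\<dots> = D ^ Suc (length A) * (e * P A)" by (simp add: D_def Q_def algebra_simps)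
  finally show ?case unfolding D_def P_def .
qed

lemma power_const_mono:
  fixes D q :: real assumes "1 \<le> D" "m \<le> n" "0 \<le> q" shows "D ^ m * q \<le> D ^ n * q"
  using assms by (intro mult_right_mono power_increasing)

lemma set_splits_E: "set A \<subseteq> E \<Longrightarrow> p \<in> set (splits A) \<Longrightarrow> set (fst p) \<subseteq> E \<and> set (snd p) \<subseteq> E"
  using splits_set [of p A] by auto

lemma Y_lipschitz:
  "\<exists>K\<ge>0. \<forall>u\<in>U. \<forall>h\<in>E. u + h \<in> U \<longrightarrow> (\<forall>hs. set hs \<subseteq> E \<longrightarrow> length hs \<le> n \<longrightarrow>
     pn (Y (u + h) hs - Y u hs) \<le> K * N h * prod_list (map N hs))"
proof -
  obtain K where K: "0 \<le> K" "\<And>u hs. u \<in> U \<Longrightarrow> set hs \<subseteq> E \<Longrightarrow> length hs \<le> n \<Longrightarrow> pn (Y u hs) \<le> K * prod_list (map N hs)"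
    using Y_bound [of n] by blast
  let ?D = "2 + 2 ^ (n + 2) * (\<beta> * K)"
  have D: "1 \<le> ?D" using K \<beta>_nonneg by (simp add: add_increasing2)
  have "pn (Y (u + h) hs - Y u hs) \<le> ?D ^ Suc n * N h * prod_list (map N hs)"
    if u: "u \<in> U" and h: "h \<in> E" and uh: "u + h \<in> U" and hs: "set hs \<subseteq> E" "length hs \<le> n" for u h hs
  proof -
    have "pn (Y (u + h) hs - Y u hs) \<le> ?D ^ Suc (length hs) * (N h * prod_list (map N hs))"
    proof (rule stability [where G = "\<lambda>A. set A \<subseteq> E" and X = "\<lambda>A. Y (u + h) A - Y u A" and y = "Y u" and y' = "Y (u + h)" and r = "\<lambda>_. 0",
          OF set_splits_E _ pn_Y_Nil [OF u] pn_Y_Nil [OF uh] N_nonneg K(1) N_nonneg K(2) [OF u] K(2) [OF uh] _ _ hs])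
      show "fst (Y (u + h) A - Y u A) \<in> E \<and> fst (Y u A) \<in> E \<and> fst (Y (u + h) A) \<in> E" if "set A \<subseteq> E" for A
        using fst_Y [OF u that] fst_Y [OF uh that] E_diff by simp
      show "N (fst (Y (u + h) A - Y u A)) + norm (0::'z) \<le> N h * prod_list (map N A)" for A
        using prod_nonneg [of A] N_nonneg [of h] by (cases "A = []") (simp_all add: Y_def lead_def N_0)
      fix A assume A: "set A \<subseteq> E"
      show "snd (Y (u + h) A - Y u A) = 0 + (\<Sum>p\<leftarrow>splits A. b (Y (u + h) (fst p) - Y u (fst p)) (Y (u + h) (snd p))
          + b (Y u (fst p)) (Y (u + h) (snd p) - Y u (snd p)))"
      proof -
        have "snd (Y (u + h) A - Y u A) = der (u + h) A - der u A" by (simp add: Y_def)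
        also have "\<dots> = (\<Sum>p\<leftarrow>splits A. b (Y (u + h) (fst p) - Y u (fst p)) (Y (u + h) (snd p))
          + b (Y u (fst p)) (Y (u + h) (snd p) - Y u (snd p)))"
          unfolding der_eq [OF u A] der_eq [OF uh A] sum_list_diffs
        proof (rule sum_list_cong)
          fix p assume "p \<in> set (splits A)"
          note s = set_splits_E [OF A this]
          note f = fst_Y [OF uh conjunct1 [OF s]] fst_Y [OF uh conjunct2 [OF s]] fst_Y [OF u conjunct1 [OF s]] fst_Y [OF u conjunct2 [OF s]]
          show "b (Y (u + h) (fst p)) (Y (u + h) (snd p)) - b (Y u (fst p)) (Y u (snd p)) =
            b (Y (u + h) (fst p) - Y u (fst p)) (Y (u + h) (snd p)) + b (Y u (fst p)) (Y (u + h) (snd p) - Y u (snd p))"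
            by (simp add: b_diff1 b_diff2 f)
        qed
        finally show ?thesis by simp
      qed
    qed
    also have "\<dots> \<le> ?D ^ Suc n * (N h * prod_list (map N hs))"
      by (intro power_const_mono D) (use hs N_nonneg prod_nonneg in auto)
    finally show ?thesis by (simp add: mult.assoc)
  qed
  moreover have "0 \<le> ?D ^ Suc n" using D by simp
  ultimately show ?thesis by blast
qed

text \<open>Expanding \<open>b (Y (u + h)) (Y (u + h))\<close> around \<open>u\<close>, the remainder solves the hierarchy with source
  \<open>\<Sum> b (Y u (h # A)) (Y (u + h) B - Y u B)\<close>, which is quadratic in \<open>h\<close> by the Lipschitz estimate.\<close>

lemma Y_remainder:
  "\<exists>K\<ge>0. \<forall>u\<in>U. \<forall>h\<in>E. u + h \<in> U \<longrightarrow> (\<forall>hs. set hs \<subseteq> E \<longrightarrow> length hs \<le> n \<longrightarrow>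
     pn (Y (u + h) hs - Y u hs - Y u (h # hs)) \<le> K * (N h)\<^sup>2 * prod_list (map N hs))"
proof -
  obtain L where L: "0 \<le> L" "\<And>u h hs. u \<in> U \<Longrightarrow> h \<in> E \<Longrightarrow> u + h \<in> U \<Longrightarrow> set hs \<subseteq> E \<Longrightarrow> length hs \<le> n \<Longrightarrow>
     pn (Y (u + h) hs - Y u hs) \<le> L * N h * prod_list (map N hs)" using Y_lipschitz [of n] by blast
  obtain K where K: "0 \<le> K" "\<And>u hs. u \<in> U \<Longrightarrow> set hs \<subseteq> E \<Longrightarrow> length hs \<le> Suc n \<Longrightarrow> pn (Y u hs) \<le> K * prod_list (map N hs)"
    using Y_bound [of "Suc n"] by blast
  let ?D = "2 + 2 ^ (n + 2) * (\<beta> * K)"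
  have D: "1 \<le> ?D" using K \<beta>_nonneg by (simp add: add_increasing2)
  let ?c = "2 ^ n * (\<beta> * K * L)"
  have c0: "0 \<le> ?c" using K L \<beta>_nonneg by simp
  have "pn (Y (u + h) hs - Y u hs - Y u (h # hs)) \<le> (?D ^ Suc n * ?c) * (N h)\<^sup>2 * prod_list (map N hs)"
    if u: "u \<in> U" and h: "h \<in> E" and uh: "u + h \<in> U" and hs: "set hs \<subseteq> E" "length hs \<le> n" for u h hs
  proof -
    define r where "r A = (\<Sum>p\<leftarrow>splits A. b (Y u (h # fst p)) (Y (u + h) (snd p) - Y u (snd p)))" for A
    define X where "X A = Y (u + h) A - Y u A - Y u (h # A)" for A
    have hA: "set (h # A) \<subseteq> E" if "set A \<subseteq> E" for A using that h by simp
    have lead: "fst (X A) = 0" for A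
      by (cases A) (auto simp: X_def Y_def lead_def)
    have "pn (X hs) \<le> ?D ^ Suc (length hs) * ((?c * (N h)\<^sup>2) * prod_list (map N hs))"
    proof (rule stability [where G = "\<lambda>A. set A \<subseteq> E" and X = X and y = "Y u" and y' = "Y (u + h)" and r = r,
          OF set_splits_E _ pn_Y_Nil [OF u] pn_Y_Nil [OF uh] N_nonneg K(1) _ K(2) [OF u] K(2) [OF uh] _ _ hs])
      show "fst (X A) \<in> E \<and> fst (Y u A) \<in> E \<and> fst (Y (u + h) A) \<in> E" if "set A \<subseteq> E" for A
        using fst_Y [OF u that] fst_Y [OF uh that] lead E0 by simp
      show "0 \<le> ?c * (N h)\<^sup>2" by (rule mult_nonneg_nonneg [OF c0 zero_le_power2])
      fix A assume A: "set A \<subseteq> E" "length A \<le> n"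
      have "norm (r A) \<le> real (length (splits A)) * (\<beta> * K * L * (N h)\<^sup>2 * prod_list (map N A))"
        unfolding r_def
      proof (rule norm_sum_list_le)
        fix p assume p: "p \<in> set (splits A)"
        then have s: "set (fst p) \<subseteq> E" "set (snd p) \<subseteq> E" and l: "length (h # fst p) \<le> Suc n" "length (snd p) \<le> n"
          using splits_set [OF p] A by auto
        have "fst (Y (u + h) (snd p) - Y u (snd p)) \<in> E" using fst_Y [OF u s(2)] fst_Y [OF uh s(2)] by (simp add: E_diff)
        then have "norm (b (Y u (h # fst p)) (Y (u + h) (snd p) - Y u (snd p))) \<le> \<beta> * pn (Y u (h # fst p)) * pn (Y (u + h) (snd p) - Y u (snd p))"
          by (intro b_pn fst_Y [OF u hA [OF s(1)]])
        also have "\<dots> \<le> \<beta> * (K * (N h * prod_list (map N (fst p)))) * (L * N h * prod_list (map N (snd p)))"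
          using K(2) [OF u hA [OF s(1)] l(1)]
          by (intro mult_mono mult_left_mono mult_nonneg_nonneg K(1) L(1) L(2) [OF u h uh s(2) l(2)] prod_nonneg \<beta>_nonneg pn_nonneg N_nonneg) simp
        also have "\<dots> = \<beta> * K * L * (N h)\<^sup>2 * (prod_list (map N (fst p)) * prod_list (map N (snd p)))" by (simp add: power2_eq_square)
        finally show "norm (b (Y u (h # fst p)) (Y (u + h) (snd p) - Y u (snd p))) \<le> \<beta> * K * L * (N h)\<^sup>2 * prod_list (map N A)"
          by (simp only: splits_prod [OF p])
      qed
      also have "\<dots> \<le> 2 ^ n * (\<beta> * K * L * (N h)\<^sup>2 * prod_list (map N A))"
        using A(2) K(1) L(1) \<beta>_nonneg prod_nonneg [of A] by (intro mult_right_mono) (simp_all add: length_splits)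
      finally show "N (fst (X A)) + norm (r A) \<le> ?c * (N h)\<^sup>2 * prod_list (map N A)"
        by (simp add: lead N_0 mult.assoc)
      have "snd (X A) = der (u + h) A - der u A - der u (h # A)" by (simp add: X_def Y_def)
      also have "der u (h # A) = (\<Sum>p\<leftarrow>splits A. b (Y u (h # fst p)) (Y u (snd p)) + b (Y u (fst p)) (Y u (h # snd p)))"
        unfolding der_eq [OF u hA [OF A(1)]] by (simp add: sum_list_addf o_def case_prod_unfold)
      also have "der (u + h) A - der u A - \<dots> = (\<Sum>p\<leftarrow>splits A. b (Y u (h # fst p)) (Y (u + h) (snd p) - Y u (snd p)) +
          (b (X (fst p)) (Y (u + h) (snd p)) + b (Y u (fst p)) (X (snd p))))"
        unfolding der_eq [OF u A(1)] der_eq [OF uh A(1)] sum_list_diffs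
      proof (rule sum_list_cong)
        fix p assume "p \<in> set (splits A)"
        note s = set_splits_E [OF A(1) this]
        note s1 = conjunct1 [OF s] and s2 = conjunct2 [OF s]
        note f = fst_Y [OF u s1] fst_Y [OF u s2] fst_Y [OF uh s1] fst_Y [OF uh s2] fst_Y [OF u hA [OF s1]] fst_Y [OF u hA [OF s2]]
        show "b (Y (u + h) (fst p)) (Y (u + h) (snd p)) - b (Y u (fst p)) (Y u (snd p)) -
          (b (Y u (h # fst p)) (Y u (snd p)) + b (Y u (fst p)) (Y u (h # snd p))) =
          b (Y u (h # fst p)) (Y (u + h) (snd p) - Y u (snd p)) +
          (b (X (fst p)) (Y (u + h) (snd p)) + b (Y u (fst p)) (X (snd p)))"
          unfolding X_def by (simp add: b_diff1 b_diff2 f E_diff)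
      qed
      finally show "snd (X A) = r A + (\<Sum>p\<leftarrow>splits A. b (X (fst p)) (Y (u + h) (snd p)) + b (Y u (fst p)) (X (snd p)))"
        by (simp only: r_def sum_list_addf)
    qed simp_all
    also have "\<dots> \<le> ?D ^ Suc n * ((?c * (N h)\<^sup>2) * prod_list (map N hs))"
      by (intro power_const_mono D mult_nonneg_nonneg c0 prod_nonneg) (use hs in auto)
    finally show ?thesis by (simp only: X_def mult.assoc)
  qed
  moreover have "0 \<le> ?D ^ Suc n * ?c" using D by (intro mult_nonneg_nonneg c0 zero_le_power) simp
  ultimately show ?thesis by blast
qed

text \<open>The vectors are replaced by their positions, so that the three lists have the same splits. Only
  sublists containing the position \<open>m\<close> of the linear combination matter, and of the two parts of a
  split exactly one does. The defect from linearity then solves the hierarchy without source,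
  hence vanishes.\<close>

lemma Y_multilinear:
  assumes u: "u \<in> U" and E: "set hs \<subseteq> E" "h \<in> E" "k \<in> E" "set ks \<subseteq> E"
  shows "Y u (hs @ (a *\<^sub>R h + c *\<^sub>R k) # ks) = a *\<^sub>R Y u (hs @ h # ks) + c *\<^sub>R Y u (hs @ k # ks)"
proof -
  let ?z = "a *\<^sub>R h + c *\<^sub>R k"
  define n where "n = Suc (length hs + length ks)"
  define m where "m = length hs"
  define g where "g x i = (hs @ x # ks) ! i" for x i
  define G where "G A \<longleftrightarrow> distinct A \<and> set A \<subseteq> {..<n}" for A :: "nat list"
  have gm: "g x m = x" for x by (simp add: g_def m_def)
  have same: "map (g x) A = map (g h) A" if "m \<notin> set A" for x A
    using that by (auto simp: g_def m_def nth_append nth_Cons split: nat.splits)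
  have gE: "set (map (g x) A) \<subseteq> E" if "G A" "x \<in> E" for x A
  proof -
    have "g x i \<in> E" if "i < n" for i
    proof -
      have "g x i \<in> set (hs @ x # ks)" unfolding g_def by (rule nth_mem) (use that in \<open>simp add: n_def\<close>)
      then show ?thesis using E \<open>x \<in> E\<close> by auto
    qed
    then show ?thesis using that(1) by (auto simp: G_def)
  qed
  have zE: "?z \<in> E" using E by (intro E_add E_scale)
  define F where "F x A = Y u (map (g x) A)" for x A
  have FE: "fst (F x A) \<in> E" if "G A" "x \<in> E" for x A
    unfolding F_def by (rule fst_Y [OF u gE [OF that]])
  define X where "X A = (if m \<in> set A then F ?z A - a *\<^sub>R F h A - c *\<^sub>R F k A else 0)" for A
  have lead0: "fst (X A) = 0" for A
    by (cases A) (auto simp: X_def F_def Y_def lead_def gm)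
  obtain K where K: "0 \<le> K" "\<And>hs. set hs \<subseteq> E \<Longrightarrow> length hs \<le> n \<Longrightarrow> pn (Y u hs) \<le> K * prod_list (map N hs)"
    using Y_bound [of n] u by blast
  have KF: "pn (F h A) \<le> K * prod_list (map (\<lambda>i. N (g h i)) A)" if "G A" "length A \<le> n" for A
    using K(2) [OF gE [OF that(1) E(2)]] that(2) by (simp add: F_def o_def)
  have b0: "b 0 y = 0" "b y 0 = 0" if "fst y \<in> E" for y
    using b_scale1 [of y y 0] b_scale2 [of y y 0] that by simp_all
  have Gs: "G (fst p) \<and> G (snd p)" if "G A" "p \<in> set (splits A)" for A p
    using splits_distinct [of A p] splits_set [OF that(2)] that by (auto simp: G_def)
  have F0: "pn (F h []) \<le> 2 * R" using pn_Y_Nil [OF u] by (simp add: F_def)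
  have GA: "G [0..<n]" by (auto simp: G_def)
  have "pn (X [0..<n]) \<le> (2 + 2 ^ (n + 2) * (\<beta> * K)) ^ Suc (length [0..<n]) * (0 * prod_list (map (\<lambda>i. N (g h i)) [0..<n]))"
  proof (rule stability [where G = G and r = "\<lambda>_. 0" and y = "F h" and y' = "F h", OF Gs _ F0 F0 N_nonneg K(1) order_refl KF KF _ _ GA])
    show "fst (X A) \<in> E \<and> fst (F h A) \<in> E \<and> fst (F h A) \<in> E" if "G A" for A
      using FE [OF that E(2)] E0 by (simp add: lead0)
    show "N (fst (X A)) + norm (0::'z) \<le> 0 * prod_list (map (\<lambda>i. N (g h i)) A)" for A
      by (simp add: lead0 N_0)
    fix A assume A: "G A"
    have dF: "snd (F x A) = (\<Sum>p\<leftarrow>splits A. b (F x (fst p)) (F x (snd p)))" if "x \<in> E" for x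
      unfolding F_def Y_def snd_conv der_eq [OF u gE [OF A that]] by (simp add: splits_map o_def Y_def)
    show "snd (X A) = 0 + (\<Sum>p\<leftarrow>splits A. b (X (fst p)) (F h (snd p)) + b (F h (fst p)) (X (snd p)))"
    proof (cases "m \<in> set A")
      case True
      have scale: "a *\<^sub>R (\<Sum>p\<leftarrow>l. f p) = (\<Sum>p\<leftarrow>l. a *\<^sub>R f p)" for a l and f :: "_ \<Rightarrow> 'z"
        by (induction l) (auto simp: scaleR_right_distrib)
      have "snd (X A) = (\<Sum>p\<leftarrow>splits A. b (F ?z (fst p)) (F ?z (snd p)) - a *\<^sub>R b (F h (fst p)) (F h (snd p)) - c *\<^sub>R b (F k (fst p)) (F k (snd p)))"
        using True by (simp add: X_def dF [OF zE] dF [OF E(2)] dF [OF E(3)] sum_list_diffs scale)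
      also have "\<dots> = (\<Sum>p\<leftarrow>splits A. b (X (fst p)) (F h (snd p)) + b (F h (fst p)) (X (snd p)))"
      proof (rule sum_list_cong)
        fix p assume p: "p \<in> set (splits A)"
        note g = Gs [OF A p]
        note f = FE [OF conjunct1 [OF g] zE] FE [OF conjunct1 [OF g] E(2)] FE [OF conjunct1 [OF g] E(3)]
          FE [OF conjunct2 [OF g] zE] FE [OF conjunct2 [OF g] E(2)] FE [OF conjunct2 [OF g] E(3)]
        have one: "m \<in> set (fst p) \<and> m \<notin> set (snd p) \<or> m \<notin> set (fst p) \<and> m \<in> set (snd p)"
          using splits_set [OF p] splits_distinct [OF _ p] A True by (auto simp: G_def)
        then show "b (F ?z (fst p)) (F ?z (snd p)) - a *\<^sub>R b (F h (fst p)) (F h (snd p)) - c *\<^sub>R b (F k (fst p)) (F k (snd p)) =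
            b (X (fst p)) (F h (snd p)) + b (F h (fst p)) (X (snd p))"
        proof (elim disjE conjE)
          assume m: "m \<in> set (fst p)" "m \<notin> set (snd p)"
          have "F ?z (snd p) = F h (snd p)" "F k (snd p) = F h (snd p)"
            unfolding F_def same [OF m(2), of ?z] same [OF m(2), of k] by (rule refl)+
          then show ?thesis using m f by (simp add: X_def b0 b_diff1 b_scale1 E_diff E_scale)
        next
          assume m: "m \<notin> set (fst p)" "m \<in> set (snd p)"
          have "F ?z (fst p) = F h (fst p)" "F k (fst p) = F h (fst p)"
            unfolding F_def same [OF m(1), of ?z] same [OF m(1), of k] by (rule refl)+
          then show ?thesis using m f by (simp add: X_def b0 b_diff2 b_scale2 E_diff E_scale)
        qed
      qed
      finally show ?thesis by simp
    next
      case False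
      have "(\<Sum>p\<leftarrow>splits A. b (X (fst p)) (F h (snd p)) + b (F h (fst p)) (X (snd p))) = (\<Sum>p\<leftarrow>splits A. 0)"
      proof (rule sum_list_cong)
        fix p assume p: "p \<in> set (splits A)"
        then have "X (fst p) = 0" "X (snd p) = 0" using splits_set [OF p] False by (auto simp: X_def)
        then show "b (X (fst p)) (F h (snd p)) + b (F h (fst p)) (X (snd p)) = 0"
          using Gs [OF A p] FE E(2) by (simp add: b0)
      qed
      then show ?thesis using False by (simp add: X_def)
    qed
  qed simp_all
  then have "N (fst (X [0..<n])) + norm (snd (X [0..<n])) \<le> 0" by (simp add: pn_def)
  with N_nonneg [of "fst (X [0..<n])"] norm_ge_zero [of "snd (X [0..<n])"] have "norm (snd (X [0..<n])) = 0" by linarith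
  then have "snd (X [0..<n]) = 0" by simp
  then have "X [0..<n] = 0" using lead0 by (simp add: prod_eq_iff)
  moreover have "map (g x) [0..<n] = hs @ x # ks" for x
    unfolding g_def n_def using map_nth [of "hs @ x # ks"] by simp
  ultimately show ?thesis by (simp add: X_def F_def m_def n_def algebra_simps)
qed

end

section \<open>Bounded measurable functions\<close>

text \<open>The bounded Borel functions themselves are used, not classes modulo null sets: the Duhamel
  integral is defined at every \<open>(t, \<xi>)\<close>, and its value at every single time matters.\<close>

typedef bmf = "{f :: real \<times> real \<Rightarrow> complex. f \<in> borel_measurable (borel \<Otimes>\<^sub>M borel) \<and> bounded (range f)}"
  morphisms bm_apply Abs_bmf
  by (rule exI [of _ "\<lambda>_. 0"]) auto

setup_lifting type_definition_bmf

lemma bm_measurable [measurable (raw)]: "bm_apply f \<in> borel_measurable (borel \<Otimes>\<^sub>M borel)"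
  and bm_bounded: "bounded (range (bm_apply f))"
  using bm_apply [of f] by auto

lemma bm_measurable2 [measurable (raw)]:
  assumes "f \<in> borel_measurable M" "g \<in> borel_measurable M"
  shows "(\<lambda>x. bm_apply z (f x, g x)) \<in> borel_measurable M"
  by (rule measurable_compose [OF measurable_Pair bm_measurable]) (use assms in auto)

instantiation bmf :: real_vector
begin

lift_definition zero_bmf :: bmf is "\<lambda>_. 0" by auto

lift_definition plus_bmf :: "bmf \<Rightarrow> bmf \<Rightarrow> bmf" is "\<lambda>f g z. f z + g z"
  by (auto intro: bounded_plus_comp)

lift_definition uminus_bmf :: "bmf \<Rightarrow> bmf" is "\<lambda>f z. - f z"
  by (auto simp: bounded_iff)

lift_definition minus_bmf :: "bmf \<Rightarrow> bmf \<Rightarrow> bmf" is "\<lambda>f g z. f z - g z"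
  by (auto intro: bounded_minus_comp)

lift_definition scaleR_bmf :: "real \<Rightarrow> bmf \<Rightarrow> bmf" is "\<lambda>c f z. c *\<^sub>R f z"
  by (auto intro: bounded_scaleR_comp)

instance
  by standard (transfer; simp add: fun_eq_iff algebra_simps)+

end

instantiation bmf :: real_normed_vector
begin

definition norm_bmf :: "bmf \<Rightarrow> real" where "norm_bmf f = (SUP z. cmod (bm_apply f z))"
definition dist_bmf :: "bmf \<Rightarrow> bmf \<Rightarrow> real" where "dist_bmf f g = norm (f - g)"
definition sgn_bmf :: "bmf \<Rightarrow> bmf" where "sgn_bmf f = f /\<^sub>R norm f"
definition uniformity_bmf :: "(bmf \<times> bmf) filter" where
  "uniformity_bmf = (INF e\<in>{0<..}. principal {(x, y). dist x y < e})"
definition open_bmf :: "bmf set \<Rightarrow> bool" where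
  "open_bmf S = (\<forall>x\<in>S. \<forall>\<^sub>F (x', y) in uniformity. x' = x \<longrightarrow> y \<in> S)"

lemma bm_norm_upper: "cmod (bm_apply f z) \<le> norm f"
  unfolding norm_bmf_def
proof (rule cSUP_upper)
  show "bdd_above (range (\<lambda>z. cmod (bm_apply f z)))"
    using bm_bounded [of f] by (auto simp: bounded_iff bdd_above_def)
qed simp

lemma bm_norm_least: "(\<And>z. cmod (bm_apply f z) \<le> C) \<Longrightarrow> norm f \<le> C"
  unfolding norm_bmf_def by (rule cSUP_least) auto

instance
proof
  fix f g :: bmf and c :: real
  show "dist f g = norm (f - g)" by (rule dist_bmf_def)
  show "sgn f = f /\<^sub>R norm f" by (rule sgn_bmf_def)
  show "(uniformity :: (bmf \<times> bmf) filter) = (INF e\<in>{0<..}. principal {(x, y). dist x y < e})"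
    by (rule uniformity_bmf_def)
  show "open S = (\<forall>x\<in>S. \<forall>\<^sub>F (x', y) in uniformity. x' = x \<longrightarrow> y \<in> S)" for S :: "bmf set"
    by (rule open_bmf_def)
  show "(norm f = 0) = (f = 0)"
  proof
    assume "norm f = 0"
    then have "bm_apply f z = 0" for z using bm_norm_upper [of f z] by simp
    then show "f = 0" by (simp add: bm_apply_inject [symmetric] zero_bmf.rep_eq fun_eq_iff)
  next
    assume "f = 0"
    then show "norm f = 0" by (simp add: norm_bmf_def zero_bmf.rep_eq)
  qed
  show "norm (f + g) \<le> norm f + norm g"
    by (rule bm_norm_least) (auto simp: plus_bmf.rep_eq intro!: norm_triangle_le add_mono bm_norm_upper)
  have le: "norm (r *\<^sub>R h) \<le> \<bar>r\<bar> * norm h" for r and h :: bmf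
    by (rule bm_norm_least) (auto simp: scaleR_bmf.rep_eq intro!: mult_left_mono bm_norm_upper)
  show "norm (c *\<^sub>R f) = \<bar>c\<bar> * norm f"
  proof (cases "c = 0")
    case True
    have "norm (0 :: bmf) = 0" by (simp add: norm_bmf_def zero_bmf.rep_eq)
    then show ?thesis using True by simp
  next
    case False
    have "\<bar>c\<bar> * norm f = \<bar>c\<bar> * norm (inverse c *\<^sub>R (c *\<^sub>R f))" using False by simp
    also have "\<dots> \<le> \<bar>c\<bar> * (\<bar>inverse c\<bar> * norm (c *\<^sub>R f))" by (intro mult_left_mono le) simp
    also have "\<dots> = norm (c *\<^sub>R f)" using False by (simp add: mult.assoc [symmetric] abs_mult [symmetric])
    finally show ?thesis using le [of c f] by simp
  qed
qed

end

instance bmf :: banach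
proof
  fix X :: "nat \<Rightarrow> bmf" assume X: "Cauchy X"
  have cauchy: "\<exists>M. \<forall>m\<ge>M. \<forall>n\<ge>M. norm (X m - X n) < e" if "0 < e" for e
    using CauchyD [OF X that] .
  have pw: "Cauchy (\<lambda>n. bm_apply (X n) z)" for z
  proof (rule CauchyI)
    fix e :: real assume "0 < e"
    then obtain M where M: "\<And>m n. m \<ge> M \<Longrightarrow> n \<ge> M \<Longrightarrow> norm (X m - X n) < e" using cauchy [of e] by blast
    have "norm (bm_apply (X m) z - bm_apply (X n) z) < e" if "m \<ge> M" "n \<ge> M" for m n
      using bm_norm_upper [of "X m - X n" z] M [OF that] by (simp add: minus_bmf.rep_eq)
    then show "\<exists>M. \<forall>m\<ge>M. \<forall>n\<ge>M. norm (bm_apply (X m) z - bm_apply (X n) z) < e" by blast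
  qed
  define L where "L z = lim (\<lambda>n. bm_apply (X n) z)" for z
  have L: "(\<lambda>n. bm_apply (X n) z) \<longlonglongrightarrow> L z" for z
    using pw [of z] by (simp add: L_def Cauchy_convergent_iff convergent_LIMSEQ_iff)
  have close: "\<exists>M. \<forall>n\<ge>M. \<forall>z. cmod (L z - bm_apply (X n) z) \<le> e" if e0: "0 < e" for e
  proof -
    obtain M where M: "\<And>m n. m \<ge> M \<Longrightarrow> n \<ge> M \<Longrightarrow> norm (X m - X n) < e" using cauchy [of e] e0 by blast
    have "cmod (L z - bm_apply (X n) z) \<le> e" if nM: "n \<ge> M" for n z
    proof (rule LIMSEQ_le_const2)
      show "(\<lambda>m. cmod (bm_apply (X m) z - bm_apply (X n) z)) \<longlonglongrightarrow> cmod (L z - bm_apply (X n) z)"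
        by (intro tendsto_intros L)
      have "cmod (bm_apply (X m) z - bm_apply (X n) z) \<le> e" if "m \<ge> M" for m
        using bm_norm_upper [of "X m - X n" z] M [OF that nM] by (simp add: minus_bmf.rep_eq)
      then show "\<exists>N. \<forall>m\<ge>N. cmod (bm_apply (X m) z - bm_apply (X n) z) \<le> e" by blast
    qed
    then show ?thesis by blast
  qed
  have Lm: "L \<in> borel_measurable (borel \<Otimes>\<^sub>M borel)"
    by (rule borel_measurable_LIMSEQ_metric [OF _ L]) measurable
  have "bounded (range L)"
  proof -
    obtain M where M: "\<And>z. cmod (L z - bm_apply (X M) z) \<le> 1" using close [of 1] by auto
    have "cmod (L z) \<le> 1 + norm (X M)" for z
      using norm_triangle_sub [of "L z" "bm_apply (X M) z"] M [of z] bm_norm_upper [of "X M" z] by linarith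
    then show ?thesis unfolding bounded_iff by blast
  qed
  with Lm have La: "bm_apply (Abs_bmf L) = L" by (intro Abs_bmf_inverse) simp
  have "X \<longlonglongrightarrow> Abs_bmf L"
  proof (rule LIMSEQ_I)
    fix r :: real assume "0 < r"
    then obtain M where M: "\<And>n z. n \<ge> M \<Longrightarrow> cmod (L z - bm_apply (X n) z) \<le> r / 2" using close [of "r / 2"] by auto
    have "norm (X n - Abs_bmf L) < r" if "n \<ge> M" for n
    proof -
      have "norm (X n - Abs_bmf L) \<le> r / 2"
        using M [OF that] by (intro bm_norm_least) (simp add: minus_bmf.rep_eq La norm_minus_commute)
      then show ?thesis using \<open>0 < r\<close> by simp
    qed
    then show "\<exists>no. \<forall>n\<ge>no. norm (X n - Abs_bmf L) < r" by blast
  qed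
  then show "convergent X" by (rule convergentI)
qed

section \<open>Time integrals\<close>

lemma exp_neg_le_powr:
  assumes "0 < (x::real)" "0 \<le> k" "k \<le> 1" shows "exp (- x) \<le> x powr - k"
proof -
  have "x powr k \<le> exp x"
  proof (cases "x \<le> 1")
    case True
    then have "x powr k \<le> 1" using powr_le1 [of k x] assms by simp
    then show ?thesis using assms one_le_exp_iff [of x] by linarith
  next
    case False
    then have "x powr k \<le> x powr 1" using assms by (intro powr_mono) auto
    also have "x powr 1 = x" using assms by simp
    also have "x \<le> exp x" using exp_ge_add_one_self [of x] by linarith
    finally show ?thesis .
  qed
  then have "inverse (exp x) \<le> inverse (x powr k)" using assms by (intro le_imp_inverse_le) auto
  then show ?thesis by (simp add: exp_minus powr_minus)
qed

lemma nn_integral_beta: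
  assumes "0 < a" "0 < b"
  shows "(\<integral>\<^sup>+r. indicator {0..1} r * ennreal (r powr (a - 1) * (1 - r) powr (b - 1))) = ennreal (Beta a b)"
proof -
  have "((\<lambda>r. if r \<in> {0..1} then r powr (a - 1) * (1 - r) powr (b - 1) else 0) has_integral Beta a b) UNIV"
    using has_integral_Beta_real [OF assms] by (simp only: has_integral_restrict_UNIV)
  then have "(\<integral>\<^sup>+r. ennreal (if r \<in> {0..1} then r powr (a - 1) * (1 - r) powr (b - 1) else 0)) = ennreal (Beta a b)"
    by (rule nn_integral_has_integral_lborel [rotated 2]) auto
  moreover have "ennreal (if r \<in> {0..1} then r powr (a - 1) * (1 - r) powr (b - 1) else 0) =
      indicator {0..1} r * ennreal (r powr (a - 1) * (1 - r) powr (b - 1))" for r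
    by (auto simp: indicator_def)
  ultimately show ?thesis by (simp only:)
qed

text \<open>The Beta integral; the maximum with \<open>0\<close> makes it nonnegative without conditions on the
  parameters.\<close>

definition tbeta :: "real \<Rightarrow> real \<Rightarrow> real" where "tbeta k a = max 0 (Beta (1 - a) (1 - k))"

lemma tbeta_nonneg [simp]: "0 \<le> tbeta k a"
  by (simp add: tbeta_def)

lemma nn_integral_time:
  assumes k: "k < 1" and a: "a < 1" and t: "0 < t"
  shows "(\<integral>\<^sup>+r. indicator {0..t} r * ennreal ((t - r) powr - k * r powr - a)) \<le> ennreal (tbeta k a * t powr (1 - k - a))"
proof -
  let ?f = "\<lambda>r. indicator {0..t} r * ennreal ((t - r) powr - k * r powr - a)"
  have "(\<integral>\<^sup>+r. ?f r) = ennreal \<bar>t\<bar> * (\<integral>\<^sup>+x. ?f (0 + t * x))"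
    using t by (intro nn_integral_real_affine) auto
  also have "(\<integral>\<^sup>+x. ?f (0 + t * x)) = (\<integral>\<^sup>+x. ennreal (t powr (- k - a)) * (indicator {0..1} x * ennreal (x powr ((1 - a) - 1) * (1 - x) powr ((1 - k) - 1))))"
  proof (rule nn_integral_cong)
    fix x
    show "?f (0 + t * x) = ennreal (t powr (- k - a)) * (indicator {0..1} x * ennreal (x powr ((1 - a) - 1) * (1 - x) powr ((1 - k) - 1)))"
    proof (cases "x \<in> {0..1}")
      case True
      then have "t - t * x = t * (1 - x)" "0 \<le> 1 - x" "0 \<le> x" by (auto simp: algebra_simps)
      then have "(t - t * x) powr - k * (t * x) powr - a = t powr (- k - a) * (x powr - a * (1 - x) powr - k)"
        using t by (simp add: powr_mult powr_diff powr_add [symmetric] powr_minus divide_inverse mult_ac)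
      moreover have "0 \<le> t * x" "t * x \<le> t" using True t by (auto simp: mult_le_cancel_left1)
      ultimately show ?thesis using True by (simp add: ennreal_mult [symmetric])
    next
      case False
      then have "t * x \<notin> {0..t}" using t by (auto simp: zero_le_mult_iff mult_le_cancel_left1)
      then show ?thesis using False by simp
    qed
  qed
  also have "\<dots> = ennreal (t powr (- k - a)) * (\<integral>\<^sup>+x. indicator {0..1} x * ennreal (x powr ((1 - a) - 1) * (1 - x) powr ((1 - k) - 1)))"
    by (rule nn_integral_cmult) measurable
  also have "(\<integral>\<^sup>+x. indicator {0..1} x * ennreal (x powr ((1 - a) - 1) * (1 - x) powr ((1 - k) - 1))) = ennreal (Beta (1 - a) (1 - k))"
    by (rule nn_integral_beta) (use a k in auto)
  also have "ennreal \<bar>t\<bar> * (ennreal (t powr (- k - a)) * ennreal (Beta (1 - a) (1 - k))) \<le> ennreal \<bar>t\<bar> * (ennreal (t powr (- k - a)) * ennreal (tbeta k a))"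
    by (intro mult_left_mono ennreal_leI) (auto simp: tbeta_def)
  also have "\<dots> = ennreal (tbeta k a * (t powr 1 * t powr (- k - a)))"
    using t by (simp add: ennreal_mult [symmetric] mult_ac)
  also have "t powr 1 * t powr (- k - a) = t powr (1 - k - a)"
    unfolding powr_add [symmetric] by (simp add: algebra_simps)
  finally show ?thesis .
qed

lemma integrable_bound_nn:
  fixes f :: "real \<Rightarrow> complex"
  assumes "f \<in> borel_measurable borel" "(\<integral>\<^sup>+r. ennreal (cmod (f r))) \<le> ennreal C" "0 \<le> C"
  shows "integrable lborel f" "cmod (\<integral>r. f r) \<le> C"
proof -
  show "integrable lborel f"
    using assms by (intro integrableI_bounded) (auto intro: le_less_trans)
  show "cmod (\<integral>r. f r) \<le> C"
    using order_trans [OF norm_integral_le_nn_integral assms(2)] assms(3) by simp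
qed

section \<open>The dissipative semigroup\<close>

text \<open>The order \<open>p\<close> and the exponent \<open>s\<close> of the theorem. The symbol enters through the decay of the
  propagator, which is of the order \<open>exp (- c t \<langle>\<xi>\<rangle>\<^sup>p)\<close> for times in \<open>[0,1]\<close>.\<close>

locale dissipative =
  fixes \<eta> p s c K :: real and \<Phi> :: "real \<Rightarrow> real"
  assumes \<Phi>_meas [measurable]: "\<Phi> \<in> borel_measurable borel" and p: "p > 3" and s: "s > - p / 2" and c: "0 < c" and K: "1 \<le> K"
    and decay: "0 \<le> t \<Longrightarrow> t \<le> 1 \<Longrightarrow> exp (\<eta> * t * \<Phi> \<xi>) \<le> K * exp (- (c * t * jap \<xi> powr p))"
begin

text \<open>Positive and negative part of \<open>s\<close>, and the rate \<open>al\<close> at which the \<open>L\<^sup>2\<close> norm may blow up at time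
  \<open>0\<close>.\<close>

definition sp :: real where "sp = max 0 s"
definition sm :: real where "sm = max 0 (- s)"
definition al :: real where "al = sm / p"

lemma sp_nonneg [simp]: "0 \<le> sp" and sm_nonneg [simp]: "0 \<le> sm" and sp_sm: "sp - sm = s"
  by (auto simp: sp_def sm_def)

lemma al: "0 \<le> al" "al < 1/2" and p_al: "p * al = sm"
proof -
  have p0: "0 < p" using p by simp
  show "0 \<le> al" using p0 by (simp add: al_def)
  have "sm < p / 2" using s p by (simp add: sm_def)
  then show "al < 1/2" using p0 by (simp add: al_def field_simps)
  show "p * al = sm" using p0 by (simp add: al_def)
qed

definition sem :: "real \<Rightarrow> real \<Rightarrow> complex" where
  "sem t \<xi> = exp (\<i> * cx (t * \<xi> ^ 3) + cx (\<eta> * t * \<Phi> \<xi>))"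

text \<open>The integrand of the Duhamel term when the square of the solution has transform \<open>z / 2 \<pi>\<close>.\<close>

abbreviation dterm :: "real \<Rightarrow> real \<Rightarrow> complex \<Rightarrow> complex" where
  "dterm t \<xi> z \<equiv> sem t \<xi> * (\<i> * cx \<xi> * (cx (1 / (2 * pi)) * z))"

lemma V_eq: "V \<eta> \<Phi> t = fourier_multiplier (sem t)"
  by (simp add: V_def sem_def [abs_def])

lemma norm_sem: "cmod (sem t \<xi>) = exp (\<eta> * t * \<Phi> \<xi>)"
  by (simp add: sem_def norm_exp_eq_Re)

lemma sem_measurable2 [measurable (raw)]:
  assumes [measurable]: "f \<in> borel_measurable M" "g \<in> borel_measurable M"
  shows "(\<lambda>x. sem (f x) (g x)) \<in> borel_measurable M"
  unfolding sem_def by measurable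

lemma sem_add: "sem (t + r) \<xi> = sem t \<xi> * sem r \<xi>"
  unfolding sem_def exp_add [symmetric] by (simp add: algebra_simps)

lemma sem_le: "0 \<le> t \<Longrightarrow> t \<le> 1 \<Longrightarrow> cmod (sem t \<xi>) \<le> K"
proof -
  assume t: "0 \<le> t" "t \<le> 1"
  have "exp (- (c * t * jap \<xi> powr p)) \<le> 1" using t c by simp
  then have "K * exp (- (c * t * jap \<xi> powr p)) \<le> K * 1" using K by (intro mult_left_mono) auto
  then show ?thesis using decay [OF t, of \<xi>] by (simp add: norm_sem)
qed

definition CK :: real where "CK = K * max 1 (1 / c)"

lemma K_le_CK: "K \<le> CK" and CK_pos: "0 < CK"
proof -
  have "K * 1 \<le> K * max 1 (1 / c)" using K by (intro mult_left_mono) auto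
  then show "K \<le> CK" by (simp add: CK_def)
  then show "0 < CK" using K by simp
qed

text \<open>Trading powers of \<open>t\<close> for derivatives: \<open>e^(-x) \<le> x^(-k)\<close> at \<open>x = c t \<langle>\<xi>\<rangle>\<^sup>p\<close>.\<close>

lemma sem_bound:
  assumes t: "0 < t" "t \<le> 1" and k: "0 \<le> k" "k \<le> 1"
  shows "cmod (sem t \<xi>) \<le> CK * (t powr - k * jap \<xi> powr - (p * k))"
proof -
  have "exp (- (c * t * jap \<xi> powr p)) \<le> (c * t * jap \<xi> powr p) powr - k"
    using t c k by (intro exp_neg_le_powr) auto
  also have "\<dots> = c powr - k * (t powr - k * jap \<xi> powr - (p * k))"
    using t c by (simp add: powr_mult powr_powr mult.assoc)
  also have "\<dots> \<le> max 1 (1 / c) * (t powr - k * jap \<xi> powr - (p * k))"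
  proof (rule mult_right_mono)
    have "c powr - k = (1 / c) powr k" using c by (simp add: powr_minus powr_divide inverse_eq_divide)
    also have "\<dots> \<le> max 1 (1 / c) powr k" using c k by (intro powr_mono2) auto
    also have "\<dots> \<le> max 1 (1 / c) powr 1" using k by (intro powr_mono) auto
    finally show "c powr - k \<le> max 1 (1 / c)" by simp
  qed simp
  finally have "K * exp (- (c * t * jap \<xi> powr p)) \<le> K * (max 1 (1 / c) * (t powr - k * jap \<xi> powr - (p * k)))"
    using K by (intro mult_left_mono) auto
  then show ?thesis using decay [of t \<xi>] t by (simp add: norm_sem CK_def mult.assoc)
qed

definition hat :: "tempered \<Rightarrow> real \<Rightarrow> complex" where "hat u = (SOME g. rep u g)"

lemma rep_hat: "u \<in> Hs \<sigma> \<Longrightarrow> rep u (hat u)"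
  unfolding hat_def using Hs_rep someI_ex by metis

lemma hat_measurable: "u \<in> Hs \<sigma> \<Longrightarrow> hat u \<in> borel_measurable borel"
  by (rule rep_measurable [OF rep_hat])

text \<open>The pointwise size of the Duhamel term. The first entry of the minimum makes it \<open>O(t^(-al))\<close> in
  \<open>H^(sp)\<close>, the second one bounded in \<open>H\<^sup>s\<close>. At time \<open>0\<close> it is set to \<open>0\<close>, so that the curve
  starts at the datum whatever the correction is.\<close>

definition om :: "real \<Rightarrow> real \<Rightarrow> real" where
  "om t \<xi> = (if 0 < t then jap \<xi> powr (1 - p / 2 - sp) * min (t powr - al) (jap \<xi> powr sm) else 0)"

lemma om_measurable [measurable (raw)]:
  assumes [measurable]: "f \<in> borel_measurable M" "g \<in> borel_measurable M"
  shows "(\<lambda>x. om (f x) (g x)) \<in> borel_measurable M"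
  unfolding om_def by measurable

lemma om_nonneg [simp]: "0 \<le> om t \<xi>" and om_pos: "0 < t \<Longrightarrow> 0 < om t \<xi>" and om_0: "om 0 \<xi> = 0"
  by (auto simp: om_def)

lemma om_le1: "0 < t \<Longrightarrow> om t \<xi> \<le> jap \<xi> powr (1 - p / 2 - sp) * t powr - al"
  by (simp add: om_def)

lemma om_le2: "om t \<xi> \<le> jap \<xi> powr (1 - p / 2 - s)"
proof (cases "0 < t")
  case True
  then have "om t \<xi> \<le> jap \<xi> powr (1 - p / 2 - sp) * jap \<xi> powr sm" by (simp add: om_def)
  also have "\<dots> = jap \<xi> powr (1 - p / 2 - s)" unfolding powr_add [symmetric] using sp_sm by (simp add: algebra_simps)
  finally show ?thesis .
qed (simp add: om_def)

lemma om_ge: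
  assumes "0 < t" "x \<le> Q * (jap \<xi> powr (1 - p / 2 - sp) * t powr - al)" "x \<le> Q * jap \<xi> powr (1 - p / 2 - s)"
  shows "x \<le> Q * om t \<xi>"
proof -
  have eq: "jap \<xi> powr (1 - p / 2 - s) = jap \<xi> powr (1 - p / 2 - sp) * jap \<xi> powr sm"
    unfolding powr_add [symmetric] using sp_sm by (simp add: algebra_simps)
  show ?thesis
    using assms unfolding eq by (cases "t powr - al \<le> jap \<xi> powr sm") (auto simp: om_def min_def)
qed

text \<open>A bound for the \<open>L\<^sup>2\<close> norm of \<open>\<langle>\<xi>\<rangle>^(1-p/2)\<close>, finite because \<open>p > 3\<close>.\<close>

definition jA :: real where "jA = (SOME A. l2_le (\<lambda>\<xi>. cx (jap \<xi> powr - (p / 2 - 1))) A)"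

lemma jA: "l2_le (\<lambda>\<xi>. cx (jap \<xi> powr (1 - p / 2))) jA"
proof -
  have "\<exists>A. l2_le (\<lambda>\<xi>. cx (jap \<xi> powr - (p / 2 - 1))) A"
    by (rule l2_le_jap) (use p in simp)
  from someI_ex [OF this] show ?thesis unfolding jA_def [symmetric] by simp
qed

text \<open>The transform of the curve with datum \<open>fst y\<close> and correction \<open>snd y\<close>.\<close>

definition crv :: "tempered \<times> bmf \<Rightarrow> real \<Rightarrow> real \<Rightarrow> complex" where
  "crv y t \<xi> = sem t \<xi> * hat (fst y) \<xi> + cx (om t \<xi>) * bm_apply (snd y) (t, \<xi>)"

definition nY :: "tempered \<times> bmf \<Rightarrow> real" where "nY y = Hs_nrm s (fst y) + norm (snd y)"

definition C1 :: real where "C1 = 2 * (CK + jA)"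

lemma jA_nonneg: "0 \<le> jA" by (rule l2_leD(2) [OF jA])
lemma C1_nonneg: "0 \<le> C1" using jA_nonneg CK_pos by (simp add: C1_def)
lemma nY_nonneg [simp]: "0 \<le> nY y" by (simp add: nY_def)

lemma crv_measurable2:
  assumes "fst y \<in> Hs s"
  shows "jmeas (crv y)"
proof -
  note [measurable] = hat_measurable [OF assms]
  show ?thesis unfolding crv_def by measurable
qed

lemma crv_measurable:
  assumes "fst y \<in> Hs s" shows "crv y t \<in> borel_measurable borel"
  using measurable_compose [OF measurable_Pair1' crv_measurable2 [OF assms]] by simp

lemma crv_l2_le:
  assumes y: "fst y \<in> Hs s" and A: "0 \<le> \<tau>"
    and sem: "\<And>\<xi>. jap \<xi> powr \<sigma> * cmod (sem t \<xi>) \<le> \<tau> * CK * jap \<xi> powr s"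
    and om: "\<And>\<xi>. jap \<xi> powr \<sigma> * om t \<xi> \<le> \<tau> * jap \<xi> powr (1 - p / 2)"
  shows "l2_le (wt \<sigma> (crv y t)) (C1 * \<tau> * nY y)"
proof -
  note [measurable] = hat_measurable [OF y]
  have 1: "l2_le (wt \<sigma> (\<lambda>\<xi>. sem t \<xi> * hat (fst y) \<xi>)) ((\<tau> * CK) * Hs_nrm s (fst y))"
  proof (rule l2_le_bound [OF Hs_nrm_rep [OF rep_hat [OF y] y]])
    show "wt \<sigma> (\<lambda>\<xi>. sem t \<xi> * hat (fst y) \<xi>) \<in> borel_measurable borel" by measurable
    show "0 \<le> \<tau> * CK" using A CK_pos by simp
    show "AE \<xi> in lborel. cmod (wt \<sigma> (\<lambda>\<xi>. sem t \<xi> * hat (fst y) \<xi>) \<xi>) \<le> \<tau> * CK * cmod (wt s (hat (fst y)) \<xi>)"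
    proof (rule AE_I2)
      fix \<xi>
      show "cmod (wt \<sigma> (\<lambda>\<xi>. sem t \<xi> * hat (fst y) \<xi>) \<xi>) \<le> \<tau> * CK * cmod (wt s (hat (fst y)) \<xi>)"
        using mult_right_mono [OF sem [of \<xi>], of "cmod (hat (fst y) \<xi>)"] by (simp add: norm_wt norm_mult mult.assoc)
    qed
  qed
  have 2: "l2_le (wt \<sigma> (\<lambda>\<xi>. cx (om t \<xi>) * bm_apply (snd y) (t, \<xi>))) ((\<tau> * norm (snd y)) * jA)"
  proof (rule l2_le_bound [OF jA])
    show "wt \<sigma> (\<lambda>\<xi>. cx (om t \<xi>) * bm_apply (snd y) (t, \<xi>)) \<in> borel_measurable borel" by measurable
    show "0 \<le> \<tau> * norm (snd y)" using A by simp
    show "AE \<xi> in lborel. cmod (wt \<sigma> (\<lambda>\<xi>. cx (om t \<xi>) * bm_apply (snd y) (t, \<xi>)) \<xi>)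
       \<le> \<tau> * norm (snd y) * cmod (cx (jap \<xi> powr (1 - p / 2)))"
    proof (rule AE_I2)
      fix \<xi>
      have "(jap \<xi> powr \<sigma> * om t \<xi>) * cmod (bm_apply (snd y) (t, \<xi>)) \<le> (\<tau> * jap \<xi> powr (1 - p / 2)) * norm (snd y)"
        using A by (intro mult_mono om bm_norm_upper) auto
      then show "cmod (wt \<sigma> (\<lambda>\<xi>. cx (om t \<xi>) * bm_apply (snd y) (t, \<xi>)) \<xi>)
       \<le> \<tau> * norm (snd y) * cmod (cx (jap \<xi> powr (1 - p / 2)))"
        by (simp add: norm_wt norm_mult mult_ac)
    qed
  qed
  have "l2_le (wt \<sigma> (crv y t)) (2 * ((\<tau> * CK) * Hs_nrm s (fst y) + (\<tau> * norm (snd y)) * jA))"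
    using l2_le_add [OF 1 2] by (simp add: crv_def [abs_def] wt_add)
  moreover have "2 * ((\<tau> * CK) * Hs_nrm s (fst y) + (\<tau> * norm (snd y)) * jA) \<le> C1 * \<tau> * nY y"
  proof -
    have "\<tau> * (CK * Hs_nrm s (fst y)) \<le> \<tau> * ((CK + jA) * Hs_nrm s (fst y))"
      using A jA_nonneg by (intro mult_left_mono mult_right_mono) auto
    moreover have "\<tau> * (norm (snd y) * jA) \<le> \<tau> * (norm (snd y) * (CK + jA))"
      using A CK_pos by (intro mult_left_mono) auto
    ultimately show ?thesis by (simp add: C1_def nY_def algebra_simps)
  qed
  ultimately show ?thesis by (rule l2_le_weaken)
qed

lemma crv_l2:
  assumes y: "fst y \<in> Hs s" and t: "0 < t" "t \<le> 1"
  shows "l2_le (wt sp (crv y t)) (C1 * t powr - al * nY y)"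
proof (rule crv_l2_le [OF y])
  fix \<xi>
  have "jap \<xi> powr sp * cmod (sem t \<xi>) \<le> jap \<xi> powr sp * (CK * (t powr - al * jap \<xi> powr - (p * al)))"
    using al by (intro mult_left_mono sem_bound t) auto
  also have "\<dots> = t powr - al * CK * (jap \<xi> powr sp * jap \<xi> powr - sm)" by (simp add: p_al mult_ac)
  also have "jap \<xi> powr sp * jap \<xi> powr - sm = jap \<xi> powr s" unfolding powr_add [symmetric] using sp_sm by simp
  finally show "jap \<xi> powr sp * cmod (sem t \<xi>) \<le> t powr - al * CK * jap \<xi> powr s" .
  have "jap \<xi> powr sp * om t \<xi> \<le> jap \<xi> powr sp * (jap \<xi> powr (1 - p / 2 - sp) * t powr - al)"
    by (intro mult_left_mono om_le1 t) simp
  also have "\<dots> = t powr - al * (jap \<xi> powr sp * jap \<xi> powr (1 - p / 2 - sp))" by (simp only: mult_ac)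
  also have "jap \<xi> powr sp * jap \<xi> powr (1 - p / 2 - sp) = jap \<xi> powr (1 - p / 2)" unfolding powr_add [symmetric] by simp
  finally show "jap \<xi> powr sp * om t \<xi> \<le> t powr - al * jap \<xi> powr (1 - p / 2)" .
qed simp

lemma crv_Hs:
  assumes y: "fst y \<in> Hs s" and t: "0 \<le> t" "t \<le> 1"
  shows "l2_le (wt s (crv y t)) (C1 * nY y)"
proof -
  have "l2_le (wt s (crv y t)) (C1 * 1 * nY y)"
  proof (rule crv_l2_le [OF y])
    fix \<xi>
    show "jap \<xi> powr s * cmod (sem t \<xi>) \<le> 1 * CK * jap \<xi> powr s"
      using mult_left_mono [OF order_trans [OF sem_le [OF t] K_le_CK], of "jap \<xi> powr s" \<xi>] by (simp add: mult.commute)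
    have "jap \<xi> powr s * om t \<xi> \<le> jap \<xi> powr s * jap \<xi> powr (1 - p / 2 - s)"
      by (intro mult_left_mono om_le2) simp
    also have "\<dots> = jap \<xi> powr (1 - p / 2)" unfolding powr_add [symmetric] by simp
    finally show "jap \<xi> powr s * om t \<xi> \<le> 1 * jap \<xi> powr (1 - p / 2)" by simp
  qed simp
  then show ?thesis by simp
qed

lemma crv_l2_plain:
  assumes y: "fst y \<in> Hs s" and t: "0 < t" "t \<le> 1"
  shows "l2_le (crv y t) (C1 * t powr - al * nY y)"
proof -
  have "l2_le (crv y t) (1 * (C1 * t powr - al * nY y))"
  proof (rule l2_le_bound [OF crv_l2 [OF y t] crv_measurable [OF y]])
    have "cmod (crv y t \<xi>) \<le> 1 * cmod (wt sp (crv y t) \<xi>)" for \<xi>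
      using mult_right_mono [OF ge_one_powr_ge_zero [OF jap_ge_1 sp_nonneg], of "cmod (crv y t \<xi>)" \<xi>] by (simp add: norm_wt)
    then show "AE \<xi> in lborel. cmod (crv y t \<xi>) \<le> 1 * cmod (wt sp (crv y t) \<xi>)" by simp
  qed simp
  then show ?thesis by simp
qed

end

context dissipative
begin

section \<open>The bilinear estimate\<close>

text \<open>The Duhamel integral with \<open>G r\<close> in the place of the self-convolution at time \<open>r\<close>.\<close>

definition duh :: "real \<Rightarrow> (real \<Rightarrow> real \<Rightarrow> complex) \<Rightarrow> real \<Rightarrow> complex" where
  "duh t G = tint t (\<lambda>r \<xi>. dterm (t - r) \<xi> (G r \<xi>))"

lemma duh_integrand_measurable:
  assumes [measurable]: "jmeas G"
  shows "jmeas (\<lambda>r \<xi>. dterm (t - r) \<xi> (G r \<xi>))"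
  by measurable

lemma duh_measurable2:
  assumes [measurable]: "jmeas G"
  shows "jmeas (\<lambda>t \<xi>. duh t G \<xi>)"
proof -
  have "duh t G \<xi> = (\<integral>r. (if 0 \<le> r \<and> r \<le> t then dterm (t - r) \<xi> (G r \<xi>) else 0))" for t \<xi>
    unfolding duh_def tint_def by (rule Bochner_Integration.integral_cong [OF refl]) (auto simp: indicator_def)
  then show ?thesis by (simp only:) measurable
qed

text \<open>The propagator is estimated with exponent \<open>k\<close>, and the singularities \<open>(t - r)^(-k)\<close> and \<open>r^(-a)\<close>
  are integrated by the Beta function.\<close>

lemma duh_estimate:
  assumes G [measurable]: "jmeas G"
    and t: "0 < t" "t \<le> 1" and k: "0 \<le> k" "k < 1" and a: "a < 1" and M: "0 \<le> M"
    and b: "\<And>r. 0 < r \<Longrightarrow> r < t \<Longrightarrow> cmod (G r \<xi>) \<le> M * r powr - a"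
  shows "integrable lborel (\<lambda>r. indicator {0..t} r *\<^sub>R (dterm (t - r) \<xi> (G r \<xi>)))"
    and "cmod (duh t G \<xi>) \<le> CK * tbeta k a * t powr (1 - k - a) * jap \<xi> powr (1 - p * k) * M"
proof -
  let ?f = "\<lambda>r. indicator {0..t} r *\<^sub>R (dterm (t - r) \<xi> (G r \<xi>))"
  define Q where "Q = CK * jap \<xi> powr (1 - p * k) * M"
  have Q: "0 \<le> Q" using CK_pos M by (simp add: Q_def)
  have [measurable]: "(\<lambda>r. G r \<xi>) \<in> borel_measurable borel"
    using measurable_compose [OF measurable_Pair2' G, of \<xi>] by simp
  have m: "?f \<in> borel_measurable borel" by measurable
  have pi1: "1 / (2 * pi) \<le> 1" using pi_gt3 by simp
  have le: "cmod (?f r) \<le> indicator {0..t} r * (Q * ((t - r) powr - k * r powr - a))" if r: "r \<noteq> 0" "r \<noteq> t" for r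
  proof (cases "r \<in> {0..t}")
    case True
    then have r: "0 < r" "r < t" "0 < t - r" "t - r \<le> 1" using r t by auto
    have "cmod (?f r) = cmod (sem (t - r) \<xi>) * (\<bar>\<xi>\<bar> * (1 / (2 * pi) * cmod (G r \<xi>)))"
      using True by (simp add: norm_mult norm_divide)
    also have "\<dots> \<le> (CK * ((t - r) powr - k * jap \<xi> powr - (p * k))) * (jap \<xi> * (1 * (M * r powr - a)))"
      using k CK_pos M r b by (intro mult_mono sem_bound abs_le_jap pi1 mult_nonneg_nonneg) auto
    also have "\<dots> = (CK * (jap \<xi> powr 1 * jap \<xi> powr - (p * k)) * M) * ((t - r) powr - k * r powr - a)"
      by (simp add: mult_ac)
    also have "jap \<xi> powr 1 * jap \<xi> powr - (p * k) = jap \<xi> powr (1 - p * k)" unfolding powr_add [symmetric] by simp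
    finally show ?thesis using True by (simp add: Q_def)
  qed simp
  have "AE r in lborel. ennreal (cmod (?f r)) \<le> ennreal Q * (indicator {0..t} r * ennreal ((t - r) powr - k * r powr - a))"
    using AE_lborel_singleton [of 0] AE_lborel_singleton [of t]
  proof eventually_elim
    case (elim r)
    have "ennreal (cmod (?f r)) \<le> ennreal (indicator {0..t} r * (Q * ((t - r) powr - k * r powr - a)))"
      by (rule ennreal_leI [OF le [OF elim]])
    also have "\<dots> = ennreal Q * (indicator {0..t} r * ennreal ((t - r) powr - k * r powr - a))"
      using Q by (cases "r \<in> {0..t}") (auto simp: ennreal_mult)
    finally show ?case .
  qed
  then have "(\<integral>\<^sup>+r. ennreal (cmod (?f r))) \<le> (\<integral>\<^sup>+r. ennreal Q * (indicator {0..t} r * ennreal ((t - r) powr - k * r powr - a)))"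
    by (rule nn_integral_mono_AE)
  also have "\<dots> = ennreal Q * (\<integral>\<^sup>+r. indicator {0..t} r * ennreal ((t - r) powr - k * r powr - a))"
    by (rule nn_integral_cmult) measurable
  also have "\<dots> \<le> ennreal Q * ennreal (tbeta k a * t powr (1 - k - a))"
    by (intro mult_left_mono nn_integral_time k a t) simp
  finally have le: "(\<integral>\<^sup>+r. ennreal (cmod (?f r))) \<le> ennreal (Q * (tbeta k a * t powr (1 - k - a)))"
    using Q by (simp add: ennreal_mult [symmetric])
  have "0 \<le> Q * (tbeta k a * t powr (1 - k - a))" using Q by simp
  from integrable_bound_nn [OF m le this]
  show "integrable lborel ?f" "cmod (duh t G \<xi>) \<le> CK * tbeta k a * t powr (1 - k - a) * jap \<xi> powr (1 - p * k) * M"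
    by (simp_all add: duh_def tint_def Q_def mult_ac)
qed

lemma duh_cong:
  assumes "\<And>r. 0 < r \<Longrightarrow> r \<le> t \<Longrightarrow> G r \<xi> = H r \<xi>"
    and [measurable]: "jmeas G" "jmeas H"
  shows "duh t G \<xi> = duh t H \<xi>"
  unfolding duh_def tint_def
proof (rule integral_cong_AE)
  have [measurable]: "(\<lambda>r. G r \<xi>) \<in> borel_measurable borel" "(\<lambda>r. H r \<xi>) \<in> borel_measurable borel"
    using measurable_compose [OF measurable_Pair2' assms(2), of \<xi>] measurable_compose [OF measurable_Pair2' assms(3), of \<xi>] by simp_all
  show "(\<lambda>r. indicator {0..t} r *\<^sub>R (dterm (t - r) \<xi> (G r \<xi>))) \<in> borel_measurable lborel"
    "(\<lambda>r. indicator {0..t} r *\<^sub>R (dterm (t - r) \<xi> (H r \<xi>))) \<in> borel_measurable lborel"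
    by measurable
  show "AE r in lborel. indicator {0..t} r *\<^sub>R (dterm (t - r) \<xi> (G r \<xi>)) =
      indicator {0..t} r *\<^sub>R (dterm (t - r) \<xi> (H r \<xi>))"
    using AE_lborel_singleton [of 0] by eventually_elim (auto simp: indicator_def assms(1))
qed

text \<open>The transform of the product of two curves, up to the factor \<open>2 \<pi>\<close>.\<close>

definition Gc :: "tempered \<times> bmf \<Rightarrow> tempered \<times> bmf \<Rightarrow> real \<Rightarrow> real \<Rightarrow> complex" where
  "Gc y w r = conv (crv y r) (crv w r)"

lemma Gc_measurable:
  assumes "fst y \<in> Hs s" "fst w \<in> Hs s"
  shows "jmeas (Gc y w)"
  unfolding Gc_def by (rule conv_measurable2 [OF crv_measurable2 [OF assms(1)] crv_measurable2 [OF assms(2)]])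

definition CM :: real where "CM = 2 powr sp * C1\<^sup>2"

lemma CM_nonneg: "0 \<le> CM" by (simp add: CM_def)

lemma Gc_bound:
  assumes y: "fst y \<in> Hs s" and w: "fst w \<in> Hs s" and r: "0 < r" "r \<le> 1"
  shows "cmod (Gc y w r \<xi>) \<le> (CM * nY y * nY w * jap \<xi> powr - sp) * r powr - (2 * al)"
proof -
  have "jap \<xi> powr sp * cmod (Gc y w r \<xi>) \<le> 2 powr sp * ((C1 * r powr - al * nY y) * (C1 * r powr - al * nY w))"
    unfolding Gc_def
    using conv_weighted_bound [OF sp_nonneg crv_measurable [OF y] crv_measurable [OF w]
        crv_l2 [OF y r, unfolded wt_def] crv_l2 [OF w r, unfolded wt_def]] .
  also have "\<dots> = CM * nY y * nY w * (r powr - al * r powr - al)" by (simp add: CM_def power2_eq_square)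
  also have "r powr - al * r powr - al = r powr - (2 * al)" unfolding powr_add [symmetric] by simp
  finally have "jap \<xi> powr - sp * (jap \<xi> powr sp * cmod (Gc y w r \<xi>)) \<le> jap \<xi> powr - sp * (CM * nY y * nY w * r powr - (2 * al))"
    by (rule mult_left_mono) simp
  moreover have "jap \<xi> powr - sp * jap \<xi> powr sp = 1" unfolding powr_add [symmetric] by simp
  ultimately show ?thesis by (simp add: mult.assoc [symmetric]) (simp add: mult_ac)
qed

definition TB :: real where "TB = max (tbeta (1/2) (2 * al)) (tbeta (1/2 - al) (2 * al))"

definition C2 :: real where "C2 = CK * TB * CM"

lemma TB_nonneg: "0 \<le> TB" by (simp add: TB_def max_def)
lemma C2_nonneg: "0 \<le> C2" using CK_pos TB_nonneg CM_nonneg by (simp add: C2_def)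

text \<open>The exponent \<open>k = 1/2\<close> gives the bound that is singular in time but decays faster in frequency,
  \<open>k = 1/2 - al\<close> the one that is bounded in time; together they give the minimum in \<open>om\<close>. Both
  leave the same power \<open>t^(1/2-al)\<close>, which makes the map contractive for short times.\<close>

lemma duh_Gc_bound:
  assumes y: "fst y \<in> Hs s" and w: "fst w \<in> Hs s" and t: "0 < t" "t \<le> 1"
  shows "cmod (duh t (Gc y w) \<xi>) \<le> (C2 * t powr (1/2 - al) * nY y * nY w) * om t \<xi>"
proof (rule om_ge [OF t(1)])
  define P where "P = CM * nY y * nY w"
  have P: "0 \<le> P" using CM_nonneg by (simp add: P_def)
  have gb: "cmod (Gc y w r \<xi>) \<le> (P * jap \<xi> powr - sp) * r powr - (2 * al)" if "0 < r" "r < t" for r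
    using Gc_bound [OF y w, of r \<xi>] that t by (simp add: P_def)
  have est: "cmod (duh t (Gc y w) \<xi>) \<le> CK * tbeta k (2 * al) * t powr (1 - k - 2 * al) * jap \<xi> powr (1 - p * k) * (P * jap \<xi> powr - sp)"
    if "0 \<le> k" "k < 1" for k
    using al P by (intro duh_estimate(2) Gc_measurable y w t that gb) auto
  have "cmod (duh t (Gc y w) \<xi>) \<le> CK * tbeta (1/2) (2 * al) * t powr (1 - 1/2 - 2 * al) * jap \<xi> powr (1 - p * (1/2)) * (P * jap \<xi> powr - sp)"
    by (rule est) auto
  also have "\<dots> \<le> CK * TB * t powr (1 - 1/2 - 2 * al) * jap \<xi> powr (1 - p * (1/2)) * (P * jap \<xi> powr - sp)"
    using CK_pos P by (intro mult_right_mono mult_left_mono) (auto simp: TB_def)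
  also have "\<dots> = (CK * TB * P) * (t powr (1 - 1/2 - 2 * al)) * (jap \<xi> powr (1 - p * (1/2)) * jap \<xi> powr - sp)"
    by (simp only: mult_ac)
  also have "jap \<xi> powr (1 - p * (1/2)) * jap \<xi> powr - sp = jap \<xi> powr (1 - p / 2 - sp)" unfolding powr_add [symmetric] by simp
  also have "t powr (1 - 1/2 - 2 * al) = t powr (1/2 - al) * t powr - al" unfolding powr_add [symmetric] by simp
  finally show "cmod (duh t (Gc y w) \<xi>) \<le> (C2 * t powr (1/2 - al) * nY y * nY w) * (jap \<xi> powr (1 - p / 2 - sp) * t powr - al)"
    by (simp add: C2_def P_def mult_ac)
  have "cmod (duh t (Gc y w) \<xi>) \<le> CK * tbeta (1/2 - al) (2 * al) * t powr (1 - (1/2 - al) - 2 * al) * jap \<xi> powr (1 - p * (1/2 - al)) * (P * jap \<xi> powr - sp)"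
    by (rule est) (use al in auto)
  also have "\<dots> \<le> CK * TB * t powr (1 - (1/2 - al) - 2 * al) * jap \<xi> powr (1 - p * (1/2 - al)) * (P * jap \<xi> powr - sp)"
    using CK_pos P by (intro mult_right_mono mult_left_mono) (auto simp: TB_def)
  also have "\<dots> = (CK * TB * P) * (t powr (1 - (1/2 - al) - 2 * al)) * (jap \<xi> powr (1 - p * (1/2 - al)) * jap \<xi> powr - sp)"
    by (simp only: mult_ac)
  also have "jap \<xi> powr (1 - p * (1/2 - al)) * jap \<xi> powr - sp = jap \<xi> powr (1 - p / 2 - s)"
  proof -
    have "1 - p * (1/2 - al) + - sp = 1 - p / 2 - s" using p_al sp_sm by (simp add: algebra_simps)
    then show ?thesis by (simp only: powr_add [symmetric])
  qed
  also have "t powr (1 - (1/2 - al) - 2 * al) = t powr (1/2 - al)" by simp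
  finally show "cmod (duh t (Gc y w) \<xi>) \<le> (C2 * t powr (1/2 - al) * nY y * nY w) * jap \<xi> powr (1 - p / 2 - s)"
    by (simp add: C2_def P_def mult_ac)
qed

text \<open>The Duhamel term of two curves, measured in units of \<open>om\<close>.\<close>

definition bop :: "real \<Rightarrow> tempered \<times> bmf \<Rightarrow> tempered \<times> bmf \<Rightarrow> bmf" where
  "bop T y w = Abs_bmf (\<lambda>(t, \<xi>). if 0 < t \<and> t \<le> T then - duh t (Gc y w) \<xi> / cx (om t \<xi>) else 0)"

lemma bop_pointwise_bound:
  assumes y: "fst y \<in> Hs s" and w: "fst w \<in> Hs s" and T: "T \<le> 1" and t: "0 < t" "t \<le> T"
  shows "cmod (- duh t (Gc y w) \<xi> / cx (om t \<xi>)) \<le> C2 * T powr (1/2 - al) * nY y * nY w"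
proof -
  have "cmod (duh t (Gc y w) \<xi>) \<le> (C2 * t powr (1/2 - al) * nY y * nY w) * om t \<xi>"
    using T t by (intro duh_Gc_bound y w) auto
  also have "\<dots> \<le> (C2 * T powr (1/2 - al) * nY y * nY w) * om t \<xi>"
    using t al C2_nonneg by (intro mult_right_mono mult_left_mono powr_mono2) auto
  finally show ?thesis using om_pos [OF t(1), of \<xi>] by (simp add: norm_divide pos_divide_le_eq)
qed

lemma bop_apply:
  assumes y: "fst y \<in> Hs s" and w: "fst w \<in> Hs s" and T: "T \<le> 1"
  shows "bm_apply (bop T y w) (t, \<xi>) = (if 0 < t \<and> t \<le> T then - duh t (Gc y w) \<xi> / cx (om t \<xi>) else 0)"
proof -
  let ?f = "\<lambda>(t, \<xi>). if 0 < t \<and> t \<le> T then - duh t (Gc y w) \<xi> / cx (om t \<xi>) else 0"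
  note [measurable] = duh_measurable2 [OF Gc_measurable [OF y w]]
  have m: "?f \<in> borel_measurable (borel \<Otimes>\<^sub>M borel)" by measurable
  have nn: "0 \<le> C2 * T powr (1/2 - al) * nY y * nY w" using C2_nonneg by simp
  have "cmod (?f z) \<le> C2 * T powr (1/2 - al) * nY y * nY w" for z
    using bop_pointwise_bound [OF y w T] nn by (cases z) auto
  then have "bounded (range ?f)" unfolding bounded_iff by blast
  with m have "bm_apply (bop T y w) = ?f" unfolding bop_def by (intro Abs_bmf_inverse) simp
  then show ?thesis by simp
qed

lemma bop_norm:
  assumes y: "fst y \<in> Hs s" and w: "fst w \<in> Hs s" and T: "T \<le> 1"
  shows "norm (bop T y w) \<le> (C2 * T powr (1/2 - al)) * nY y * nY w"
proof (rule bm_norm_least)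
  fix z :: "real \<times> real"
  obtain t \<xi> where z: "z = (t, \<xi>)" by (cases z)
  have nn: "0 \<le> C2 * T powr (1/2 - al) * nY y * nY w" using C2_nonneg by simp
  show "cmod (bm_apply (bop T y w) z) \<le> (C2 * T powr (1/2 - al)) * nY y * nY w"
    unfolding z bop_apply [OF y w T] using bop_pointwise_bound [OF y w T, of t \<xi>] nn by simp
qed

lemma bop_om:
  assumes y: "fst y \<in> Hs s" and w: "fst w \<in> Hs s" and T: "T \<le> 1" and t: "0 \<le> t" "t \<le> T"
  shows "cx (om t \<xi>) * bm_apply (bop T y w) (t, \<xi>) = - duh t (Gc y w) \<xi>"
proof (cases "t = 0")
  case True
  have "duh 0 (Gc y w) \<xi> = 0"
    unfolding duh_def tint_def
  proof (rule integral_eq_zero_AE)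
    show "AE r in lborel. indicat_real {0..0} r *\<^sub>R (dterm (0 - r) \<xi> (Gc y w r \<xi>)) = 0"
      using AE_lborel_singleton [of 0] by eventually_elim (simp add: indicator_def)
  qed
  then show ?thesis using True by (simp add: om_0)
next
  case False
  then have "0 < t" using t by simp
  then show ?thesis using om_pos [of t \<xi>] t by (simp add: bop_apply [OF y w T])
qed

lemma hat_add_AE:
  assumes "x \<in> Hs s" "x' \<in> Hs s" shows "AE \<xi> in lborel. hat (x + x') \<xi> = hat x \<xi> + hat x' \<xi>"
  using rep_unique [OF rep_hat [OF Hs_add [OF assms]] rep_add [OF rep_hat [OF assms(1)] rep_hat [OF assms(2)]]] .

lemma hat_scaleR_AE:
  assumes "x \<in> Hs s" shows "AE \<xi> in lborel. hat (r *\<^sub>R x) \<xi> = cx r * hat x \<xi>"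
  using rep_unique [OF rep_hat [OF Hs_scaleR [OF assms]] rep_scaleR [OF rep_hat [OF assms]]] .

lemma crv_add_AE:
  assumes "fst y \<in> Hs s" "fst y' \<in> Hs s" shows "AE \<xi> in lborel. crv (y + y') t \<xi> = crv y t \<xi> + crv y' t \<xi>"
  using hat_add_AE [OF assms] by eventually_elim (simp add: crv_def plus_bmf.rep_eq algebra_simps)

lemma crv_scaleR_AE:
  assumes "fst y \<in> Hs s" shows "AE \<xi> in lborel. crv (r *\<^sub>R y) t \<xi> = cx r * crv y t \<xi>"
  using hat_scaleR_AE [OF assms, of r] by eventually_elim (simp add: crv_def scaleR_bmf.rep_eq scaleR_conv_of_real algebra_simps)

lemma conv_add1:
  assumes "l2_le f A" "l2_le g B" "l2_le h C" shows "conv (\<lambda>x. f x + g x) h \<xi> = conv f h \<xi> + conv g h \<xi>"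
  unfolding conv_def distrib_right
  by (rule Bochner_Integration.integral_add [OF conv_bound(1) [OF assms(1,3)] conv_bound(1) [OF assms(2,3)]])

lemma conv_cmult1: "conv (\<lambda>x. a * f x) h \<xi> = a * conv f h \<xi>"
  unfolding conv_def mult.assoc by (rule integral_mult_right_zero)

lemma conv_commute: "conv g h \<xi> = conv h g \<xi>"
  unfolding conv_def
  using lborel_integral_real_affine [of "-1" "\<lambda>\<zeta>. g (\<xi> - \<zeta>) * h \<zeta>" \<xi>] by (simp add: mult.commute)

lemma bop_commute: "bop T y w = bop T w y"
proof -
  have "Gc y w = Gc w y" by (intro ext) (unfold Gc_def, rule conv_commute)
  then show ?thesis by (simp only: bop_def)
qed

lemma Gc_add1:
  assumes "fst y \<in> Hs s" "fst y' \<in> Hs s" "fst w \<in> Hs s" "0 < r" "r \<le> 1"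
  shows "Gc (y + y') w r \<xi> = Gc y w r \<xi> + Gc y' w r \<xi>"
proof -
  note m [measurable] = crv_measurable [OF assms(1), of r] crv_measurable [OF assms(2), of r] crv_measurable [OF assms(3), of r]
  have yy: "fst (y + y') \<in> Hs s" using assms by (simp add: Hs_add)
  have m': "(\<lambda>x. crv y r x + crv y' r x) \<in> borel_measurable borel" by measurable
  have "Gc (y + y') w r \<xi> = conv (\<lambda>x. crv y r x + crv y' r x) (crv w r) \<xi>"
    unfolding Gc_def by (rule conv_cong_AE [OF crv_measurable [OF yy] m(3) m' m(3) crv_add_AE [OF assms(1,2)]]) simp
  then show ?thesis unfolding Gc_def
    by (simp only: conv_add1 [OF crv_l2_plain [OF assms(1,4,5)] crv_l2_plain [OF assms(2,4,5)] crv_l2_plain [OF assms(3,4,5)]])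
qed

lemma Gc_scaleR1:
  assumes "fst y \<in> Hs s" "fst w \<in> Hs s" shows "Gc (a *\<^sub>R y) w r \<xi> = cx a * Gc y w r \<xi>"
proof -
  note m [measurable] = crv_measurable [OF assms(1), of r] crv_measurable [OF assms(2), of r]
  have yy: "fst (a *\<^sub>R y) \<in> Hs s" using assms by (simp add: Hs_scaleR)
  have m': "(\<lambda>x. cx a * crv y r x) \<in> borel_measurable borel" by measurable
  have "Gc (a *\<^sub>R y) w r \<xi> = conv (\<lambda>x. cx a * crv y r x) (crv w r) \<xi>"
    unfolding Gc_def by (rule conv_cong_AE [OF crv_measurable [OF yy] m(2) m' m(2) crv_scaleR_AE [OF assms(1)]]) simp
  then show ?thesis unfolding Gc_def by (simp only: conv_cmult1)
qed

lemma duh_Gc_integrable: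
  assumes y: "fst y \<in> Hs s" and w: "fst w \<in> Hs s" and t: "0 < t" "t \<le> 1"
  shows "integrable lborel (\<lambda>r. indicator {0..t} r *\<^sub>R (dterm (t - r) \<xi> (Gc y w r \<xi>)))"
proof (rule duh_estimate(1) [where k = 0 and a = "2 * al" and M = "CM * nY y * nY w * jap \<xi> powr - sp"])
  show "cmod (Gc y w r \<xi>) \<le> CM * nY y * nY w * jap \<xi> powr - sp * r powr - (2 * al)" if "0 < r" "r < t" for r
    using Gc_bound [OF y w, of r \<xi>] that t by simp
qed (use al t CM_nonneg Gc_measurable [OF y w] in auto)

lemma duh_Gc_add:
  assumes y: "fst y \<in> Hs s" "fst w \<in> Hs s" "fst y' \<in> Hs s" "fst w' \<in> Hs s" "fst y'' \<in> Hs s" "fst w'' \<in> Hs s"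
    and t: "0 < t" "t \<le> 1" and eq: "\<And>r. 0 < r \<Longrightarrow> r \<le> 1 \<Longrightarrow> Gc y w r \<xi> = Gc y' w' r \<xi> + Gc y'' w'' r \<xi>"
  shows "duh t (Gc y w) \<xi> = duh t (Gc y' w') \<xi> + duh t (Gc y'' w'') \<xi>"
proof -
  note [measurable] = Gc_measurable [OF y(1,2)] Gc_measurable [OF y(3,4)] Gc_measurable [OF y(5,6)]
  have "duh t (Gc y w) \<xi> = duh t (\<lambda>r \<xi>. Gc y' w' r \<xi> + Gc y'' w'' r \<xi>) \<xi>"
    by (rule duh_cong) (use eq t in auto)
  also have "\<dots> = duh t (Gc y' w') \<xi> + duh t (Gc y'' w'') \<xi>"
    unfolding duh_def tint_def distrib_left scaleR_add_right
    by (rule Bochner_Integration.integral_add [OF duh_Gc_integrable [OF y(3,4) t] duh_Gc_integrable [OF y(5,6) t]])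
  finally show ?thesis .
qed

lemma duh_Gc_scaleR:
  assumes eq: "\<And>r. Gc y w r \<xi> = cx a * Gc y' w' r \<xi>"
  shows "duh t (Gc y w) \<xi> = cx a * duh t (Gc y' w') \<xi>"
proof -
  have "duh t (Gc y w) \<xi> = (\<integral>r. cx a * (indicator {0..t} r *\<^sub>R (dterm (t - r) \<xi> (Gc y' w' r \<xi>))))"
    unfolding duh_def tint_def eq by (rule Bochner_Integration.integral_cong [OF refl]) (simp add: mult_ac)
  then show ?thesis unfolding duh_def tint_def by (simp only: integral_mult_right_zero)
qed

lemma bmf_eqI: "(\<And>t \<xi>. bm_apply f (t, \<xi>) = bm_apply g (t, \<xi>)) \<Longrightarrow> f = g"
  by (subst bm_apply_inject [symmetric]) (rule ext, auto)

lemma bop_add: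
  assumes H: "fst y \<in> Hs s" "fst y' \<in> Hs s" "fst w \<in> Hs s" and T: "T \<le> 1"
  shows "bop T (y + y') w = bop T y w + bop T y' w"
proof (rule bmf_eqI)
  fix t \<xi>
  have H': "fst (y + y') \<in> Hs s" using H by (simp add: Hs_add)
  show "bm_apply (bop T (y + y') w) (t, \<xi>) = bm_apply (bop T y w + bop T y' w) (t, \<xi>)"
  proof (cases "0 < t \<and> t \<le> T")
    case True
    then have t: "0 < t" "t \<le> 1" using T by auto
    have "duh t (Gc (y + y') w) \<xi> = duh t (Gc y w) \<xi> + duh t (Gc y' w) \<xi>"
      by (rule duh_Gc_add [OF H' H(3) H(1,3) H(2,3) t]) (rule Gc_add1 [OF H])
    then show ?thesis using True
      by (simp add: plus_bmf.rep_eq bop_apply [OF H' H(3) T] bop_apply [OF H(1,3) T] bop_apply [OF H(2,3) T] add_divide_distrib diff_divide_distrib)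
  next
    case False
    show ?thesis
      by (simp only: plus_bmf.rep_eq bop_apply [OF H' H(3) T] bop_apply [OF H(1,3) T] bop_apply [OF H(2,3) T] False if_False add_0)
  qed
qed

lemma bop_scaleR:
  assumes H: "fst y \<in> Hs s" "fst w \<in> Hs s" and T: "T \<le> 1"
  shows "bop T (r *\<^sub>R y) w = r *\<^sub>R bop T y w"
proof (rule bmf_eqI)
  fix t \<xi>
  have H': "fst (r *\<^sub>R y) \<in> Hs s" using H by (simp add: Hs_scaleR)
  have "duh t (Gc (r *\<^sub>R y) w) \<xi> = cx r * duh t (Gc y w) \<xi>"
    by (rule duh_Gc_scaleR) (rule Gc_scaleR1 [OF H])
  then show "bm_apply (bop T (r *\<^sub>R y) w) (t, \<xi>) = bm_apply (r *\<^sub>R bop T y w) (t, \<xi>)"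
    by (simp add: scaleR_bmf.rep_eq bop_apply [OF H' H(2) T] bop_apply [OF H T] scaleR_conv_of_real)
qed

text \<open>The Duhamel term is symmetric in its two arguments, so linearity in the first one suffices.\<close>

lemma bop_quadratic_problem:
  assumes T: "0 < T" "T \<le> 1" and R: "0 < R" "8 * R * (C2 * T powr (1/2 - al)) \<le> 1"
  shows "quadratic_problem (Hs s) (Hs_nrm s) (bop T) (C2 * T powr (1/2 - al)) R"
proof
  fix y y' w :: "tempered \<times> bmf" and r :: real
  show "bop T (y + y') w = bop T y w + bop T y' w" "bop T w (y + y') = bop T w y + bop T w y'"
    if "fst y \<in> Hs s" "fst y' \<in> Hs s" "fst w \<in> Hs s"
    unfolding bop_commute [of T w] using bop_add [OF that T(2)] by simp_all
  show "bop T (r *\<^sub>R y) w = r *\<^sub>R bop T y w" "bop T w (r *\<^sub>R y) = r *\<^sub>R bop T w y"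
    if "fst y \<in> Hs s" "fst w \<in> Hs s"
    unfolding bop_commute [of T w] using bop_scaleR [OF that T(2)] by simp_all
  show "norm (bop T y w) \<le> C2 * T powr (1/2 - al) * (Hs_nrm s (fst y) + norm (snd y)) * (Hs_nrm s (fst w) + norm (snd w))"
    if "fst y \<in> Hs s" "fst w \<in> Hs s"
    using bop_norm [OF that T(2)] by (simp add: nY_def)
qed (use Hs_0 Hs_add Hs_scaleR C2_nonneg R in auto)

end

section \<open>Continuity in time\<close>

lemma ennsqrt_tendsto_0:
  assumes "(f \<longlongrightarrow> 0) F" shows "((\<lambda>x. ennsqrt (f x)) \<longlongrightarrow> 0) F"
proof (rule tendsto_zero_ennreal)
  fix r :: real assume r: "0 < r"
  have "\<forall>\<^sub>F x in F. f x < ennreal ((r / 2)\<^sup>2)"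
    using r by (intro order_tendstoD(2) [OF assms]) simp
  then show "\<forall>\<^sub>F x in F. ennsqrt (f x) < ennreal r"
  proof eventually_elim
    case (elim x)
    then have "ennsqrt (f x) \<le> ennreal (r / 2)" using r by (intro ennsqrt_le) auto
    also have "\<dots> < ennreal r" using r by (simp add: ennreal_less_iff)
    finally show ?case .
  qed
qed

text \<open>Continuity of the transform at every frequency and a common square integrable majorant give
  continuity in the Sobolev norm.\<close>

lemma Hs_continuous_dominated:
  assumes rep: "\<And>t. t \<in> I \<Longrightarrow> rep (v t) (W t)"
    and cont: "\<And>\<xi> t0. t0 \<in> I \<Longrightarrow> ((\<lambda>t. W t \<xi>) \<longlongrightarrow> W t0 \<xi>) (at t0 within I)"
    and G: "l2_le G A" and dom: "\<And>t \<xi>. t \<in> I \<Longrightarrow> cmod (wt \<sigma> (W t) \<xi>) \<le> cmod (G \<xi>)"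
  shows "Hs_continuous_on I \<sigma> v"
  unfolding Hs_continuous_on_def
proof (intro conjI ballI)
  fix t assume t: "t \<in> I"
  have "l2_le (wt \<sigma> (W t)) (1 * A)"
    by (rule l2_le_bound [OF G wt_measurable [OF rep_measurable [OF rep [OF t]]]]) (use dom [OF t] in auto)
  then show "v t \<in> Hs \<sigma>" by (rule HsI(1) [OF rep [OF t]])
next
  fix t0 assume t0: "t0 \<in> I"
  note [measurable] = l2_leD(1) [OF G]
  have "((\<lambda>t. ennsqrt (l2 (wt \<sigma> (\<lambda>\<xi>. W t \<xi> - W t0 \<xi>)))) \<longlongrightarrow> 0) (at t0 within I)"
  proof (rule ennsqrt_tendsto_0, unfold tendsto_at_iff_sequentially, intro allI impI)
    fix X :: "nat \<Rightarrow> real"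
    assume X: "\<forall>i. X i \<in> I - {t0}" "X \<longlonglongrightarrow> t0"
    then have XI: "X n \<in> I" for n by blast
    have m [measurable]: "W t \<in> borel_measurable borel" if "t \<in> I" for t
      by (rule rep_measurable [OF rep [OF that]])
    note [measurable] = m [OF XI] m [OF t0]
    have "(\<lambda>n. l2 (wt \<sigma> (\<lambda>\<xi>. W (X n) \<xi> - W t0 \<xi>))) \<longlonglongrightarrow> (\<integral>\<^sup>+\<xi>. 0 \<partial>(lborel :: real measure))"
      unfolding l2_def
    proof (rule nn_integral_dominated_convergence)
      show "(\<lambda>\<xi>. ennreal ((cmod (wt \<sigma> (\<lambda>\<xi>. W (X n) \<xi> - W t0 \<xi>) \<xi>))\<^sup>2)) \<in> borel_measurable lborel" for n by measurable
      show "(\<lambda>\<xi>. 4 * ennreal ((cmod (G \<xi>))\<^sup>2)) \<in> borel_measurable lborel" by measurable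
      show "(\<integral>\<^sup>+\<xi>. 4 * ennreal ((cmod (G \<xi>))\<^sup>2)) < \<infinity>"
        using l2_leD(4) [OF G] by (simp add: nn_integral_cmult l2_def ennreal_mult_less_top)
      show "AE \<xi> in lborel. ennreal ((cmod (wt \<sigma> (\<lambda>\<xi>. W (X n) \<xi> - W t0 \<xi>) \<xi>))\<^sup>2) \<le> 4 * ennreal ((cmod (G \<xi>))\<^sup>2)" for n
      proof (rule AE_I2)
        fix \<xi>
        have "cmod (wt \<sigma> (\<lambda>\<xi>. W (X n) \<xi> - W t0 \<xi>) \<xi>) \<le> cmod (G \<xi>) + cmod (G \<xi>)"
          unfolding wt_diff by (rule order_trans [OF norm_triangle_ineq4]) (intro add_mono dom XI t0)
        then have "(cmod (wt \<sigma> (\<lambda>\<xi>. W (X n) \<xi> - W t0 \<xi>) \<xi>))\<^sup>2 \<le> (2 * cmod (G \<xi>))\<^sup>2" by (intro power_mono) auto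
        then have "ennreal ((cmod (wt \<sigma> (\<lambda>\<xi>. W (X n) \<xi> - W t0 \<xi>) \<xi>))\<^sup>2) \<le> ennreal (4 * (cmod (G \<xi>))\<^sup>2)"
          by (intro ennreal_leI) (simp add: power_mult_distrib)
        then show "ennreal ((cmod (wt \<sigma> (\<lambda>\<xi>. W (X n) \<xi> - W t0 \<xi>) \<xi>))\<^sup>2) \<le> 4 * ennreal ((cmod (G \<xi>))\<^sup>2)"
          by (simp add: ennreal_mult)
      qed
      show "AE \<xi> in lborel. (\<lambda>n. ennreal ((cmod (wt \<sigma> (\<lambda>\<xi>. W (X n) \<xi> - W t0 \<xi>) \<xi>))\<^sup>2)) \<longlonglongrightarrow> 0"
      proof (rule AE_I2)
        fix \<xi>
        have "(\<lambda>n. W (X n) \<xi>) \<longlonglongrightarrow> W t0 \<xi>"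
          using cont [OF t0, of \<xi>] X unfolding tendsto_at_iff_sequentially o_def by blast
        then have "(\<lambda>n. ennreal ((cmod (wt \<sigma> (\<lambda>\<xi>. W (X n) \<xi> - W t0 \<xi>) \<xi>))\<^sup>2)) \<longlonglongrightarrow> ennreal ((cmod (cx (jap \<xi> powr \<sigma>) * (W t0 \<xi> - W t0 \<xi>)))\<^sup>2)"
          unfolding wt_def by (intro tendsto_intros)
        then show "(\<lambda>n. ennreal ((cmod (wt \<sigma> (\<lambda>\<xi>. W (X n) \<xi> - W t0 \<xi>) \<xi>))\<^sup>2)) \<longlonglongrightarrow> 0" by simp
      qed
    qed measurable
    then show "((\<lambda>t. l2 (wt \<sigma> (\<lambda>\<xi>. W t \<xi> - W t0 \<xi>))) \<circ> X) \<longlonglongrightarrow> 0" by (simp add: o_def)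
  qed
  moreover have "\<forall>\<^sub>F t in at t0 within I. Hs_norm \<sigma> (v t - v t0) = ennsqrt (l2 (wt \<sigma> (\<lambda>\<xi>. W t \<xi> - W t0 \<xi>)))"
    using Hs_norm_rep [OF rep_diff [OF rep rep [OF t0]]] by (simp add: eventually_at_filter)
  ultimately show "((\<lambda>t. Hs_norm \<sigma> (v t - v t0)) \<longlongrightarrow> 0) (at t0 within I)"
    by (rule Lim_transform_eventually [OF _ eventually_mono [OF _ sym]])
qed

lemma indefinite_integral_tendsto:
  fixes k :: "real \<Rightarrow> complex"
  assumes k: "integrable lborel (\<lambda>r. indicator {0..T} r *\<^sub>R k r)" and t0: "t0 \<in> {0..T}"
  shows "((\<lambda>t. \<integral>r. indicator {0..t} r *\<^sub>R k r \<partial>lborel) \<longlongrightarrow> (\<integral>r. indicator {0..t0} r *\<^sub>R k r)) (at t0 within {0..T})"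
  unfolding tendsto_at_iff_sequentially o_def
proof (intro allI impI)
  fix X :: "nat \<Rightarrow> real"
  assume X: "\<forall>i. X i \<in> {0..T} - {t0}" "X \<longlonglongrightarrow> t0"
  have meas: "(\<lambda>r. indicator {0..t} r *\<^sub>R k r) \<in> borel_measurable borel" if "t \<in> {0..T}" for t
  proof -
    have "(\<lambda>r. indicator {0..t} r *\<^sub>R k r) = (\<lambda>r. indicator {0..t} r *\<^sub>R (indicator {0..T} r *\<^sub>R k r))"
      using that by (auto simp: indicator_def fun_eq_iff)
    moreover have "(\<lambda>r. indicator {0..t} r *\<^sub>R (indicator {0..T} r *\<^sub>R k r)) \<in> borel_measurable borel"
      by (rule borel_measurable_scaleR [OF borel_measurable_indicator]) (use borel_measurable_integrable [OF k] in simp_all)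
    ultimately show ?thesis by (simp only:)
  qed
  show "(\<lambda>n. \<integral>r. indicator {0..X n} r *\<^sub>R k r \<partial>lborel) \<longlonglongrightarrow> (\<integral>r. indicator {0..t0} r *\<^sub>R k r)"
  proof (rule integral_dominated_convergence [OF _ _ integrable_norm [OF k]])
    show "(\<lambda>r. indicator {0..t0} r *\<^sub>R k r) \<in> borel_measurable lborel" using meas [OF t0] by simp
    show "(\<lambda>r. indicator {0..X n} r *\<^sub>R k r) \<in> borel_measurable lborel" for n using meas [of "X n"] X(1) by simp
    show "AE r in lborel. norm (indicator {0..X n} r *\<^sub>R k r) \<le> norm (indicator {0..T} r *\<^sub>R k r)" for n
      using X(1) [rule_format, of n] by (intro AE_I2) (auto simp: indicator_def)
    show "AE r in lborel. (\<lambda>n. indicator {0..X n} r *\<^sub>R k r) \<longlonglongrightarrow> indicator {0..t0} r *\<^sub>R k r"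
      using AE_lborel_singleton [of t0]
    proof eventually_elim
      case (elim r)
      have "\<forall>\<^sub>F n in sequentially. indicator {0..X n} r *\<^sub>R k r = indicator {0..t0} r *\<^sub>R k r"
      proof (cases "r < t0")
        case True
        then have "\<forall>\<^sub>F n in sequentially. r < X n" by (rule order_tendstoD(1) [OF X(2)])
        then show ?thesis by eventually_elim (use True in \<open>auto simp: indicator_def\<close>)
      next
        case False
        then have "t0 < r" using elim by simp
        then have "\<forall>\<^sub>F n in sequentially. X n < r" by (rule order_tendstoD(2) [OF X(2)])
        then show ?thesis by eventually_elim (use \<open>t0 < r\<close> in \<open>auto simp: indicator_def\<close>)
      qed
      then show ?case by (rule tendsto_eventually)
    qed
  qed
qed

context dissipative
begin

lemma sem_nz: "sem t \<xi> \<noteq> 0"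
  by (simp add: sem_def)

lemma sem_tendsto: "((\<lambda>t. sem t \<xi>) \<longlongrightarrow> sem t0 \<xi>) (at t0 within I)"
  unfolding sem_def by (intro tendsto_intros)

text \<open>Factoring \<open>e^(tm)\<close> out of the integral, which is possible at fixed frequency since \<open>e^(tm)\<close> has
  no zero, leaves an indefinite integral.\<close>

lemma duh_tendsto:
  assumes y: "fst y \<in> Hs s" and w: "fst w \<in> Hs s" and T: "0 < T" "T \<le> 1" and t0: "t0 \<in> {0..T}"
  shows "((\<lambda>t. duh t (Gc y w) \<xi>) \<longlongrightarrow> duh t0 (Gc y w) \<xi>) (at t0 within {0..T})"
proof -
  \<comment> \<open>At negative times \<open>sem\<close> is not bounded in the frequency, but at a fixed frequency it is just a number.\<close>
  define k where "k r = dterm (- r) \<xi> (Gc y w r \<xi>)" for r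
  have eq: "duh t (Gc y w) \<xi> = sem t \<xi> * (\<integral>r. indicator {0..t} r *\<^sub>R k r)" for t
  proof -
    have "duh t (Gc y w) \<xi> = (\<integral>r. sem t \<xi> * (indicator {0..t} r *\<^sub>R k r))"
      unfolding duh_def tint_def k_def
      by (rule Bochner_Integration.integral_cong [OF refl]) (simp add: sem_add [of t "- r" for r, simplified] mult_ac)
    then show ?thesis by (simp only: integral_mult_right_zero)
  qed
  have "integrable lborel (\<lambda>r. inverse (sem T \<xi>) * (indicator {0..T} r *\<^sub>R (dterm (T - r) \<xi> (Gc y w r \<xi>))))"
    by (intro integrable_mult_right duh_Gc_integrable y w T)
  also have "(\<lambda>r. inverse (sem T \<xi>) * (indicator {0..T} r *\<^sub>R (dterm (T - r) \<xi> (Gc y w r \<xi>)))) = (\<lambda>r. indicator {0..T} r *\<^sub>R k r)"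
    using sem_nz by (intro ext) (simp add: k_def sem_add [of T "- r" for r, simplified] field_simps)
  finally have "integrable lborel (\<lambda>r. indicator {0..T} r *\<^sub>R k r)" .
  from indefinite_integral_tendsto [OF this t0] show ?thesis
    unfolding eq by (intro tendsto_mult sem_tendsto)
qed

text \<open>The curve of distributions, extended by \<open>0\<close> as in the definition of \<open>C_Hs\<close>.\<close>

definition tcurve :: "real \<Rightarrow> tempered \<times> bmf \<Rightarrow> real \<Rightarrow> tempered" where
  "tcurve T y t = (if t \<in> {0..T} then inv_td (crv y t) else 0)"

lemma rep_tcurve:
  assumes y: "fst y \<in> Hs s" and T: "T \<le> 1" and t: "t \<in> {0..T}"
  shows "rep (tcurve T y t) (crv y t)"
proof -
  have "l2_le (wt s (crv y t)) (C1 * nY y)" using T t by (intro crv_Hs y) auto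
  then have "moderate (crv y t)"
    using l2_weighted_moderate [OF crv_measurable [OF y, of t], of s] l2_leD(4) unfolding wt_def by blast
  then show ?thesis using t by (simp add: tcurve_def rep_inv_td)
qed

lemma tcurve_add:
  assumes y: "fst y \<in> Hs s" "fst y' \<in> Hs s" and T: "T \<le> 1"
  shows "tcurve T (y + y') t = tcurve T y t + tcurve T y' t"
proof (cases "t \<in> {0..T}")
  case True
  have yy: "fst (y + y') \<in> Hs s" using y by (simp add: Hs_add)
  show ?thesis
    by (rule rep_inject_AE [OF rep_tcurve [OF yy T True] rep_add [OF rep_tcurve [OF y(1) T True] rep_tcurve [OF y(2) T True]] crv_add_AE [OF y]])
next
  case False
  then show ?thesis by (simp only: tcurve_def if_False add_0)
qed

lemma tcurve_scaleR:
  assumes y: "fst y \<in> Hs s" and T: "T \<le> 1"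
  shows "tcurve T (a *\<^sub>R y) t = a *\<^sub>R tcurve T y t"
proof (cases "t \<in> {0..T}")
  case True
  have yy: "fst (a *\<^sub>R y) \<in> Hs s" using y by (simp add: Hs_scaleR)
  show ?thesis
    by (rule rep_inject_AE [OF rep_tcurve [OF yy T True] rep_scaleR [OF rep_tcurve [OF y T True]] crv_scaleR_AE [OF y]])
next
  case False
  then show ?thesis by (simp only: tcurve_def if_False scaleR_zero_right)
qed

lemma tcurve_diff:
  assumes y: "fst y \<in> Hs s" "fst y' \<in> Hs s" and T: "T \<le> 1"
  shows "tcurve T (y - y') t = tcurve T y t - tcurve T y' t"
  using tcurve_add [OF y(1) _ T, of "(-1) *\<^sub>R y'" t] tcurve_scaleR [OF y(2) T, of "-1" t] Hs_scaleR [OF y(2), of "-1"] by simp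

text \<open>Both parts of the norm are covered by the two entries of the minimum in \<open>om\<close>.\<close>

lemma X_norm_tcurve:
  assumes y: "fst y \<in> Hs s" and T: "T \<le> 1"
  shows "X_norm p s T (tcurve T y) \<le> ennreal (2 * C1 * nY y)"
  unfolding X_norm_def
proof (rule SUP_least)
  fix t assume t: "t \<in> {0..T}"
  then have t': "0 \<le> t" "t \<le> 1" using T by auto
  note r = rep_tcurve [OF y T t]
  have nn: "0 \<le> C1 * nY y" using C1_nonneg by simp
  have two: "2 * C1 * nY y = C1 * nY y + C1 * nY y" by simp
  have 1: "Hs_norm s (tcurve T y t) \<le> ennreal (C1 * nY y)"
    by (rule Hs_norm_le [OF r crv_Hs [OF y t']])
  have 2: "ennreal (if s = 0 then 1 else t powr (\<bar>s\<bar> / p)) * L2_norm (tcurve T y t) \<le> ennreal (C1 * nY y)"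
  proof (cases "s = 0 \<or> t = 0")
    case True
    show ?thesis
    proof (cases "s = 0")
      case True
      then have "l2_le (crv y t) (C1 * nY y)" using crv_Hs [OF y t'] by simp
      then show ?thesis using L2_norm_le [OF r] True by simp
    next
      case False
      then show ?thesis using \<open>s = 0 \<or> t = 0\<close> by simp
    qed
  next
    case False
    then have t0: "0 < t" using t' by simp
    have "t powr (\<bar>s\<bar> / p) * (C1 * t powr - al * nY y) \<le> C1 * nY y"
    proof -
      have "t powr (\<bar>s\<bar> / p) * t powr - al \<le> 1"
      proof (cases "s < 0")
        case True
        then have "\<bar>s\<bar> / p = al" by (simp add: al_def sm_def)
        then show ?thesis using t0 by (simp add: powr_minus)
      next
        case False
        then have "al = 0" by (simp add: al_def sm_def)
        moreover have "t powr (\<bar>s\<bar> / p) \<le> 1" using p t' by (intro powr_le1) auto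
        ultimately show ?thesis using t0 by simp
      qed
      from mult_right_mono [OF this nn] show ?thesis by (simp add: mult_ac)
    qed
    have "ennreal (t powr (\<bar>s\<bar> / p)) * L2_norm (tcurve T y t) \<le> ennreal (t powr (\<bar>s\<bar> / p)) * ennreal (C1 * t powr - al * nY y)"
      by (intro mult_left_mono L2_norm_le [OF r crv_l2_plain [OF y t0 t'(2)]]) simp
    also have "\<dots> = ennreal (t powr (\<bar>s\<bar> / p) * (C1 * t powr - al * nY y))"
      using C1_nonneg by (simp add: ennreal_mult [symmetric])
    also have "\<dots> \<le> ennreal (C1 * nY y)" by (rule ennreal_leI) fact
    finally show ?thesis using False by simp
  qed
  have "Hs_norm s (tcurve T y t) + ennreal (if s = 0 then 1 else t powr (\<bar>s\<bar> / p)) * L2_norm (tcurve T y t) \<le> ennreal (C1 * nY y) + ennreal (C1 * nY y)"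
    by (rule add_mono [OF 1 2])
  then show "Hs_norm s (tcurve T y t) + ennreal (if s = 0 then 1 else t powr (\<bar>s\<bar> / p)) * L2_norm (tcurve T y t) \<le> ennreal (2 * C1 * nY y)"
    by (simp only: ennreal_plus [OF nn nn] two)
qed

lemma X_nrm_tcurve:
  assumes y: "fst y \<in> Hs s" and T: "T \<le> 1"
  shows "X_nrm p s T (tcurve T y) \<le> 2 * C1 * nY y"
  unfolding X_nrm_def by (rule enn2real_leI [OF _ X_norm_tcurve [OF assms]]) (use C1_nonneg in simp)

text \<open>The correction is a sum of Duhamel terms. An arbitrary bounded correction is not continuous in
  time; those of this form are, and the solution and all its derivatives with respect to the datum
  have it.\<close>

definition duhamel_type :: "real \<Rightarrow> tempered \<times> bmf \<Rightarrow> bool" where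
  "duhamel_type T y \<longleftrightarrow> fst y \<in> Hs s \<and>
     (\<exists>L. (\<forall>q\<in>set L. fst (fst q) \<in> Hs s \<and> fst (snd q) \<in> Hs s) \<and> snd y = sum_list (map (\<lambda>q. bop T (fst q) (snd q)) L))"

lemma crv_tendsto:
  assumes y: "duhamel_type T y" and T: "0 < T" "T \<le> 1" and t0: "t0 \<in> {0..T}"
  shows "((\<lambda>t. crv y t \<xi>) \<longlongrightarrow> crv y t0 \<xi>) (at t0 within {0..T})"
proof -
  obtain L where L: "\<And>q. q \<in> set L \<Longrightarrow> fst (fst q) \<in> Hs s \<and> fst (snd q) \<in> Hs s"
    and z: "snd y = sum_list (map (\<lambda>q. bop T (fst q) (snd q)) L)"
    using y unfolding duhamel_type_def by blast
  have om: "cx (om t \<xi>) * bm_apply (sum_list (map (\<lambda>q. bop T (fst q) (snd q)) L)) (t, \<xi>) =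
      - sum_list (map (\<lambda>q. duh t (Gc (fst q) (snd q)) \<xi>) L)" if t: "t \<in> {0..T}" for t
    using L
  proof (induction L)
    case Nil show ?case by (simp add: zero_bmf.rep_eq)
  next
    case (Cons q L)
    have "cx (om t \<xi>) * bm_apply (bop T (fst q) (snd q)) (t, \<xi>) = - duh t (Gc (fst q) (snd q)) \<xi>"
      using Cons.prems [of q] T t by (intro bop_om) auto
    then show ?case using Cons by (simp add: plus_bmf.rep_eq distrib_left)
  qed
  have lim: "((\<lambda>t. sum_list (map (\<lambda>q. duh t (Gc (fst q) (snd q)) \<xi>) L)) \<longlongrightarrow> sum_list (map (\<lambda>q. duh t0 (Gc (fst q) (snd q)) \<xi>) L)) (at t0 within {0..T})"
    using L by (induction L) (auto intro!: tendsto_add duh_tendsto T simp: t0 [simplified])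
  have lim0: "((\<lambda>t. sem t \<xi> * hat (fst y) \<xi> - sum_list (map (\<lambda>q. duh t (Gc (fst q) (snd q)) \<xi>) L)) \<longlongrightarrow>
     sem t0 \<xi> * hat (fst y) \<xi> - sum_list (map (\<lambda>q. duh t0 (Gc (fst q) (snd q)) \<xi>) L)) (at t0 within {0..T})"
    by (intro tendsto_diff tendsto_mult tendsto_const sem_tendsto lim)
  have eq: "crv y t \<xi> = sem t \<xi> * hat (fst y) \<xi> - sum_list (map (\<lambda>q. duh t (Gc (fst q) (snd q)) \<xi>) L)" if "t \<in> {0..T}" for t
    unfolding crv_def z om [OF that] by simp
  have LL: "((\<lambda>t. sem t \<xi> * hat (fst y) \<xi> - sum_list (map (\<lambda>q. duh t (Gc (fst q) (snd q)) \<xi>) L)) \<longlongrightarrow> crv y t0 \<xi>) (at t0 within {0..T})"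
    using lim0 by (simp only: eq [OF t0])
  have "\<forall>\<^sub>F t in at t0 within {0..T}. sem t \<xi> * hat (fst y) \<xi> - sum_list (map (\<lambda>q. duh t (Gc (fst q) (snd q)) \<xi>) L) = crv y t \<xi>"
    unfolding eventually_at_filter by (intro always_eventually allI impI) (rule eq [symmetric])
  with LL show ?thesis by (rule Lim_transform_eventually)
qed

lemma tcurve_C_Hs:
  assumes y: "duhamel_type T y" and T: "0 < T" "T \<le> 1"
  shows "tcurve T y \<in> C_Hs T s"
proof -
  have yE: "fst y \<in> Hs s" using y by (simp add: duhamel_type_def)
  note [measurable] = hat_measurable [OF yE]
  define g where "g \<xi> = CK * cmod (wt s (hat (fst y)) \<xi>) + norm (snd y) * jap \<xi> powr (1 - p / 2)" for \<xi>
  have "l2_le (\<lambda>\<xi>. cx (CK * cmod (wt s (hat (fst y)) \<xi>))) (CK * Hs_nrm s (fst y))"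
    by (rule l2_le_bound [OF Hs_nrm_rep [OF rep_hat [OF yE] yE]]) (use CK_pos in \<open>auto simp: norm_mult\<close>)
  moreover have "l2_le (\<lambda>\<xi>. cx (norm (snd y) * jap \<xi> powr (1 - p / 2))) (norm (snd y) * jA)"
    by (rule l2_le_bound [OF jA]) (auto simp: norm_mult)
  ultimately have G: "l2_le (\<lambda>\<xi>. cx (g \<xi>)) (2 * (CK * Hs_nrm s (fst y) + norm (snd y) * jA))"
    unfolding g_def of_real_add by (rule l2_le_add)
  have g0: "0 \<le> g \<xi>" for \<xi> using CK_pos by (simp add: g_def)
  have "Hs_continuous_on {0..T} s (tcurve T y)"
  proof (rule Hs_continuous_dominated [OF rep_tcurve [OF yE T(2)] crv_tendsto [OF y T] G])
    fix t \<xi> assume t: "t \<in> {0..T}"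
    then have t': "0 \<le> t" "t \<le> 1" using T by auto
    have "cmod (wt s (crv y t) \<xi>) \<le> jap \<xi> powr s * (cmod (sem t \<xi>) * cmod (hat (fst y) \<xi>) + om t \<xi> * cmod (bm_apply (snd y) (t, \<xi>)))"
      unfolding norm_wt crv_def by (intro mult_left_mono order_trans [OF norm_triangle_ineq]) (simp_all add: norm_mult)
    also have "\<dots> \<le> jap \<xi> powr s * (CK * cmod (hat (fst y) \<xi>) + jap \<xi> powr (1 - p / 2 - s) * norm (snd y))"
      by (intro mult_left_mono add_mono mult_mono mult_right_mono order_trans [OF sem_le [OF t'] K_le_CK] om_le2 bm_norm_upper) auto
    also have "\<dots> = CK * cmod (wt s (hat (fst y)) \<xi>) + norm (snd y) * (jap \<xi> powr s * jap \<xi> powr (1 - p / 2 - s))"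
      by (simp add: norm_wt algebra_simps)
    also have "jap \<xi> powr s * jap \<xi> powr (1 - p / 2 - s) = jap \<xi> powr (1 - p / 2)" unfolding powr_add [symmetric] by simp
    finally have "cmod (wt s (crv y t) \<xi>) \<le> g \<xi>" by (simp only: g_def)
    then show "cmod (wt s (crv y t) \<xi>) \<le> cmod (cx (g \<xi>))" by (simp only: norm_of_real abs_of_nonneg [OF g0])
  qed
  then show ?thesis by (auto simp: C_Hs_def tcurve_def)
qed

lemma tcurve_CX:
  assumes y: "duhamel_type T y" and T: "0 < T" "T \<le> 1"
  shows "tcurve T y \<in> CX p s T"
proof -
  have yE: "fst y \<in> Hs s" using y by (simp add: duhamel_type_def)
  show ?thesis
    using tcurve_C_Hs [OF assms] X_norm_tcurve [OF yE T(2)] by (auto simp: CX_def intro: le_less_trans)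
qed

lemma crv_fixed_point:
  assumes y: "fst y \<in> Hs s" and z: "snd y = bop T y y" and T: "T \<le> 1" and t: "0 \<le> t" "t \<le> T"
  shows "crv y t \<xi> = sem t \<xi> * hat (fst y) \<xi> - duh t (Gc y y) \<xi>"
  using bop_om [OF y y T t, of \<xi>] by (simp add: crv_def z [symmetric])

lemma hat_moderate: "x \<in> Hs s \<Longrightarrow> moderate (hat x)"
  using l2_weighted_moderate [OF hat_measurable [of x s], of s] l2_leD(4) [OF Hs_nrm_rep [OF rep_hat [of x s]]] unfolding wt_def by blast

lemma rep_V:
  assumes x: "x \<in> Hs s" and t: "0 \<le> t" "t \<le> 1"
  shows "rep (V \<eta> \<Phi> t x) (\<lambda>\<xi>. sem t \<xi> * hat x \<xi>)"
  unfolding V_eq by (rule rep_bounded_multiplier [OF rep_hat [OF x] _ sem_le [OF t] hat_moderate [OF x]]) measurable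

lemma rep_nonlinearity:
  assumes u: "rep u g" and g: "l2_le g A" and t: "0 \<le> t" "t \<le> 1"
  shows "rep (V \<eta> \<Phi> t (td_deriv (td_square u))) (\<lambda>\<xi>. dterm t \<xi> (conv g g \<xi>))"
  unfolding V_eq
proof (rule rep_bounded_multiplier [OF rep_td_deriv [OF rep_td_square [OF u g]] _ sem_le [OF t]])
  note [measurable] = l2_leD(1) [OF g]
  have pi1: "1 / (2 * pi) \<le> 1" using pi_gt3 by simp
  show "moderate (\<lambda>\<xi>. \<i> * cx \<xi> * (cx (1 / (2 * pi)) * conv g g \<xi>))"
  proof (rule moderateI_poly [where k = 1 and B = "A * A"])
    show "(\<lambda>\<xi>. \<i> * cx \<xi> * (cx (1 / (2 * pi)) * conv g g \<xi>)) \<in> borel_measurable borel" by measurable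
    fix \<xi>
    have "cmod (\<i> * cx \<xi> * (cx (1 / (2 * pi)) * conv g g \<xi>)) = \<bar>\<xi>\<bar> * (1 / (2 * pi) * cmod (conv g g \<xi>))"
      by (simp add: norm_mult norm_divide)
    also have "\<dots> \<le> jap \<xi> * (1 * (A * A))"
      by (intro mult_mono abs_le_jap pi1 conv_bound(2) g) auto
    finally show "cmod (\<i> * cx \<xi> * (cx (1 / (2 * pi)) * conv g g \<xi>)) \<le> A * A * jap \<xi> ^ 1" by (simp add: mult_ac)
  qed
qed measurable

text \<open>The absolute integrability required by the weak integral: one power of \<open>\<langle>\<xi>\<rangle>\<close> is lost to the
  derivative, and two more make the frequency integral converge.\<close>

lemma duh_fin:
  assumes G [measurable]: "jmeas G" and t: "t \<le> 1"
    and b: "AE r in lborel. r \<in> {0..t} \<longrightarrow> (\<forall>\<xi>. ennreal (cmod (G r \<xi>)) \<le> B r)"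
    and B: "B \<in> borel_measurable borel" "(\<integral>\<^sup>+r. indicator {0..t} r * B r) < \<infinity>"
  shows "(\<integral>\<^sup>+r. indicator {0..t} r * (\<integral>\<^sup>+\<xi>. ennreal (cmod (dterm (t - r) \<xi> (G r \<xi>)) / jap \<xi> ^ 3))) < \<infinity>"
proof -
  have pi1: "1 / (2 * pi) \<le> 1" using pi_gt3 by simp
  define I where "I = (\<integral>\<^sup>+\<xi>. ennreal (1 / jap \<xi> ^ 2))"
  have I: "I < \<infinity>" unfolding I_def using nn_integral_eq_integral [OF integrable_jap_power [of 2]] by simp
  note [measurable] = B(1)
  have "(\<integral>\<^sup>+r. indicator {0..t} r * (\<integral>\<^sup>+\<xi>. ennreal (cmod (dterm (t - r) \<xi> (G r \<xi>)) / jap \<xi> ^ 3)))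
    \<le> (\<integral>\<^sup>+r. (ennreal K * I) * (indicator {0..t} r * B r))"
  proof (rule nn_integral_mono_AE, use b in eventually_elim)
    case (elim r)
    show ?case
    proof (cases "r \<in> {0..t}")
      case True
      then have tr: "0 \<le> t - r" "t - r \<le> 1" using t by auto
      have "(\<integral>\<^sup>+\<xi>. ennreal (cmod (dterm (t - r) \<xi> (G r \<xi>)) / jap \<xi> ^ 3))
        \<le> (\<integral>\<^sup>+\<xi>. (ennreal K * B r) * ennreal (1 / jap \<xi> ^ 2))"
      proof (rule nn_integral_mono)
        fix \<xi>
        have "cmod (dterm (t - r) \<xi> (G r \<xi>)) = cmod (sem (t - r) \<xi>) * (\<bar>\<xi>\<bar> * (1 / (2 * pi) * cmod (G r \<xi>)))"
          by (simp add: norm_mult norm_divide)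
        also have "\<dots> \<le> K * (jap \<xi> * (1 * cmod (G r \<xi>)))"
          using K by (intro mult_mono mult_right_mono sem_le tr abs_le_jap pi1) auto
        finally have "cmod (dterm (t - r) \<xi> (G r \<xi>)) / jap \<xi> ^ 3 \<le> K * (jap \<xi> * (1 * cmod (G r \<xi>))) / jap \<xi> ^ 3"
          by (rule divide_right_mono) simp
        also have "\<dots> = K * cmod (G r \<xi>) * (1 / jap \<xi> ^ 2)" by (simp add: power3_eq_cube power2_eq_square)
        finally have "ennreal (cmod (dterm (t - r) \<xi> (G r \<xi>)) / jap \<xi> ^ 3) \<le> ennreal (K * cmod (G r \<xi>) * (1 / jap \<xi> ^ 2))"
          by (rule ennreal_leI)
        also have "\<dots> = ennreal K * ennreal (cmod (G r \<xi>)) * ennreal (1 / jap \<xi> ^ 2)" using K by (simp only: ennreal_mult norm_ge_zero mult_nonneg_nonneg order_trans [OF zero_le_one] zero_le_divide_1_iff zero_le_power jap_nonneg)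
        also have "\<dots> \<le> ennreal K * B r * ennreal (1 / jap \<xi> ^ 2)" using elim True by (intro mult_left_mono mult_right_mono) auto
        finally show "ennreal (cmod (dterm (t - r) \<xi> (G r \<xi>)) / jap \<xi> ^ 3) \<le> (ennreal K * B r) * ennreal (1 / jap \<xi> ^ 2)" .
      qed
      also have "\<dots> = (ennreal K * B r) * I" unfolding I_def by (rule nn_integral_cmult) measurable
      finally show ?thesis using True by (simp add: mult_ac)
    qed simp
  qed
  also have "\<dots> = (ennreal K * I) * (\<integral>\<^sup>+r. indicator {0..t} r * B r)" by (rule nn_integral_cmult) measurable
  also have "\<dots> < \<infinity>" using I B(2) by (simp add: ennreal_mult_less_top)
  finally show ?thesis .
qed

lemma nn_integral_powr_finite:
  assumes "a < 1" "t \<le> 1" shows "(\<integral>\<^sup>+r. indicator {0..t} r * ennreal (Q * r powr - a)) < \<infinity>"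
proof -
  have "(\<integral>\<^sup>+r. indicator {0..t} r * ennreal (Q * r powr - a)) \<le> (\<integral>\<^sup>+r. ennreal \<bar>Q\<bar> * (indicator {0..1} r * ennreal ((1 - r) powr - 0 * r powr - a)))"
  proof (rule nn_integral_mono_AE, use AE_lborel_singleton [of 1] in eventually_elim)
    case (elim r)
    show ?case
    proof (cases "r \<in> {0..t}")
      case True
      then have "r \<in> {0..1}" "(1 - r) powr - 0 = 1" using assms elim by auto
      moreover have "ennreal (Q * r powr - a) \<le> ennreal \<bar>Q\<bar> * ennreal (r powr - a)"
        unfolding ennreal_mult [OF abs_ge_zero powr_ge_zero, symmetric] by (intro ennreal_leI mult_right_mono) auto
      ultimately show ?thesis using True by simp
    qed simp
  qed
  also have "\<dots> = ennreal \<bar>Q\<bar> * (\<integral>\<^sup>+r. indicator {0..1} r * ennreal ((1 - r) powr - 0 * r powr - a))"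
    by (rule nn_integral_cmult) measurable
  also have "\<dots> \<le> ennreal \<bar>Q\<bar> * ennreal (tbeta 0 a * 1 powr (1 - 0 - a))"
    by (intro mult_left_mono nn_integral_time assms) auto
  also have "\<dots> < \<infinity>" by (simp add: ennreal_mult [symmetric])
  finally show ?thesis .
qed

text \<open>All ingredients of the integral equation are translated to the Fourier side, where it is the
  fixed point equation multiplied by \<open>om\<close>.\<close>

lemma fixed_point_solution:
  assumes y: "fst y \<in> Hs s" and z: "snd y = bop T y y" and T: "0 < T" "T \<le> 1"
  shows "solution \<eta> \<Phi> s T (fst y) (tcurve T y)"
  unfolding solution_def
proof (intro conjI ballI)
  have "duhamel_type T y" unfolding duhamel_type_def
    using y z by (intro conjI exI [of _ "[(y, y)]"]) auto
  then show "tcurve T y \<in> C_Hs T s" using T by (rule tcurve_C_Hs)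
  have al2: "2 * al < 1" using al by simp
  have "(\<integral>\<^sup>+t. (L2_norm (tcurve T y t))\<^sup>2 * indicator {0..T} t) \<le> (\<integral>\<^sup>+r. indicator {0..T} r * ennreal ((C1 * nY y)\<^sup>2 * r powr - (2 * al)))"
  proof (rule nn_integral_mono_AE, use AE_lborel_singleton [of 0] in eventually_elim)
    case (elim r)
    show ?case
    proof (cases "r \<in> {0..T}")
      case True
      then have r: "0 < r" "r \<le> 1" using elim T by auto
      have "(L2_norm (tcurve T y r))\<^sup>2 \<le> (ennreal (C1 * r powr - al * nY y))\<^sup>2"
        by (intro power_mono L2_norm_le [OF rep_tcurve [OF y T(2) True] crv_l2_plain [OF y r]]) simp
      also have "\<dots> = ennreal ((C1 * nY y)\<^sup>2 * (r powr - al * r powr - al))"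
        using C1_nonneg by (simp add: ennreal_power) (simp add: power2_eq_square mult_ac)
      also have "r powr - al * r powr - al = r powr - (2 * al)" unfolding powr_add [symmetric] by simp
      finally show ?thesis using True by simp
    qed simp
  qed
  then show "(\<integral>\<^sup>+t. (L2_norm (tcurve T y t))\<^sup>2 * indicator {0..T} t) < \<infinity>"
    using nn_integral_powr_finite [OF al2 T(2)] by (rule le_less_trans)
  fix t assume t: "t \<in> {0..T}"
  then have t1: "0 \<le> t" "t \<le> T" "t \<le> 1" using T by auto
  note Gm = Gc_measurable [OF y y]
  have fin: "(\<integral>\<^sup>+r. indicator {0..t} r * (\<integral>\<^sup>+\<xi>. ennreal (cmod (dterm (t - r) \<xi> (Gc y y r \<xi>)) / jap \<xi> ^ 3))) < \<infinity>"
  proof (rule duh_fin [OF Gm t1(3), where B = "\<lambda>r. ennreal (CM * nY y * nY y * r powr - (2 * al))"])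
    show "AE r in lborel. r \<in> {0..t} \<longrightarrow> (\<forall>\<xi>. ennreal (cmod (Gc y y r \<xi>)) \<le> ennreal (CM * nY y * nY y * r powr - (2 * al)))"
      using AE_lborel_singleton [of 0]
    proof (eventually_elim, intro impI allI)
      fix r \<xi> assume "r \<noteq> 0" "r \<in> {0..t}"
      then have r: "0 < r" "r \<le> 1" using t1 by auto
      have "jap \<xi> powr - sp \<le> jap \<xi> powr 0" by (intro powr_mono) auto
      then have "(CM * nY y * nY y * r powr - (2 * al)) * jap \<xi> powr - sp \<le> (CM * nY y * nY y * r powr - (2 * al)) * 1"
        using CM_nonneg by (intro mult_left_mono) auto
      then show "ennreal (cmod (Gc y y r \<xi>)) \<le> ennreal (CM * nY y * nY y * r powr - (2 * al))"
        using Gc_bound [OF y y r, of \<xi>] by (intro ennreal_leI) (simp add: mult_ac)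
    qed
    show "(\<integral>\<^sup>+r. indicator {0..t} r * ennreal (CM * nY y * nY y * r powr - (2 * al))) < \<infinity>"
      by (rule nn_integral_powr_finite [OF al2 t1(3)])
  qed measurable
  define D where "D = inv_td (duh t (Gc y y))"
  have "has_td_integral (\<lambda>t'. V \<eta> \<Phi> (t - t') (td_deriv (td_square (tcurve T y t')))) D {0..t}"
    unfolding D_def duh_def
  proof (rule has_td_integral_inv_td [OF duh_integrand_measurable [OF Gm] fin])
    fix r assume r: "r \<in> {0<..t}"
    then have r': "0 < r" "r \<le> 1" "r \<in> {0..T}" "0 \<le> t - r" "t - r \<le> 1" using t1 by auto
    show "rep (V \<eta> \<Phi> (t - r) (td_deriv (td_square (tcurve T y r)))) (\<lambda>\<xi>. dterm (t - r) \<xi> (Gc y y r \<xi>))"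
      unfolding Gc_def by (rule rep_nonlinearity [OF rep_tcurve [OF y T(2) r'(3)] crv_l2_plain [OF y r'(1,2)] r'(4,5)])
  qed
  moreover have "tcurve T y t = V \<eta> \<Phi> t (fst y) - D"
  proof (rule rep_inject [OF rep_tcurve [OF y T(2) t]])
    have "rep D (duh t (Gc y y))"
      unfolding D_def duh_def by (rule rep_inv_td [OF tint_moderate [OF duh_integrand_measurable [OF Gm] fin]])
    note R = rep_diff [OF rep_V [OF y t1(1,3)] this]
    have "crv y t = (\<lambda>\<xi>. sem t \<xi> * hat (fst y) \<xi> - duh t (Gc y y) \<xi>)"
      by (rule ext) (rule crv_fixed_point [OF y z T(2) t1(1,2)])
    with R show "rep (V \<eta> \<Phi> t (fst y) - D) (crv y t)" by (simp only:)
  qed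
  ultimately show "\<exists>D. has_td_integral (\<lambda>t'. V \<eta> \<Phi> (t - t') (td_deriv (td_square (tcurve T y t')))) D {0..t} \<and> tcurve T y t = V \<eta> \<Phi> t (fst y) - D"
    by blast
qed

end

context dissipative
begin

section \<open>Smoothing\<close>

text \<open>Away from time \<open>0\<close> the propagator decays faster than any power.\<close>

lemma sem_rapid:
  assumes "0 < \<epsilon>"
  shows "\<exists>B\<ge>0. \<forall>t\<in>{\<epsilon>..1}. \<forall>\<xi>. jap \<xi> powr m * cmod (sem t \<xi>) \<le> B"
proof -
  obtain k :: nat where k: "m \<le> real k" using real_arch_simple by blast
  obtain B where B: "\<And>x. jap x ^ k * exp (- (c * \<epsilon> * x\<^sup>2)) \<le> B"
    using jap_power_le_exp [of "c * \<epsilon>" k] c assms by auto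
  have B0: "0 \<le> B" using B [of 0] order_trans [of 0 "jap 0 ^ k * exp (- (c * \<epsilon> * 0\<^sup>2))" B] by simp
  have "jap \<xi> powr m * cmod (sem t \<xi>) \<le> K * B" if t: "t \<in> {\<epsilon>..1}" for t \<xi>
  proof -
    have "\<xi>\<^sup>2 \<le> (jap \<xi>)\<^sup>2" by (simp add: jap_sq)
    also have "\<dots> = jap \<xi> powr 2" by simp
    also have "\<dots> \<le> jap \<xi> powr p" using p by (intro powr_mono) auto
    finally have "c * \<epsilon> * \<xi>\<^sup>2 \<le> c * t * jap \<xi> powr p" using c assms t by (intro mult_mono) auto
    then have "cmod (sem t \<xi>) \<le> K * exp (- (c * \<epsilon> * \<xi>\<^sup>2))"
      using decay [of t \<xi>] t assms K by (auto simp: norm_sem intro: order_trans)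
    moreover have "jap \<xi> powr m \<le> jap \<xi> ^ k" using powr_mono [OF k jap_ge_1, of \<xi>] by (simp add: powr_realpow)
    ultimately have "jap \<xi> powr m * cmod (sem t \<xi>) \<le> jap \<xi> ^ k * (K * exp (- (c * \<epsilon> * \<xi>\<^sup>2)))"
      by (intro mult_mono) auto
    also have "\<dots> = K * (jap \<xi> ^ k * exp (- (c * \<epsilon> * \<xi>\<^sup>2)))" by simp
    also have "\<dots> \<le> K * B" using K by (intro mult_left_mono B) auto
    finally show ?thesis .
  qed
  moreover have "0 \<le> K * B" using K B0 by simp
  ultimately show ?thesis by blast
qed

text \<open>The two terms of the majorant are singular at the two ends of the time interval and come from
  its early and its late part.\<close>

lemma duh_two_bound:
  assumes G [measurable]: "jmeas G"
    and t: "0 < t" "t \<le> 1" and k: "k < 1" and a: "a < 1" and Q: "0 \<le> Q1" "0 \<le> Q2"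
    and b: "\<And>r. 0 < r \<Longrightarrow> r < t \<Longrightarrow> cmod (sem (t - r) \<xi>) * (jap \<xi> * cmod (G r \<xi>)) \<le> Q1 * r powr - a + Q2 * (t - r) powr - k"
  shows "cmod (duh t G \<xi>) \<le> Q1 * tbeta 0 a + Q2 * tbeta k 0"
proof -
  let ?f = "\<lambda>r. indicator {0..t} r *\<^sub>R (dterm (t - r) \<xi> (G r \<xi>))"
  have pi1: "1 / (2 * pi) \<le> 1" using pi_gt3 by simp
  have [measurable]: "(\<lambda>r. G r \<xi>) \<in> borel_measurable borel"
    using measurable_compose [OF measurable_Pair2' G, of \<xi>] by simp
  have m: "?f \<in> borel_measurable borel" by measurable
  have "(\<integral>\<^sup>+r. ennreal (cmod (?f r))) \<le> (\<integral>\<^sup>+r. ennreal Q1 * (indicator {0..t} r * ennreal ((t - r) powr - 0 * r powr - a)) +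
     ennreal Q2 * (indicator {0..t} r * ennreal ((t - r) powr - k * r powr - 0)))"
  proof (rule nn_integral_mono_AE, use AE_lborel_singleton [of 0] AE_lborel_singleton [of t] in eventually_elim)
    case (elim r)
    show ?case
    proof (cases "r \<in> {0..t}")
      case True
      then have r: "0 < r" "r < t" using elim by auto
      have "cmod (?f r) = cmod (sem (t - r) \<xi>) * (\<bar>\<xi>\<bar> * (1 / (2 * pi) * cmod (G r \<xi>)))"
        using True by (simp add: norm_mult norm_divide)
      also have "\<dots> \<le> cmod (sem (t - r) \<xi>) * (jap \<xi> * (1 * cmod (G r \<xi>)))"
        by (intro mult_left_mono mult_mono mult_right_mono abs_le_jap pi1) auto
      also have "\<dots> \<le> Q1 * r powr - a + Q2 * (t - r) powr - k" using b [OF r] by simp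
      finally have "ennreal (cmod (?f r)) \<le> ennreal (Q1 * r powr - a + Q2 * (t - r) powr - k)" by (rule ennreal_leI)
      also have "\<dots> = ennreal Q1 * ennreal (r powr - a) + ennreal Q2 * ennreal ((t - r) powr - k)"
        using Q by (simp add: ennreal_mult)
      finally show ?thesis using True r by simp
    qed simp
  qed
  also have "\<dots> = ennreal Q1 * (\<integral>\<^sup>+r. indicator {0..t} r * ennreal ((t - r) powr - 0 * r powr - a))
     + ennreal Q2 * (\<integral>\<^sup>+r. indicator {0..t} r * ennreal ((t - r) powr - k * r powr - 0))"
    by (subst nn_integral_add) (simp_all add: nn_integral_cmult)
  also have "\<dots> \<le> ennreal Q1 * ennreal (tbeta 0 a * t powr (1 - 0 - a)) + ennreal Q2 * ennreal (tbeta k 0 * t powr (1 - k - 0))"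
    by (intro add_mono mult_left_mono nn_integral_time k a t) auto
  also have "\<dots> \<le> ennreal Q1 * ennreal (tbeta 0 a * 1) + ennreal Q2 * ennreal (tbeta k 0 * 1)"
    using t a k by (intro add_mono mult_left_mono ennreal_leI powr_le1) auto
  also have "\<dots> = ennreal (Q1 * tbeta 0 a + Q2 * tbeta k 0)"
    using Q by (simp add: ennreal_mult)
  finally have le: "(\<integral>\<^sup>+r. ennreal (cmod (?f r))) \<le> ennreal (Q1 * tbeta 0 a + Q2 * tbeta k 0)" .
  have "0 \<le> Q1 * tbeta 0 a + Q2 * tbeta k 0" using Q by simp
  from integrable_bound_nn(2) [OF m le this] show ?thesis by (simp add: duh_def tint_def)
qed

text \<open>Away from time \<open>0\<close> the curve has \<open>n\<close> derivatives, with a majorant that does not depend on time,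
  as the proof of continuity requires.\<close>

definition regular_at :: "real \<Rightarrow> tempered \<times> bmf \<Rightarrow> real \<Rightarrow> bool" where
  "regular_at T y n \<longleftrightarrow> (\<forall>\<epsilon>>0. \<exists>G A. l2_le G A \<and> (\<forall>t\<in>{\<epsilon>..T}. \<forall>\<xi>. cmod (wt n (crv y t) \<xi>) \<le> cmod (G \<xi>)))"

lemma regular_0:
  assumes y: "fst y \<in> Hs s" and T: "T \<le> 1" shows "regular_at T y 0"
  unfolding regular_at_def
proof (intro allI impI)
  fix \<epsilon> :: real assume \<epsilon>: "0 < \<epsilon>"
  note [measurable] = hat_measurable [OF y]
  define e where "e = \<epsilon> powr - al"
  define g where "g \<xi> = (CK * e) * cmod (wt s (hat (fst y)) \<xi>) + (norm (snd y) * e) * jap \<xi> powr (1 - p / 2)" for \<xi>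
  have e0: "0 \<le> e" by (simp add: e_def)
  have "l2_le (\<lambda>\<xi>. cx ((CK * e) * cmod (wt s (hat (fst y)) \<xi>))) ((CK * e) * Hs_nrm s (fst y))"
    by (rule l2_le_bound [OF Hs_nrm_rep [OF rep_hat [OF y] y]]) (use CK_pos e0 in \<open>auto simp: norm_mult\<close>)
  moreover have "l2_le (\<lambda>\<xi>. cx ((norm (snd y) * e) * jap \<xi> powr (1 - p / 2))) ((norm (snd y) * e) * jA)"
    by (rule l2_le_bound [OF jA]) (use e0 in \<open>auto simp: norm_mult\<close>)
  ultimately have G: "l2_le (\<lambda>\<xi>. cx (g \<xi>)) (2 * ((CK * e) * Hs_nrm s (fst y) + (norm (snd y) * e) * jA))"
    unfolding g_def of_real_add by (rule l2_le_add)
  have "cmod (wt 0 (crv y t) \<xi>) \<le> cmod (cx (g \<xi>))" if t: "t \<in> {\<epsilon>..T}" for t \<xi>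
  proof -
    have t': "0 < t" "t \<le> 1" using t \<epsilon> T by auto
    have te: "t powr - al \<le> e" unfolding e_def using t \<epsilon> al by (intro powr_mono2') auto
    have "cmod (sem t \<xi>) \<le> CK * (t powr - al * jap \<xi> powr - (p * al))" by (rule sem_bound) (use al t' in auto)
    also have "\<dots> \<le> CK * (e * jap \<xi> powr s)"
      using CK_pos te e0 p_al sp_sm sp_nonneg by (intro mult_left_mono mult_mono powr_mono) (auto simp del: sp_nonneg)
    finally have 1: "cmod (sem t \<xi>) \<le> CK * (e * jap \<xi> powr s)" .
    have "om t \<xi> \<le> jap \<xi> powr (1 - p / 2 - sp) * t powr - al" by (rule om_le1 [OF t'(1)])
    also have "\<dots> \<le> jap \<xi> powr (1 - p / 2) * e" using te by (intro mult_mono powr_mono) auto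
    finally have 2: "om t \<xi> \<le> jap \<xi> powr (1 - p / 2) * e" .
    have "cmod (crv y t \<xi>) \<le> cmod (sem t \<xi>) * cmod (hat (fst y) \<xi>) + om t \<xi> * cmod (bm_apply (snd y) (t, \<xi>))"
      unfolding crv_def by (rule order_trans [OF norm_triangle_ineq]) (simp add: norm_mult)
    also have "\<dots> \<le> (CK * (e * jap \<xi> powr s)) * cmod (hat (fst y) \<xi>) + (jap \<xi> powr (1 - p / 2) * e) * norm (snd y)"
      by (intro add_mono mult_right_mono mult_mono 1 2 bm_norm_upper) (use e0 in auto)
    also have "\<dots> = g \<xi>" by (simp add: g_def norm_wt mult_ac)
    finally show ?thesis by simp
  qed
  with G show "\<exists>G A. l2_le G A \<and> (\<forall>t\<in>{\<epsilon>..T}. \<forall>\<xi>. cmod (wt 0 (crv y t) \<xi>) \<le> cmod (G \<xi>))" by blast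
qed

text \<open>For early times the propagator is rapidly decaying and the crude bound for the convolution
  suffices. For late times \<open>n\<close> derivatives fall on the convolution, one is lost, and the
  propagator gains \<open>p k > 5/2\<close> with \<open>k = 5/6\<close>; the remaining decay \<open>\<langle>\<xi>\<rangle>^(-(pk-2))\<close> after \<open>n + 1\<close>
  derivatives is square integrable.\<close>

lemma regular_Suc:
  assumes y: "fst y \<in> Hs s" and z: "snd y = bop T y y" and T: "0 < T" "T \<le> 1" and n: "0 \<le> n" and reg: "regular_at T y n"
  shows "regular_at T y (n + 1)"
  unfolding regular_at_def
proof (intro allI impI)
  fix \<epsilon> :: real assume \<epsilon>: "0 < \<epsilon>"
  note [measurable] = hat_measurable [OF y]
  obtain G0 A0 where G0: "l2_le G0 A0" and dom: "\<And>t \<xi>. t \<in> {\<epsilon> / 2..T} \<Longrightarrow> cmod (wt n (crv y t) \<xi>) \<le> cmod (G0 \<xi>)"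
    using reg \<epsilon> unfolding regular_at_def by (metis half_gt_zero)
  have l2: "l2_le (wt n (crv y t)) A0" if "t \<in> {\<epsilon> / 2..T}" for t
    using l2_le_bound [OF G0 wt_measurable [OF crv_measurable [OF y, of t]], where s1 = n and c = 1] dom [OF that] by simp
  obtain B where B: "0 \<le> B" "\<And>t \<xi>. t \<in> {\<epsilon> / 2..1} \<Longrightarrow> jap \<xi> powr (n + 3) * cmod (sem t \<xi>) \<le> B"
    using sem_rapid [of "\<epsilon> / 2" "n + 3"] \<epsilon> by (metis half_gt_zero)
  obtain B' where B': "0 \<le> B'" "\<And>t \<xi>. t \<in> {\<epsilon>..1} \<Longrightarrow> jap \<xi> powr (n + 1 - s) * cmod (sem t \<xi>) \<le> B'"
    using sem_rapid [OF \<epsilon>, of "n + 1 - s"] by metis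
  define P where "P = CM * nY y * nY y"
  have P0: "0 \<le> P" using CM_nonneg by (simp add: P_def)
  have A0: "0 \<le> A0" by (rule l2_leD(2) [OF G0])
  \<comment> \<open>Any \<open>k < 1\<close> with \<open>p k - 2 > 1/2\<close> would do; for \<open>p > 3\<close> this is one.\<close>
  define k where "k = (5/6 :: real)"
  define c1 where "c1 = B * P * tbeta 0 (2 * al)"
  define c2 where "c2 = CK * (2 powr n * (A0 * A0)) * tbeta k 0"
  have c0: "0 \<le> c1" "0 \<le> c2" using B(1) P0 CK_pos A0 by (simp_all add: c1_def c2_def)
  obtain J1 where J1: "l2_le (\<lambda>\<xi>. cx (jap \<xi> powr - 1)) J1" using l2_le_jap [of 1] by auto
  obtain J2 where J2: "l2_le (\<lambda>\<xi>. cx (jap \<xi> powr - (p * k - 2))) J2" using l2_le_jap [of "p * k - 2"] p by (auto simp: k_def)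
  define g where "g \<xi> = B' * cmod (wt s (hat (fst y)) \<xi>) + (c1 * jap \<xi> powr - 1 + c2 * jap \<xi> powr - (p * k - 2))" for \<xi>
  have "l2_le (\<lambda>\<xi>. cx (B' * cmod (wt s (hat (fst y)) \<xi>))) (B' * Hs_nrm s (fst y))"
    by (rule l2_le_bound [OF Hs_nrm_rep [OF rep_hat [OF y] y]]) (use B' in \<open>auto simp: norm_mult\<close>)
  moreover have "l2_le (\<lambda>\<xi>. cx (c1 * jap \<xi> powr - 1)) (c1 * J1)"
    by (rule l2_le_bound [OF J1]) (use c0 in \<open>auto simp: norm_mult norm_divide\<close>)
  moreover have "l2_le (\<lambda>\<xi>. cx (c2 * jap \<xi> powr - (p * k - 2))) (c2 * J2)"
    by (rule l2_le_bound [OF J2]) (use c0 in \<open>auto simp: norm_mult norm_divide\<close>)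
  ultimately have G: "l2_le (\<lambda>\<xi>. cx (g \<xi>)) (2 * (B' * Hs_nrm s (fst y) + 2 * (c1 * J1 + c2 * J2)))"
    unfolding g_def of_real_add by (intro l2_le_add)
  have "cmod (wt (n + 1) (crv y t) \<xi>) \<le> cmod (cx (g \<xi>))" if t: "t \<in> {\<epsilon>..T}" for t \<xi>
  proof -
    have t': "0 < t" "t \<le> 1" "0 \<le> t" "t \<le> T" using t \<epsilon> T by auto
    have duh: "cmod (duh t (Gc y y) \<xi>) \<le> (B * P * jap \<xi> powr - (n + 2)) * tbeta 0 (2 * al) + (CK * (2 powr n * (A0 * A0)) * jap \<xi> powr (1 - n - p * k)) * tbeta k 0"
    proof (rule duh_two_bound [OF Gc_measurable [OF y y] t'(1,2)])
      fix r assume r: "0 < r" "r < t"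
      show "cmod (sem (t - r) \<xi>) * (jap \<xi> * cmod (Gc y y r \<xi>)) \<le> B * P * jap \<xi> powr - (n + 2) * r powr - (2 * al) +
          CK * (2 powr n * (A0 * A0)) * jap \<xi> powr (1 - n - p * k) * (t - r) powr - k"
      proof (cases "r < \<epsilon> / 2")
        case True
        have "jap \<xi> powr (n + 3) * cmod (sem (t - r) \<xi>) \<le> B" using True t r T by (intro B(2)) auto
        then have "jap \<xi> powr - (n + 3) * (jap \<xi> powr (n + 3) * cmod (sem (t - r) \<xi>)) \<le> jap \<xi> powr - (n + 3) * B" by (rule mult_left_mono) simp
        moreover have "jap \<xi> powr - (n + 3) * jap \<xi> powr (n + 3) = 1" unfolding powr_add [symmetric] by simp
        ultimately have 1: "cmod (sem (t - r) \<xi>) \<le> jap \<xi> powr - (n + 3) * B" by (simp only: mult.assoc [symmetric] mult_1_left)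
        have "jap \<xi> powr - sp \<le> jap \<xi> powr 0" by (intro powr_mono) auto
        then have "(P * r powr - (2 * al)) * jap \<xi> powr - sp \<le> (P * r powr - (2 * al)) * 1"
          using P0 by (intro mult_left_mono) auto
        then have 2: "cmod (Gc y y r \<xi>) \<le> P * r powr - (2 * al)"
          using Gc_bound [OF y y r(1), of \<xi>] r t' by (simp add: P_def mult_ac)
        have "cmod (sem (t - r) \<xi>) * (jap \<xi> * cmod (Gc y y r \<xi>)) \<le> (jap \<xi> powr - (n + 3) * B) * (jap \<xi> powr 1 * (P * r powr - (2 * al)))"
          using B(1) 2 by (intro mult_mono 1) auto
        also have "\<dots> = B * P * (jap \<xi> powr - (n + 3) * jap \<xi> powr 1) * r powr - (2 * al)" by (simp only: mult_ac)
        also have "jap \<xi> powr - (n + 3) * jap \<xi> powr 1 = jap \<xi> powr - (n + 2)" unfolding powr_add [symmetric] by (rule arg_cong [where f = "\<lambda>x. jap \<xi> powr x"]) simp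
        finally show ?thesis
          using CK_pos A0 by (intro order_trans [OF _ add_increasing2 [OF _ order_refl]]) auto
      next
        case False
        then have rI: "r \<in> {\<epsilon> / 2..T}" using r t by auto
        have "jap \<xi> powr n * cmod (Gc y y r \<xi>) \<le> 2 powr n * (A0 * A0)"
          unfolding Gc_def
          by (rule conv_weighted_bound [OF n crv_measurable [OF y] crv_measurable [OF y]]) (use l2 [OF rI] in \<open>simp_all add: wt_def\<close>)
        then have "jap \<xi> powr - n * (jap \<xi> powr n * cmod (Gc y y r \<xi>)) \<le> jap \<xi> powr - n * (2 powr n * (A0 * A0))" by (rule mult_left_mono) simp
        moreover have "jap \<xi> powr - n * jap \<xi> powr n = 1" unfolding powr_add [symmetric] by simp
        ultimately have 1: "cmod (Gc y y r \<xi>) \<le> jap \<xi> powr - n * (2 powr n * (A0 * A0))" by (simp only: mult.assoc [symmetric] mult_1_left)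
        have 2: "cmod (sem (t - r) \<xi>) \<le> CK * ((t - r) powr - k * jap \<xi> powr - (p * k))"
          using r t' by (intro sem_bound) (auto simp: k_def)
        have "cmod (sem (t - r) \<xi>) * (jap \<xi> * cmod (Gc y y r \<xi>)) \<le> (CK * ((t - r) powr - k * jap \<xi> powr - (p * k))) * (jap \<xi> powr 1 * (jap \<xi> powr - n * (2 powr n * (A0 * A0))))"
          using CK_pos 1 by (intro mult_mono 2) auto
        also have "\<dots> = CK * (2 powr n * (A0 * A0)) * (jap \<xi> powr - (p * k) * (jap \<xi> powr 1 * jap \<xi> powr - n)) * (t - r) powr - k" by (simp only: mult_ac)
        also have "jap \<xi> powr - (p * k) * (jap \<xi> powr 1 * jap \<xi> powr - n) = jap \<xi> powr (1 - n - p * k)" unfolding powr_add [symmetric] by (simp add: algebra_simps)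
        finally show ?thesis
          using B(1) P0 by (intro order_trans [OF _ add_increasing [OF _ order_refl]]) auto
      qed
    qed (use B(1) P0 CK_pos A0 al in \<open>auto simp: k_def\<close>)
    have "cmod (crv y t \<xi>) \<le> cmod (sem t \<xi>) * cmod (hat (fst y) \<xi>) + cmod (duh t (Gc y y) \<xi>)"
      unfolding crv_fixed_point [OF y z T(2) t'(3,4)] by (rule order_trans [OF norm_triangle_ineq4]) (simp add: norm_mult)
    then have "cmod (wt (n + 1) (crv y t) \<xi>) \<le> jap \<xi> powr (n + 1) * (cmod (sem t \<xi>) * cmod (hat (fst y) \<xi>) +
       ((B * P * jap \<xi> powr - (n + 2)) * tbeta 0 (2 * al) + (CK * (2 powr n * (A0 * A0)) * jap \<xi> powr (1 - n - p * k)) * tbeta k 0))"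
      unfolding norm_wt using duh by (intro mult_left_mono) auto
    also have "\<dots> = (jap \<xi> powr (n + 1) * cmod (sem t \<xi>)) * cmod (hat (fst y) \<xi>) +
       (c1 * (jap \<xi> powr (n + 1) * jap \<xi> powr - (n + 2)) + c2 * (jap \<xi> powr (n + 1) * jap \<xi> powr (1 - n - p * k)))"
      by (simp add: c1_def c2_def algebra_simps)
    also have "jap \<xi> powr (n + 1) * jap \<xi> powr - (n + 2) = jap \<xi> powr - 1" unfolding powr_add [symmetric] by simp
    also have "jap \<xi> powr (n + 1) * jap \<xi> powr (1 - n - p * k) = jap \<xi> powr - (p * k - 2)" unfolding powr_add [symmetric] by simp
    also have "jap \<xi> powr (n + 1) * cmod (sem t \<xi>) = jap \<xi> powr s * (jap \<xi> powr (n + 1 - s) * cmod (sem t \<xi>))"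
      unfolding mult.assoc [symmetric] powr_add [symmetric] by simp
    also have "jap \<xi> powr s * (jap \<xi> powr (n + 1 - s) * cmod (sem t \<xi>)) * cmod (hat (fst y) \<xi>) \<le> jap \<xi> powr s * B' * cmod (hat (fst y) \<xi>)"
      using t T by (intro mult_right_mono mult_left_mono B'(2)) auto
    also have "jap \<xi> powr s * B' * cmod (hat (fst y) \<xi>) = B' * cmod (wt s (hat (fst y)) \<xi>)" by (simp add: norm_wt)
    finally have "cmod (wt (n + 1) (crv y t) \<xi>) \<le> g \<xi>" by (simp only: g_def)
    then show ?thesis by simp
  qed
  with G show "\<exists>G A. l2_le G A \<and> (\<forall>t\<in>{\<epsilon>..T}. \<forall>\<xi>. cmod (wt (n + 1) (crv y t) \<xi>) \<le> cmod (G \<xi>))" by blast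
qed

lemma regular_all:
  assumes y: "fst y \<in> Hs s" and z: "snd y = bop T y y" and T: "0 < T" "T \<le> 1"
  shows "regular_at T y (real n)"
proof (induction n)
  case 0 then show ?case using regular_0 [OF y T(2)] by simp
next
  case (Suc n)
  then show ?case using regular_Suc [OF y z T _ Suc] by (simp add: add.commute)
qed

text \<open>Continuity is local in time, so the majorants on \<open>[\<epsilon>, T]\<close> suffice.\<close>

lemma tcurve_Hinf:
  assumes y: "fst y \<in> Hs s" and z: "snd y = bop T y y" and T: "0 < T" "T \<le> 1"
  shows "Hinf_continuous_on {0<..T} (tcurve T y)"
  unfolding Hinf_continuous_on_def
proof
  fix \<sigma>
  obtain n :: nat where n: "\<sigma> \<le> real n" using real_arch_simple by blast
  have dt: "duhamel_type T y" unfolding duhamel_type_def using y z by (intro conjI exI [of _ "[(y, y)]"]) auto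
  have part: "Hs_continuous_on {\<epsilon>..T} \<sigma> (tcurve T y)" if \<epsilon>: "0 < \<epsilon>" for \<epsilon>
  proof -
    obtain G A where G: "l2_le G A" "\<And>t \<xi>. t \<in> {\<epsilon>..T} \<Longrightarrow> cmod (wt (real n) (crv y t) \<xi>) \<le> cmod (G \<xi>)"
      using regular_all [OF y z T, of n] \<epsilon> unfolding regular_at_def by metis
    show ?thesis
    proof (rule Hs_continuous_dominated [OF _ _ G(1)])
      show "rep (tcurve T y t) (crv y t)" if "t \<in> {\<epsilon>..T}" for t using that \<epsilon> by (intro rep_tcurve y T) auto
      show "((\<lambda>t. crv y t \<xi>) \<longlongrightarrow> crv y t0 \<xi>) (at t0 within {\<epsilon>..T})" if "t0 \<in> {\<epsilon>..T}" for \<xi> t0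
        by (rule tendsto_within_subset [OF crv_tendsto [OF dt T]]) (use that \<epsilon> in auto)
      fix t \<xi> assume t: "t \<in> {\<epsilon>..T}"
      have "cmod (wt \<sigma> (crv y t) \<xi>) \<le> cmod (wt (real n) (crv y t) \<xi>)"
        unfolding norm_wt by (intro mult_right_mono powr_mono n) auto
      then show "cmod (wt \<sigma> (crv y t) \<xi>) \<le> cmod (G \<xi>)" using G(2) [OF t, of \<xi>] by linarith
    qed
  qed
  show "Hs_continuous_on {0<..T} \<sigma> (tcurve T y)"
    unfolding Hs_continuous_on_def
  proof (intro conjI ballI)
    fix t assume t: "t \<in> {0<..T}"
    then have p: "Hs_continuous_on {t / 2..T} \<sigma> (tcurve T y)" and tI: "t \<in> {t / 2..T}" by (auto intro: part)
    from p tI show "tcurve T y t \<in> Hs \<sigma>" by (simp add: Hs_continuous_on_def)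
    have "at t within {0<..T} = at t within {t / 2..T}"
      by (rule at_within_nhd [of t "{t / 2<..}"]) (use t in auto)
    then show "((\<lambda>r. Hs_norm \<sigma> (tcurve T y r - tcurve T y t)) \<longlongrightarrow> 0) (at t within {0<..T})"
      using p tI by (simp add: Hs_continuous_on_def)
  qed
qed

end

section \<open>Uniqueness\<close>

text \<open>Integrated against the weight \<open>e^(-\<nu>t)\<close>, the convolution inequality has the kernel \<open>\<tau>^(-m)
  e^(-\<nu>\<tau>)\<close>, whose mass tends to \<open>0\<close> as \<open>\<nu>\<close> grows. For large \<open>\<nu>\<close> the weighted integral of \<open>a\<close> is at
  most half of itself, hence zero, and then the inequality gives \<open>a t = 0\<close> for every \<open>t\<close>.\<close>

lemma singular_gronwall:
  fixes a :: "real \<Rightarrow> ennreal"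
  assumes a [measurable]: "a \<in> borel_measurable borel" and T: "T \<le> 1" and m: "0 \<le> m" "m < 1" and C: "0 \<le> C"
    and fin: "(\<integral>\<^sup>+t. indicator {0..T} t * a t) < \<infinity>"
    and le: "\<And>t. t \<in> {0..T} \<Longrightarrow> a t \<le> ennreal C * (\<integral>\<^sup>+r. indicator {0..t} r * (ennreal ((t - r) powr - m) * a r))"
    and t: "t \<in> {0..T}"
  shows "a t = 0"
proof -
  \<comment> \<open>A part \<open>\<mu>\<close> of the distance from \<open>m\<close> to \<open>1\<close> is spent on the factor \<open>\<nu>^(-\<mu>)\<close>, by \<open>e^(-x) \<le> x^(-\<mu>)\<close>.\<close>
  define \<mu> where "\<mu> = (1 - m) / 2"
  define Q where "Q = tbeta 0 (m + \<mu>)"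
  define \<nu> where "\<nu> = (2 * C * Q + 1) powr (1 / \<mu>)"
  have \<mu>: "0 < \<mu>" "\<mu> \<le> 1" "m + \<mu> < 1" using m by (auto simp: \<mu>_def field_simps)
  have Q: "0 \<le> Q" by (simp add: Q_def)
  have CQ: "1 \<le> 2 * C * Q + 1" using C Q by simp
  have \<nu>: "0 < \<nu>" using CQ by (simp add: \<nu>_def)
  have \<nu>\<mu>: "\<nu> powr - \<mu> = 1 / (2 * C * Q + 1)"
    using \<mu> CQ by (simp add: \<nu>_def powr_powr powr_minus inverse_eq_divide)
  have small: "C * (\<nu> powr - \<mu> * Q) \<le> 1/2"
    unfolding \<nu>\<mu> using CQ by (simp add: field_simps)
  define F where "F \<tau> = indicator {0..1} \<tau> * ennreal (\<tau> powr - m * exp (- (\<nu> * \<tau>)))" for \<tau>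
  have Fm [measurable]: "F \<in> borel_measurable borel" unfolding F_def by measurable
  have FQ: "(\<integral>\<^sup>+\<tau>. F \<tau>) \<le> ennreal (\<nu> powr - \<mu> * Q)"
  proof -
    have "(\<integral>\<^sup>+\<tau>. F \<tau>) \<le> (\<integral>\<^sup>+\<tau>. ennreal (\<nu> powr - \<mu>) * (indicator {0..1} \<tau> * ennreal ((1 - \<tau>) powr - 0 * \<tau> powr - (m + \<mu>))))"
    proof (rule nn_integral_mono_AE, use AE_lborel_singleton [of 0] AE_lborel_singleton [of 1] in eventually_elim)
      case (elim \<tau>)
      show ?case
      proof (cases "\<tau> \<in> {0..1}")
        case True
        then have \<tau>: "0 < \<tau>" "\<tau> < 1" using elim by auto
        have "exp (- (\<nu> * \<tau>)) \<le> (\<nu> * \<tau>) powr - \<mu>" using \<nu> \<tau> \<mu> by (intro exp_neg_le_powr) auto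
        also have "\<dots> = \<nu> powr - \<mu> * \<tau> powr - \<mu>" using \<nu> \<tau> by (simp add: powr_mult)
        finally have "\<tau> powr - m * exp (- (\<nu> * \<tau>)) \<le> \<tau> powr - m * (\<nu> powr - \<mu> * \<tau> powr - \<mu>)" by (rule mult_left_mono) simp
        also have "\<dots> = \<nu> powr - \<mu> * (\<tau> powr - m * \<tau> powr - \<mu>)" by simp
        also have "\<tau> powr - m * \<tau> powr - \<mu> = \<tau> powr - (m + \<mu>)" unfolding powr_add [symmetric] by simp
        finally have "ennreal (\<tau> powr - m * exp (- (\<nu> * \<tau>))) \<le> ennreal (\<nu> powr - \<mu>) * ennreal (\<tau> powr - (m + \<mu>))"
          unfolding ennreal_mult [OF powr_ge_zero powr_ge_zero, symmetric] by (rule ennreal_leI)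
        then show ?thesis using True \<tau> by (simp add: F_def)
      qed (simp add: F_def)
    qed
    also have "\<dots> = ennreal (\<nu> powr - \<mu>) * (\<integral>\<^sup>+\<tau>. indicator {0..1} \<tau> * ennreal ((1 - \<tau>) powr - 0 * \<tau> powr - (m + \<mu>)))"
      by (rule nn_integral_cmult) measurable
    also have "\<dots> \<le> ennreal (\<nu> powr - \<mu>) * ennreal (tbeta 0 (m + \<mu>) * 1 powr (1 - 0 - (m + \<mu>)))"
      by (intro mult_left_mono nn_integral_time \<mu>) auto
    also have "\<dots> = ennreal (\<nu> powr - \<mu> * Q)" by (simp add: Q_def ennreal_mult)
    finally show ?thesis .
  qed
  define w where "w r = indicator {0..T} r * (ennreal (exp (- (\<nu> * r))) * a r)" for r
  have wm [measurable]: "w \<in> borel_measurable borel" unfolding w_def by measurable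
  define S where "S = (\<integral>\<^sup>+t. w t)"
  have "S \<le> (\<integral>\<^sup>+t. indicator {0..T} t * a t)"
    unfolding S_def
  proof (rule nn_integral_mono)
    fix r
    show "w r \<le> indicator {0..T} r * a r"
    proof (cases "r \<in> {0..T}")
      case True
      then have "ennreal (exp (- (\<nu> * r))) * a r \<le> ennreal 1 * a r" using \<nu> by (intro mult_right_mono ennreal_leI) auto
      then show ?thesis using True by (simp add: w_def)
    qed (simp add: w_def)
  qed
  with fin have S_fin: "S < \<infinity>" by (rule le_less_trans [rotated])
  have "S \<le> (\<integral>\<^sup>+t. (\<integral>\<^sup>+r. (ennreal C * w r) * F (t - r)))"
    unfolding S_def
  proof (rule nn_integral_mono)
    fix t
    show "w t \<le> (\<integral>\<^sup>+r. (ennreal C * w r) * F (t - r))"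
    proof (cases "t \<in> {0..T}")
      case True
      have "w t \<le> ennreal (exp (- (\<nu> * t))) * (ennreal C * (\<integral>\<^sup>+r. indicator {0..t} r * (ennreal ((t - r) powr - m) * a r)))"
        using True by (simp add: w_def) (intro mult_left_mono le, auto)
      also have "\<dots> = (\<integral>\<^sup>+r. (ennreal (exp (- (\<nu> * t))) * ennreal C) * (indicator {0..t} r * (ennreal ((t - r) powr - m) * a r)))"
      proof -
        have "(\<integral>\<^sup>+r. (ennreal (exp (- (\<nu> * t))) * ennreal C) * (indicator {0..t} r * (ennreal ((t - r) powr - m) * a r))) =
            (ennreal (exp (- (\<nu> * t))) * ennreal C) * (\<integral>\<^sup>+r. indicator {0..t} r * (ennreal ((t - r) powr - m) * a r))"
          by (rule nn_integral_cmult) measurable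
        then show ?thesis by (simp only: mult.assoc)
      qed
      also have "\<dots> \<le> (\<integral>\<^sup>+r. (ennreal C * w r) * F (t - r))"
      proof (rule nn_integral_mono)
        fix r
        show "(ennreal (exp (- (\<nu> * t))) * ennreal C) * (indicator {0..t} r * (ennreal ((t - r) powr - m) * a r)) \<le> (ennreal C * w r) * F (t - r)"
        proof (cases "r \<in> {0..t}")
          case r: True
          then have rT: "r \<in> {0..T}" "t - r \<in> {0..1}" using True T by auto
          have "- (\<nu> * t) = - (\<nu> * r) + - (\<nu> * (t - r))" by (simp add: algebra_simps)
          then have "ennreal (exp (- (\<nu> * t))) = ennreal (exp (- (\<nu> * r))) * ennreal (exp (- (\<nu> * (t - r))))"
            by (simp only: exp_add ennreal_mult exp_ge_zero)
          then show ?thesis using r rT by (simp add: w_def F_def ennreal_mult mult_ac)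
        qed simp
      qed
      finally show ?thesis .
    qed (simp add: w_def)
  qed
  also have "\<dots> = (\<integral>\<^sup>+r. (\<integral>\<^sup>+t. (ennreal C * w r) * F (t - r)))"
    by (rule lborel_pair.Fubini') measurable
  also have "\<dots> \<le> (\<integral>\<^sup>+r. ennreal (C * (\<nu> powr - \<mu> * Q)) * w r)"
  proof (rule nn_integral_mono)
    fix r
    have "(\<integral>\<^sup>+t. F (t - r)) = ennreal \<bar>1\<bar> * (\<integral>\<^sup>+x. F (r + 1 * x - r))"
      by (rule nn_integral_real_affine) auto
    then have tr: "(\<integral>\<^sup>+t. F (t - r)) = (\<integral>\<^sup>+x. F x)" by simp
    have "(\<integral>\<^sup>+t. (ennreal C * w r) * F (t - r)) = (ennreal C * w r) * (\<integral>\<^sup>+t. F (t - r))"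
      by (rule nn_integral_cmult) measurable
    also have "\<dots> \<le> (ennreal C * w r) * ennreal (\<nu> powr - \<mu> * Q)" unfolding tr by (intro mult_left_mono FQ) simp
    also have "\<dots> = ennreal (C * (\<nu> powr - \<mu> * Q)) * w r" using C Q by (simp add: ennreal_mult mult_ac)
    finally show "(\<integral>\<^sup>+t. (ennreal C * w r) * F (t - r)) \<le> ennreal (C * (\<nu> powr - \<mu> * Q)) * w r" .
  qed
  also have "\<dots> = ennreal (C * (\<nu> powr - \<mu> * Q)) * S" unfolding S_def by (rule nn_integral_cmult) measurable
  also have "\<dots> \<le> ennreal (1/2) * S" by (intro mult_right_mono ennreal_leI small) simp
  finally have S_le: "S \<le> ennreal (1/2) * S" .
  have "S = 0"
  proof (cases S)
    case (real x)
    then have "x \<le> 1/2 * x" using S_le by (simp add: ennreal_mult [symmetric] del: ennreal_half)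
    then show ?thesis using real by simp
  qed (use S_fin in simp)
  then have "AE r in lborel. w r = 0" unfolding S_def by (simp add: nn_integral_0_iff_AE)
  then have "AE r in lborel. indicator {0..t} r * (ennreal ((t - r) powr - m) * a r) = 0"
    by eventually_elim (use t in \<open>auto simp: w_def indicator_def split: if_splits\<close>)
  then have "(\<integral>\<^sup>+r. indicator {0..t} r * (ennreal ((t - r) powr - m) * a r)) = 0"
    by (subst nn_integral_0_iff_AE) auto
  then show ?thesis using le [OF t] by simp
qed

text \<open>A function that is piecewise constant in time: the value at the first node whose neighbourhood
  contains the time.\<close>

primrec pick :: "(real \<Rightarrow> real) \<Rightarrow> (real \<Rightarrow> real \<Rightarrow> complex) \<Rightarrow> real list \<Rightarrow> real \<Rightarrow> real \<Rightarrow> complex" where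
  "pick \<delta> F [] t \<xi> = 0"
| "pick \<delta> F (x # xs) t \<xi> = (if \<bar>t - x\<bar> < \<delta> x then F x \<xi> else pick \<delta> F xs t \<xi>)"

lemma pick_measurable:
  assumes "\<And>x. x \<in> set xs \<Longrightarrow> F x \<in> borel_measurable borel"
  shows "jmeas (pick \<delta> F xs)"
  using assms
proof (induction xs)
  case Nil then show ?case by simp
next
  case (Cons x xs)
  have [measurable]: "jmeas (pick \<delta> F xs)"
    using Cons by simp
  have [measurable]: "F x \<in> borel_measurable borel" using Cons by simp
  show ?case unfolding pick.simps by measurable
qed

lemma pick_cases:
  "\<exists>x\<in>set xs. \<bar>t - x\<bar> < \<delta> x \<Longrightarrow> \<exists>x\<in>set xs. \<bar>t - x\<bar> < \<delta> x \<and> pick \<delta> F xs t = F x"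
  by (induction xs) (auto simp: fun_eq_iff)

context dissipative
begin

text \<open>A continuous curve is the uniform limit of curves that are piecewise constant in time, obtained
  from finite covers of the compact interval. Transforms of these are jointly measurable, and at
  every time they converge almost everywhere when the approximation is fast.\<close>

lemma joint_rep:
  assumes v: "Hs_continuous_on {0..T} s v"
  shows "\<exists>g. jmeas g \<and> (\<forall>t\<in>{0..T}. rep (v t) (g t))"
proof -
  have vE: "v t \<in> Hs s" if "t \<in> {0..T}" for t using v that by (simp add: Hs_continuous_on_def)
  have step: "\<exists>h. jmeas h \<and>
      (\<forall>t\<in>{0..T}. l2 (wt s (\<lambda>\<xi>. h t \<xi> - hat (v t) \<xi>)) \<le> ennreal ((1/8) ^ n))" for n :: nat
  proof -
    \<comment> \<open>The rate \<open>3^(-n)\<close> squares to \<open>9^(-n) \<le> 8^(-n)\<close>, fast enough for convergence almost everywhere.\<close>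
    have "\<exists>d>0. \<forall>t\<in>{0..T}. \<bar>t - x\<bar> < d \<longrightarrow> Hs_norm s (v t - v x) < ennreal ((1/3) ^ n)" if x: "x \<in> {0..T}" for x
    proof -
      have "((\<lambda>t. Hs_norm s (v t - v x)) \<longlongrightarrow> 0) (at x within {0..T})"
        using v x by (simp add: Hs_continuous_on_def)
      then have "\<forall>\<^sub>F t in at x within {0..T}. Hs_norm s (v t - v x) < ennreal ((1/3) ^ n)"
        by (rule order_tendstoD(2)) simp
      then obtain d where d: "0 < d" "\<And>t. t \<in> {0..T} \<Longrightarrow> t \<noteq> x \<Longrightarrow> dist t x < d \<Longrightarrow> Hs_norm s (v t - v x) < ennreal ((1/3) ^ n)"
        unfolding eventually_at by blast
      have "Hs_norm s (v x - v x) < ennreal ((1/3) ^ n)"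
        using le_less_trans [OF Hs_norm_le [of 0 "\<lambda>_. 0" s 0]] rep_0 l2_le_0 by (simp add: wt_def)
      then have "Hs_norm s (v t - v x) < ennreal ((1/3) ^ n)" if "t \<in> {0..T}" "\<bar>t - x\<bar> < d" for t
        using d(2) [OF that(1)] that(2) unfolding dist_real_def by (cases "t = x") blast+
      then show ?thesis using d(1) by blast
    qed
    then obtain \<delta> where \<delta>: "\<And>x. x \<in> {0..T} \<Longrightarrow> 0 < \<delta> x"
      and close: "\<And>x t. x \<in> {0..T} \<Longrightarrow> t \<in> {0..T} \<Longrightarrow> \<bar>t - x\<bar> < \<delta> x \<Longrightarrow> Hs_norm s (v t - v x) < ennreal ((1/3) ^ n)"
      by metis
    have "{0..T} \<subseteq> (\<Union>x\<in>{0..T}. ball x (\<delta> x))" using \<delta> by force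
    then obtain D where D: "D \<subseteq> {0..T}" "finite D" "{0..T} \<subseteq> (\<Union>x\<in>D. ball x (\<delta> x))"
      using compactE_image [OF compact_Icc, of "{0..T}" "\<lambda>x. ball x (\<delta> x)"] by (metis open_ball)
    obtain xs where xs: "set xs = D" using finite_list [OF D(2)] by blast
    let ?h = "pick \<delta> (\<lambda>x. hat (v x)) xs"
    have "jmeas (\<lambda>t \<xi>. ?h t \<xi>)"
    proof (rule pick_measurable)
      fix x assume "x \<in> set xs"
      then have "x \<in> {0..T}" using xs D(1) by blast
      then show "hat (v x) \<in> borel_measurable borel" by (rule hat_measurable [OF vE])
    qed
    moreover have "l2 (wt s (\<lambda>\<xi>. ?h t \<xi> - hat (v t) \<xi>)) \<le> ennreal ((1/8) ^ n)" if t: "t \<in> {0..T}" for t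
    proof -
      have "\<exists>x\<in>set xs. \<bar>t - x\<bar> < \<delta> x"
        using subsetD [OF D(3) t] unfolding xs by (auto simp: dist_real_def abs_minus_commute)
      from pick_cases [OF this] obtain x where x: "x \<in> D" "\<bar>t - x\<bar> < \<delta> x" and h: "?h t = hat (v x)"
        unfolding xs by blast
      have xT: "x \<in> {0..T}" using x(1) D(1) by blast
      have "l2 (wt s (\<lambda>\<xi>. ?h t \<xi> - hat (v t) \<xi>)) = l2 (wt s (\<lambda>\<xi>. hat (v t) \<xi> - hat (v x) \<xi>))"
        unfolding h by (rule l2_cong_AE) (simp add: norm_wt norm_minus_commute)
      also have "\<dots> = (Hs_norm s (v t - v x))\<^sup>2"
        by (simp add: Hs_norm_rep [OF rep_diff [OF rep_hat [OF vE [OF t]] rep_hat [OF vE [OF xT]]]] ennsqrt_sq)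
      also have "\<dots> \<le> (ennreal ((1/3) ^ n))\<^sup>2"
        using close [OF xT t x(2)] by (intro power_mono) auto
      also have "\<dots> = ennreal ((1/9) ^ n)" by (simp add: ennreal_power power_mult [symmetric] power_divide mult.commute [of n]) (simp add: power_mult)
      also have "\<dots> \<le> ennreal ((1/8) ^ n)" by (intro ennreal_leI power_mono) auto
      finally show ?thesis .
    qed
    ultimately show ?thesis by blast
  qed
  then obtain h where hm: "\<And>n. jmeas (h n)"
    and hl: "\<And>n t. t \<in> {0..T} \<Longrightarrow> l2 (wt s (\<lambda>\<xi>. h n t \<xi> - hat (v t) \<xi>)) \<le> ennreal ((1/8) ^ n)"
    by metis
  note [measurable] = hm
  define g where "g t \<xi> = lim (\<lambda>n. h n t \<xi>)" for t \<xi>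
  have gm: "jmeas g" unfolding g_def by measurable
  have "rep (v t) (g t)" if t: "t \<in> {0..T}" for t
  proof (rule rep_cong_AE [OF rep_hat [OF vE [OF t]]])
    note [measurable] = hat_measurable [OF vE [OF t]]
    have hmt [measurable]: "h n t \<in> borel_measurable borel" for n
      using measurable_compose [OF measurable_Pair1' hm] by simp
    show "g t \<in> borel_measurable borel" using measurable_compose [OF measurable_Pair1' gm] by simp
    have "AE \<xi> in lborel. summable (\<lambda>n. cmod (wt s (\<lambda>\<xi>. h n t \<xi> - hat (v t) \<xi>) \<xi>))"
      by (rule AE_summable_of_l2 [OF _ hl [OF t]]) measurable
    then show "AE \<xi> in lborel. hat (v t) \<xi> = g t \<xi>"
    proof eventually_elim
      case (elim \<xi>)
      then have "(\<lambda>n. jap \<xi> powr s * cmod (h n t \<xi> - hat (v t) \<xi>)) \<longlonglongrightarrow> 0"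
        unfolding norm_wt by (rule summable_LIMSEQ_zero)
      then have "(\<lambda>n. inverse (jap \<xi> powr s) * (jap \<xi> powr s * cmod (h n t \<xi> - hat (v t) \<xi>))) \<longlonglongrightarrow> inverse (jap \<xi> powr s) * 0"
        by (rule tendsto_mult_left)
      then have "(\<lambda>n. cmod (h n t \<xi> - hat (v t) \<xi>)) \<longlonglongrightarrow> 0" by simp
      then have "(\<lambda>n. h n t \<xi>) \<longlonglongrightarrow> hat (v t) \<xi>"
        unfolding tendsto_norm_zero_iff by (simp add: LIM_zero_iff)
      then show ?case by (simp add: g_def limI)
    qed
  qed
  with gm show ?thesis by blast
qed

lemma conv_self_le_l2:
  assumes "g \<in> borel_measurable borel" "l2 g < \<infinity>"
  shows "ennreal (cmod (conv g g \<xi>)) \<le> l2 g"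
proof -
  have "cmod (conv g g \<xi>) \<le> sqrt (enn2real (l2 g)) * sqrt (enn2real (l2 g))"
    using conv_bound(2) [OF l2_finite_le [OF assms] l2_finite_le [OF assms]] .
  then have "ennreal (cmod (conv g g \<xi>)) \<le> ennreal (enn2real (l2 g))" by (intro ennreal_leI) simp
  also have "\<dots> = l2 g" using assms(2) by simp
  finally show ?thesis .
qed

text \<open>The integral equation on the Fourier side, at every time and almost every frequency.\<close>

definition mild :: "real \<Rightarrow> tempered \<Rightarrow> (real \<Rightarrow> real \<Rightarrow> complex) \<Rightarrow> bool" where
  "mild T v0 g \<longleftrightarrow> jmeas g \<and>
     (\<integral>\<^sup>+t. indicator {0..T} t * l2 (g t)) < \<infinity> \<and>
     (\<forall>t\<in>{0..T}. AE \<xi> in lborel. g t \<xi> = sem t \<xi> * hat v0 \<xi> - duh t (\<lambda>r. conv (g r) (g r)) \<xi>)"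

lemma l2_time_measurable:
  assumes [measurable]: "jmeas g"
  shows "(\<lambda>t. l2 (g t)) \<in> borel_measurable borel"
  unfolding l2_def by measurable

lemma slice_measurable:
  assumes "jmeas g" shows "g t \<in> borel_measurable borel"
  using measurable_compose [OF measurable_Pair1' assms] by simp

lemma AE_l2_finite:
  fixes g :: "real \<Rightarrow> real \<Rightarrow> complex"
  assumes g: "jmeas g"
    and fin: "(\<integral>\<^sup>+t. indicator {0..T} t * l2 (g t)) < \<infinity>"
  shows "AE r in lborel. r \<in> {0..T} \<longrightarrow> l2 (g r) < \<infinity>"
proof -
  note [measurable] = l2_time_measurable [OF g]
  have "AE r in lborel. indicator {0..T} r * l2 (g r) \<noteq> \<infinity>"
  proof (rule nn_integral_noteq_infinite)
    show "(\<lambda>r. indicator {0..T} r * l2 (g r)) \<in> borel_measurable lborel" by measurable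
  qed (use fin in simp)
  then show ?thesis by eventually_elim (auto simp: less_top)
qed

lemma nn_integral_Icc_mono:
  fixes f :: "real \<Rightarrow> ennreal"
  assumes "t \<le> T" shows "(\<integral>\<^sup>+r. indicator {0..t} r * f r) \<le> (\<integral>\<^sup>+r. indicator {0..T} r * f r)"
  by (rule nn_integral_mono) (use assms in \<open>auto simp: indicator_def\<close>)

text \<open>The bound on the \<open>L\<^sup>2\<close> norms is transferred to the measurable function \<open>l2 (g t)\<close>, since the
  norm of the solution itself is not known to be measurable in time.\<close>

lemma solution_mild:
  assumes sol: "solution \<eta> \<Phi> s T v0 v" and v0: "v0 \<in> Hs s" and T: "T \<le> 1"
  shows "\<exists>g. mild T v0 g \<and> (\<forall>t\<in>{0..T}. rep (v t) (g t))"
proof -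
  have "Hs_continuous_on {0..T} s v" using sol by (simp add: solution_def C_Hs_def)
  from joint_rep [OF this] obtain g where gm: "jmeas g"
    and rg: "\<And>t. t \<in> {0..T} \<Longrightarrow> rep (v t) (g t)" by blast
  note [measurable] = gm l2_time_measurable [OF gm]
  have le: "ennreal (1 / (2 * pi)) * l2 (g t) \<le> (L2_norm (v t))\<^sup>2" if t: "t \<in> {0..T}" for t
  proof (cases "L2_norm (v t) < \<infinity>")
    case True
    then obtain h where h: "rep (v t) h" "l2 h \<le> ennreal (2 * pi) * (L2_norm (v t))\<^sup>2" using L2_norm_finite_rep by blast
    have "l2 (g t) = l2 h"
      by (rule l2_cong_AE) (use rep_unique [OF rg [OF t] h(1)] in eventually_elim, simp)
    then have "ennreal (1 / (2 * pi)) * l2 (g t) \<le> ennreal (1 / (2 * pi)) * (ennreal (2 * pi) * (L2_norm (v t))\<^sup>2)"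
      using h(2) by (intro mult_left_mono) auto
    also have "\<dots> = (ennreal (1 / (2 * pi)) * ennreal (2 * pi)) * (L2_norm (v t))\<^sup>2" by (simp only: mult.assoc)
    also have "ennreal (1 / (2 * pi)) * ennreal (2 * pi) = 1" by (simp add: ennreal_mult [symmetric])
    finally show ?thesis by simp
  qed (simp add: less_top [symmetric] power2_eq_square ennreal_top_mult)
  have "ennreal (1 / (2 * pi)) * (\<integral>\<^sup>+t. indicator {0..T} t * l2 (g t)) = (\<integral>\<^sup>+t. ennreal (1 / (2 * pi)) * (indicator {0..T} t * l2 (g t)))"
    by (rule nn_integral_cmult [symmetric]) measurable
  also have "\<dots> \<le> (\<integral>\<^sup>+t. (L2_norm (v t))\<^sup>2 * indicator {0..T} t)"
    by (rule nn_integral_mono) (use le in \<open>auto simp: indicator_def\<close>)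
  also have "\<dots> < \<infinity>" using sol by (simp add: solution_def)
  finally have "ennreal (1 / (2 * pi)) * (\<integral>\<^sup>+t. indicator {0..T} t * l2 (g t)) < \<infinity>" .
  then have fin: "(\<integral>\<^sup>+t. indicator {0..T} t * l2 (g t)) < \<infinity>"
    using pi_gt_zero by (auto simp: ennreal_mult_less_top)
  note l2f = AE_l2_finite [OF gm fin]
  have eq: "AE \<xi> in lborel. g t \<xi> = sem t \<xi> * hat v0 \<xi> - duh t (\<lambda>r. conv (g r) (g r)) \<xi>" if t: "t \<in> {0..T}" for t
  proof -
    have t': "0 \<le> t" "t \<le> 1" "t \<le> T" using t T by auto
    have Gm: "jmeas (\<lambda>r \<xi>. conv (g r) (g r) \<xi>)"
      by (rule conv_measurable2 [OF gm gm])
    obtain D where D: "has_td_integral (\<lambda>r. V \<eta> \<Phi> (t - r) (td_deriv (td_square (v r)))) D {0..t}" and vt: "v t = V \<eta> \<Phi> t v0 - D"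
      using sol t unfolding solution_def by blast
    have f: "(\<integral>\<^sup>+r. indicator {0..t} r * (\<integral>\<^sup>+\<xi>. ennreal (cmod (dterm (t - r) \<xi> (conv (g r) (g r) \<xi>)) / jap \<xi> ^ 3))) < \<infinity>"
    proof (rule duh_fin [OF Gm t'(2)])
      show "AE r in lborel. r \<in> {0..t} \<longrightarrow> (\<forall>\<xi>. ennreal (cmod (conv (g r) (g r) \<xi>)) \<le> l2 (g r))"
        using l2f by eventually_elim (use t' in \<open>auto intro!: conv_self_le_l2 slice_measurable [OF gm]\<close>)
      show "(\<integral>\<^sup>+r. indicator {0..t} r * l2 (g r)) < \<infinity>"
        by (rule le_less_trans [OF nn_integral_Icc_mono [OF t'(3)] fin])
    qed measurable
    have "AE r in lborel. r \<in> {0..t} \<longrightarrow> rep (V \<eta> \<Phi> (t - r) (td_deriv (td_square (v r)))) (\<lambda>\<xi>. dterm (t - r) \<xi> (conv (g r) (g r) \<xi>))"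
      using l2f
    proof eventually_elim
      case (elim r)
      show ?case
      proof
        assume r: "r \<in> {0..t}"
        then have r': "r \<in> {0..T}" "0 \<le> t - r" "t - r \<le> 1" using t' by auto
        then have "l2 (g r) < \<infinity>" using elim by blast
        from rep_nonlinearity [OF rg [OF r'(1)] l2_finite_le [OF slice_measurable [OF gm] this] r'(2,3)]
        show "rep (V \<eta> \<Phi> (t - r) (td_deriv (td_square (v r)))) (\<lambda>\<xi>. dterm (t - r) \<xi> (conv (g r) (g r) \<xi>))" .
      qed
    qed
    from has_td_integral_rep [OF duh_integrand_measurable [OF Gm] f D this]
    have "rep D (duh t (\<lambda>r. conv (g r) (g r)))" by (simp only: duh_def)
    from rep_diff [OF rep_V [OF v0 t'(1,2)] this, folded vt]
    show ?thesis by (rule rep_unique [OF rg [OF t]])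
  qed
  show ?thesis using gm fin eq rg unfolding mild_def by blast
qed

lemma duh_integrable:
  assumes G: "jmeas G" and t: "t \<le> 1"
    and b: "AE r in lborel. r \<in> {0..t} \<longrightarrow> ennreal (cmod (G r \<xi>)) \<le> B r"
    and B [measurable]: "B \<in> borel_measurable borel" and fin: "(\<integral>\<^sup>+r. indicator {0..t} r * B r) < \<infinity>"
  shows "integrable lborel (\<lambda>r. indicator {0..t} r *\<^sub>R (dterm (t - r) \<xi> (G r \<xi>)))"
    (is "integrable lborel ?f")
proof (rule integrableI_bounded)
  have [measurable]: "(\<lambda>r. G r \<xi>) \<in> borel_measurable borel"
    using measurable_compose [OF measurable_Pair2' G, of \<xi>] by simp
  show "?f \<in> borel_measurable lborel" by measurable
  have "(\<integral>\<^sup>+r. ennreal (norm (?f r))) \<le> (\<integral>\<^sup>+r. ennreal (K * (jap \<xi> / (2 * pi))) * (indicator {0..t} r * B r))"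
  proof (rule nn_integral_mono_AE, use b in eventually_elim)
    case (elim r)
    show ?case
    proof (cases "r \<in> {0..t}")
      case True
      then have r: "0 \<le> t - r" "t - r \<le> 1" using t by auto
      have "norm (?f r) = cmod (sem (t - r) \<xi>) * (\<bar>\<xi>\<bar> / (2 * pi)) * cmod (G r \<xi>)"
        using True by (simp add: norm_mult norm_divide)
      also have "\<dots> \<le> K * (jap \<xi> / (2 * pi)) * cmod (G r \<xi>)"
        using K by (intro mult_right_mono mult_mono sem_le r divide_right_mono abs_le_jap) auto
      finally have "ennreal (norm (?f r)) \<le> ennreal (K * (jap \<xi> / (2 * pi)) * cmod (G r \<xi>))" by (rule ennreal_leI)
      also have "\<dots> = ennreal (K * (jap \<xi> / (2 * pi))) * ennreal (cmod (G r \<xi>))"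
        using K by (intro ennreal_mult) auto
      also have "\<dots> \<le> ennreal (K * (jap \<xi> / (2 * pi))) * B r" using elim True by (intro mult_left_mono) auto
      finally show ?thesis using True by simp
    qed simp
  qed
  also have "\<dots> = ennreal (K * (jap \<xi> / (2 * pi))) * (\<integral>\<^sup>+r. indicator {0..t} r * B r)"
    by (rule nn_integral_cmult) measurable
  also have "\<dots> < \<infinity>" using fin by (simp add: ennreal_mult_less_top)
  finally show "(\<integral>\<^sup>+r. ennreal (norm (?f r))) < \<infinity>" .
qed

lemma nn_Cauchy_Schwarz_time:
  fixes d A :: "real \<Rightarrow> real"
  assumes [measurable]: "d \<in> borel_measurable borel" "A \<in> borel_measurable borel" and nn: "\<And>r. 0 \<le> d r" "\<And>r. 0 \<le> A r"
  shows "(\<integral>\<^sup>+r. indicator {0..t} r * ennreal ((t - r) powr - k * (d r * A r)))\<^sup>2 \<le>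
     (\<integral>\<^sup>+r. indicator {0..t} r * (ennreal ((t - r) powr - (2 * k)) * ennreal ((d r)\<^sup>2))) * (\<integral>\<^sup>+r. indicator {0..t} r * ennreal ((A r)\<^sup>2))"
proof -
  have sq: "(t - r) powr - (2 * k) = ((t - r) powr - k)\<^sup>2" for r
    unfolding power2_eq_square powr_add [symmetric] by simp
  have "(\<integral>\<^sup>+r. (indicator {0..t} r * ennreal ((t - r) powr - k * d r)) * (indicator {0..t} r * ennreal (A r)))\<^sup>2 \<le>
     (\<integral>\<^sup>+r. (indicator {0..t} r * ennreal ((t - r) powr - k * d r)) ^ 2) * (\<integral>\<^sup>+r. (indicator {0..t} r * ennreal (A r)) ^ 2)"
    by (rule Cauchy_Schwarz_nn_integral) measurable
  moreover have "(indicator {0..t} r * ennreal ((t - r) powr - k * d r)) * (indicator {0..t} r * ennreal (A r)) = indicator {0..t} r * ennreal ((t - r) powr - k * (d r * A r))" for r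
    using nn by (simp add: indicator_def ennreal_mult mult_ac)
  moreover have "(indicator {0..t} r * ennreal ((t - r) powr - k * d r)) ^ 2 = indicator {0..t} r * (ennreal ((t - r) powr - (2 * k)) * ennreal ((d r)\<^sup>2))" for r
    using nn by (simp add: indicator_def sq ennreal_power power_mult_distrib ennreal_mult)
  moreover have "(indicator {0..t} r * ennreal (A r)) ^ 2 = indicator {0..t} r * ennreal ((A r)\<^sup>2)" for r
    using nn by (simp add: indicator_def ennreal_power)
  ultimately show ?thesis by (simp only:)
qed

text \<open>The difference is estimated in \<open>L\<^sup>2\<close> of the frequency, whatever \<open>s\<close> is. The propagator is used
  with an exponent \<open>k\<close> such that \<open>2 k < 1\<close>, for the singularity in time after Cauchy-Schwarz, and
  \<open>p k - 1 > 1/2\<close>, for square integrability in the frequency.\<close>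

lemma mild_unique:
  assumes 1: "mild T v0 g1" and 2: "mild T v0 g2" and T: "T \<le> 1" and t: "t \<in> {0..T}"
  shows "l2 (\<lambda>\<xi>. g1 t \<xi> - g2 t \<xi>) = 0"
proof -
  have gm: "jmeas g1" "jmeas g2"
    and fin: "(\<integral>\<^sup>+t. indicator {0..T} t * l2 (g1 t)) < \<infinity>" "(\<integral>\<^sup>+t. indicator {0..T} t * l2 (g2 t)) < \<infinity>"
    and eq: "\<And>t. t \<in> {0..T} \<Longrightarrow> AE \<xi> in lborel. g1 t \<xi> = sem t \<xi> * hat v0 \<xi> - duh t (\<lambda>r. conv (g1 r) (g1 r)) \<xi>"
      "\<And>t. t \<in> {0..T} \<Longrightarrow> AE \<xi> in lborel. g2 t \<xi> = sem t \<xi> * hat v0 \<xi> - duh t (\<lambda>r. conv (g2 r) (g2 r)) \<xi>"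
    using 1 2 unfolding mild_def by blast+
  note [measurable] = gm l2_time_measurable [OF gm(1)] l2_time_measurable [OF gm(2)]
  note sl = slice_measurable [OF gm(1)] slice_measurable [OF gm(2)]
  note [measurable] = sl
  define \<delta> where "\<delta> t \<xi> = g1 t \<xi> - g2 t \<xi>" for t \<xi>
  have dm: "jmeas \<delta>" unfolding \<delta>_def by measurable
  note [measurable] = dm l2_time_measurable [OF dm] slice_measurable [OF dm]
  have ae: "AE r in lborel. r \<in> {0..T} \<longrightarrow> l2 (g1 r) < \<infinity> \<and> l2 (g2 r) < \<infinity>"
    using AE_l2_finite [OF gm(1) fin(1)] AE_l2_finite [OF gm(2) fin(2)] by eventually_elim blast
  have l2d: "l2 (\<delta> r) \<le> 2 * l2 (g1 r) + 2 * l2 (g2 r)" for r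
    using l2_add_le [of "g1 r" "\<lambda>\<xi>. - g2 r \<xi>"] by (simp add: \<delta>_def [abs_def] l2_def sl)
  define d where "d r = sqrt (enn2real (l2 (\<delta> r)))" for r
  define A where "A r = sqrt (enn2real (l2 (g1 r))) + sqrt (enn2real (l2 (g2 r)))" for r
  have [measurable]: "d \<in> borel_measurable borel" "A \<in> borel_measurable borel" unfolding d_def A_def by measurable
  have dA: "0 \<le> d r" "0 \<le> A r" for r by (simp_all add: d_def A_def)
  have ae': "AE r in lborel. r \<in> {0..T} \<longrightarrow> l2 (\<delta> r) < \<infinity> \<and> (\<forall>\<xi>. cmod (conv (g1 r) (g1 r) \<xi> - conv (g2 r) (g2 r) \<xi>) \<le> d r * A r)"
    using ae
  proof eventually_elim
    case (elim r)
    show ?case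
    proof (intro impI conjI allI)
      fix \<xi> assume "r \<in> {0..T}"
      then have f: "l2 (g1 r) < \<infinity>" "l2 (g2 r) < \<infinity>" using elim by blast+
      show fd: "l2 (\<delta> r) < \<infinity>" by (rule le_less_trans [OF l2d]) (use f in \<open>simp add: ennreal_mult_less_top\<close>)
      note L = l2_finite_le [OF sl(1) f(1)] l2_finite_le [OF sl(2) f(2)]
      have Ld: "l2_le (\<lambda>\<xi>. g1 r \<xi> - g2 r \<xi>) (d r)"
        using l2_finite_le [OF slice_measurable [OF dm] fd] by (simp add: d_def \<delta>_def [abs_def])
      have "cmod (conv (g1 r) (g1 r) \<xi> - conv (g2 r) (g2 r) \<xi>) \<le> d r * sqrt (enn2real (l2 (g1 r))) + sqrt (enn2real (l2 (g2 r))) * d r"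
        unfolding conv_diff_squares [OF L]
        by (rule order_trans [OF norm_triangle_ineq]) (intro add_mono conv_bound(2) Ld L)
      then show "cmod (conv (g1 r) (g1 r) \<xi> - conv (g2 r) (g2 r) \<xi>) \<le> d r * A r" by (simp add: A_def algebra_simps)
    qed
  qed
  \<comment> \<open>The midpoint of the admissible interval \<open>3 / (2 p) < k < 1/2\<close>.\<close>
  define k where "k = (3 / p + 1) / 4"
  have p0: "0 < p" using p by simp
  have "3 / p < 1" using p p0 by (simp add: field_simps)
  then have k: "0 \<le> k" "2 * k < 1" "k \<le> 1" using p0 by (auto simp: k_def field_simps)
  have pk: "3 / 2 < p * k" using p p0 by (simp add: k_def field_simps)
  obtain J where J: "l2_le (\<lambda>\<xi>. cx (jap \<xi> powr - (p * k - 1))) J" using l2_le_jap [of "p * k - 1"] pk by auto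
  define I where "I t = (\<integral>\<^sup>+r. indicator {0..t} r * ennreal ((t - r) powr - k * (d r * A r)))" for t
  define BB where "BB = (\<integral>\<^sup>+r. indicator {0..T} r * ennreal ((A r)\<^sup>2))"
  have BB: "BB < \<infinity>"
  proof -
    have "BB \<le> (\<integral>\<^sup>+r. 2 * (indicator {0..T} r * l2 (g1 r)) + 2 * (indicator {0..T} r * l2 (g2 r)))"
      unfolding BB_def
    proof (rule nn_integral_mono_AE, use ae in eventually_elim)
      case (elim r)
      show ?case
      proof (cases "r \<in> {0..T}")
        case True
        then have f: "l2 (g1 r) < \<infinity>" "l2 (g2 r) < \<infinity>" using elim by blast+
        have "(A r)\<^sup>2 \<le> 2 * (sqrt (enn2real (l2 (g1 r))))\<^sup>2 + 2 * (sqrt (enn2real (l2 (g2 r))))\<^sup>2"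
          unfolding A_def using sum_squares_bound [of "sqrt (enn2real (l2 (g1 r)))" "sqrt (enn2real (l2 (g2 r)))"] by (simp add: power2_sum)
        then have "ennreal ((A r)\<^sup>2) \<le> ennreal (2 * enn2real (l2 (g1 r)) + 2 * enn2real (l2 (g2 r)))" by (intro ennreal_leI) simp
        also have "\<dots> = 2 * l2 (g1 r) + 2 * l2 (g2 r)" using f by (simp add: ennreal_mult)
        finally show ?thesis using True by simp
      qed simp
    qed
    also have "\<dots> = 2 * (\<integral>\<^sup>+r. indicator {0..T} r * l2 (g1 r)) + 2 * (\<integral>\<^sup>+r. indicator {0..T} r * l2 (g2 r))"
      by (subst nn_integral_add) (simp_all add: nn_integral_cmult)
    also have "\<dots> < \<infinity>" using fin by (simp add: ennreal_mult_less_top)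
    finally show ?thesis .
  qed
  have pw: "AE \<xi> in lborel. ennreal (cmod (\<delta> t \<xi>)) \<le> ennreal (CK * jap \<xi> powr - (p * k - 1)) * I t" if t: "t \<in> {0..T}" for t
    using eq(1) [OF t] eq(2) [OF t]
  proof eventually_elim
    case (elim \<xi>)
    have t': "t \<le> T" "t \<le> 1" using t T by auto
    define f where "f g r = indicator {0..t} r *\<^sub>R (dterm (t - r) \<xi> (conv (g r) (g r) \<xi>))" for g :: "real \<Rightarrow> real \<Rightarrow> complex" and r
    have int: "integrable lborel (f g)"
      if g: "jmeas g" "(\<integral>\<^sup>+t. indicator {0..T} t * l2 (g t)) < \<infinity>" for g
    proof -
      have "AE r in lborel. r \<in> {0..t} \<longrightarrow> ennreal (cmod (conv (g r) (g r) \<xi>)) \<le> l2 (g r)"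
        using AE_l2_finite [OF g] by eventually_elim (use t' in \<open>auto intro!: conv_self_le_l2 slice_measurable [OF g(1)]\<close>)
      then show ?thesis
        unfolding f_def by (rule duh_integrable [OF conv_measurable2 [OF g(1) g(1)] t'(2) _ l2_time_measurable [OF g(1)]])
          (rule le_less_trans [OF nn_integral_Icc_mono [OF t'(1)] g(2)])
    qed
    have "\<delta> t \<xi> = (\<integral>r. f g2 r) - (\<integral>r. f g1 r)"
      using elim by (simp add: \<delta>_def duh_def tint_def f_def)
    also have "\<dots> = (\<integral>r. f g2 r - f g1 r)"
      by (rule Bochner_Integration.integral_diff [symmetric, OF int [OF gm(2) fin(2)] int [OF gm(1) fin(1)]])
    finally have "ennreal (cmod (\<delta> t \<xi>)) \<le> (\<integral>\<^sup>+r. ennreal (cmod (f g2 r - f g1 r)))"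
      by (simp only: norm_integral_le_nn_integral)
    also have "\<dots> \<le> (\<integral>\<^sup>+r. ennreal (CK * jap \<xi> powr - (p * k - 1)) * (indicator {0..t} r * ennreal ((t - r) powr - k * (d r * A r))))"
    proof (rule nn_integral_mono_AE, use ae' AE_lborel_singleton [of t] in eventually_elim)
      case (elim r)
      show ?case
      proof (cases "r \<in> {0..t}")
        case True
        then have r: "0 < t - r" "t - r \<le> 1" "r \<in> {0..T}" using t' elim by auto
        have pi1: "1 / (2 * pi) \<le> 1" using pi_gt3 by simp
        have "f g2 r - f g1 r = - (dterm (t - r) \<xi> ((conv (g1 r) (g1 r) \<xi> - conv (g2 r) (g2 r) \<xi>)))"
          using True by (simp add: f_def algebra_simps)
        then have "cmod (f g2 r - f g1 r) = cmod (sem (t - r) \<xi>) * (\<bar>\<xi>\<bar> * (1 / (2 * pi) * cmod (conv (g1 r) (g1 r) \<xi> - conv (g2 r) (g2 r) \<xi>)))"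
          by (simp only: norm_minus_cancel) (simp add: norm_mult norm_divide)
        also have "\<dots> \<le> (CK * ((t - r) powr - k * jap \<xi> powr - (p * k))) * (jap \<xi> powr 1 * (1 * (d r * A r)))"
          using elim r(3) CK_pos dA by (intro mult_mono sem_bound r(1,2) k pi1) (auto simp: abs_le_jap)
        also have "\<dots> = (CK * (jap \<xi> powr 1 * jap \<xi> powr - (p * k))) * ((t - r) powr - k * (d r * A r))" by (simp only: mult_ac mult_1_left)
        also have "jap \<xi> powr 1 * jap \<xi> powr - (p * k) = jap \<xi> powr - (p * k - 1)" unfolding powr_add [symmetric] by simp
        finally have "ennreal (cmod (f g2 r - f g1 r)) \<le> ennreal ((CK * jap \<xi> powr - (p * k - 1)) * ((t - r) powr - k * (d r * A r)))"
          by (rule ennreal_leI)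
        also have "\<dots> = ennreal (CK * jap \<xi> powr - (p * k - 1)) * ennreal ((t - r) powr - k * (d r * A r))"
          using CK_pos dA by (intro ennreal_mult) auto
        finally show ?thesis using True by simp
      qed (simp add: f_def)
    qed
    also have "\<dots> = ennreal (CK * jap \<xi> powr - (p * k - 1)) * I t" unfolding I_def by (rule nn_integral_cmult) measurable
    finally show ?case .
  qed
  have main: "l2 (\<delta> t) \<le> ennreal (CK\<^sup>2 * J\<^sup>2 * enn2real BB) * (\<integral>\<^sup>+r. indicator {0..t} r * (ennreal ((t - r) powr - (2 * k)) * l2 (\<delta> r)))"
    if t: "t \<in> {0..T}" for t
  proof -
    have mJ: "(\<lambda>\<xi>. ennreal ((cmod (cx (jap \<xi> powr - (p * k - 1))))\<^sup>2)) \<in> borel_measurable lborel"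
      by measurable
    have "l2 (\<delta> t) \<le> (\<integral>\<^sup>+\<xi>. (I t)\<^sup>2 * (ennreal (CK\<^sup>2) * ennreal ((cmod (cx (jap \<xi> powr - (p * k - 1))))\<^sup>2)))"
      unfolding l2_def
    proof (rule nn_integral_mono_AE, use pw [OF t] in eventually_elim)
      case (elim \<xi>)
      have "ennreal ((cmod (\<delta> t \<xi>))\<^sup>2) = (ennreal (cmod (\<delta> t \<xi>)))\<^sup>2" by (simp add: ennreal_power)
      also have "\<dots> \<le> (ennreal (CK * jap \<xi> powr - (p * k - 1)) * I t)\<^sup>2" by (intro power_mono elim) simp
      also have "\<dots> = (I t)\<^sup>2 * (ennreal (CK\<^sup>2) * ennreal ((cmod (cx (jap \<xi> powr - (p * k - 1))))\<^sup>2))"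
      proof -
        have "(ennreal (CK * jap \<xi> powr - (p * k - 1)))\<^sup>2 = ennreal (CK\<^sup>2) * ennreal ((cmod (cx (jap \<xi> powr - (p * k - 1))))\<^sup>2)"
          using CK_pos by (simp add: ennreal_power power_mult_distrib ennreal_mult)
        then show ?thesis by (simp only: power_mult_distrib mult.commute)
      qed
      finally show ?case .
    qed
    also have "\<dots> = (I t)\<^sup>2 * (ennreal (CK\<^sup>2) * l2 (\<lambda>\<xi>. cx (jap \<xi> powr - (p * k - 1))))"
      unfolding l2_def by (simp only: nn_integral_cmult borel_measurable_times_ennreal borel_measurable_const mJ)
    also have "\<dots> \<le> (I t)\<^sup>2 * (ennreal (CK\<^sup>2) * ennreal (J\<^sup>2))" by (intro mult_left_mono l2_leD(3) J) auto
    also have "\<dots> \<le> ((\<integral>\<^sup>+r. indicator {0..t} r * (ennreal ((t - r) powr - (2 * k)) * ennreal ((d r)\<^sup>2))) * BB) * (ennreal (CK\<^sup>2) * ennreal (J\<^sup>2))"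
    proof (intro mult_right_mono)
      have "(\<integral>\<^sup>+r. indicator {0..t} r * ennreal ((A r)\<^sup>2)) \<le> BB"
        unfolding BB_def by (rule nn_integral_Icc_mono) (use t in simp)
      then show "(I t)\<^sup>2 \<le> (\<integral>\<^sup>+r. indicator {0..t} r * (ennreal ((t - r) powr - (2 * k)) * ennreal ((d r)\<^sup>2))) * BB"
        unfolding I_def by (intro order_trans [OF nn_Cauchy_Schwarz_time] mult_left_mono dA) auto
    qed simp
    also have "BB = ennreal (enn2real BB)" using BB by simp
    also have "(\<integral>\<^sup>+r. indicator {0..t} r * (ennreal ((t - r) powr - (2 * k)) * ennreal ((d r)\<^sup>2))) = (\<integral>\<^sup>+r. indicator {0..t} r * (ennreal ((t - r) powr - (2 * k)) * l2 (\<delta> r)))"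
    proof (rule nn_integral_cong_AE, use ae' in eventually_elim)
      case (elim r)
      show ?case
      proof (cases "r \<in> {0..t}")
        case True
        then have "l2 (\<delta> r) < \<infinity>" using elim t by auto
        then show ?thesis by (simp add: d_def)
      qed simp
    qed
    finally show ?thesis by (simp add: ennreal_mult mult_ac)
  qed
  have "l2 (\<delta> t) = 0"
  proof (rule singular_gronwall [OF _ T _ k(2) _ _ main t])
    have "(\<integral>\<^sup>+t. indicator {0..T} t * l2 (\<delta> t)) \<le> (\<integral>\<^sup>+r. 2 * (indicator {0..T} r * l2 (g1 r)) + 2 * (indicator {0..T} r * l2 (g2 r)))"
      by (rule nn_integral_mono) (use l2d in \<open>auto simp: indicator_def\<close>)
    also have "\<dots> = 2 * (\<integral>\<^sup>+r. indicator {0..T} r * l2 (g1 r)) + 2 * (\<integral>\<^sup>+r. indicator {0..T} r * l2 (g2 r))"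
      by (subst nn_integral_add) (simp_all add: nn_integral_cmult)
    also have "\<dots> < \<infinity>" using fin by (simp add: ennreal_mult_less_top)
    finally show "(\<integral>\<^sup>+t. indicator {0..T} t * l2 (\<delta> t)) < \<infinity>" .
  qed (use k in auto)
  then show ?thesis by (simp add: \<delta>_def [abs_def])
qed

lemma solution_unique:
  assumes s1: "solution \<eta> \<Phi> s T v0 v" and s2: "solution \<eta> \<Phi> s T v0 w" and v0: "v0 \<in> Hs s" and T: "T \<le> 1"
  shows "v = w"
proof
  fix t
  show "v t = w t"
  proof (cases "t \<in> {0..T}")
    case True
    obtain g1 g2 where g1: "mild T v0 g1" "\<And>t. t \<in> {0..T} \<Longrightarrow> rep (v t) (g1 t)" and g2: "mild T v0 g2" "\<And>t. t \<in> {0..T} \<Longrightarrow> rep (w t) (g2 t)"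
      using solution_mild [OF s1 v0 T] solution_mild [OF s2 v0 T] by metis
    note [measurable] = rep_measurable [OF g1(2) [OF True]] rep_measurable [OF g2(2) [OF True]]
    have "l2 (\<lambda>\<xi>. g1 t \<xi> - g2 t \<xi>) = 0" by (rule mild_unique [OF g1(1) g2(1) T True])
    then have "AE \<xi> in lborel. ennreal ((cmod (g1 t \<xi> - g2 t \<xi>))\<^sup>2) = 0"
      unfolding l2_def by (subst (asm) nn_integral_0_iff_AE) auto
    then have "AE \<xi> in lborel. g1 t \<xi> = g2 t \<xi>" by eventually_elim simp
    then show ?thesis by (rule rep_inject_AE [OF g1(2) [OF True] g2(2) [OF True]])
  next
    case False
    then show ?thesis using s1 s2 by (simp add: solution_def C_Hs_def)
  qed
qed

end

context dissipative
begin

section \<open>Smooth dependence on the data\<close>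

lemma exists_time:
  assumes "0 < R" shows "\<exists>T. 0 < T \<and> T \<le> 1 \<and> 8 * R * (C2 * T powr (1/2 - al)) \<le> 1"
proof -
  \<comment> \<open>The summand \<open>1\<close> keeps the time at most \<open>1\<close> and covers the case \<open>C2 = 0\<close>.\<close>
  define B where "B = 8 * R * C2 + 1"
  have B: "1 \<le> B" using assms C2_nonneg by (simp add: B_def)
  have e: "0 < 1/2 - al" using al by simp
  define T where "T = (1 / B) powr (1 / (1/2 - al))"
  have "T powr (1/2 - al) = 1 / B" using B e by (simp add: T_def powr_powr)
  then have "8 * R * (C2 * T powr (1/2 - al)) = (B - 1) / B" by (simp add: B_def)
  also have "\<dots> \<le> 1" using B by (simp add: field_simps)
  finally have "8 * R * (C2 * T powr (1/2 - al)) \<le> 1" .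
  moreover have "0 < T" using B by (simp add: T_def)
  moreover have "T \<le> 1" unfolding T_def using B e by (intro powr_le1) auto
  ultimately show ?thesis by blast
qed

context
  fixes T R :: real
  assumes T: "0 < T" "T \<le> 1" and R: "0 < R" "8 * R * (C2 * T powr (1/2 - al)) \<le> 1"
begin

interpretation Q: quadratic_problem "Hs s" "Hs_nrm s" "bop T" "C2 * T powr (1/2 - al)" R
  by (rule bop_quadratic_problem [OF T R])

lemma Q_U: "Q.U = Hs_ball s R"
  by (simp add: Q.U_def Hs_ball_def)

lemma Q_pn: "Q.pn y = nY y"
  by (simp add: Q.pn_def nY_def)

lemma fixed_point:
  assumes "u \<in> Hs_ball s R"
  shows "fst (Q.Y u []) = u" "u \<in> Hs s" "snd (Q.Y u []) = bop T (Q.Y u []) (Q.Y u [])"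
  using assms Q.zsol(2) [of u] by (simp_all add: Q.Y_Nil Q_U) (simp add: Hs_ball_def)

lemma solution_tcurve:
  assumes "u \<in> Hs_ball s R" shows "solution \<eta> \<Phi> s T u (tcurve T (Q.Y u []))"
proof -
  note f = fixed_point [OF assms]
  have "fst (Q.Y u []) \<in> Hs s" by (simp only: f(1,2))
  from fixed_point_solution [OF this f(3) T] show ?thesis by (simp only: f(1))
qed

lemma solution_ex1:
  assumes "u \<in> Hs_ball s R" shows "\<exists>!v. solution \<eta> \<Phi> s T u v"
  using solution_tcurve [OF assms] solution_unique [OF _ _ fixed_point(2) [OF assms] T(2)] by blast

lemma solution_map_eq:
  assumes "u \<in> Hs_ball s R" shows "solution_map \<eta> \<Phi> s T u = tcurve T (Q.Y u [])"
  unfolding solution_map_def by (rule the1_equality [where P = "solution \<eta> \<Phi> s T u", OF solution_ex1 [OF assms] solution_tcurve [OF assms]])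

lemma Y_duhamel_type:
  assumes u: "u \<in> Hs_ball s R" and hs: "set hs \<subseteq> Hs s"
  shows "duhamel_type T (Q.Y u hs)"
proof -
  have uU: "u \<in> Q.U" using u by (simp only: Q_U)
  have in_E: "fst (Q.Y u (fst q)) \<in> Hs s \<and> fst (Q.Y u (snd q)) \<in> Hs s" if "q \<in> set (splits hs)" for q
    using splits_set [OF that] hs by (intro conjI Q.fst_Y [OF uU]) auto
  have "snd (Q.Y u hs) = sum_list (map (\<lambda>q. bop T (fst q) (snd q)) (map (\<lambda>q. (Q.Y u (fst q), Q.Y u (snd q))) (splits hs)))"
    using Q.der_eq [OF uU hs] by (simp add: Q.Y_def [of u hs] o_def)
  moreover have "\<forall>q\<in>set (map (\<lambda>q. (Q.Y u (fst q), Q.Y u (snd q))) (splits hs)). fst (fst q) \<in> Hs s \<and> fst (snd q) \<in> Hs s"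
    using in_E by auto
  ultimately show ?thesis unfolding duhamel_type_def using Q.fst_Y [OF uU hs] by blast
qed

lemma solution_map_CX:
  assumes "u \<in> Hs_ball s R" shows "solution_map \<eta> \<Phi> s T u \<in> CX p s T"
  unfolding solution_map_eq [OF assms] by (rule tcurve_CX [OF Y_duhamel_type [OF assms] T]) simp

lemma solution_map_Hinf:
  assumes "u \<in> Hs_ball s R" shows "Hinf_continuous_on {0<..T} (solution_map \<eta> \<Phi> s T u)"
  unfolding solution_map_eq [OF assms]
  by (rule tcurve_Hinf [OF _ fixed_point(3) [OF assms] T]) (simp only: fixed_point(1,2) [OF assms])

text \<open>The derivatives of the solution map are the curves that belong to the derivatives of the fixed
  point, as the passage from pairs to curves is linear and bounded.\<close>

lemma solution_map_smooth:
  "smooth_map (Hs s) (Hs_nrm s) (Hs_ball s R) (CX p s T) (X_nrm p s T) (solution_map \<eta> \<Phi> s T)"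
  unfolding smooth_map_def
proof (rule exI [of _ "\<lambda>u hs. tcurve T (Q.Y u hs)"], intro ballI conjI allI impI)
  fix u assume u: "u \<in> Hs_ball s R"
  then have uU: "u \<in> Q.U" by (simp only: Q_U)
  note fE = Q.fst_Y [OF uU]
  show "tcurve T (Q.Y u []) = solution_map \<eta> \<Phi> s T u" by (rule solution_map_eq [OF u, symmetric])
  show "tcurve T (Q.Y u hs) \<in> CX p s T" if "set hs \<subseteq> Hs s" for hs
    by (rule tcurve_CX [OF Y_duhamel_type [OF u that] T])
  show "tcurve T (Q.Y u (hs @ (a *\<^sub>R h + b *\<^sub>R k) # ks)) =
      (\<lambda>t. a *\<^sub>R tcurve T (Q.Y u (hs @ h # ks)) t + b *\<^sub>R tcurve T (Q.Y u (hs @ k # ks)) t)"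
    if H: "h \<in> Hs s" "k \<in> Hs s" "set hs \<subseteq> Hs s" "set ks \<subseteq> Hs s" for hs ks h k a b
  proof -
    have E: "set (hs @ h # ks) \<subseteq> Hs s" "set (hs @ k # ks) \<subseteq> Hs s"
      using H by auto
    have "Q.Y u (hs @ (a *\<^sub>R h + b *\<^sub>R k) # ks) = a *\<^sub>R Q.Y u (hs @ h # ks) + b *\<^sub>R Q.Y u (hs @ k # ks)"
      using H by (intro Q.Y_multilinear uU)
    moreover have "tcurve T (a *\<^sub>R Q.Y u (hs @ h # ks) + b *\<^sub>R Q.Y u (hs @ k # ks)) t =
        a *\<^sub>R tcurve T (Q.Y u (hs @ h # ks)) t + b *\<^sub>R tcurve T (Q.Y u (hs @ k # ks)) t" for t
      using tcurve_add [OF _ _ T(2), of "a *\<^sub>R Q.Y u (hs @ h # ks)" "b *\<^sub>R Q.Y u (hs @ k # ks)" t] fE [OF E(1)] fE [OF E(2)]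
      by (simp add: Hs_scaleR tcurve_scaleR [OF _ T(2)])
    ultimately show ?thesis by (intro ext) (simp only:)
  qed
  have nn: "0 \<le> 2 * C1" using C1_nonneg by simp
  show "\<exists>B. \<forall>hs. set hs \<subseteq> Hs s \<longrightarrow> length hs = n \<longrightarrow> X_nrm p s T (tcurve T (Q.Y u hs)) \<le> B * prod_list (map (Hs_nrm s) hs)" for n
  proof -
    obtain K where K: "\<And>hs. set hs \<subseteq> Hs s \<Longrightarrow> length hs \<le> n \<Longrightarrow> nY (Q.Y u hs) \<le> K * prod_list (map (Hs_nrm s) hs)"
      using Q.Y_bound [of n] uU unfolding Q_pn by blast
    have "X_nrm p s T (tcurve T (Q.Y u hs)) \<le> (2 * C1 * K) * prod_list (map (Hs_nrm s) hs)" if "set hs \<subseteq> Hs s" "length hs = n" for hs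
      using order_trans [OF X_nrm_tcurve [OF fE [OF that(1)] T(2)] mult_left_mono [OF K [OF that(1)] nn]] that by (simp add: mult.assoc)
    then show ?thesis by blast
  qed
  fix n :: nat and \<epsilon> :: real assume \<epsilon>: "0 < \<epsilon>"
  obtain K where K: "0 \<le> K" "\<And>h hs. h \<in> Hs s \<Longrightarrow> u + h \<in> Q.U \<Longrightarrow> set hs \<subseteq> Hs s \<Longrightarrow> length hs \<le> n \<Longrightarrow>
      nY (Q.Y (u + h) hs - Q.Y u hs - Q.Y u (h # hs)) \<le> K * (Hs_nrm s h)\<^sup>2 * prod_list (map (Hs_nrm s) hs)"
    using Q.Y_remainder [of n] uU unfolding Q_pn by blast
  define B where "B = 2 * C1 * K"
  have B: "0 \<le> B" using nn K(1) by (simp add: B_def)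
  have "X_nrm p s T (\<lambda>t. tcurve T (Q.Y (u + h) hs) t - tcurve T (Q.Y u hs) t - tcurve T (Q.Y u (h # hs)) t)
      \<le> \<epsilon> * Hs_nrm s h * prod_list (map (Hs_nrm s) hs)"
    if h: "h \<in> Hs s" "Hs_nrm s h < \<epsilon> / (B + 1)" and uh: "u + h \<in> Hs_ball s R" and hs: "set hs \<subseteq> Hs s" "length hs = n" for h hs
  proof -
    have uhU: "u + h \<in> Q.U" using uh by (simp only: Q_U)
    have hhs: "set (h # hs) \<subseteq> Hs s" using h hs by simp
    note E = Q.fst_Y [OF uhU hs(1)] fE [OF hs(1)] fE [OF hhs]
    have E': "fst (Q.Y (u + h) hs - Q.Y u hs) \<in> Hs s" using E by (simp add: Q.E_diff)
    have E'': "fst (Q.Y (u + h) hs - Q.Y u hs - Q.Y u (h # hs)) \<in> Hs s" using Q.E_diff [OF E' E(3)] by simp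
    have eq: "(\<lambda>t. tcurve T (Q.Y (u + h) hs) t - tcurve T (Q.Y u hs) t - tcurve T (Q.Y u (h # hs)) t) =
        tcurve T (Q.Y (u + h) hs - Q.Y u hs - Q.Y u (h # hs))"
      by (rule ext) (simp only: tcurve_diff [OF E' E(3) T(2)] tcurve_diff [OF E(1,2) T(2)])
    have P: "0 \<le> prod_list (map (Hs_nrm s) hs)" by (rule Q.prod_nonneg)
    have "B * Hs_nrm s h \<le> (B + 1) * Hs_nrm s h" by (intro mult_right_mono) auto
    also have "\<dots> \<le> \<epsilon>" using h(2) B by (simp add: pos_less_divide_eq mult.commute)
    finally have small: "B * Hs_nrm s h \<le> \<epsilon>" .
    have "X_nrm p s T (tcurve T (Q.Y (u + h) hs - Q.Y u hs - Q.Y u (h # hs))) \<le> 2 * C1 * (K * (Hs_nrm s h)\<^sup>2 * prod_list (map (Hs_nrm s) hs))"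
      using order_trans [OF X_nrm_tcurve [OF E'' T(2)] mult_left_mono [OF K(2) [OF h(1) uhU hs(1)] nn]] hs(2) by simp
    also have "\<dots> = (B * Hs_nrm s h) * (Hs_nrm s h * prod_list (map (Hs_nrm s) hs))" by (simp add: B_def power2_eq_square)
    also have "\<dots> \<le> \<epsilon> * (Hs_nrm s h * prod_list (map (Hs_nrm s) hs))" using P by (intro mult_right_mono small) auto
    finally show ?thesis unfolding eq by (simp add: mult.assoc)
  qed
  moreover have "0 < \<epsilon> / (B + 1)" using \<epsilon> B by simp
  ultimately show "\<exists>\<delta>>0. \<forall>h\<in>Hs s. Hs_nrm s h < \<delta> \<longrightarrow> u + h \<in> Hs_ball s R \<longrightarrow>
      (\<forall>hs. set hs \<subseteq> Hs s \<longrightarrow> length hs = n \<longrightarrow>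
        X_nrm p s T (\<lambda>t. tcurve T (Q.Y (u + h) hs) t - tcurve T (Q.Y u hs) t - tcurve T (Q.Y u (h # hs)) t)
          \<le> \<epsilon> * Hs_nrm s h * prod_list (map (Hs_nrm s) hs))"
    by (intro exI [of _ "\<epsilon> / (B + 1)"]) blast
qed

end

end

section \<open>Local well-posedness\<close>

text \<open>Since \<open>q < p\<close>, the perturbation is at most \<open>\<bar>\<xi>\<bar>\<^sup>p / 2\<close> up to a constant, and a constant only
  contributes a factor for times in \<open>[0,1]\<close>.\<close>

lemma symbol_decay:
  fixes \<Phi> \<Phi>\<^sub>1 :: "real \<Rightarrow> real"
  assumes \<eta>: "\<eta> > 0" and q: "0 \<le> q" "q < p"
    and \<Phi>: "\<And>\<xi>. \<Phi> \<xi> = - (\<bar>\<xi>\<bar> powr p) + \<Phi>\<^sub>1 \<xi>" and \<Phi>\<^sub>1: "\<And>\<xi>. \<bar>\<Phi>\<^sub>1 \<xi>\<bar> \<le> C * (1 + \<bar>\<xi>\<bar> powr q)"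
  shows "\<exists>c>0. \<exists>K\<ge>1. \<forall>t \<xi>. 0 \<le> t \<longrightarrow> t \<le> 1 \<longrightarrow> exp (\<eta> * t * \<Phi> \<xi>) \<le> K * exp (- (c * t * jap \<xi> powr p))"
proof -
  have C: "0 \<le> C" using order_trans [OF abs_ge_zero \<Phi>\<^sub>1 [of 1]] by simp
  have p: "0 < p" using q by simp
  define x0 where "x0 = max 1 ((4 * C) powr (1 / (p - q)))"
  have x0: "1 \<le> x0" by (simp add: x0_def)
  define M where "M = C * (1 + x0 powr q)"
  have M: "0 \<le> M" using C by (simp add: M_def)
  have lower: "C * (1 + x powr q) \<le> x powr p / 2 + M" if x: "0 \<le> x" for x
  proof (cases "x \<le> x0")
    case True
    then have "x powr q \<le> x0 powr q" using x q by (intro powr_mono2) auto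
    then have "C * (1 + x powr q) \<le> M" unfolding M_def using C by (intro mult_left_mono) auto
    then show ?thesis using powr_ge_zero [of x p] by linarith
  next
    case False
    then have x1: "1 \<le> x" "(4 * C) powr (1 / (p - q)) \<le> x" using x0 by (auto simp: x0_def)
    have "4 * C = ((4 * C) powr (1 / (p - q))) powr (p - q)" using C q by (simp add: powr_powr)
    also have "\<dots> \<le> x powr (p - q)" using x1 q by (intro powr_mono2) auto
    finally have "4 * C * x powr q \<le> x powr (p - q) * x powr q" by (intro mult_right_mono) auto
    also have "x powr (p - q) * x powr q = x powr p" unfolding powr_add [symmetric] by simp
    finally have "4 * C * x powr q \<le> x powr p" .
    moreover have "C * 1 \<le> C * x powr q" using C x1 q ge_one_powr_ge_zero [of x q] by (intro mult_left_mono) auto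
    ultimately show ?thesis using M by (simp add: algebra_simps)
  qed
  have jap_le: "jap \<xi> powr p \<le> 2 powr p * (1 + \<bar>\<xi>\<bar> powr p)" for \<xi>
  proof -
    have "(jap \<xi>)\<^sup>2 \<le> (2 * max 1 \<bar>\<xi>\<bar>)\<^sup>2"
    proof (cases "\<bar>\<xi>\<bar> \<le> 1")
      case True
      then have "\<xi>\<^sup>2 \<le> 1" by (simp add: abs_square_le_1)
      then show ?thesis using True by (simp add: jap_sq)
    next
      case False
      then have "1 \<le> \<xi>\<^sup>2" using abs_le_square_iff [of 1 \<xi>] by simp
      then show ?thesis using False by (simp add: jap_sq power_mult_distrib max_def)
    qed
    then have "jap \<xi> \<le> 2 * max 1 \<bar>\<xi>\<bar>" by (rule power2_le_imp_le) simp
    then have "jap \<xi> powr p \<le> (2 * max 1 \<bar>\<xi>\<bar>) powr p" using p by (intro powr_mono2) auto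
    also have "\<dots> = 2 powr p * max 1 \<bar>\<xi>\<bar> powr p" by (simp add: powr_mult)
    also have "\<dots> \<le> 2 powr p * (1 + \<bar>\<xi>\<bar> powr p)" by (intro mult_left_mono) (auto simp: max_def)
    finally show ?thesis .
  qed
  define c where "c = \<eta> / (2 * 2 powr p)"
  have bound: "\<eta> * t * \<Phi> \<xi> \<le> \<eta> * (M + 1) + - (c * t * jap \<xi> powr p)" if t: "0 \<le> t" "t \<le> 1" for t \<xi>
  proof -
    have "\<Phi> \<xi> \<le> - (\<bar>\<xi>\<bar> powr p / 2) + M" using lower [of "\<bar>\<xi>\<bar>"] \<Phi>\<^sub>1 [of \<xi>] by (simp add: \<Phi>)
    also have "\<dots> \<le> M + 1 - jap \<xi> powr p / (2 * 2 powr p)"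
    proof -
      have "jap \<xi> powr p / (2 * 2 powr p) \<le> 2 powr p * (1 + \<bar>\<xi>\<bar> powr p) / (2 * 2 powr p)"
        by (intro divide_right_mono jap_le) simp
      also have "\<dots> = (1 + \<bar>\<xi>\<bar> powr p) / 2" by simp
      finally have j: "jap \<xi> powr p / (2 * 2 powr p) \<le> (1 + \<bar>\<xi>\<bar> powr p) / 2" .
      have "- (x / 2) + M \<le> M + 1 - j" if "j \<le> (1 + x) / 2" for j x :: real using that by (simp add: field_simps)
      from this [OF j] show ?thesis .
    qed
    finally have "\<Phi> \<xi> \<le> (M + 1) - jap \<xi> powr p / (2 * 2 powr p)" .
    then have "\<eta> * t * \<Phi> \<xi> \<le> \<eta> * t * ((M + 1) - jap \<xi> powr p / (2 * 2 powr p))" using \<eta> t by (intro mult_left_mono) auto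
    also have "\<dots> = t * (\<eta> * (M + 1)) + - (c * t * jap \<xi> powr p)" by (simp add: c_def algebra_simps)
    also have "\<dots> \<le> 1 * (\<eta> * (M + 1)) + - (c * t * jap \<xi> powr p)" using t \<eta> M by (intro add_right_mono mult_right_mono) auto
    finally show ?thesis by simp
  qed
  have "exp (\<eta> * t * \<Phi> \<xi>) \<le> exp (\<eta> * (M + 1)) * exp (- (c * t * jap \<xi> powr p))" if "0 \<le> t" "t \<le> 1" for t \<xi>
    unfolding exp_add [symmetric] using bound [OF that] by simp
  moreover have "0 < c" using \<eta> by (simp add: c_def)
  moreover have "1 \<le> exp (\<eta> * (M + 1))" using \<eta> M by simp
  ultimately show ?thesis by blast
qed

theorem theorem1p1:
  fixes \<eta> p q C s :: real and \<Phi> \<Phi>\<^sub>1 :: "real \<Rightarrow> real"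
  assumes "\<eta> > 0" and "p > 3" and "0 \<le> q" and "q < p"
    and "\<Phi>\<^sub>1 \<in> borel_measurable borel"
    and "\<And>\<xi>. \<Phi> \<xi> = - (\<bar>\<xi>\<bar> powr p) + \<Phi>\<^sub>1 \<xi>"
    and "\<And>\<xi>. \<bar>\<Phi>\<^sub>1 \<xi>\<bar> \<le> C * (1 + \<bar>\<xi>\<bar> powr q)"
    and "s > - p / 2"
  shows "\<exists>T :: real \<Rightarrow> real. (\<forall>r\<ge>0. 0 < T r \<and> T r \<le> 1) \<and>
    (\<forall>v0\<in>Hs s. let \<tau> = T (Hs_nrm s v0) in
       (\<exists>!v. solution \<eta> \<Phi> s \<tau> v0 v) \<and>
       solution_map \<eta> \<Phi> s \<tau> v0 \<in> CX p s \<tau> \<and>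
       Hinf_continuous_on {0<..\<tau>} (solution_map \<eta> \<Phi> s \<tau> v0) \<and>
       (\<exists>\<rho>>Hs_nrm s v0.
          (\<forall>u0\<in>Hs_ball s \<rho>. \<exists>!u. solution \<eta> \<Phi> s \<tau> u0 u) \<and>
          smooth_map (Hs s) (Hs_nrm s) (Hs_ball s \<rho>) (CX p s \<tau>) (X_nrm p s \<tau>)
            (solution_map \<eta> \<Phi> s \<tau>)))"
proof -
  obtain c K where c: "0 < c" and K: "1 \<le> K"
    and decay: "\<And>t \<xi>. 0 \<le> t \<Longrightarrow> t \<le> 1 \<Longrightarrow> exp (\<eta> * t * \<Phi> \<xi>) \<le> K * exp (- (c * t * jap \<xi> powr p))"
    using symbol_decay [OF assms(1,3,4,6,7)] by blast
  have "\<Phi> = (\<lambda>\<xi>. - (\<bar>\<xi>\<bar> powr p) + \<Phi>\<^sub>1 \<xi>)" using assms(6) by (rule ext)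
  moreover note [measurable] = assms(5)
  have "(\<lambda>\<xi>. - (\<bar>\<xi>\<bar> powr p) + \<Phi>\<^sub>1 \<xi>) \<in> borel_measurable borel" by measurable
  ultimately have \<Phi>m: "\<Phi> \<in> borel_measurable borel" by (simp only:)
  interpret dissipative \<eta> p s c K \<Phi>
    by standard (use \<Phi>m assms(2,8) c K decay in auto)
  \<comment> \<open>The time is chosen for the ball of radius \<open>r + 1\<close>, so that it also serves all data near one of norm \<open>r\<close>.\<close>
  have "\<exists>T. 0 \<le> r \<longrightarrow> 0 < T \<and> T \<le> 1 \<and> 8 * (r + 1) * (C2 * T powr (1/2 - al)) \<le> 1" for r
    using exists_time [of "r + 1"] by (cases "0 \<le> r") auto
  then obtain T where T: "\<And>r. 0 \<le> r \<Longrightarrow> 0 < T r" "\<And>r. 0 \<le> r \<Longrightarrow> T r \<le> 1"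
    "\<And>r. 0 \<le> r \<Longrightarrow> 8 * (r + 1) * (C2 * T r powr (1/2 - al)) \<le> 1" by metis
  show ?thesis
    unfolding Let_def
  proof (intro exI [of _ T] conjI ballI allI impI)
    show "0 < T r" "T r \<le> 1" if "0 \<le> r" for r using T that by blast+
    fix v0 assume v0: "v0 \<in> Hs s"
    define r where "r = Hs_nrm s v0"
    have r: "0 \<le> r" "0 < r + 1" by (simp_all add: r_def add_nonneg_pos)
    note TR = T(1,2) [OF r(1)] r(2) T(3) [OF r(1)]
    have v0R: "v0 \<in> Hs_ball s (r + 1)" using v0 by (simp add: Hs_ball_def r_def)
    show "\<exists>!v. solution \<eta> \<Phi> s (T (Hs_nrm s v0)) v0 v"
      using solution_ex1 [OF TR v0R] by (simp only: r_def)
    show "solution_map \<eta> \<Phi> s (T (Hs_nrm s v0)) v0 \<in> CX p s (T (Hs_nrm s v0))"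
      using solution_map_CX [OF TR v0R] by (simp only: r_def)
    show "Hinf_continuous_on {0<..T (Hs_nrm s v0)} (solution_map \<eta> \<Phi> s (T (Hs_nrm s v0)) v0)"
      using solution_map_Hinf [OF TR v0R] by (simp only: r_def)
    show "\<exists>\<rho>>Hs_nrm s v0. (\<forall>u0\<in>Hs_ball s \<rho>. \<exists>!u. solution \<eta> \<Phi> s (T (Hs_nrm s v0)) u0 u) \<and>
        smooth_map (Hs s) (Hs_nrm s) (Hs_ball s \<rho>) (CX p s (T (Hs_nrm s v0))) (X_nrm p s (T (Hs_nrm s v0)))
          (solution_map \<eta> \<Phi> s (T (Hs_nrm s v0)))"
    proof (intro exI [of _ "r + 1"] conjI ballI)
      show "Hs_nrm s v0 < r + 1" by (simp add: r_def)
      show "\<exists>!u. solution \<eta> \<Phi> s (T (Hs_nrm s v0)) u0 u" if "u0 \<in> Hs_ball s (r + 1)" for u0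
        using solution_ex1 [OF TR that] by (simp only: r_def)
      show "smooth_map (Hs s) (Hs_nrm s) (Hs_ball s (r + 1)) (CX p s (T (Hs_nrm s v0))) (X_nrm p s (T (Hs_nrm s v0)))
          (solution_map \<eta> \<Phi> s (T (Hs_nrm s v0)))"
        using solution_map_smooth [OF TR] by (simp only: r_def)
    qed
  qed
qed

end
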